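(* For an MDP $P$ with $n$ vertices and $m$ edges and a Streett objective given by Streett pairs $\mathrm{SP}=\{(L_i,U_i)\mid 1\le i\le k\}$ with $b=\sum_{i=1}^k(|L_i|+|U_i|)$, the almost-sure winning set $\langle\langle 1\rangle\rangle_{as}(P,\mathrm{Streett}(\mathrm{SP}))$ can be computed in $O(\min(n^2,m\sqrt{m\log n})+b\log n)$ time.
   Context: An MDP $P=((V,E),(V_1,V_R),\delta)$: finite directed graph, vertices partitioned into player-1 vertices $V_1$ and random vertices $V_R$, each $v\in V_R$ with a probability distribution over its out-neighbours (positive on each). Player-1 strategies choose successors at $V_1$ vertices based on the history. $\langle\langle 1\rangle\rangle_{as}(P,\psi)$ is the set of vertices from which player 1 can satisfy $\psi$ with probability 1. For a play $\omega$, $\mathrm{Inf}(\omega)$ is the set of vertices occurring infinitely often. $\mathrm{Streett}(\mathrm{SP})$ is the set of plays $\omega$ such that for each $i$, $L_i\cap\mathrm{Inf}(\omega)=\emptyset$ or $U_i\cap\mathrm{Inf}(\omega)\neq\emptyset$, where $L_i,U_i\subseteq V$. *)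

theory Defs
  imports "HOL-Probability.Probability"
begin

section \<open>Markov decision processes and almost-sure winning\<close>

record 'v mdp =
  verts :: "'v set"
  edges :: "('v \<times> 'v) set"
  player1 :: "'v set"
  randv :: "'v set"
  prob_dist :: "'v \<Rightarrow> 'v pmf"

text \<open>Every vertex has an outgoing edge, so that plays are infinite; for random vertices
  this already follows from \<^const>\<open>set_pmf\<close> being nonempty.\<close>

definition is_mdp :: "'v mdp \<Rightarrow> bool" where
  "is_mdp P \<longleftrightarrow>
     finite (verts P) \<and>
     edges P \<subseteq> verts P \<times> verts P \<and>
     player1 P \<union> randv P = verts P \<and>
     player1 P \<inter> randv P = {} \<and>
     (\<forall>v\<in>verts P. edges P `` {v} \<noteq> {}) \<and>
     (\<forall>v\<in>randv P. set_pmf (prob_dist P v) = edges P `` {v})"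

text \<open>A history is a finite nonempty list of vertices, the current vertex being the last one.\<close>

definition strategies :: "'v mdp \<Rightarrow> ('v list \<Rightarrow> 'v) set" where
  "strategies P =
     {\<sigma>. \<forall>h\<in>lists (verts P). \<forall>v\<in>player1 P. (v, \<sigma> (h @ [v])) \<in> edges P}"

definition next_pmf :: "'v mdp \<Rightarrow> ('v list \<Rightarrow> 'v) \<Rightarrow> 'v list \<Rightarrow> 'v pmf" where
  "next_pmf P \<sigma> h =
     (if last h \<in> randv P then prob_dist P (last h) else return_pmf (\<sigma> h))"

text \<open>Law of the vertex at time \<open>i\<close> given the vertices at the times before \<open>i\<close>.\<close>

definition play_kernel ::
  "'v mdp \<Rightarrow> ('v list \<Rightarrow> 'v) \<Rightarrow> 'v \<Rightarrow> nat \<Rightarrow> (nat \<Rightarrow> 'v) \<Rightarrow> 'v measure" where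
  "play_kernel P \<sigma> v i \<omega> =
     measure_pmf (if i = 0 then return_pmf v else next_pmf P \<sigma> (map \<omega> [0..<i]))"

text \<open>The probability measure on plays obtained from these kernels by the Ionescu-Tulcea
  extension theorem.\<close>

definition play_measure ::
  "'v mdp \<Rightarrow> ('v list \<Rightarrow> 'v) \<Rightarrow> 'v \<Rightarrow> (nat \<Rightarrow> 'v) measure" where
  "play_measure P \<sigma> v =
     projective_family.lim UNIV
       (Ionescu_Tulcea.CI (play_kernel P \<sigma> v) (\<lambda>_. count_space UNIV))
       (\<lambda>_. count_space UNIV)"

lemma Ionescu_Tulcea_play_kernel:
  fixes P :: "('v::countable) mdp"
  shows "Ionescu_Tulcea (play_kernel P \<sigma> v) (\<lambda>_. count_space UNIV)"
proof (rule Ionescu_Tulcea.intro)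
  fix i
  have "(PiM {0..<i} (\<lambda>_. count_space UNIV) :: (nat \<Rightarrow> 'v) measure)
        = count_space (PiE {0..<i} (\<lambda>_. UNIV))"
    by (rule count_space_PiM_finite) auto
  then show "play_kernel P \<sigma> v i
      \<in> measurable (PiM {0..<i} (\<lambda>_. count_space UNIV)) (subprob_algebra (count_space UNIV))"
    by (auto simp: play_kernel_def measure_pmf_in_subprob_algebra)
next
  fix i \<omega>
  show "prob_space (play_kernel P \<sigma> v i \<omega>)"
    unfolding play_kernel_def by (rule prob_space_measure_pmf)
qed

lemma sets_play_measure:
  fixes P :: "('v::countable) mdp"
  shows "sets (play_measure P \<sigma> v) = sets (PiM UNIV (\<lambda>_. count_space UNIV))"
proof -
  interpret Ionescu_Tulcea "play_kernel P \<sigma> v" "\<lambda>_. count_space UNIV"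
    by (rule Ionescu_Tulcea_play_kernel)
  show ?thesis unfolding play_measure_def by (rule PF.sets_lim)
qed

lemma prob_space_play_measure:
  fixes P :: "('v::countable) mdp"
  shows "prob_space (play_measure P \<sigma> v)"
proof -
  interpret Ionescu_Tulcea "play_kernel P \<sigma> v" "\<lambda>_. count_space UNIV"
    by (rule Ionescu_Tulcea_play_kernel)
  interpret L: prob_space "distr PF.lim (PiM {} (\<lambda>_. count_space UNIV)) (\<lambda>x. restrict x {})"
    by (subst distr_lim) (auto intro: PF.prob_space_P)
  show ?thesis unfolding play_measure_def
    by (rule prob_space_distrD[OF _ L.prob_space_axioms])
       (auto intro!: measurable_restrict simp: measurable_cong_sets[OF PF.sets_lim refl])
qed

definition almost_sure_win :: "'v mdp \<Rightarrow> (nat \<Rightarrow> 'v) set \<Rightarrow> 'v set" where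
  "almost_sure_win P \<psi> =
     {v \<in> verts P. \<exists>\<sigma>\<in>strategies P. AE \<omega> in play_measure P \<sigma> v. \<omega> \<in> \<psi>}"

definition Inf_verts :: "(nat \<Rightarrow> 'v) \<Rightarrow> 'v set" where
  "Inf_verts \<omega> = {v. \<exists>\<^sub>\<infinity>i. \<omega> i = v}"

definition Streett :: "('v set \<times> 'v set) list \<Rightarrow> (nat \<Rightarrow> 'v) set" where
  "Streett SP =
     {\<omega>. \<forall>(L, U)\<in>set SP. L \<inter> Inf_verts \<omega> = {} \<or> U \<inter> Inf_verts \<omega> \<noteq> {}}"

lemma Streett_measurable:
  fixes P :: "('v::countable) mdp"
  shows "Streett SP \<in> sets (play_measure P \<sigma> v)"
proof -
  let ?M = "PiM UNIV (\<lambda>_. count_space UNIV) :: (nat \<Rightarrow> 'v) measure"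
  have "Streett SP =
      {\<omega>\<in>space ?M. \<forall>X\<in>set SP. (\<forall>v. v \<in> fst X \<longrightarrow> \<not> (\<forall>i. \<exists>j. j > i \<and> \<omega> j = v))
         \<or> (\<exists>v. v \<in> snd X \<and> (\<forall>i. \<exists>j. j > i \<and> \<omega> j = v))}"
    by (auto simp: Streett_def Inf_verts_def INFM_nat space_PiM split_beta disjoint_iff)
  also have "\<dots> \<in> sets ?M"
    by measurable
  finally show ?thesis by (simp add: sets_play_measure)
qed

definition pairs_size :: "('v set \<times> 'v set) list \<Rightarrow> nat" where
  "pairs_size SP = (\<Sum>(L, U)\<leftarrow>SP. card L + card U)"

section \<open>A word RAM\<close>

text \<open>Programs have finitely many registers and finitely many randomly accessible arrays, all
  holding natural numbers below the word bound \<open>W\<close>. Computing a value that is not below \<open>W\<close>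
  blocks the execution, so an execution that terminates never exceeds the word length.
  Comparisons yield 0 or 1.\<close>

datatype binop = Add | Sub | Mul | Div | Less | Equal

datatype expr =
    Const nat
  | Reg nat
  | Read nat expr  \<comment> \<open>array (part of the program text) and index\<close>
  | Op binop expr expr

datatype com =
    Skip
  | Assign nat expr
  | Write nat expr expr
  | Seq com com
  | Cond expr com com
  | While expr com

record state =
  regs :: "nat \<Rightarrow> nat"
  arrs :: "nat \<Rightarrow> nat \<Rightarrow> nat"

fun apply_op :: "binop \<Rightarrow> nat \<Rightarrow> nat \<Rightarrow> nat" where
  "apply_op Add x y = x + y"
| "apply_op Sub x y = x - y"
| "apply_op Mul x y = x * y"
| "apply_op Div x y = x div y"
| "apply_op Less x y = of_bool (x < y)"
| "apply_op Equal x y = of_bool (x = y)"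

definition word :: "nat \<Rightarrow> nat \<Rightarrow> nat option" where
  "word W x = (if x < W then Some x else None)"

fun eval_expr :: "nat \<Rightarrow> state \<Rightarrow> expr \<Rightarrow> nat option" where
  "eval_expr W s (Const x) = word W x"
| "eval_expr W s (Reg r) = word W (regs s r)"
| "eval_expr W s (Read a e) =
     Option.bind (eval_expr W s e) (\<lambda>i. word W (arrs s a i))"
| "eval_expr W s (Op f d e) =
     Option.bind (eval_expr W s d) (\<lambda>x.
     Option.bind (eval_expr W s e) (\<lambda>y. word W (apply_op f x y)))"

fun cost :: "expr \<Rightarrow> nat" where
  "cost (Const x) = 1"
| "cost (Reg r) = 1"
| "cost (Read a e) = cost e + 1"
| "cost (Op f d e) = cost d + cost e + 1"

text \<open>\<open>exec W p s t s'\<close>: started in \<open>s\<close>, the program \<open>p\<close> halts in \<open>s'\<close> after exactly \<open>t\<close>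
  unit-cost operations.\<close>

inductive exec :: "nat \<Rightarrow> com \<Rightarrow> state \<Rightarrow> nat \<Rightarrow> state \<Rightarrow> bool" for W :: nat where
  Skip: "exec W Skip s 1 s"
| Assign: "eval_expr W s e = Some x \<Longrightarrow>
    exec W (Assign r e) s (cost e + 1) (s\<lparr>regs := (regs s)(r := x)\<rparr>)"
| Write: "eval_expr W s d = Some i \<Longrightarrow> eval_expr W s e = Some x \<Longrightarrow>
    exec W (Write a d e) s (cost d + cost e + 1)
      (s\<lparr>arrs := (arrs s)(a := (arrs s a)(i := x))\<rparr>)"
| Seq: "exec W p s t s' \<Longrightarrow> exec W q s' t' s'' \<Longrightarrow> exec W (Seq p q) s (t + t') s''"
| CondTrue: "eval_expr W s e = Some x \<Longrightarrow> x \<noteq> 0 \<Longrightarrow> exec W p s t s' \<Longrightarrow>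
    exec W (Cond e p q) s (cost e + 1 + t) s'"
| CondFalse: "eval_expr W s e = Some 0 \<Longrightarrow> exec W q s t s' \<Longrightarrow>
    exec W (Cond e p q) s (cost e + 1 + t) s'"
| WhileFalse: "eval_expr W s e = Some 0 \<Longrightarrow>
    exec W (While e p) s (cost e + 1) s"
| WhileTrue: "eval_expr W s e = Some x \<Longrightarrow> x \<noteq> 0 \<Longrightarrow> exec W p s t s' \<Longrightarrow>
    exec W (While e p) s' t' s'' \<Longrightarrow>
    exec W (While e p) s (cost e + 1 + t + t') s''"

inductive_cases exec_elims:
  "exec W Skip s t s'"
  "exec W (Assign r e) s t s'"
  "exec W (Write a d e) s t s'"
  "exec W (Seq p q) s t s'"
  "exec W (Cond e p q) s t s'"
  "exec W (While e p) s t s'"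

lemma exec_deterministic:
  "exec W p s t s' \<Longrightarrow> exec W p s u s'' \<Longrightarrow> t = u \<and> s' = s''"
proof (induction arbitrary: u s'' rule: exec.induct)
  case (Skip s)
  then show ?case by (elim exec_elims) simp
next
  case (Assign s e x r)
  then show ?case by (elim exec_elims) simp
next
  case (Write s d i e x a)
  then show ?case by (elim exec_elims) simp
next
  case (Seq p s t s' q t' s2)
  from Seq.prems obtain v r v' where "u = v + v'" "exec W p s v r" "exec W q r v' s''"
    by (rule exec_elims(4))
  with Seq.IH show ?case by metis
next
  case (CondTrue s e x p t s' q)
  from CondTrue.prems obtain v where
    "u = cost e + 1 + v" "exec W p s v s''"
    by (rule exec_elims(5)) (use CondTrue.hyps in auto)
  with CondTrue.IH show ?case by metis
next
  case (CondFalse s e q t s' p)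
  from CondFalse.prems obtain v where
    "u = cost e + 1 + v" "exec W q s v s''"
    by (rule exec_elims(5)) (use CondFalse.hyps in auto)
  with CondFalse.IH show ?case by metis
next
  case (WhileFalse s e p)
  from WhileFalse.prems show ?case
    by (rule exec_elims(6)) (use WhileFalse.hyps in auto)
next
  case (WhileTrue s e x p t s' t' s2)
  from WhileTrue.prems obtain v r v' where
    "u = cost e + 1 + v + v'" "exec W p s v r" "exec W (While e p) r v' s''"
    by (rule exec_elims(6)) (use WhileTrue.hyps in auto)
  with WhileTrue.IH show ?case by metis
qed

section \<open>Input and output\<close>

text \<open>The members of the Streett pairs: \<open>(i, v, False)\<close> stands for \<open>v \<in> L\<^sub>i\<close> and
  \<open>(i, v, True)\<close> for \<open>v \<in> U\<^sub>i\<close>.\<close>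

definition memberships :: "('v set \<times> 'v set) list \<Rightarrow> (nat \<times> 'v \<times> bool) set" where
  "memberships SP =
     {(i, v, u). i < length SP \<and> v \<in> (if u then snd (SP ! i) else fst (SP ! i))}"

text \<open>An instance has vertices \<open>0, \<dots>, n - 1\<close>. The lists \<open>es\<close> and \<open>ms\<close> are arbitrary
  enumerations of the edges and of the memberships, so that the representation of the pairs takes
  space linear in their total size \<open>b\<close>, even if many pairs are \<open>({}, {})\<close>. The probabilities
  themselves are not part of the input of the program.\<close>

definition is_instance ::
  "nat mdp \<Rightarrow> (nat set \<times> nat set) list \<Rightarrow> (nat \<times> nat) list \<Rightarrow> (nat \<times> nat \<times> bool) list \<Rightarrow> bool"
where
  "is_instance P SP es ms \<longleftrightarrow>
     is_mdp P \<and> verts P = {..<card (verts P)} \<and>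
     (\<forall>(L, U)\<in>set SP. L \<subseteq> verts P \<and> U \<subseteq> verts P) \<and>
     distinct es \<and> set es = edges P \<and>
     distinct ms \<and> set ms = memberships SP"

definition array_of :: "nat list \<Rightarrow> nat \<Rightarrow> nat" where
  "array_of xs i = (if i < length xs then xs ! i else 0)"

definition input_state ::
  "nat mdp \<Rightarrow> (nat set \<times> nat set) list \<Rightarrow> (nat \<times> nat) list \<Rightarrow> (nat \<times> nat \<times> bool) list \<Rightarrow> state"
where
  "input_state P SP es ms =
     \<lparr>regs = array_of [card (verts P), length es, length ms, length SP],
      arrs = (\<lambda>_ _. 0)
        (0 := array_of (map fst es),
         1 := array_of (map snd es),
         2 := (\<lambda>v. of_bool (v \<in> randv P)),
         3 := array_of (map fst ms),
         4 := array_of (map (fst \<circ> snd) ms),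
         5 := array_of (map (of_bool \<circ> snd \<circ> snd) ms))\<rparr>"

text \<open>The output is the characteristic vector of the computed set in array 6.\<close>

definition output_set :: "nat \<Rightarrow> state \<Rightarrow> nat set" where
  "output_set n s = {v. v < n \<and> arrs s 6 v \<noteq> 0}"

end

theory Submission
  imports Defs
begin

text \<open>A vertex wins almost surely iff player 1 can almost surely reach the union of the good end
  components, i.e. of the end components that satisfy all Streett conditions: almost surely the set of
  vertices visited infinitely often is an end component, and inside a good end component the
  strategy that always heads for the least visited vertex visits all its vertices infinitely often.

  The good end components are found by refining a partition of the vertices. A vertex is doomed if
  it violates an end component condition within its class; it is then split off. A class without
  doomed vertices is either certified to be strongly connected or split along a closed set. When a
  class is split, only the memberships of the smaller part are moved, which costs \<open>b log n\<close> in
  total. Closed sets are found in time \<open>O(n\<^sup>2)\<close> by searching with doubling degree thresholds, so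
  that the search is paid for by the size of the smaller part, or in time \<open>O(m powr (3/2))\<close> by
  searches from the end points of deleted edges that are cut off after \<open>sqrt m\<close> edges: if none of
  them succeeds, both parts of the next split have more than \<open>sqrt m\<close> edges. The faster of the two
  variants is chosen in advance. Almost-sure reachability is reduced to the same problem by an
  additional vertex.\<close>

section \<open>Unbounded execution\<close>

text \<open>Two demands shape the proof. First, the word RAM blocks on overflow although one fixed
  exponent must suffice for all inputs. The programs are therefore verified in a semantics without
  word bound, and a syntactic criterion transfers their runs to \<open>exec\<close>: stored values
  exceed the input values at most by the elapsed time, and intermediate values stay below a sixth
  power. Second, single steps may be expensive. Each iteration of the main loop is paid for by the
  decrease of a real potential \<open>Phi\<close>, so its initial value bounds the running time. In
  the sparse variant the cut-off D is about sqrt m. Every cut edge queues two vertices, and each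
  queued vertex causes one search of cost O(D); with the initial queues these are O(m) searches. A
  split into two parts with more than D edges each costs O(m) and occurs at most m / D times. The
  sum O(m D + m^2 / D) = O(m sqrt m) is below m sqrt (m log n) for n >= 2. In the dense variant the
  squares of the class sizes pay for the searches. The second pass has O(m) edges and only n + 1
  memberships, so it fits into the same bound.\<close>

fun ev :: "state => expr => nat" where
 "ev s (Const x) = x"
| "ev s (Reg r) = regs s r"
| "ev s (Read a e) = arrs s a (ev s e)"
| "ev s (Op f d e) = apply_op f (ev s d) (ev s e)"

text \<open>Same rules and costs as \<open>exec\<close>, but without the check against the word
  bound, so that expressions have total values. \<open>run_exec\<close> adds the bound
  again.\<close>

inductive run :: "com => state => nat => state => bool" where
 "run Skip s 1 s"
| "run (Assign r e) s (cost e + 1) (s\<lparr>regs := (regs s)(r := ev s e)\<rparr>)"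
| "run (Write a d e) s (cost d + cost e + 1)
   (s\<lparr>arrs := (arrs s)(a := (arrs s a)(ev s d := ev s e))\<rparr>)"
| "run p s t s' ==> run q s' t' s'' ==> run (Seq p q) s (t + t') s''"
| "ev s e ~= 0 ==> run p s t s' ==> run (Cond e p q) s (cost e + 1 + t) s'"
| "ev s e = 0 ==> run q s t s' ==> run (Cond e p q) s (cost e + 1 + t) s'"
| "ev s e = 0 ==> run (While e p) s (cost e + 1) s"
| "ev s e ~= 0 ==> run p s t s' ==> run (While e p) s' t' s'' ==>
   run (While e p) s (cost e + 1 + t + t') s''"

text \<open>If all registers and array entries are below \<open>M\<close>, then the value of \<open>e\<close> is below
 \<open>M ^ edeg e\<close>.\<close>

fun edeg :: "expr => nat" where
 "edeg (Const x) = 1"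
| "edeg (Reg r) = 1"
| "edeg (Read a e) = 1"
| "edeg (Op f d e) = (case f of Add => max (edeg d) (edeg e) + 1 | Mul => edeg d + edeg e
   | Sub => edeg d | Div => edeg d | _ => 1)"

text \<open>Constants up to 2 lie below \<open>M\<close> because \<open>3 <= M\<close> is assumed
  throughout. The degree 6 leaves room for cell indices such as \<open>(c * k + i) * N + y\<close>
  and for the product of four registers in \<open>Setup\<close>.\<close>

fun expr_ok :: "expr => bool" where
 "expr_ok (Const x) = (x <= 2)"
| "expr_ok (Reg r) = True"
| "expr_ok (Read a e) = (expr_ok e & edeg e <= 6)"
| "expr_ok (Op f d e) = (expr_ok d & expr_ok e & edeg (Op f d e) <= 6)"

text \<open>Expressions whose value exceeds the largest stored value at most by the number of
 operations. A program that stores only such values cannot produce numbers larger than its running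
 time plus the largest input value.\<close>

fun slow :: "expr => bool" where
 "slow (Op Add d e) = (slow d & e = Const 1)"
| "slow (Op Mul d e) = False"
| "slow (Op Sub d e) = slow d"
| "slow (Op Div d e) = slow d"
| "slow _ = True"

text \<open>Only stored values have to be \<open>slow\<close>. Addresses and conditions are
  transient, so a bound on their degree is enough.\<close>

fun com_ok :: "com => bool" where
 "com_ok Skip = True"
| "com_ok (Assign r e) = (expr_ok e & edeg e <= 6 & slow e)"
| "com_ok (Write a d e) = (expr_ok d & edeg d <= 6 & expr_ok e & edeg e <= 6 & slow e)"
| "com_ok (Seq p q) = (com_ok p & com_ok q)"
| "com_ok (Cond e p q) = (expr_ok e & edeg e <= 6 & com_ok p & com_ok q)"
| "com_ok (While e p) = (expr_ok e & edeg e <= 6 & com_ok p)"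

definition bounded_state :: "nat => state => bool" where
 "bounded_state M s \<longleftrightarrow> (ALL r. regs s r < M) & (ALL a i. arrs s a i < M)"

lemma edeg_pos: "1 <= edeg e"
 by (induction e) (auto split: binop.split)

lemma ev_bound:
 assumes "bounded_state M s" "3 <= M"
 shows "expr_ok e ==> ev s e < M ^ edeg e"
proof (induction e)
 case (Op f d e)
 have d: "ev s d < M ^ edeg d" and e: "ev s e < M ^ edeg e" using Op by auto
 have M1: "M <= M ^ edeg x" for x
  using edeg_pos[of x] assms(2) power_increasing[of 1 "edeg x" M] by auto
 show ?case
 proof (cases f)
  case Add
  let ?m = "max (edeg d) (edeg e)"
  have "M ^ edeg d <= M ^ ?m" "M ^ edeg e <= M ^ ?m"
   using assms(2) by (auto intro!: power_increasing)
  hence "ev s d + ev s e < 2 * M ^ ?m" using d e by linarith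
  also have "... <= M ^ (?m + 1)" using assms(2) by simp
  finally show ?thesis using Add by simp
 next
  case Mul
  thus ?thesis using mult_strict_mono'[OF d e] by (simp add: power_add)
 next
  case Sub
  thus ?thesis using d by simp
 next
  case Div
  have "ev s d div ev s e <= ev s d" by simp
  thus ?thesis using d Div by (simp del: div_le_dividend)
 next
  case Less
  thus ?thesis using assms by simp
 next
  case Equal
  thus ?thesis using assms by simp
 qed
qed (use assms in \<open>auto simp: bounded_state_def\<close>)

lemma eval_expr_ev:
 assumes "bounded_state M s" "3 <= M" "M ^ 6 <= W"
 shows "expr_ok e ==> edeg e <= 6 ==> eval_expr W s e = Some (ev s e)"
proof (induction e)
 case (Op f d e)
 have "ev s (Op f d e) < M ^ edeg (Op f d e)" using ev_bound[OF assms(1,2) Op.prems(1)] .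
 also have "... <= M ^ 6" using Op.prems assms(2) by (intro power_increasing) auto
 finally have "ev s (Op f d e) < W" using assms(3) by linarith
 \<comment> \<open>The degree of a difference, quotient or comparison says little about the
   arguments; the line after the next bounds these by their own \<open>expr_ok\<close>.\<close>
 moreover have "edeg d <= 6 & edeg e <= 6 \<or> f = Sub \<or> f = Div \<or> f = Less \<or> f = Equal"
  using Op.prems edeg_pos[of d] edeg_pos[of e] by (cases f) auto
 moreover have "edeg x <= 6" if "expr_ok x" for x using that by (cases x) auto
 ultimately show ?case using Op by (auto simp: word_def)
next
 case (Read a e)
 have "arrs s a (ev s e) < M" using assms by (auto simp: bounded_state_def)
 also have "M <= W" using assms self_le_power[of M 6] by linarith
 finally show ?case using Read by (auto simp: word_def)
next
 case (Const x)
 have "M <= W" using assms self_le_power[of M 6] by linarith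
 thus ?case using Const assms by (auto simp: word_def)
next
 case (Reg x)
 have "M <= W" using assms self_le_power[of M 6] by linarith
 thus ?case using assms by (auto simp: word_def bounded_state_def intro: less_le_trans)
qed

lemma slow_bound:
 assumes "bounded_state M s" "3 <= M"
 shows "expr_ok e ==> slow e ==> ev s e < M + cost e"
proof (induction e rule: slow.induct)
 case (3 d e)
 hence "ev s d < M + cost d" by simp
 thus ?case by simp
next
 case (4 d e)
 have "ev s d div ev s e <= ev s d" by simp
 also have "ev s d < M + cost d" using 4 by simp
 finally show ?case by simp
qed (use assms in \<open>auto simp: bounded_state_def trans_less_add1 less_Suc_eq\<close>)

lemma bounded_state_mono: "bounded_state M s ==> M <= M' ==> bounded_state M' s"
 by (meson bounded_state_def less_le_trans)

text \<open>By \<open>slow_bound\<close> the value stored by an operation exceeds the old bound by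
  less than the cost of the operation. So after time \<open>t\<close> everything stored is below
  \<open>M + t\<close>, and \<open>(M + t) ^ 6\<close> bounds all intermediate values of the
  run.\<close>

lemma run_exec:
 "run p s t s' ==> com_ok p ==> bounded_state M s ==> 3 <= M ==> (M + t) ^ 6 <= W ==>
   exec W p s t s' & bounded_state (M + t) s'"
proof (induction arbitrary: M rule: run.induct)
 case (1 s)
 thus ?case using exec.Skip by (auto intro: bounded_state_mono)
next
 case (2 r e s)
 have "M ^ 6 <= W" using 2(4) power_mono[of M "M + (cost e + 1)" 6] by linarith
 hence "eval_expr W s e = Some (ev s e)" using eval_expr_ev[OF 2(2,3)] 2(1) by simp
 moreover have "ev s e < M + cost e" using slow_bound[OF 2(2,3)] 2(1) by simp
 moreover have "x < M ==> x < M + (cost e + 1)" for x by simp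
 moreover have "x < M + cost e ==> x < M + (cost e + 1)" for x by simp
 ultimately show ?case using 2 exec.Assign
  unfolding bounded_state_def
  by (auto simp del: One_nat_def add_Suc_right intro: trans_less_add1)
next
 case (3 a d e s)
 have "M ^ 6 <= W" using 3(4) power_mono[of M "M + (cost d + cost e + 1)" 6] by linarith
 hence "eval_expr W s e = Some (ev s e)" "eval_expr W s d = Some (ev s d)"
  using eval_expr_ev[OF 3(2,3)] 3(1) by auto
 moreover have "ev s e < M + cost e" using slow_bound[OF 3(2,3)] 3(1) by simp
 moreover have "x < M ==> x < M + (cost d + cost e + 1)" for x by simp
 moreover have "x < M + cost e ==> x < M + (cost d + cost e + 1)" for x by simp
 ultimately show ?case using 3
  using exec.Write unfolding bounded_state_def
  by (auto simp del: One_nat_def add_Suc_right intro: trans_less_add1)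
next
 case (4 p s t s' q t' s'')
 have "(M + t) ^ 6 <= W" using 4(8) power_mono[of "M + t" "M + (t + t')" 6] by linarith
 hence "exec W p s t s'" "bounded_state (M + t) s'" using 4(3)[of M] 4 by auto
 moreover have "exec W q s' t' s'' & bounded_state (M + t + t') s''"
  using 4(4)[of "M + t"] calculation 4 by (simp add: add.assoc)
 ultimately show ?case by (auto intro: exec.Seq simp: add.assoc)
next
 case (5 s e p t s' q)
 have W: "(M + t) ^ 6 <= W" "M ^ 6 <= W"
  using 5(7) power_mono[of "M + t" "M + (cost e + 1 + t)" 6]
   power_mono[of M "M + (cost e + 1 + t)" 6] by linarith+
 hence "exec W p s t s' & bounded_state (M + t) s'" using 5(3)[of M] 5 by auto
 moreover have "eval_expr W s e = Some (ev s e)" using eval_expr_ev[OF 5(5,6)] 5(4) W by simp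
 ultimately show ?case using 5(1) by (auto simp del: One_nat_def intro: exec.CondTrue bounded_state_mono)
next
 case (6 s e q t s' p)
 have W: "(M + t) ^ 6 <= W" "M ^ 6 <= W"
  using 6(7) power_mono[of "M + t" "M + (cost e + 1 + t)" 6]
   power_mono[of M "M + (cost e + 1 + t)" 6] by linarith+
 hence "exec W q s t s' & bounded_state (M + t) s'" using 6(3)[of M] 6 by auto
 moreover have "eval_expr W s e = Some (ev s e)" using eval_expr_ev[OF 6(5,6)] 6(4) W by simp
 ultimately show ?case using 6(1) by (auto simp del: One_nat_def intro: exec.CondFalse bounded_state_mono)
next
 case (7 s e p)
 have W: "M ^ 6 <= W" using 7(5) power_mono[of M "M + (cost e + 1)" 6] by linarith
 moreover have "eval_expr W s e = Some (ev s e)" using eval_expr_ev[OF 7(3,4)] 7(2) W by simp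
 ultimately show ?case using 7(1,3) by (auto simp del: One_nat_def intro: exec.WhileFalse bounded_state_mono)
next
 case (8 s e p t s' t' s'')
 have W: "(M + t) ^ 6 <= W" "M ^ 6 <= W" "((M + t) + t') ^ 6 <= W"
  using 8(9) power_mono[of "M + t" "M + (cost e + 1 + t + t')" 6]
   power_mono[of M "M + (cost e + 1 + t + t')" 6]
   power_mono[of "(M + t) + t'" "M + (cost e + 1 + t + t')" 6] by linarith+
 hence a: "exec W p s t s'" "bounded_state (M + t) s'" using 8(4)[of M] 8 by auto
 hence b: "exec W (While e p) s' t' s'' & bounded_state (M + t + t') s''"
  using 8(5)[OF 8(6) a(2)] 8(8) W by simp
 moreover have "eval_expr W s e = Some (ev s e)" using eval_expr_ev[OF 8(7,8)] 8(6) W by simp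
 ultimately show ?case using 8(1) a by (auto simp del: One_nat_def intro!: exec.WhileTrue intro: bounded_state_mono)
qed

section \<open>Programs on families of sparse sets\<close>

text \<open>In the abstract view of a state, the arrays below 100 are kept, while the arrays
 \<open>100 + 3 f\<close>, \<open>101 + 3 f\<close> and \<open>102 + 3 f\<close> hold, for each row \<open>r\<close>, a list of distinct numbers
 below \<open>N f\<close>: its elements, its length and the positions of its elements. Membership tests,
 insertion, deletion and clearing take constant time, without any initialisation of the rows.\<close>

record astate =
 areg :: "nat => nat"
 aarr :: "nat => nat => nat"
 alst :: "nat => nat => nat list"

text \<open>Nothing is demanded of cells behind the end of a list or of the positions of absent
  elements. Hence a memory of zeros represents empty rows.\<close>

definition rep :: "(nat => nat) => state => astate => bool" where
 "rep N s x \<longleftrightarrow> regs s = areg x & (ALL a<100. arrs s a = aarr x a) &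
   (ALL f r. arrs s (101 + 3 * f) r = length (alst x f r) & distinct (alst x f r) &
    set (alst x f r) \<subseteq> {..<N f} &
    (ALL i<length (alst x f r). arrs s (100 + 3 * f) (r * N f + i) = alst x f r ! i &
      arrs s (102 + 3 * f) (r * N f + alst x f r ! i) = i))"

definition setr :: "astate => nat => nat => astate" where
 "setr x r v = x\<lparr>areg := (areg x)(r := v)\<rparr>"
definition seta :: "astate => nat => nat => nat => astate" where
 "seta x a i v = x\<lparr>aarr := (aarr x)(a := (aarr x a)(i := v))\<rparr>"
definition setl :: "astate => nat => nat => nat list => astate" where
 "setl x f r l = x\<lparr>alst := (alst x)(f := (alst x f)(r := l))\<rparr>"

lemma set_simps [simp]:
 "areg (setr x r v) = (areg x)(r := v)" "aarr (setr x r v) = aarr x" "alst (setr x r v) = alst x"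
 "areg (seta x a i v) = areg x" "aarr (seta x a i v) = (aarr x)(a := (aarr x a)(i := v))"
 "alst (seta x a i v) = alst x"
 "areg (setl x f r l) = areg x" "aarr (setl x f r l) = aarr x"
 "alst (setl x f r l) = (alst x)(f := (alst x f)(r := l))"
 by (simp_all add: setr_def seta_def setl_def)

fun aev :: "astate => expr => nat" where
 "aev x (Const c) = c"
| "aev x (Reg r) = areg x r"
| "aev x (Read a e) = (if a < 100 then aarr x a (aev x e)
   else length (alst x ((a - 101) div 3) (aev x e)))"
| "aev x (Op f d e) = apply_op f (aev x d) (aev x e)"

text \<open>\<open>101 + 3 * f\<close> is congruent to 2 modulo 3: of the arrays from 100 on, an
  expression may read only the lengths directly.\<close>

fun abs_ok :: "expr => bool" where
 "abs_ok (Const c) = True"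
| "abs_ok (Reg r) = True"
| "abs_ok (Read a e) = ((a < 100 \<or> a mod 3 = 2) & abs_ok e)"
| "abs_ok (Op f d e) = (abs_ok d & abs_ok e)"

text \<open>Such expressions read no array of a list family, so their values do not change between
  the writes of one list operation.\<close>

fun plain :: "expr => bool" where
 "plain (Const c) = True"
| "plain (Reg r) = True"
| "plain (Read a e) = (a < 100 & plain e)"
| "plain (Op f d e) = (plain d & plain e)"

definition Cnt :: "nat => expr => expr" where "Cnt f r = Read (101 + 3 * f) r"

lemma Cnt_simps [simp]:
 "aev x (Cnt f r) = length (alst x f (aev x r))" "abs_ok (Cnt f r) = abs_ok r"
 "cost (Cnt f r) = cost r + 1" "edeg (Cnt f r) = 1"
 "expr_ok (Cnt f r) = (expr_ok r & edeg r <= 6)" "slow (Cnt f r)"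
proof -
 have "(101 + 3 * f) mod 3 = 2" by presburger
 thus "abs_ok (Cnt f r) = abs_ok r" by (simp add: Cnt_def)
qed (simp_all add: Cnt_def)

lemma ev_aev: "rep N s x ==> abs_ok e ==> ev s e = aev x e"
proof (induction e)
 case (Read a e)
 show ?case
 proof (cases "a < 100")
  case True
  thus ?thesis using Read by (auto simp: rep_def)
 next
  case False
  with Read.prems have "a mod 3 = 2" by simp
  then obtain q where q: "a = 3 * q + 2" by (metis mult_div_mod_eq)
  with False have "a = 101 + 3 * (q - 33)" by auto
  moreover from this have "(a - 101) div 3 = q - 33" by simp
  ultimately show ?thesis using Read False unfolding rep_def by auto
 qed
qed (auto simp: rep_def)

lemma plain_abs_ok: "plain e ==> abs_ok e"
 by (induction e) auto

lemma ev_plain_cong: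
 "plain e ==> regs s = regs s' ==> (!!a. a < 100 ==> arrs s a = arrs s' a) ==> ev s e = ev s' e"
 by (induction e) auto

text \<open>The postcondition takes an upper bound of the running time.\<close>

definition hw :: "(nat => nat) => com => (nat => astate => bool) => astate => bool" where
 "hw N p Q x \<longleftrightarrow> (ALL s. rep N s x --> (EX t T s' x'. run p s t s' & t <= T & rep N s' x' & Q T x'))"

section \<open>Rules for total correctness with time bounds\<close>

lemma hw_mono: "hw N p Q x ==> (!!T x'. Q T x' ==> Q' T x') ==> hw N p Q' x"
 unfolding hw_def by meson

lemma hw_time: "hw N p Q x ==> (!!T x'. Q T x' ==> EX T'>=T. Q' T' x') ==> hw N p Q' x"
 unfolding hw_def by (meson order_trans)

text \<open>Distinctness and range of the lists are part of \<open>rep\<close>, so that any proof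
  about a program may assume them of its start state.\<close>

lemma hw_lists:
 "((!!f r. distinct (alst x f r) & set (alst x f r) \<subseteq> {..<N f}) ==> hw N p Q x) ==> hw N p Q x"
 unfolding hw_def rep_def by blast

lemma hw_Skip: "Q 1 x ==> hw N Skip Q x"
 unfolding hw_def using run.intros(1) by blast

lemma hw_Assign: "abs_ok e ==> Q (cost e + 1) (setr x r (aev x e)) ==> hw N (Assign r e) Q x"
 unfolding hw_def
proof (intro allI impI)
 fix s assume e: "abs_ok e" and Q: "Q (cost e + 1) (setr x r (aev x e))" and r: "rep N s x"
 have "rep N (s\<lparr>regs := (regs s)(r := ev s e)\<rparr>) (setr x r (aev x e))"
  using r ev_aev[OF r e] unfolding rep_def by auto
 thus "EX t T s' x'. run (Assign r e) s t s' & t <= T & rep N s' x' & Q T x'"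
  using Q run.intros(2) by blast
qed

lemma hw_Write:
 assumes "a < 100" "abs_ok d" "abs_ok e"
  and "Q (cost d + cost e + 1) (seta x a (aev x d) (aev x e))"
 shows "hw N (Write a d e) Q x"
 unfolding hw_def
proof (intro allI impI)
 fix s assume r: "rep N s x"
 have "rep N (s\<lparr>arrs := (arrs s)(a := (arrs s a)(ev s d := ev s e))\<rparr>) (seta x a (aev x d) (aev x e))"
  using r ev_aev[OF r assms(2)] ev_aev[OF r assms(3)] assms(1) unfolding rep_def by auto
 thus "EX t T s' x'. run (Write a d e) s t s' & t <= T & rep N s' x' & Q T x'"
  using assms(4) run.intros(3) by blast
qed

lemma hw_Seq: "hw N p (%t. hw N q (%t'. Q (t + t'))) x ==> hw N (Seq p q) Q x"
 unfolding hw_def by (meson add_mono run.intros(4))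

lemma hw_Cond:
 assumes "abs_ok e" "aev x e ~= 0 ==> hw N p (%t. Q (cost e + 1 + t)) x"
  "aev x e = 0 ==> hw N q (%t. Q (cost e + 1 + t)) x"
 shows "hw N (Cond e p q) Q x"
 unfolding hw_def
proof (intro allI impI)
 fix s assume r: "rep N s x"
 have e: "ev s e = aev x e" using ev_aev[OF r assms(1)] .
 show "EX t T s' x'. run (Cond e p q) s t s' & t <= T & rep N s' x' & Q T x'"
 proof (cases "aev x e = 0")
  case True
  then obtain t T s' x' where "run q s t s'" "t <= T" "rep N s' x'" "Q (cost e + 1 + T) x'"
   using assms(3) r unfolding hw_def by blast
  thus ?thesis using run.intros(6)[of s e q t s' p] True e add_left_mono by metis
 next
  case False
  then obtain t T s' x' where "run p s t s'" "t <= T" "rep N s' x'" "Q (cost e + 1 + T) x'"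
   using assms(2) r unfolding hw_def by blast
  thus ?thesis using run.intros(5)[of s e p t s' q] False e add_left_mono by metis
 qed
qed

text \<open>The index of \<open>I\<close> is the time spent so far, which turns a time bound into an
  ordinary invariant; the measure gives termination.\<close>

lemma hw_While:
 fixes \<mu> :: "astate => nat"
 assumes e: "abs_ok e"
  and step: "!!T x. I T x ==> aev x e ~= 0 ==>
   hw N p (%t x'. I (T + cost e + 1 + t) x' & \<mu> x' < \<mu> x) x"
  and exit: "!!T x. I T x ==> aev x e = 0 ==> Q (T + cost e + 1) x"
  and init: "I 0 x"
 shows "hw N (While e p) Q x"
proof -
 have "EX t T' s' x'. run (While e p) s t s' & T + t <= T' & rep N s' x' & Q T' x'"
  if "I T x" "rep N s x" for T s x
  using that
 proof (induction "\<mu> x" arbitrary: x s T rule: less_induct)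
  case less
  have ev: "ev s e = aev x e" using ev_aev[OF less.prems(2) e] .
  show ?case
  proof (cases "aev x e = 0")
   case True
   have "run (While e p) s (cost e + 1) s" using True ev by (intro run.intros) simp
   thus ?thesis using exit[OF less.prems(1) True] less.prems(2)
    by (metis add.assoc order_refl)
  next
   case False
   then obtain t U s' x' where 1: "run p s t s'" "t <= U" "rep N s' x'"
    "I (T + cost e + 1 + U) x'" "\<mu> x' < \<mu> x"
    using step[OF less.prems(1) False] less.prems(2) unfolding hw_def by blast
   then obtain t' T' s'' x'' where 2: "run (While e p) s' t' s''"
    "T + cost e + 1 + U + t' <= T'" "rep N s'' x''" "Q T' x''"
    using less.hyps by blast
   have "run (While e p) s (cost e + 1 + t + t') s''"
    using run.intros(8)[OF _ 1(1) 2(1)] False ev by simp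
   moreover have "T + (cost e + 1 + t + t') <= T'" using 1(2) 2(2) by linarith
   ultimately show ?thesis using 2 by blast
  qed
 qed
 thus ?thesis using init unfolding hw_def by fastforce
qed

lemma row_index_eq:
 "(i::nat) < N ==> j < N ==> r * N + i = r' * N + j \<longleftrightarrow> r = r' & i = j"
proof -
 assume a: "i < N" "j < N"
 have "(r * N + i) div N = r" "(r' * N + j) div N = r'" using a by auto
 thus ?thesis by auto
qed

text \<open>The frame argument shared by insertion, deletion and truncation. Rows of one family are
  disjoint segments of length \<open>N f\<close>, and by distinctness no list is longer than
  \<open>N f\<close>, so the remaining rows are not touched.\<close>

lemma rep_setl:
 assumes r: "rep N s x" and l: "distinct l" "set l \<subseteq> {..<N f}"
  and C: "C = (arrs s (101 + 3 * f))(r := length l)"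
  and AP: "!!i. i < length l ==> A (r * N f + i) = l ! i & P (r * N f + l ! i) = i"
  and other: "!!r' i. r' ~= r ==> i < N f ==> A (r' * N f + i) = arrs s (100 + 3 * f) (r' * N f + i) &
   P (r' * N f + i) = arrs s (102 + 3 * f) (r' * N f + i)"
  and s': "regs s' = regs s" "arrs s' = (arrs s)(100 + 3 * f := A, 101 + 3 * f := C, 102 + 3 * f := P)"
 shows "rep N s' (setl x f r l)"
proof -
 have ne: "100 + 3 * f ~= 101 + 3 * g" "100 + 3 * f ~= 102 + 3 * g" "101 + 3 * f ~= 102 + 3 * g" for f g :: nat
  by presburger+
 have R: "arrs s (101 + 3 * g) r' = length (alst x g r')" "distinct (alst x g r')"
  "set (alst x g r') \<subseteq> {..<N g}"
  "i < length (alst x g r') ==> arrs s (100 + 3 * g) (r' * N g + i) = alst x g r' ! i"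
  "i < length (alst x g r') ==> arrs s (102 + 3 * g) (r' * N g + alst x g r' ! i) = i" for g r' i
  using r unfolding rep_def by auto
 have len: "length (alst x f r') <= N f" for r'
  using card_mono[OF _ R(3)[where g=f and r'=r']] distinct_card[OF R(2)[where g=f and r'=r']] by simp
 have o: "arrs s' (100 + 3 * g) = (if g = f then A else arrs s (100 + 3 * g))"
  "arrs s' (101 + 3 * g) = (if g = f then C else arrs s (101 + 3 * g))"
  "arrs s' (102 + 3 * g) = (if g = f then P else arrs s (102 + 3 * g))" for g
  unfolding s' using ne[of f g] ne[of g f] by auto
 show ?thesis
  unfolding rep_def
 proof (intro conjI allI impI)
  show "regs s' = areg (setl x f r l)" using r s' by (simp add: rep_def)
  show "arrs s' a = aarr (setl x f r l) a" if "a < 100" for a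
   using r s' that by (auto simp: rep_def)
  fix g r'
  show "arrs s' (101 + 3 * g) r' = length (alst (setl x f r l) g r')"
   using R(1) by (auto simp: o C)
  show "distinct (alst (setl x f r l) g r')" "set (alst (setl x f r l) g r') \<subseteq> {..<N g}"
   using R(2,3) l by auto
  fix i assume i: "i < length (alst (setl x f r l) g r')"
  have "alst x f r' ! i < N f" if "g = f" "r' ~= r"
  proof -
   have "alst x f r' ! i : set (alst x f r')" using i that by auto
   thus ?thesis using R(3) by blast
  qed
  moreover have "i < N f" if "g = f" "r' ~= r" using i len[of r'] that by auto
  ultimately show "arrs s' (100 + 3 * g) (r' * N g + i) = alst (setl x f r l) g r' ! i"
   "arrs s' (102 + 3 * g) (r' * N g + alst (setl x f r l) g r' ! i) = i"
   using i R(4,5)[of i g r'] AP[of i] other[of r' i] other[of r' "alst x f r' ! i"]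
   by (auto simp: o split: if_splits)
 qed
qed

section \<open>Operations on sparse sets\<close>

definition lins :: "nat => nat list => nat list" where
 "lins y xs = (if y : set xs then xs else xs @ [y])"

text \<open>Models deletion in constant time, in which the last element fills the gap. The order
  matters because loops run over lists that shrink.\<close>

definition sdel :: "nat => nat list => nat list" where
 "sdel y xs = (if y : set xs then butlast (xs[(LEAST i. i < length xs & xs ! i = y) := last xs]) else xs)"

lemma set_lins [simp]: "set (lins y xs) = insert y (set xs)"
 by (auto simp: lins_def)

lemma distinct_lins [simp]: "distinct (lins y xs) = distinct xs"
 by (auto simp: lins_def)

lemma sdel_index:
 assumes "distinct xs" "i < length xs"
 shows "sdel (xs ! i) xs = butlast (xs[i := last xs])"
proof -
 have "(LEAST j. j < length xs & xs ! j = xs ! i) = i"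
  using assms nth_eq_iff_index_eq[OF assms(1)] by (intro Least_equality) auto
 thus ?thesis using assms by (simp add: sdel_def)
qed

lemma set_sdel [simp]: "distinct xs ==> set (sdel y xs) = set xs - {y}"
 and distinct_sdel [simp]: "distinct xs ==> distinct (sdel y xs)"
proof -
 assume d: "distinct xs"
 have "set (sdel y xs) = set xs - {y} & distinct (sdel y xs)"
 proof (cases "y : set xs")
  case False
  thus ?thesis using d by (simp add: sdel_def)
 next
  case True
  then obtain i where i: "i < length xs" "xs ! i = y" by (auto simp: in_set_conv_nth)
  have s: "sdel y xs = butlast (xs[i := last xs])" using sdel_index[OF d i(1)] i(2) by simp
  obtain ys z where xs: "xs = ys @ [z]" using True by (cases xs rule: rev_cases) auto
  show ?thesis
  proof (cases "i = length ys")
   case True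
   thus ?thesis using s xs i d by (auto simp: list_update_append)
  next
   case False
   hence il: "i < length ys" using i xs by simp
   hence "sdel y xs = ys[i := z]" using s xs by (simp add: list_update_append butlast_append)
   moreover have "ys ! i = y" using i il xs by (simp add: nth_append)
   ultimately show ?thesis using xs d il
    by (auto simp: set_update_distinct distinct_list_update)
  qed
 qed
 thus "set (sdel y xs) = set xs - {y}" "distinct (sdel y xs)" by auto
qed

lemma take_sdel: "distinct xs ==> i < length xs ==> take i (sdel (xs ! i) xs) = take i xs"
 by (simp add: sdel_index take_butlast)

definition Idx :: "nat => expr => expr => expr" where
 "Idx rN r i = Op Add (Op Mul r (Reg rN)) i"
definition Elt :: "nat => nat => expr => expr => expr" where
 "Elt f rN r i = Read (100 + 3 * f) (Idx rN r i)"
definition Pos :: "nat => nat => expr => expr => expr" where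
 "Pos f rN r y = Read (102 + 3 * f) (Idx rN r y)"
text \<open>The position cell of an absent element may hold anything. It is believed only if it
  points into the list and the entry there is the element itself.\<close>

definition Member :: "nat => nat => expr => expr => expr" where
 "Member f rN r y = Op Mul (Op Less (Pos f rN r y) (Cnt f r))
   (Op Equal (Elt f rN r (Pos f rN r y)) y)"

definition Insert :: "nat => nat => expr => expr => com" where
 "Insert f rN r y = Cond (Member f rN r y) Skip
   (Seq (Write (100 + 3 * f) (Idx rN r (Cnt f r)) y)
   (Seq (Write (102 + 3 * f) (Idx rN r y) (Cnt f r))
     (Write (101 + 3 * f) r (Op Add (Cnt f r) (Const 1)))))"

text \<open>The length is lowered first, so that \<open>Cnt\<close> is the index of the last element
  in the two writes after it.\<close>

definition Delete :: "nat => nat => expr => expr => com" where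
 "Delete f rN r y = Cond (Member f rN r y)
   (Seq (Write (101 + 3 * f) r (Op Sub (Cnt f r) (Const 1)))
   (Seq (Write (100 + 3 * f) (Idx rN r (Pos f rN r y)) (Elt f rN r (Cnt f r)))
     (Write (102 + 3 * f) (Idx rN r (Elt f rN r (Cnt f r))) (Pos f rN r y)))) Skip"

definition Clear :: "nat => expr => com" where
 "Clear f r = Write (101 + 3 * f) r (Const 0)"

definition Pop :: "nat => nat => expr => nat => com" where
 "Pop f rN r q = Seq (Write (101 + 3 * f) r (Op Sub (Cnt f r) (Const 1)))
   (Assign q (Elt f rN r (Cnt f r)))"

definition For :: "nat => nat => expr => nat => nat => com => com" where
 "For f rN r i q p = Seq (Assign i (Cnt f r))
   (While (Reg i) (Seq (Assign i (Op Sub (Reg i) (Const 1)))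
    (Seq (Assign q (Elt f rN r (Reg i))) p)))"

lemma ev_Member:
 assumes r: "rep N s x" and p: "plain r" "plain y" and N: "areg x rN = N f" and y: "aev x y < N f"
 shows "ev s (Member f rN r y) = of_bool (aev x y : set (alst x f (aev x r)))"
  and "i < length (alst x f (aev x r)) ==> alst x f (aev x r) ! i = aev x y ==> ev s (Pos f rN r y) = i"
proof -
 let ?l = "alst x f (aev x r)"
 have e: "ev s r = aev x r" "ev s y = aev x y" "regs s rN = N f"
  using ev_aev[OF r] p plain_abs_ok N r by (auto simp: rep_def)
 let ?p = "arrs s (102 + 3 * f) (aev x r * N f + aev x y)"
 have P: "ev s (Pos f rN r y) = ?p" by (simp add: Pos_def Idx_def e)
 have C: "ev s (Cnt f r) = length ?l" using ev_aev[OF r, of "Cnt f r"] p plain_abs_ok by auto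
 have A: "i < length ?l ==> arrs s (100 + 3 * f) (aev x r * N f + i) = ?l ! i"
   "i < length ?l ==> arrs s (102 + 3 * f) (aev x r * N f + ?l ! i) = i" for i
  using r unfolding rep_def by auto
 show "i < length ?l ==> ?l ! i = aev x y ==> ev s (Pos f rN r y) = i"
  using A[of i] P by auto
 show "ev s (Member f rN r y) = of_bool (aev x y : set ?l)"
 proof (cases "aev x y : set ?l")
  case True
  then obtain i where i: "i < length ?l" "?l ! i = aev x y" by (auto simp: in_set_conv_nth)
  hence "?p = i" using A(2)[of i] by simp
  thus ?thesis using i A(1)[of i] True unfolding Member_def
   by (simp add: P C Elt_def Idx_def e)
 next
  case False
  hence "~ (?p < length ?l & arrs s (100 + 3 * f) (aev x r * N f + ?p) = aev x y)"
   using A(1)[of ?p] by (metis nth_mem)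
  thus ?thesis using False unfolding Member_def by (auto simp: P C Elt_def Idx_def e)
 qed
qed

lemma hw_Insert:
 assumes p: "plain r" "plain y" and N: "areg x rN = N f" and y: "aev x y < N f"
  and Q: "Q (32 + 12 * cost r + 6 * cost y)
   (setl x f (aev x r) (lins (aev x y) (alst x f (aev x r))))"
 shows "hw N (Insert f rN r y) Q x"
 unfolding hw_def
proof (intro allI impI)
 fix s assume rep: "rep N s x"
 let ?r = "aev x r" and ?y = "aev x y"
 let ?l = "alst x f ?r"
 let ?T = "32 + 12 * cost r + 6 * cost y"
 have ne: "100 + 3 * f ~= 101 + 3 * f" "100 + 3 * f ~= 102 + 3 * f" "101 + 3 * f ~= 102 + 3 * f" by auto
 have rc: "regs s = areg x" "arrs s (101 + 3 * f) ?r = length ?l" "distinct ?l" "set ?l \<subseteq> {..<N f}"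
  and AP: "i < length ?l ==> arrs s (100 + 3 * f) (?r * N f + i) = ?l ! i &
   arrs s (102 + 3 * f) (?r * N f + ?l ! i) = i" for i
  using rep unfolding rep_def by auto
 show "EX t T s' x'. run (Insert f rN r y) s t s' & t <= T & rep N s' x' & Q T x'"
 proof (cases "?y : set ?l")
  case True
  hence "run (Insert f rN r y) s (cost (Member f rN r y) + 1 + 1) s"
   unfolding Insert_def using ev_Member(1)[OF rep p N y] by (intro run.intros) auto
  moreover have "cost (Member f rN r y) + 1 + 1 <= ?T"
   by (simp add: Member_def Pos_def Elt_def Idx_def)
  moreover have "setl x f ?r (lins ?y ?l) = x" using True by (simp add: setl_def lins_def)
  ultimately show ?thesis using rep Q by metis
 next
  case False
  define s1 where "s1 = s\<lparr>arrs := (arrs s)(100 + 3 * f := (arrs s (100 + 3 * f))(?r * N f + length ?l := ?y))\<rparr>"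
  define s2 where "s2 = s1\<lparr>arrs := (arrs s1)(102 + 3 * f := (arrs s1 (102 + 3 * f))(?r * N f + ?y := length ?l))\<rparr>"
  define s3 where "s3 = s2\<lparr>arrs := (arrs s2)(101 + 3 * f := (arrs s2 (101 + 3 * f))(?r := length ?l + 1))\<rparr>"
  have e: "ev s r = ?r" "ev s y = ?y" "ev s1 r = ?r" "ev s1 y = ?y" "ev s2 r = ?r" "ev s2 y = ?y"
   using ev_aev[OF rep] p plain_abs_ok ev_plain_cong[OF p(1), of s s1] ev_plain_cong[OF p(2), of s s1]
    ev_plain_cong[OF p(1), of s1 s2] ev_plain_cong[OF p(2), of s1 s2]
   by (auto simp: s1_def s2_def)
  have rs: "regs s1 = regs s" "regs s2 = regs s" "arrs s1 (101 + 3 * f) = arrs s (101 + 3 * f)"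
    "arrs s2 (101 + 3 * f) = arrs s (101 + 3 * f)"
   using ne by (auto simp: s1_def s2_def)
  have 1: "run (Write (100 + 3 * f) (Idx rN r (Cnt f r)) y) s (cost (Idx rN r (Cnt f r)) + cost y + 1) s1"
   using run.intros(3)[of "100 + 3 * f" "Idx rN r (Cnt f r)" y s]
   by (simp add: Idx_def Cnt_def e rc N s1_def)
  have 2: "run (Write (102 + 3 * f) (Idx rN r y) (Cnt f r)) s1 (cost (Idx rN r y) + cost (Cnt f r) + 1) s2"
   using run.intros(3)[of "102 + 3 * f" "Idx rN r y" "Cnt f r" s1]
   by (simp add: Idx_def Cnt_def e rs rc N s2_def)
  have 3: "run (Write (101 + 3 * f) r (Op Add (Cnt f r) (Const 1))) s2 (cost r + cost (Op Add (Cnt f r) (Const 1)) + 1) s3"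
   using run.intros(3)[of "101 + 3 * f" r "Op Add (Cnt f r) (Const 1)" s2]
   by (simp add: Idx_def Cnt_def e rs rc N s3_def)
  have "run (Insert f rN r y) s (cost (Member f rN r y) + 1 +
   ((cost (Idx rN r (Cnt f r)) + cost y + 1) + ((cost (Idx rN r y) + cost (Cnt f r) + 1) +
    (cost r + cost (Op Add (Cnt f r) (Const 1)) + 1)))) s3"
   unfolding Insert_def using ev_Member(1)[OF rep p N y] False 1 2 3
   by (intro run.intros(6) run.intros(4)) auto
  moreover have "cost (Member f rN r y) + 1 +
   ((cost (Idx rN r (Cnt f r)) + cost y + 1) + ((cost (Idx rN r y) + cost (Cnt f r) + 1) +
    (cost r + cost (Op Add (Cnt f r) (Const 1)) + 1))) <= ?T"
   by (simp add: Member_def Pos_def Elt_def Idx_def)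
  moreover have "rep N s3 (setl x f ?r (lins ?y ?l))"
  proof (rule rep_setl[OF rep])
   have len: "length ?l < N f"
   proof -
    have "insert ?y (set ?l) \<subseteq> {..<N f}" using rc y by auto
    from card_mono[OF _ this] show ?thesis using False distinct_card[OF rc(3)] by simp
   qed
   show "arrs s3 = (arrs s)(100 + 3 * f := (arrs s (100 + 3 * f))(?r * N f + length ?l := ?y),
    101 + 3 * f := (arrs s (101 + 3 * f))(?r := length ?l + 1),
    102 + 3 * f := (arrs s (102 + 3 * f))(?r * N f + ?y := length ?l))"
    using ne unfolding s3_def s2_def s1_def by (simp add: fun_upd_twist)
   show "distinct (lins ?y ?l)" "set (lins ?y ?l) \<subseteq> {..<N f}" using rc y by auto
   show "(arrs s (101 + 3 * f))(?r := length ?l + 1) = (arrs s (101 + 3 * f))(?r := length (lins ?y ?l))"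
    using False by (simp add: lins_def)
   show "regs s3 = regs s" by (simp add: s3_def rs)
   show "((arrs s (100 + 3 * f))(?r * N f + length ?l := ?y)) (?r * N f + i) = lins ?y ?l ! i &
    ((arrs s (102 + 3 * f))(?r * N f + ?y := length ?l)) (?r * N f + lins ?y ?l ! i) = i"
    if "i < length (lins ?y ?l)" for i
   proof (cases "i < length ?l")
    case True
    hence "?l ! i ~= ?y" using False nth_mem by metis
    thus ?thesis using True AP[of i] False by (simp add: lins_def nth_append)
   next
    case ge: False
    thus ?thesis using that False by (simp add: lins_def nth_append less_Suc_eq)
   qed
   show "((arrs s (100 + 3 * f))(?r * N f + length ?l := ?y)) (r' * N f + i) =
     arrs s (100 + 3 * f) (r' * N f + i) &
    ((arrs s (102 + 3 * f))(?r * N f + ?y := length ?l)) (r' * N f + i) =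
     arrs s (102 + 3 * f) (r' * N f + i)" if "r' ~= ?r" "i < N f" for r' i
    using that len y row_index_eq[of i "N f" "length ?l" r' ?r] row_index_eq[of i "N f" ?y r' ?r] by simp
  qed
  ultimately show ?thesis using Q by metis
 qed
qed

lemma hw_Delete:
 assumes p: "plain r" "plain y" and N: "areg x rN = N f" and y: "aev x y < N f"
  and Q: "Q (50 + 20 * cost r + 10 * cost y)
   (setl x f (aev x r) (sdel (aev x y) (alst x f (aev x r))))"
 shows "hw N (Delete f rN r y) Q x"
 unfolding hw_def
proof (intro allI impI)
 fix s assume rep: "rep N s x"
 let ?r = "aev x r" and ?y = "aev x y"
 let ?l = "alst x f ?r"
 let ?T = "50 + 20 * cost r + 10 * cost y"
 have ne: "100 + 3 * f ~= 101 + 3 * f" "100 + 3 * f ~= 102 + 3 * f" "101 + 3 * f ~= 102 + 3 * f" by auto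
 have rc: "regs s = areg x" "arrs s (101 + 3 * f) ?r = length ?l" "distinct ?l" "set ?l \<subseteq> {..<N f}"
  and AP: "i < length ?l ==> arrs s (100 + 3 * f) (?r * N f + i) = ?l ! i &
   arrs s (102 + 3 * f) (?r * N f + ?l ! i) = i" for i
  using rep unfolding rep_def by auto
 show "EX t T s' x'. run (Delete f rN r y) s t s' & t <= T & rep N s' x' & Q T x'"
 proof (cases "?y : set ?l")
  case False
  hence "run (Delete f rN r y) s (cost (Member f rN r y) + 1 + 1) s"
   unfolding Delete_def using ev_Member(1)[OF rep p N y] by (intro run.intros) auto
  moreover have "cost (Member f rN r y) + 1 + 1 <= ?T"
   by (simp add: Member_def Pos_def Elt_def Idx_def)
  moreover have "setl x f ?r (sdel ?y ?l) = x" using False by (simp add: setl_def sdel_def)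
  ultimately show ?thesis using rep Q by metis
 next
  case True
  then obtain j where j: "j < length ?l" "?l ! j = ?y" by (auto simp: in_set_conv_nth)
  define k where "k = length ?l - 1"
  define z where "z = last ?l"
  have k: "k < length ?l" "?l ! k = z" "length ?l = Suc k"
   using j last_conv_nth[of ?l] by (cases ?l; auto simp: k_def z_def)+
  define s1 where "s1 = s\<lparr>arrs := (arrs s)(101 + 3 * f := (arrs s (101 + 3 * f))(?r := k))\<rparr>"
  define s2 where "s2 = s1\<lparr>arrs := (arrs s1)(100 + 3 * f := (arrs s1 (100 + 3 * f))(?r * N f + j := z))\<rparr>"
  define s3 where "s3 = s2\<lparr>arrs := (arrs s2)(102 + 3 * f := (arrs s2 (102 + 3 * f))(?r * N f + z := j))\<rparr>"
  have e: "ev s r = ?r" "ev s y = ?y" "ev s1 r = ?r" "ev s1 y = ?y" "ev s2 r = ?r" "ev s2 y = ?y"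
   using ev_aev[OF rep] p plain_abs_ok ev_plain_cong[OF p(1), of s s1] ev_plain_cong[OF p(2), of s s1]
    ev_plain_cong[OF p(1), of s1 s2] ev_plain_cong[OF p(2), of s1 s2]
   by (auto simp: s1_def s2_def)
  have rs: "regs s1 = regs s" "regs s2 = regs s" "arrs s1 (100 + 3 * f) = arrs s (100 + 3 * f)"
    "arrs s1 (102 + 3 * f) = arrs s (102 + 3 * f)" "arrs s2 (102 + 3 * f) = arrs s (102 + 3 * f)"
    "arrs s1 (101 + 3 * f) ?r = k" "arrs s2 (101 + 3 * f) ?r = k"
    "arrs s2 (100 + 3 * f) = (arrs s (100 + 3 * f))(?r * N f + j := z)"
   using ne by (auto simp: s1_def s2_def)
  have 1: "run (Write (101 + 3 * f) r (Op Sub (Cnt f r) (Const 1))) s (cost r + cost (Op Sub (Cnt f r) (Const 1)) + 1) s1"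
   using run.intros(3)[of "101 + 3 * f" r "Op Sub (Cnt f r) (Const 1)" s]
   by (simp add: Idx_def Cnt_def e rs rc N s1_def k_def)
  have pj: "arrs s (102 + 3 * f) (?r * N f + ?y) = j" using AP[of j] j by simp
  have zk: "arrs s (100 + 3 * f) (?r * N f + k) = z" using AP[of k] k by simp
  have 2: "run (Write (100 + 3 * f) (Idx rN r (Pos f rN r y)) (Elt f rN r (Cnt f r))) s1
    (cost (Idx rN r (Pos f rN r y)) + cost (Elt f rN r (Cnt f r)) + 1) s2"
   using run.intros(3)[of "100 + 3 * f" "Idx rN r (Pos f rN r y)" "Elt f rN r (Cnt f r)" s1]
   by (simp add: Idx_def Cnt_def Pos_def Elt_def e rs rc N pj zk s2_def)
  have zk2: "arrs s2 (100 + 3 * f) (?r * N f + k) = z" using zk rs by auto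
  have 3: "run (Write (102 + 3 * f) (Idx rN r (Elt f rN r (Cnt f r))) (Pos f rN r y)) s2
    (cost (Idx rN r (Elt f rN r (Cnt f r))) + cost (Pos f rN r y) + 1) s3"
   using run.intros(3)[of "102 + 3 * f" "Idx rN r (Elt f rN r (Cnt f r))" "Pos f rN r y" s2]
   by (simp add: Idx_def Cnt_def Pos_def Elt_def e rs(1,2,5,7) rc N pj zk2 s3_def)
  have "run (Delete f rN r y) s (cost (Member f rN r y) + 1 +
   ((cost r + cost (Op Sub (Cnt f r) (Const 1)) + 1) +
    ((cost (Idx rN r (Pos f rN r y)) + cost (Elt f rN r (Cnt f r)) + 1) +
    (cost (Idx rN r (Elt f rN r (Cnt f r))) + cost (Pos f rN r y) + 1)))) s3"
   unfolding Delete_def using ev_Member(1)[OF rep p N y] True 1 2 3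
   by (intro run.intros(5) run.intros(4)) auto
  moreover have "cost (Member f rN r y) + 1 +
   ((cost r + cost (Op Sub (Cnt f r) (Const 1)) + 1) +
    ((cost (Idx rN r (Pos f rN r y)) + cost (Elt f rN r (Cnt f r)) + 1) +
    (cost (Idx rN r (Elt f rN r (Cnt f r))) + cost (Pos f rN r y) + 1))) <= ?T"
   by (simp add: Member_def Pos_def Elt_def Idx_def)
  moreover have "rep N s3 (setl x f ?r (sdel ?y ?l))"
  proof (rule rep_setl[OF rep])
   have len: "length ?l <= N f"
    using card_mono[OF _ rc(4)] distinct_card[OF rc(3)] by simp
   have z: "z < N f" using rc(4) k nth_mem[OF k(1)] by auto
   have sd: "sdel ?y ?l = butlast (?l[j := z])" using sdel_index[OF rc(3) j(1)] j(2) by (simp add: z_def)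
   show "arrs s3 = (arrs s)(100 + 3 * f := (arrs s (100 + 3 * f))(?r * N f + j := z),
    101 + 3 * f := (arrs s (101 + 3 * f))(?r := k),
    102 + 3 * f := (arrs s (102 + 3 * f))(?r * N f + z := j))"
    using ne unfolding s3_def s2_def s1_def by (simp add: fun_upd_twist)
   show "distinct (sdel ?y ?l)" "set (sdel ?y ?l) \<subseteq> {..<N f}" using rc by auto
   show "(arrs s (101 + 3 * f))(?r := k) = (arrs s (101 + 3 * f))(?r := length (sdel ?y ?l))"
    using k by (simp add: sd)
   show "regs s3 = regs s" by (simp add: s3_def rs)
   show "((arrs s (100 + 3 * f))(?r * N f + j := z)) (?r * N f + i) = sdel ?y ?l ! i &
    ((arrs s (102 + 3 * f))(?r * N f + z := j)) (?r * N f + sdel ?y ?l ! i) = i"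
    if i: "i < length (sdel ?y ?l)" for i
   proof -
    have ik: "i < k" using i k by (simp add: sd)
    hence nth: "sdel ?y ?l ! i = (if i = j then z else ?l ! i)"
     using k j by (simp add: sd nth_butlast)
    have "?l ! i ~= z" using ik k nth_eq_iff_index_eq[OF rc(3), of i k] by auto
    thus ?thesis using AP[of i] ik k nth by auto
   qed
   show "((arrs s (100 + 3 * f))(?r * N f + j := z)) (r' * N f + i) =
     arrs s (100 + 3 * f) (r' * N f + i) &
    ((arrs s (102 + 3 * f))(?r * N f + z := j)) (r' * N f + i) =
     arrs s (102 + 3 * f) (r' * N f + i)" if "r' ~= ?r" "i < N f" for r' i
    using that len z j row_index_eq[of i "N f" j r' ?r] row_index_eq[of i "N f" z r' ?r] by simp
  qed
  ultimately show ?thesis using Q by metis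
 qed
qed

lemma rep_take:
 assumes rep: "rep N s x" and k: "k <= length (alst x f r)"
  and s': "regs s' = regs s" "arrs s' = (arrs s)(101 + 3 * f := (arrs s (101 + 3 * f))(r := k))"
 shows "rep N s' (setl x f r (take k (alst x f r)))"
proof (rule rep_setl[OF rep])
 have R: "distinct (alst x f r)" "set (alst x f r) \<subseteq> {..<N f}"
  "i < length (alst x f r) ==> arrs s (100 + 3 * f) (r * N f + i) = alst x f r ! i &
    arrs s (102 + 3 * f) (r * N f + alst x f r ! i) = i" for i
  using rep unfolding rep_def by auto
 show "distinct (take k (alst x f r))" "set (take k (alst x f r)) \<subseteq> {..<N f}"
  using R by (auto dest: in_set_takeD)
 show "arrs s (100 + 3 * f) (r * N f + i) = take k (alst x f r) ! i &
    arrs s (102 + 3 * f) (r * N f + take k (alst x f r) ! i) = i"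
  if "i < length (take k (alst x f r))" for i
  using R(3)[of i] that by auto
 show "(arrs s (101 + 3 * f))(r := k) = (arrs s (101 + 3 * f))(r := length (take k (alst x f r)))"
  using k by simp
 show "arrs s' = (arrs s)(100 + 3 * f := arrs s (100 + 3 * f),
   101 + 3 * f := (arrs s (101 + 3 * f))(r := k), 102 + 3 * f := arrs s (102 + 3 * f))"
  using s' by auto
qed (use s' in auto)

lemma hw_Clear:
 assumes p: "plain r" and Q: "Q (cost r + 2) (setl x f (aev x r) [])"
 shows "hw N (Clear f r) Q x"
 unfolding hw_def
proof (intro allI impI)
 fix s assume rep: "rep N s x"
 have e: "ev s r = aev x r" using ev_aev[OF rep] p plain_abs_ok by auto
 let ?s = "s\<lparr>arrs := (arrs s)(101 + 3 * f := (arrs s (101 + 3 * f))(aev x r := 0))\<rparr>"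
 have "run (Clear f r) s (cost r + 2) ?s"
  using run.intros(3)[of "101 + 3 * f" r "Const 0" s] by (simp add: Clear_def e)
 moreover have "rep N ?s (setl x f (aev x r) [])"
  using rep_take[OF rep, of 0 f "aev x r" ?s] by simp
 ultimately show "EX t T s' x'. run (Clear f r) s t s' & t <= T & rep N s' x' & Q T x'"
  using Q by blast
qed

lemma hw_Pop:
 assumes p: "plain r" and N: "areg x rN = N f" and ne: "alst x f (aev x r) ~= []"
  and q: "!!v. aev (setr x q v) r = aev x r" "q ~= rN"
  and Q: "Q (10 + 4 * cost r)
   (setr (setl x f (aev x r) (butlast (alst x f (aev x r)))) q (last (alst x f (aev x r))))"
 shows "hw N (Pop f rN r q) Q x"
 unfolding hw_def
proof (intro allI impI)
 fix s assume rep: "rep N s x"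
 let ?l = "alst x f (aev x r)"
 have e: "ev s r = aev x r" using ev_aev[OF rep] p plain_abs_ok by auto
 define k where "k = length ?l - 1"
 let ?s = "s\<lparr>arrs := (arrs s)(101 + 3 * f := (arrs s (101 + 3 * f))(aev x r := k))\<rparr>"
 let ?z = "last ?l"
 have e': "ev ?s r = aev x r" using ev_plain_cong[OF p, of s ?s] e by simp
 have R: "regs s = areg x" "arrs s (101 + 3 * f) (aev x r) = length ?l"
  using rep by (auto simp: rep_def)
 have z: "arrs s (100 + 3 * f) (aev x r * N f + k) = ?z"
 proof -
  have "k < length ?l" "?l ! k = ?z" using ne by (auto simp: k_def last_conv_nth)
  thus ?thesis using rep by (auto simp: rep_def)
 qed
 have 1: "run (Write (101 + 3 * f) r (Op Sub (Cnt f r) (Const 1))) s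
    (cost r + cost (Op Sub (Cnt f r) (Const 1)) + 1) ?s"
  using run.intros(3)[of "101 + 3 * f" r "Op Sub (Cnt f r) (Const 1)" s]
  by (simp add: Cnt_def e R k_def)
 have 2: "run (Assign q (Elt f rN r (Cnt f r))) ?s (cost (Elt f rN r (Cnt f r)) + 1)
   (?s\<lparr>regs := (regs ?s)(q := ?z)\<rparr>)"
  using run.intros(2)[of q "Elt f rN r (Cnt f r)" ?s] by (simp add: Elt_def Idx_def Cnt_def e' R N z)
 have "run (Pop f rN r q) s ((cost r + cost (Op Sub (Cnt f r) (Const 1)) + 1)
   + (cost (Elt f rN r (Cnt f r)) + 1)) (?s\<lparr>regs := (regs ?s)(q := ?z)\<rparr>)"
  unfolding Pop_def using 1 2 by (intro run.intros(4))
 moreover have "(cost r + cost (Op Sub (Cnt f r) (Const 1)) + 1)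
   + (cost (Elt f rN r (Cnt f r)) + 1) <= 10 + 4 * cost r" by (simp add: Elt_def Idx_def)
 moreover have "rep N ?s (setl x f (aev x r) (butlast ?l))"
  using rep_take[OF rep, of k f "aev x r" ?s] by (simp add: k_def butlast_conv_take)
 hence "rep N (?s\<lparr>regs := (regs ?s)(q := ?z)\<rparr>) (setr (setl x f (aev x r) (butlast ?l)) q ?z)"
  unfolding rep_def by simp
 ultimately show "EX t T s' x'. run (Pop f rN r q) s t s' & t <= T & rep N s' x' & Q T x'"
  using Q by blast
qed

lemma hw_Member:
 assumes p: "plain r" "plain y" and N: "areg x rN = N f" and y: "aev x y < N f"
  and "aev x y : set (alst x f (aev x r)) ==>
   hw N p (%t. Q (cost (Member f rN r y) + 1 + t)) x"
  and "aev x y ~: set (alst x f (aev x r)) ==>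
   hw N q (%t. Q (cost (Member f rN r y) + 1 + t)) x"
 shows "hw N (Cond (Member f rN r y) p q) Q x"
 unfolding hw_def
proof (intro allI impI)
 fix s assume r: "rep N s x"
 let ?e = "Member f rN r y"
 show "EX t T s' x'. run (Cond ?e p q) s t s' & t <= T & rep N s' x' & Q T x'"
 proof (cases "aev x y : set (alst x f (aev x r))")
  case True
  hence e: "ev s ?e ~= 0" using ev_Member(1)[OF r p N y] by simp
  obtain t T s' x' where "run p s t s'" "t <= T" "rep N s' x'" "Q (cost ?e + 1 + T) x'"
   using assms(5)[OF True] r unfolding hw_def by blast
  thus ?thesis using run.intros(5)[of s ?e p t s' q] e add_left_mono by metis
 next
  case False
  hence e: "ev s ?e = 0" using ev_Member(1)[OF r p N y] by simp
  obtain t T s' x' where "run q s t s'" "t <= T" "rep N s' x'" "Q (cost ?e + 1 + T) x'"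
   using assms(6)[OF False] r unfolding hw_def by blast
  thus ?thesis using run.intros(6)[of s ?e q t s' p] e add_left_mono by metis
 qed
qed

lemma hw_Elt:
 assumes p: "plain r" "plain y" and N: "areg x rN = N f"
  and y: "aev x y < length (alst x f (aev x r))"
  and Q: "Q (5 + cost r + cost y) (setr x q (alst x f (aev x r) ! aev x y))"
 shows "hw N (Assign q (Elt f rN r y)) Q x"
 unfolding hw_def
proof (intro allI impI)
 fix s assume rep: "rep N s x"
 let ?z = "alst x f (aev x r) ! aev x y"
 have e: "ev s r = aev x r" "ev s y = aev x y" using ev_aev[OF rep] p plain_abs_ok by auto
 have "ev s (Elt f rN r y) = ?z" using rep y by (simp add: Elt_def Idx_def e rep_def N)
 hence "run (Assign q (Elt f rN r y)) s (5 + cost r + cost y) (s\<lparr>regs := (regs s)(q := ?z)\<rparr>)"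
  using run.intros(2)[of q "Elt f rN r y" s] by (simp add: Elt_def Idx_def eval_nat_numeral)
 moreover have "rep N (s\<lparr>regs := (regs s)(q := ?z)\<rparr>) (setr x q ?z)"
  using rep unfolding rep_def by simp
 ultimately show "EX t T s' x'. run (Assign q (Elt f rN r y)) s t s' & t <= T & rep N s' x' & Q T x'"
  using Q by blast
qed

text \<open>The loop runs through the list from its end, so that deleting the current element, which
 moves the last one to its position, does not disturb the elements still to come.\<close>

lemma hw_For:
 assumes p: "plain r" and row: "aev x r = ro"
  and init: "J {} 0 x" and J: "!!D T x. J D T x ==> aev x r = ro & areg x rN = N f"
  and iq: "!!x v. aev (setr x i v) r = aev x r" "!!x v. aev (setr x q v) r = aev x r"
   "i ~= rN" "q ~= rN" "i ~= q"
  and Ji: "!!D T x v. J D T x ==> J D T (setr x i v)"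
  and step: "!!D y T x v. D \<subseteq> set (alst xi f ro) ==> y : set (alst xi f ro) ==> y ~: D ==> J D T x ==>
   y : set (alst x f ro) ==> distinct (alst x f ro) ==>
   hw N b (%t x'. J (insert y D) (T + 12 + cost r + t) x' & areg x' i = v &
    (alst x' f ro = alst x f ro \<or> alst x' f ro = sdel y (alst x f ro))) (setr (setr x i v) q y)"
  and exit: "!!T x. J (set (alst xi f ro)) T x ==> Q (T + 4 + cost r) x"
  and xi: "alst x f ro = alst xi f ro"
 shows "hw N (For f rN r i q b) Q x"
proof (rule hw_lists)
 let ?l = "alst xi f ro"
 assume "!!f r. distinct (alst x f r) & set (alst x f r) \<subseteq> {..<N f}"
 hence dl: "distinct ?l" using xi by metis
 \<comment> \<open>\<open>j\<close> elements are still to come. They are the first \<open>j\<close>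
   entries of the original list, and only this prefix has to be intact in the current one.\<close>
 define I where "I = (%T y. EX j<=length ?l. areg y i = j & J (set (drop j ?l)) T y &
  take j (alst y f ro) = take j ?l & j <= length (alst y f ro))"
 show ?thesis
  unfolding For_def
 proof (rule hw_Seq, rule hw_Assign, goal_cases ok loop)
  case ok
  thus ?case using p plain_abs_ok by simp
 next
  case loop
  show ?case
  proof (rule hw_While[where I = I and \<mu> = "%x. areg x i"])
  show "abs_ok (Reg i)" by simp
  show "I 0 (setr x i (aev x (Cnt f r)))"
   using init Ji row xi by (auto simp: I_def)
  show "Q (cost (Cnt f r) + 1 + (T + cost (Reg i) + 1)) y" if "I T y" "aev y (Reg i) = 0" for T y
   using that exit[of T y] by (auto simp: I_def eval_nat_numeral add.commute)
 next
  fix T y assume I: "I T y" and nz: "aev y (Reg i) ~= 0"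
  define j where "j = areg y i - 1"
  have j: "areg y i = Suc j" "Suc j <= length ?l" "J (set (drop (Suc j) ?l)) T y"
   "take (Suc j) (alst y f ro) = take (Suc j) ?l" "Suc j <= length (alst y f ro)"
   using I nz by (auto simp: I_def j_def)
  let ?z = "?l ! j"
  have Ry: "aev y r = ro" "areg y rN = N f" using J j(3) by blast+
  have zj: "alst y f ro ! j = ?z" using j(4) by (metis lessI nth_take)
  have dr: "set (drop j ?l) = insert ?z (set (drop (Suc j) ?l))"
   using j(2) by (metis Cons_nth_drop_Suc Suc_le_lessD list.simps(15))
  have nin: "?z ~: set (drop (Suc j) ?l)"
   using dl j(2) by (metis Cons_nth_drop_Suc Suc_le_lessD distinct.simps(2) distinct_drop)
  let ?P = "%t x'. I (T + cost (Reg i) + 1 + (cost (Op Sub (Reg i) (Const 1)) + 1 + ((5 + cost r + cost (Reg i)) + t))) x' &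
    areg x' i < areg y i"
  have "hw N b ?P (setr (setr y i j) q ?z)"
  proof (rule hw_lists)
   assume L: "!!f r. distinct (alst (setr (setr y i j) q ?z) f r) & set (alst (setr (setr y i j) q ?z) f r) \<subseteq> {..<N f}"
   hence dy: "distinct (alst y f ro)" by simp
   have "hw N b (%t x'. J (insert ?z (set (drop (Suc j) ?l))) (T + 12 + cost r + t) x' & areg x' i = j &
    (alst x' f ro = alst y f ro \<or> alst x' f ro = sdel ?z (alst y f ro))) (setr (setr y i j) q ?z)"
    using nin dy nth_mem[of j ?l] nth_mem[of j "alst y f ro"] j(2,5) zj
    by (intro step[OF _ _ _ j(3)]) (auto dest: in_set_dropD)
   thus ?thesis
   proof (rule hw_time)
    fix t x'
    assume a: "J (insert ?z (set (drop (Suc j) ?l))) (T + 12 + cost r + t) x' & areg x' i = j &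
     (alst x' f ro = alst y f ro \<or> alst x' f ro = sdel ?z (alst y f ro))"
    have "take j (alst x' f ro) = take j ?l"
    proof -
     have "take j (alst y f ro) = take j ?l" using j(4) by (metis Suc_n_not_le_n linear min_def take_take)
     thus ?thesis using a take_sdel[OF dy, of j] j(5) zj by auto
    qed
    moreover have "j <= length (alst x' f ro)"
    proof -
     have "length (take j ?l) = j" using j(2) by simp
     thus ?thesis using calculation by (metis length_take min.cobounded1)
    qed
    ultimately have "I (T + 12 + cost r + t) x' & areg x' i < areg y i"
     using a j(1,2) dr unfolding I_def by auto
    thus "EX T'>=t. I (T + cost (Reg i) + 1 + (cost (Op Sub (Reg i) (Const 1)) + 1 + ((5 + cost r + cost (Reg i)) + T'))) x' &
     areg x' i < areg y i"
     by (intro exI[of _ t]) (simp add: algebra_simps)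
   qed
  qed
  thus "hw N (Seq (Assign i (Op Sub (Reg i) (Const 1))) (Seq (Assign q (Elt f rN r (Reg i))) b))
    (%t x'. I (T + cost (Reg i) + 1 + t) x' & areg x' i < areg y i) y"
   using p Ry iq zj j by (intro hw_Seq hw_Assign hw_Elt) auto
  qed
 qed
qed

section \<open>Almost-sure winning for Streett objectives\<close>

definition step_pmf :: "nat mdp => (nat list => nat) => nat => nat list => nat pmf" where
 "step_pmf P sg v h = (if h = [] then return_pmf v else next_pmf P sg h)"

text \<open>The law of the first \<open>k\<close> vertices as a discrete distribution; computations
  with the play measure are reduced to it.\<close>

primrec hist :: "nat mdp => (nat list => nat) => nat => nat => nat list pmf" where
 "hist P sg v 0 = return_pmf []"
| "hist P sg v (Suc k) = bind_pmf (hist P sg v k) (%h. map_pmf (%x. h @ [x]) (step_pmf P sg v h))"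

lemma borel_measurable_prefix_space:
 "(g :: (nat => nat) => ennreal) : borel_measurable (PiM {0..<k} (%_. count_space UNIV))"
proof -
 have "(PiM {0..<k} (%_. count_space UNIV) :: (nat => nat) measure) = count_space (PiE {0..<k} (%_. UNIV))"
  by (rule count_space_PiM_finite) auto
 thus ?thesis by simp
qed

lemma map_restrict_upt: "map (restrict om {0..<k}) [0..<k] = map om [0..<k]"
 by simp

lemma restrict_play_measurable:
 "(%om. restrict om {0..<k}) : measurable (play_measure P sg v) (PiM {0..<k} (%_. count_space UNIV))"
 for P :: "nat mdp"
 unfolding measurable_cong_sets[OF sets_play_measure refl] by (rule measurable_restrict_subset) simp

lemma borel_measurable_prefix:
 fixes P :: "nat mdp" and f :: "nat list => ennreal"
 shows "(%om. f (map om [0..<k])) : borel_measurable (play_measure P sg v)"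
 using measurable_compose[OF restrict_play_measurable borel_measurable_prefix_space, of "%x. f (map x [0..<k])" k P sg v]
 unfolding map_restrict_upt .

text \<open>Both sides iterate the same kernels: for the product \<open>C 0 k\<close> of the first
  \<open>k\<close> Ionescu-Tulcea kernels this is an induction on \<open>k\<close>, and projecting
  the play measure to the first \<open>k\<close> coordinates yields this product.\<close>

lemma nn_integral_play_prefix:
 fixes f :: "nat list => ennreal"
 shows "(\<integral>\<^sup>+om. f (map om [0..<k]) \<partial>play_measure P sg v) = (\<integral>\<^sup>+h. f h \<partial>hist P sg v k)"
proof -
 interpret IT: Ionescu_Tulcea "play_kernel P sg v" "%_. count_space UNIV"
  by (rule Ionescu_Tulcea_play_kernel)
 let ?u = "%_::nat. undefined :: nat"
 have sp: "?u : space (PiM {0..<0} (%_. count_space UNIV))" by (simp add: space_PiM)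
 have C: "(\<integral>\<^sup>+x. f (map x [0..<k]) \<partial>IT.C 0 k ?u) = (\<integral>\<^sup>+h. f h \<partial>hist P sg v k)" for f :: "nat list => ennreal" and k
 proof (induction k arbitrary: f)
  case 0
  have "(\<integral>\<^sup>+x. f (map x [0..<0]) \<partial>IT.C 0 0 ?u) = f []"
   unfolding IT.C.simps by (subst nn_integral_return[OF sp borel_measurable_prefix_space]) simp
  thus ?case by simp
 next
  case (Suc k)
  have eP: "IT.eP k : measurable (IT.C 0 k ?u) (subprob_algebra (PiM {0..<Suc k} (%_. count_space UNIV)))"
   using IT.measurable_eP[of k] unfolding measurable_cong_sets[OF IT.sets_C[OF sp, of k] refl] by simp
  have "(\<integral>\<^sup>+x. f (map x [0..<Suc k]) \<partial>IT.C 0 (Suc k) ?u) =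
    (\<integral>\<^sup>+y. (\<integral>\<^sup>+x. f (map x [0..<Suc k]) \<partial>IT.eP k y) \<partial>IT.C 0 k ?u)"
   unfolding IT.C.simps add_0 by (rule nn_integral_bind[OF borel_measurable_prefix_space eP])
  also have "... = (\<integral>\<^sup>+y. (\<integral>\<^sup>+x. f (map y [0..<k] @ [x]) \<partial>step_pmf P sg v (map y [0..<k])) \<partial>IT.C 0 k ?u)"
  proof (rule nn_integral_cong)
   fix y assume "y : space (IT.C 0 k ?u)"
   hence y: "y : space (PiM {0..<k} (%_. count_space UNIV))" using IT.space_C[OF sp, of k] by simp
   have ker: "play_kernel P sg v k y = measure_pmf (step_pmf P sg v (map y [0..<k]))"
    by (auto simp: play_kernel_def step_pmf_def)
   have upd: "map (y(k := x)) [0..<Suc k] = map y [0..<k] @ [x]" for x by simp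
   show "(\<integral>\<^sup>+x. f (map x [0..<Suc k]) \<partial>IT.eP k y) = (\<integral>\<^sup>+x. f (map y [0..<k] @ [x]) \<partial>step_pmf P sg v (map y [0..<k]))"
    unfolding IT.nn_integral_eP[OF y borel_measurable_prefix_space] upd ker ..
  qed
  also have "... = (\<integral>\<^sup>+h. (\<integral>\<^sup>+x. f (h @ [x]) \<partial>step_pmf P sg v h) \<partial>hist P sg v k)"
   by (rule Suc.IH)
  also have "... = (\<integral>\<^sup>+h. f h \<partial>hist P sg v (Suc k))"
   by (simp add: nn_integral_bind_pmf nn_integral_map_pmf)
  finally show ?case .
 qed
 \<comment> \<open>\<open>CI\<close> goes through the smallest initial segment that contains the
   index set; here this is the index set itself.\<close>
 have up: "IT.up_to {0..<k} = k"
 proof (rule antisym)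
  show "IT.up_to {0..<k} <= k" by (simp add: IT.up_to_iff)
  show "k <= IT.up_to {0..<k}" using IT.up_to[of "{0..<k}"] by (cases k) auto
 qed
 have "(\<integral>\<^sup>+om. f (map om [0..<k]) \<partial>play_measure P sg v) =
   (\<integral>\<^sup>+x. f (map x [0..<k]) \<partial>distr (play_measure P sg v) (PiM {0..<k} (%_. count_space UNIV)) (%om. restrict om {0..<k}))"
  by (subst nn_integral_distr[OF restrict_play_measurable]) (simp_all only: measurable_distr_eq1 borel_measurable_prefix_space map_restrict_upt)
 also have "distr (play_measure P sg v) (PiM {0..<k} (%_. count_space UNIV)) (%om. restrict om {0..<k}) = IT.CI {0..<k}"
  unfolding play_measure_def by (rule IT.distr_lim) simp
 also have "(\<integral>\<^sup>+x. f (map x [0..<k]) \<partial>IT.CI {0..<k}) = (\<integral>\<^sup>+x. f (map x [0..<k]) \<partial>IT.C 0 k ?u)"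
 proof -
  have r: "(%f. restrict f {0..<k}) : measurable (IT.C 0 k ?u) (PiM {0..<k} (%_. count_space UNIV))"
   unfolding measurable_cong_sets[OF IT.sets_C[OF sp, of k] refl] by (rule measurable_restrict_subset) simp
  show ?thesis unfolding IT.CI_def up
   by (subst nn_integral_distr[OF r]) (simp_all only: measurable_distr_eq1 borel_measurable_prefix_space map_restrict_upt)
 qed
 finally show ?thesis using C by simp
qed

lemma AE_prefix:
 fixes P :: "nat mdp"
 shows "AE om in play_measure P sg v. ALL k. map om [0..<k] : set_pmf (hist P sg v k)"
 unfolding AE_all_countable
proof
 fix k
 let ?S = "set_pmf (hist P sg v k)"
 have "(\<integral>\<^sup>+om. indicator (- ?S) (map om [0..<k]) \<partial>play_measure P sg v) = (\<integral>\<^sup>+h. indicator (- ?S) h \<partial>hist P sg v k)"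
  by (rule nn_integral_play_prefix)
 also have "... = 0" by (subst nn_integral_0_iff_AE) (auto simp: AE_measure_pmf_iff)
 finally have "AE om in play_measure P sg v. (indicator (- ?S) (map om [0..<k]) :: ennreal) = 0"
  by (subst (asm) nn_integral_0_iff_AE) (simp_all add: borel_measurable_prefix)
 thus "AE om in play_measure P sg v. map om [0..<k] : ?S"
  by eventually_elim (simp add: indicator_def split: if_splits)
qed

text \<open>A prefix in the support has positive probability, so it cannot be avoided by a set of
  plays of measure 1.\<close>

lemma prefix_extends:
 assumes h: "h : set_pmf (hist P sg v k)" and ae: "AE om in play_measure P sg v. \<Phi> om"
 shows "EX om. \<Phi> om & map om [0..<k] = h"
proof (rule ccontr)
 assume no: "~ ?thesis"
 have "AE om in play_measure P sg v. (indicator {h} (map om [0..<k]) :: ennreal) = 0"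
  using ae by eventually_elim (use no in auto)
 hence "(\<integral>\<^sup>+om. indicator {h} (map om [0..<k]) \<partial>play_measure P sg v) = 0"
  by (subst nn_integral_0_iff_AE) (simp_all add: borel_measurable_prefix)
 hence "emeasure (hist P sg v k) {h} = 0" unfolding nn_integral_play_prefix by simp
 thus False using h by (simp add: emeasure_pmf_single set_pmf_iff)
qed

section \<open>Fairness at random vertices\<close>

definition visits :: "nat => nat => nat list => nat" where
 "visits N u h = card {j. N <= j & Suc j < length h & h ! j = u}"

text \<open>A visit counts only once its successor is known. So the number grows exactly with a step
  out of \<open>u\<close>, which is the step whose random choice may hit \<open>w\<close>.\<close>

lemma visits_snoc:
 assumes "h ~= []"
 shows "visits N u (h @ [x]) = visits N u h + of_bool (N < length h & last h = u)"
proof -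
 let ?A = "{j. N <= j & Suc j < length h & h ! j = u}"
 have fin: "finite ?A" by (rule finite_subset[of _ "{..<length h}"]) auto
 have l: "last h = h ! (length h - 1)" using assms by (rule last_conv_nth)
 have "{j. N <= j & Suc j < length (h @ [x]) & (h @ [x]) ! j = u} =
   (if N < length h & last h = u then insert (length h - 1) ?A else ?A)"
  using assms unfolding l by (auto simp: nth_append less_Suc_eq_le le_less intro: Suc_lessI)
   (metis One_nat_def Suc_lessI Suc_pred' diff_Suc_1 length_greater_0_conv)+
 moreover have "length h - 1 ~: ?A" by auto
 ultimately show ?thesis unfolding visits_def using fin by auto
qed

text \<open>The weight \<open>r ^ visits\<close>, set to 0 as soon as \<open>w\<close> is seen after time \<open>N\<close>, is a supermartingale
 if \<open>r\<close> times the probability of avoiding \<open>w\<close> is at most 1.\<close>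

lemma AE_random_successor:
 fixes P :: "nat mdp"
 assumes u: "u : randv P" "w : set_pmf (prob_dist P u)"
 shows "AE om in play_measure P sg v. (ALL j>N. om j ~= w) --> u ~: Inf_verts om"
proof -
 let ?M = "play_measure P sg v"
 define p where "p = pmf (prob_dist P u) w"
 have p: "0 < p" "p <= 1" using u(2) by (auto simp: p_def pmf_le_1 set_pmf_iff less_le)
 \<comment> \<open>Any \<open>r > 1\<close> with \<open>r * (1 - p) <= 1\<close> would do; this one
   is also defined for \<open>p = 1\<close>.\<close>
 define r where "r = 2 / (2 - p)"
 have r: "1 < r" "r * (1 - p) <= 1" using p by (auto simp: r_def field_simps)
 define g where "g h = (if EX j. N < j & j < length h & h ! j = w then 0 else ennreal (r ^ visits N u h))" for h
 have step: "(\<integral>\<^sup>+x. g (h @ [x]) \<partial>step_pmf P sg v h) <= g h" for h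
 proof -
  have ex: "EX j. N < j & j < length (h @ [x]) & (h @ [x]) ! j = w"
   if "EX j. N < j & j < length h & h ! j = w" for x
   using that by (metis length_append_singleton less_SucI nth_append)
  show ?thesis
  proof (cases "h ~= [] & N < length h & last h = u")
   case True
   show ?thesis
   proof (cases "EX j. N < j & j < length h & h ! j = w")
    case wh: True
    hence "g (h @ [x]) = 0" for x using ex[OF wh] by (simp add: g_def)
    thus ?thesis by simp
   next
    case nw: False
    have "g (h @ [x]) <= ennreal (r ^ Suc (visits N u h)) * indicator (- {w}) x" for x
    proof (cases "x = w")
     case xw: True
     hence "EX j. N < j & j < length (h @ [x]) & (h @ [x]) ! j = w"
      using True by (intro exI[of _ "length h"]) simp
     thus ?thesis by (simp add: g_def)
    next
     case False
     thus ?thesis using True visits_snoc[of h N u x] by (simp add: g_def)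
    qed
    hence "(\<integral>\<^sup>+x. g (h @ [x]) \<partial>step_pmf P sg v h) <=
      (\<integral>\<^sup>+x. ennreal (r ^ Suc (visits N u h)) * indicator (- {w}) x \<partial>step_pmf P sg v h)"
     by (intro nn_integral_mono)
    also have "... = ennreal (r ^ Suc (visits N u h)) * emeasure (prob_dist P u) (- {w})"
     using True u(1) by (subst nn_integral_cmult_indicator) (auto simp: step_pmf_def next_pmf_def)
    also have "emeasure (prob_dist P u) (- {w}) = ennreal (1 - p)"
     using measure_pmf.prob_compl[of "{w}" "prob_dist P u"]
     by (simp add: measure_pmf.emeasure_eq_measure p_def measure_pmf_single Compl_eq_Diff_UNIV)
    also have "ennreal (r ^ Suc (visits N u h)) * ennreal (1 - p) = ennreal (r ^ visits N u h * (r * (1 - p)))"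
     using r p by (subst ennreal_mult[symmetric]) (auto simp: ac_simps)
    also have "... <= ennreal (r ^ visits N u h)"
     using r p mult_left_mono[OF r(2), of "r ^ visits N u h"] by (intro ennreal_leI) auto
    also have "... = g h" unfolding g_def if_not_P[OF nw] ..
    finally show ?thesis .
   qed
  next
   case False
   have vis: "visits N u (h @ [x]) = visits N u h" for x
   proof (cases "h = []")
    case True
    thus ?thesis by (simp add: visits_def)
   next
    case h: False
    thus ?thesis using False visits_snoc[OF h, of N u x] by auto
   qed
   have "g (h @ [x]) <= g h" for x
   proof (cases "EX j. N < j & j < length h & h ! j = w")
    case True
    thus ?thesis using ex[OF True, of x] by (simp add: g_def)
   next
    case False
    have "g h = ennreal (r ^ visits N u h)" unfolding g_def if_not_P[OF False] ..
    thus ?thesis using vis[of x] by (simp add: g_def[of "h @ [x]"])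
   qed
   hence "(\<integral>\<^sup>+x. g (h @ [x]) \<partial>step_pmf P sg v h) <= (\<integral>\<^sup>+x. g h \<partial>step_pmf P sg v h)"
    by (intro nn_integral_mono)
   thus ?thesis by (simp add: measure_pmf.emeasure_space_1[simplified])
  qed
 qed
 have hist: "(\<integral>\<^sup>+h. g h \<partial>hist P sg v k) <= 1" for k
 proof (induction k)
  case 0
  thus ?case by (simp add: g_def visits_def)
 next
  case (Suc k)
  have "(\<integral>\<^sup>+h. g h \<partial>hist P sg v (Suc k)) = (\<integral>\<^sup>+h. (\<integral>\<^sup>+x. g (h @ [x]) \<partial>step_pmf P sg v h) \<partial>hist P sg v k)"
   by (simp add: nn_integral_bind_pmf nn_integral_map_pmf)
  also have "... <= (\<integral>\<^sup>+h. g h \<partial>hist P sg v k)" by (intro nn_integral_mono step)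
  finally show ?case using Suc by (rule order_trans)
 qed
 define A where "A = {om :: nat => nat. ALL j>N. om j ~= w}"
 have A: "A : sets ?M"
 proof -
  have "A = {om : space (PiM UNIV (%_. count_space UNIV)). ALL j. N < j --> om j ~= w}"
   by (auto simp: A_def space_PiM)
  also have "... : sets (PiM UNIV (%_. count_space UNIV))" by measurable
  finally show ?thesis by (simp add: sets_play_measure)
 qed
 \<comment> \<open>On plays that avoid \<open>w\<close> the weights grow with \<open>k\<close>. By
   monotone convergence their limit has expectation at most 1, hence is almost surely finite,
   whereas infinitely many visits would make it infinite.\<close>
 define f where "f k om = ennreal (r ^ visits N u (map om [0..<k])) * indicator A om" for k om
 have fm: "f k : borel_measurable ?M" for k
  unfolding f_def using borel_measurable_prefix[of "%h. ennreal (r ^ visits N u h)" k P sg v] A by measurable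
 have vis: "visits N u (map om [0..<k]) = card {j. N <= j & Suc j < k & om j = u}" for om k
  unfolding visits_def by (rule arg_cong[where f = card]) auto
 have finv: "finite {j. N <= j & Suc j < k & om j = u}" for om k
  by (rule finite_subset[of _ "{..<k}"]) auto
 have vinc: "visits N u (map om [0..<k]) <= visits N u (map om [0..<k'])" if "k <= k'" for k k' om
  unfolding vis by (rule card_mono[OF finv]) (use that in auto)
 have inc: "incseq f"
  unfolding incseq_def le_fun_def f_def
 proof (intro allI impI)
  fix k k' :: nat and om assume "k <= k'"
  hence "r ^ visits N u (map om [0..<k]) <= r ^ visits N u (map om [0..<k'])" using r(1) vinc by (intro power_increasing) auto
  thus "ennreal (r ^ visits N u (map om [0..<k])) * indicator A om <= ennreal (r ^ visits N u (map om [0..<k'])) * indicator A om"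
   by (intro mult_right_mono ennreal_leI) auto
 qed
 have "(\<integral>\<^sup>+om. f k om \<partial>?M) <= 1" for k
 proof -
  have "f k om <= g (map om [0..<k])" for om by (auto simp: f_def g_def A_def indicator_def)
  hence "(\<integral>\<^sup>+om. f k om \<partial>?M) <= (\<integral>\<^sup>+om. g (map om [0..<k]) \<partial>?M)" by (intro nn_integral_mono)
  thus ?thesis using hist[of k] unfolding nn_integral_play_prefix by (rule order_trans)
 qed
 hence "(\<integral>\<^sup>+om. (SUP k. f k om) \<partial>?M) <= 1"
  unfolding nn_integral_monotone_convergence_SUP[OF inc fm] by (intro SUP_least)
 hence "(\<integral>\<^sup>+om. (SUP k. f k om) \<partial>?M) ~= \<infinity>" using ennreal_one_less_top by (metis infinity_ennreal_def not_le)
 moreover have "(%om. SUP k. f k om) : borel_measurable ?M" using fm by measurable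
 ultimately have "AE om in ?M. (SUP k. f k om) ~= \<infinity>" by (intro nn_integral_PInf_AE)
 thus ?thesis
 proof eventually_elim
  fix om assume fin: "(SUP k. f k om) ~= \<infinity>"
  show "(ALL j>N. om j ~= w) --> u ~: Inf_verts om"
  proof (intro impI notI)
   assume wa: "ALL j>N. om j ~= w" and ui: "u : Inf_verts om"
   have big: "EX k. K <= visits N u (map om [0..<k])" for K
   proof (induction K)
    case (Suc K)
    then obtain k where k: "K <= visits N u (map om [0..<k])" by blast
    have "EX j>max N k. om j = u" using ui unfolding Inf_verts_def INFM_nat mem_Collect_eq by (rule spec)
    then obtain j where j: "max N k < j" "om j = u" by blast
    have "visits N u (map om [0..<k]) < visits N u (map om [0..<Suc (Suc j)])"
     unfolding vis
    proof (rule psubset_card_mono[OF finv])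
     have "j : {i. N <= i & Suc i < Suc (Suc j) & om i = u}" "j ~: {i. N <= i & Suc i < k & om i = u}" using j by auto
     moreover have "{i. N <= i & Suc i < k & om i = u} \<subseteq> {i. N <= i & Suc i < Suc (Suc j) & om i = u}" using j by auto
     ultimately show "{i. N <= i & Suc i < k & om i = u} \<subset> {i. N <= i & Suc i < Suc (Suc j) & om i = u}" by blast
    qed
    thus ?case using k by (intro exI[of _ "Suc (Suc j)"]) simp
   qed simp
   obtain B where B: "(SUP k. f k om) = ennreal B" "0 <= B" using fin by (cases "SUP k. f k om") auto
   obtain K where K: "B < r ^ K" using real_arch_pow[OF r(1)] by blast
   obtain k where k: "K <= visits N u (map om [0..<k])" using big by blast
   have "ennreal (r ^ K) <= f k om"
    using wa power_increasing[OF k, of r] r(1) by (simp add: f_def A_def ennreal_leI)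
   also have "... <= ennreal B" unfolding B(1)[symmetric] by (rule SUP_upper) simp
   finally show False using K B(2) r(1) by (simp add: ennreal_le_iff)
  qed
 qed
qed

text \<open>There are only countably many combinations of an edge and a time \<open>N\<close>, and
  each of them contributes a null set.\<close>

lemma AE_fair:
 fixes P :: "nat mdp"
 assumes P: "is_mdp P"
 shows "AE om in play_measure P sg v. ALL u w. u : Inf_verts om --> u : randv P --> (u, w) : edges P --> w : Inf_verts om"
proof -
 have "AE om in play_measure P sg v. ALL u w N. u : randv P --> (u, w) : edges P --> (ALL j>N. om j ~= w) --> u ~: Inf_verts om"
  unfolding AE_all_countable
 proof (intro allI)
  fix u w N
  show "AE om in play_measure P sg v. u : randv P --> (u, w) : edges P --> (ALL j>N. om j ~= w) --> u ~: Inf_verts om"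
  proof (cases "u : randv P & (u, w) : edges P")
   case True
   hence "w : set_pmf (prob_dist P u)" using P by (auto simp: is_mdp_def)
   thus ?thesis using AE_random_successor[where P = P and u = u and w = w and N = N and sg = sg and v = v] True by auto
  qed auto
 qed
 thus ?thesis
 proof eventually_elim
  fix om assume a: "ALL u w N. u : randv P --> (u, w) : edges P --> (ALL j>N. om j ~= w) --> u ~: Inf_verts om"
  show "ALL u w. u : Inf_verts om --> u : randv P --> (u, w) : edges P --> w : Inf_verts om"
  proof (intro allI impI, rule ccontr)
   fix u w assume u: "u : Inf_verts om" "u : randv P" "(u, w) : edges P" and w: "w ~: Inf_verts om"
   obtain N where "ALL j>N. om j ~= w" using w unfolding Inf_verts_def INFM_nat mem_Collect_eq by blast
   thus False using a u by blast
  qed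
 qed
qed

lemma prefix_follows:
 assumes "ALL k. map om [0..<k] : set_pmf (hist P sg v k)"
 shows "om 0 = v" "om (Suc i) : set_pmf (next_pmf P sg (map om [0..<Suc i]))"
proof -
 have s: "om k : set_pmf (step_pmf P sg v (map om [0..<k]))" for k
  using assms[THEN spec, of "Suc k"] by auto
 show "om 0 = v" using s[of 0] by (simp add: step_pmf_def)
 show "om (Suc i) : set_pmf (next_pmf P sg (map om [0..<Suc i]))" using s[of "Suc i"] by (simp add: step_pmf_def)
qed

lemma path_props:
 assumes P: "is_mdp P" and sg: "sg : strategies P" and v: "v : verts P"
  and om: "ALL k. map om [0..<k] : set_pmf (hist P sg v k)"
 shows "om i : verts P" "(om i, om (Suc i)) : edges P" "om i ~: randv P ==> om (Suc i) = sg (map om [0..<Suc i])"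
proof -
 note f = prefix_follows[OF om]
 show pl: "om (Suc i) = sg (map om [0..<Suc i])" if "om i ~: randv P" for i
  using f(2)[of i] that by (simp add: next_pmf_def)
 have edge: "(om i, om (Suc i)) : edges P" if V: "ALL j<=i. om j : verts P" for i
 proof (cases "om i : randv P")
  case True
  thus ?thesis using f(2)[of i] P by (auto simp: next_pmf_def is_mdp_def)
 next
  case False
  hence "om i : player1 P" using V P by (auto simp: is_mdp_def)
  moreover have "map om [0..<i] : lists (verts P)" using V by auto
  ultimately have "(om i, sg (map om [0..<i] @ [om i])) : edges P" using sg by (auto simp: strategies_def)
  thus ?thesis using pl[OF False] by simp
 qed
 have V: "ALL j<=i. om j : verts P" for i
 proof (induction i)
  case 0
  thus ?case using f(1) v by simp
 next
  case (Suc i)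
  hence "om (Suc i) : verts P" using edge[OF Suc] P by (auto simp: is_mdp_def)
  thus ?case using Suc by (auto simp: le_Suc_eq)
 qed
 show "om i : verts P" "(om i, om (Suc i)) : edges P" using V edge by auto
qed

section \<open>Limit sets of plays and good end components\<close>

lemma Inf_verts_iff: "u : Inf_verts om \<longleftrightarrow> infinite {i. om i = u}"
 by (simp add: Inf_verts_def frequently_cofinite)

lemma Inf_vertsD: "u : Inf_verts om ==> EX i>=t. om i = u"
 by (auto simp: Inf_verts_def INFM_nat_le)

lemma eventually_Inf:
 assumes "finite V" "!!i. om i : V"
 shows "EX t. ALL i>=t. om i : Inf_verts om"
proof -
 have "finite (\<Union>x\<in>V - Inf_verts om. {i. om i = x})" using assms(1) by (auto simp: Inf_verts_iff)
 then obtain t where "ALL i:(\<Union>x\<in>V - Inf_verts om. {i. om i = x}). i < t" by (auto simp: finite_nat_set_iff_bounded)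
 hence "om i : Inf_verts om" if i: "t <= i" for i
 proof -
  have "i ~: (\<Union>x\<in>V - Inf_verts om. {i. om i = x})" using `ALL i:_. i < t` i by (meson leD)
  thus ?thesis using assms(2)[of i] by simp
 qed
 thus ?thesis by blast
qed

text \<open>The Streett pairs are tested on the whole set, as if each of its vertices were visited
  infinitely often; the winning strategy will achieve this.\<close>

definition good_ec :: "nat mdp => (nat set \<times> nat set) list => nat set => bool" where
 "good_ec P SP X \<longleftrightarrow> X ~= {} & X \<subseteq> verts P & (ALL v:X Int randv P. ALL w. (v, w) : edges P --> w : X) &
   (ALL v:X. EX w:X. (v, w) : edges P) & (ALL u:X. ALL w:X. (u, w) : (edges P Int X \<times> X)\<^sup>*) &
   (ALL (L, U):set SP. L Int X ~= {} --> U Int X ~= {})"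

lemma good_ecD:
 assumes "good_ec P SP X"
 shows "X ~= {}" "X \<subseteq> verts P" "v : X ==> v : randv P ==> (v, w) : edges P ==> w : X"
  "v : X ==> EX w:X. (v, w) : edges P" "u : X ==> w : X ==> (u, w) : (edges P Int X \<times> X)\<^sup>*"
  "(L, U) : set SP ==> L Int X ~= {} ==> U Int X ~= {}"
proof -
 note a = assms[unfolded good_ec_def]
 show "X ~= {}" using a by (elim conjE)
 show "X \<subseteq> verts P" using a by (elim conjE)
 have "ALL v:X Int randv P. ALL w. (v, w) : edges P --> w : X" using a by (elim conjE)
 thus "v : X ==> v : randv P ==> (v, w) : edges P ==> w : X" by blast
 have "ALL v:X. EX w:X. (v, w) : edges P" using a by (elim conjE)
 thus "v : X ==> EX w:X. (v, w) : edges P" by blast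
 have "ALL u:X. ALL w:X. (u, w) : (edges P Int X \<times> X)\<^sup>*" using a by (elim conjE)
 thus "u : X ==> w : X ==> (u, w) : (edges P Int X \<times> X)\<^sup>*" by blast
 have s: "ALL (L, U):set SP. L Int X ~= {} --> U Int X ~= {}" using a by (elim conjE)
 show "(L, U) : set SP ==> L Int X ~= {} ==> U Int X ~= {}" using bspec[OF s, of "(L, U)"] by simp
qed

text \<open>From some time on the play stays in its limit set. Between two later visits the play
  itself is a path inside this set, which gives strong connectedness; closure under random moves is
  fairness.\<close>

lemma Inf_good_ec:
 assumes P: "is_mdp P" and V: "!!i. om i : verts P" and edge: "!!i. (om i, om (Suc i)) : edges P"
  and fair: "!!u w. u : Inf_verts om ==> u : randv P ==> (u, w) : edges P ==> w : Inf_verts om"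
  and S: "om : Streett SP"
 shows "good_ec P SP (Inf_verts om)"
proof -
 let ?X = "Inf_verts om"
 have fin: "finite (verts P)" using P by (simp add: is_mdp_def)
 obtain t where t: "!!i. t <= i ==> om i : ?X" using eventually_Inf[of "verts P" om, OF fin V] by blast
 have path: "(om i, om (i + d)) : (edges P Int ?X \<times> ?X)\<^sup>*" if "t <= i" for i d
 proof (induction d)
  case (Suc d)
  have "(om (i + d), om (i + Suc d)) : edges P Int ?X \<times> ?X" using edge[of "i + d"] t[of "i + d"] t[of "Suc (i + d)"] that by auto
  thus ?case by (rule rtrancl_into_rtrancl[OF Suc])
 qed simp
 show ?thesis
  unfolding good_ec_def
 proof (intro conjI ballI allI impI)
  show "?X ~= {}" using t[of t] by auto
  show "?X \<subseteq> verts P"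
  proof
   fix u assume "u : ?X"
   then obtain i where "om i = u" using Inf_vertsD[of u om 0] by blast
   thus "u : verts P" using V[of i] by simp
  qed
  show "w : ?X" if "u : ?X Int randv P" "(u, w) : edges P" for u w by (rule fair[of u]) (use that in auto)
  show "EX w:?X. (u, w) : edges P" if u: "u : ?X" for u
  proof -
   obtain i where "t <= i" "om i = u" using Inf_vertsD[OF u] by blast
   thus ?thesis using edge[of i] t[of "Suc i"] by auto
  qed
  show "(u, w) : (edges P Int ?X \<times> ?X)\<^sup>*" if u: "u : ?X" and w: "w : ?X" for u w
  proof -
   obtain i where i: "t <= i" "om i = u" using Inf_vertsD[OF u] by blast
   obtain j where j: "i <= j" "om j = w" using Inf_vertsD[OF w] by blast
   show ?thesis using path[OF i(1), of "j - i"] i j by simp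
  qed
  show "case LU of (L, U) => L Int ?X ~= {} --> U Int ?X ~= {}" if "LU : set SP" for LU
   using S that by (auto simp: Streett_def)
 qed
qed

text \<open>\<open>Z\<close> consists of the vertices reached with positive probability under the
  winning strategy. Each prefix that leads to one of them extends to a fair winning play; this play
  stays in \<open>Z\<close>, and its limit set is a good end component.\<close>

lemma winning_reaches:
 fixes P :: "nat mdp"
 assumes P: "is_mdp P" and v: "v : verts P" and sg: "sg : strategies P"
  and ae: "AE om in play_measure P sg v. om : Streett SP"
 defines "T \<equiv> \<Union>{X. good_ec P SP X}"
 shows "EX Z. Z \<subseteq> verts P & (ALL u:Z Int randv P. ALL w. (u, w) : edges P --> w : Z) &
  (ALL u:Z. EX t:T Int Z. (u, t) : (edges P Int Z \<times> Z)\<^sup>*) & v : Z"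
proof -
 define Z where "Z = {u. EX k h. h @ [u] : set_pmf (hist P sg v k)}"
 define \<Phi> where "\<Phi> om \<longleftrightarrow> om : Streett SP & (ALL k. map om [0..<k] : set_pmf (hist P sg v k)) &
  (ALL u w. u : Inf_verts om --> u : randv P --> (u, w) : edges P --> w : Inf_verts om)" for om
 have "AE om in play_measure P sg v. \<Phi> om"
  using ae AE_prefix[of P sg v] AE_fair[OF P, of sg v] by eventually_elim (simp add: \<Phi>_def)
 note ext = prefix_extends[OF _ this]
 have wit: "EX om i. \<Phi> om & om i = u & (EX h. length h = i & h @ [u] : set_pmf (hist P sg v (Suc i)))" if uZ: "u : Z" for u
 proof -
  obtain k h where h: "h @ [u] : set_pmf (hist P sg v k)" using uZ unfolding Z_def by blast
  obtain om where om: "\<Phi> om" "map om [0..<k] = h @ [u]" using ext[OF h] by blast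
  have k: "k = Suc (length h)" using arg_cong[OF om(2), of length] by simp
  have "om (length h) = u" using om(2) unfolding k by simp
  thus ?thesis using om(1) h unfolding k by blast
 qed
 have pos: "om i : Z" if "\<Phi> om" for om i
  using that unfolding \<Phi>_def Z_def by (auto intro!: exI[of _ "Suc i"] exI[of _ "map om [0..<i]"] dest!: spec[of _ "Suc i"])
 note pp = path_props[OF P sg v]
 have pr: "!!i. om i : verts P" "!!i. (om i, om (Suc i)) : edges P" if "\<Phi> om" for om
  using pp[of om] that by (auto simp: \<Phi>_def)
 have "Z \<subseteq> verts P"
 proof
  fix u assume "u : Z"
  then obtain om i where "\<Phi> om" "om i = u" using wit by blast
  thus "u : verts P" using pr(1)[of om i] by simp
 qed
 moreover have "ALL u:Z Int randv P. ALL w. (u, w) : edges P --> w : Z"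
 proof (intro ballI allI impI)
  fix u w assume u: "u : Z Int randv P" and w: "(u, w) : edges P"
  obtain h i where h: "h @ [u] : set_pmf (hist P sg v (Suc i))" using wit[of u] u by blast
  have "w : set_pmf (step_pmf P sg v (h @ [u]))"
   using u w P by (auto simp: step_pmf_def next_pmf_def is_mdp_def)
  hence "(h @ [u]) @ [w] : set_pmf (hist P sg v (Suc (Suc i)))" using h by auto
  thus "w : Z" unfolding Z_def by blast
 qed
 moreover have "ALL u:Z. EX t:T Int Z. (u, t) : (edges P Int Z \<times> Z)\<^sup>*"
 proof
  fix u assume "u : Z"
  then obtain om i where om: "\<Phi> om" "om i = u" using wit by blast
  have g: "good_ec P SP (Inf_verts om)"
   by (rule Inf_good_ec[where om = om and P = P, OF P pr[OF om(1)]]) (use om(1) in \<open>auto simp: \<Phi>_def\<close>)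
  then obtain x where x: "x : Inf_verts om" using good_ecD(1)[OF g] by blast
  obtain j where j: "i <= j" "om j = x" using Inf_vertsD[OF x, of i] by blast
  have path: "(om i, om (i + d)) : (edges P Int Z \<times> Z)\<^sup>*" for d
  proof (induction d)
   case (Suc d)
   have "(om (i + d), om (i + Suc d)) : edges P Int Z \<times> Z"
    using pr(2)[OF om(1), of "i + d"] pos[OF om(1)] by auto
   thus ?case by (rule rtrancl_into_rtrancl[OF Suc])
  qed simp
  have "x : T Int Z" using x g j pos[OF om(1), of j] by (auto simp: T_def)
  thus "EX t:T Int Z. (u, t) : (edges P Int Z \<times> Z)\<^sup>*" using path[of "j - i"] j om(2) by (intro bexI[of _ x]) auto
 qed
 moreover have "v : Z" unfolding Z_def
  by (auto intro!: exI[of _ "Suc 0"] exI[of _ "[]"] simp: step_pmf_def)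
 ultimately show ?thesis by (intro exI[of _ Z] conjI)
qed

subsection \<open>A winning strategy\<close>

definition rdist :: "(nat \<times> nat) set => nat set => nat => nat" where
 "rdist G Y u = (LEAST k. EX t:Y. (u, t) : G ^^ k)"

text \<open>The default choice matters at the target itself, where no successor is closer but a
  legal move inside \<open>G\<close> is still required.\<close>

definition nxt :: "(nat \<times> nat) set => nat set => nat => nat" where
 "nxt G Y u = (if EX w. (u, w) : G & rdist G Y w < rdist G Y u
   then SOME w. (u, w) : G & rdist G Y w < rdist G Y u else SOME w. (u, w) : G)"

lemma rdist_decreases:
 assumes "(u, t) : G\<^sup>*" "t : Y" "u ~: Y"
 shows "EX w. (u, w) : G & rdist G Y w < rdist G Y u"
proof -
 have "EX k. EX t:Y. (u, t) : G ^^ k" using assms rtrancl_imp_relpow by blast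
 hence "EX t:Y. (u, t) : G ^^ rdist G Y u" unfolding rdist_def by (rule LeastI_ex)
 then obtain t' where t': "t' : Y" "(u, t') : G ^^ rdist G Y u" by blast
 then obtain d where d: "rdist G Y u = Suc d" using assms(3) by (cases "rdist G Y u") auto
 then obtain w where w: "(u, w) : G" "(w, t') : G ^^ d" using t'(2) by (metis relpow_Suc_D2)
 have "rdist G Y w <= d" unfolding rdist_def using t'(1) w(2) by (intro Least_le) blast
 thus ?thesis using w(1) d by auto
qed

lemma nxt_less:
 assumes ex: "EX w. (u, w) : G & rdist G Y w < rdist G Y u"
 shows "(u, nxt G Y u) : G & rdist G Y (nxt G Y u) < rdist G Y u"
 unfolding nxt_def if_P[OF ex] using ex by (rule someI_ex)

lemma nxt_edge:
 assumes "(u, w) : G"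
 shows "(u, nxt G Y u) : G"
proof (cases "EX w. (u, w) : G & rdist G Y w < rdist G Y u")
 case True
 thus ?thesis using nxt_less by blast
next
 case False
 show ?thesis unfolding nxt_def if_not_P[OF False] using assms by (rule someI)
qed

text \<open>Among the vertices visited infinitely often take one of least \<open>d\<close>. If it
  lay outside \<open>Y\<close>, it would have a successor of smaller \<open>d\<close> that recurs as
  well: by fairness if it is random, and otherwise because from time \<open>s\<close> on the move is
  always the same.\<close>

lemma progress:
 fixes d :: "nat => nat"
 assumes ne: "Inf_verts om ~= {}"
  and fair: "!!u w. u : Inf_verts om ==> u : R ==> (u, w) : E ==> w : Inf_verts om"
  and rnd: "!!u. u : Inf_verts om ==> u : R ==> u ~: Y ==> EX w. (u, w) : E & d w < d u"
  and pl: "!!u. u : Inf_verts om ==> u ~: R ==> u ~: Y ==> d (nx u) < d u"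
  and mv: "!!i. s <= i ==> om i ~: R ==> om i ~: Y ==> om (Suc i) = nx (om i)"
 shows "Inf_verts om Int Y ~= {}"
proof
 assume emp: "Inf_verts om Int Y = {}"
 obtain u where u: "u : Inf_verts om" and min: "!!y. y : Inf_verts om ==> d u <= d y"
  using ne ex_has_least_nat[of "%u. u : Inf_verts om" _ d] by blast
 have uY: "u ~: Y" using u emp by blast
 show False
 proof (cases "u : R")
  case True
  thus False using rnd[OF u True uY] fair[OF u True] min by force
 next
  case False
  have "nx u : Inf_verts om"
   unfolding Inf_verts_def INFM_nat mem_Collect_eq
  proof
   fix i
   obtain j where j: "max s i <= j" "om j = u" using Inf_vertsD[OF u] by blast
   thus "EX j>i. om j = nx u" using mv[of j] False uY by (intro exI[of _ "Suc j"]) auto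
  qed
  thus False using pl[OF u False uY] min by force
 qed
qed

text \<open>Good end components that share a vertex have a good union: paths are joined at the
  shared vertex, and a pair whose \<open>L\<close> meets the union is satisfied within a member that
  \<open>L\<close> meets. So the maximal ones are disjoint.\<close>

lemma good_ec_union:
 assumes x: "x : \<Union>{X. good_ec P SP X}"
 defines "XO \<equiv> %u. \<Union>{X. good_ec P SP X & u : X}"
 shows "good_ec P SP (XO x)" "x : XO x" "y : XO x ==> XO y = XO x"
proof -
 have good: "good_ec P SP (XO x)" "x : XO x" if x: "x : \<Union>{X. good_ec P SP X}" for x
 proof -
  show xx: "x : XO x" using x by (auto simp: XO_def)
  have sub: "X \<subseteq> XO x" if "good_ec P SP X" "x : X" for X using that by (auto simp: XO_def)
  have ob: "EX X. good_ec P SP X & x : X & u : X" if "u : XO x" for u using that by (auto simp: XO_def)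
  have mono: "(a, c) : (edges P Int XO x \<times> XO x)\<^sup>*" if "(a, c) : (edges P Int X \<times> X)\<^sup>*" "X \<subseteq> XO x" for a c X
   using that rtrancl_mono[of "edges P Int X \<times> X" "edges P Int XO x \<times> XO x"] by blast
  show "good_ec P SP (XO x)"
   unfolding good_ec_def
  proof (intro conjI ballI allI impI)
   show "XO x ~= {}" using xx by blast
   show "XO x \<subseteq> verts P"
   proof
    fix u assume u: "u : XO x"
    obtain X where X: "good_ec P SP X" "x : X" "u : X" using ob[OF u] by blast
    show "u : verts P" using good_ecD(2)[OF X(1)] X(3) by blast
   qed
   show "w : XO x" if u: "u : XO x Int randv P" and w: "(u, w) : edges P" for u w
   proof -
    obtain X where X: "good_ec P SP X" "x : X" "u : X" using ob[of u] u by blast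
    have "w : X" using good_ecD(3)[OF X(1) X(3) _ w] u by blast
    thus ?thesis using sub[OF X(1,2)] by blast
   qed
   show "EX w:XO x. (u, w) : edges P" if u: "u : XO x" for u
   proof -
    obtain X where X: "good_ec P SP X" "x : X" "u : X" using ob[OF u] by blast
    show ?thesis using good_ecD(4)[OF X(1) X(3)] sub[OF X(1,2)] by blast
   qed
   show "(u, w) : (edges P Int XO x \<times> XO x)\<^sup>*" if u: "u : XO x" and w: "w : XO x" for u w
   proof -
    obtain X where X: "good_ec P SP X" "x : X" "u : X" using ob[OF u] by blast
    obtain X' where X': "good_ec P SP X'" "x : X'" "w : X'" using ob[OF w] by blast
    show ?thesis
     using mono[OF good_ecD(5)[OF X(1) X(3,2)] sub[OF X(1,2)]] mono[OF good_ecD(5)[OF X'(1) X'(2,3)] sub[OF X'(1,2)]]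
     by (rule rtrancl_trans)
   qed
   show "case LU of (L, U) => L Int XO x ~= {} --> U Int XO x ~= {}" if "LU : set SP" for LU
   proof (cases LU)
    case (Pair L U)
    have "U Int XO x ~= {}" if L: "L Int XO x ~= {}"
    proof -
     obtain l where l: "l : L" "l : XO x" using L by blast
     obtain X where X: "good_ec P SP X" "x : X" "l : X" using ob[OF l(2)] by blast
     have "U Int X ~= {}" using good_ecD(6)[OF X(1)] `LU : set SP` Pair l(1) X(3) by blast
     thus ?thesis using sub[OF X(1,2)] by blast
    qed
    thus ?thesis using Pair by simp
   qed
  qed
 qed
 show "good_ec P SP (XO x)" "x : XO x" using good[OF x] by auto
 show "XO y = XO x" if y: "y : XO x"
 proof
  have yT: "y : \<Union>{X. good_ec P SP X}" using y by (auto simp: XO_def)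
  show sub: "XO x \<subseteq> XO y" using good(1)[OF x] y unfolding XO_def by blast
  hence "x : XO y" using good(2)[OF x] by blast
  thus "XO y \<subseteq> XO x" using good(1)[OF yT] unfolding XO_def by blast
 qed
qed

lemma count_list_prefix: "count_list (map om [0..<i]) x = card {j. j < i & om j = x}"
proof (induction i)
 case (Suc i)
 have "{j. j < Suc i & om j = x} = (if om i = x then insert i {j. j < i & om j = x} else {j. j < i & om j = x})"
  by (auto simp: less_Suc_eq)
 thus ?case using Suc by (simp add: count_list_append)
qed simp

definition least_visited :: "nat set => nat list => nat" where
 "least_visited X h = (LEAST y. y : X & (ALL x:X. count_list h y <= count_list h x))"

text \<open>The counts of the finitely visited vertices become constant, while all other counts grow
  beyond them. From then on the minimum is taken over constant numbers, and the choice does not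
  change any more.\<close>

lemma least_visited_stable:
 assumes fin: "finite X" and ne: "X - Inf_verts om ~= {}"
 shows "EX y:X - Inf_verts om. EX t. ALL i>=t. least_visited X (map om [0..<i]) = y"
proof -
 let ?F = "X - Inf_verts om"
 define c where "c x = card {j. om j = x}" for x
 \<comment> \<open>\<open>B\<close> bounds the final counts of all finitely visited vertices, so a
   vertex with a count above \<open>B\<close> is eventually not least visited.\<close>
 define B where "B = (SUM x:?F. c x)"
 have cB: "c x <= B" if "x : ?F" for x unfolding B_def using that fin by (intro member_le_sum) auto
 have "EX t. ALL i>=t. (x : ?F --> count_list (map om [0..<i]) x = c x) & (x ~: ?F --> B < count_list (map om [0..<i]) x)" if "x : X" for x
 proof (cases "x : ?F")
  case True
  hence "finite {j. om j = x}" by (simp add: Inf_verts_iff)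
  then obtain t where t: "ALL j:{j. om j = x}. j < t" by (auto simp: finite_nat_set_iff_bounded)
  have "{j. j < i & om j = x} = {j. om j = x}" if "t <= i" for i using t that by auto
  thus ?thesis using True by (intro exI[of _ t]) (auto simp: count_list_prefix c_def)
 next
  case False
  hence "infinite {j. om j = x}" using that by (simp add: Inf_verts_iff)
  then obtain S where S: "finite S" "card S = Suc B" "S \<subseteq> {j. om j = x}" using infinite_arbitrarily_large by blast
  obtain t where t: "ALL j:S. j < t" using S(1) by (auto simp: finite_nat_set_iff_bounded)
  have "Suc B <= card {j. j < i & om j = x}" if "t <= i" for i
   unfolding S(2)[symmetric] using t S(3) that by (intro card_mono) force+
  thus ?thesis using False by (intro exI[of _ t]) (auto simp: count_list_prefix Suc_le_eq)
 qed
 then obtain \<tau> where \<tau>: "!!x i. x : X ==> \<tau> x <= i ==> (x : ?F --> count_list (map om [0..<i]) x = c x) & (x ~: ?F --> B < count_list (map om [0..<i]) x)"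
  by metis
 define t where "t = (SUM x:X. \<tau> x)"
 have "\<tau> x <= t" if "x : X" for x unfolding t_def using that fin by (intro member_le_sum) auto
 hence cnt: "x : ?F ==> count_list (map om [0..<i]) x = c x" "x ~: ?F ==> B < count_list (map om [0..<i]) x"
  if "x : X" "t <= i" for x i
  using \<tau>[of x i] that order_trans by blast+
 define y where "y = (LEAST y. y : ?F & (ALL x:?F. c y <= c x))"
 have "EX y. y : ?F & (ALL x:?F. c y <= c x)" using ne ex_has_least_nat[of "%x. x : ?F" _ c] by blast
 hence yF: "y : ?F" unfolding y_def by (rule LeastI2_ex) blast
 have "least_visited X (map om [0..<i]) = y" if i: "t <= i" for i
 proof -
  have "(z : X & (ALL x:X. count_list (map om [0..<i]) z <= count_list (map om [0..<i]) x)) \<longleftrightarrow> (z : ?F & (ALL x:?F. c z <= c x))" for z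
  proof
   assume z: "z : X & (ALL x:X. count_list (map om [0..<i]) z <= count_list (map om [0..<i]) x)"
   have "z : ?F"
   proof (rule ccontr)
    assume "z ~: ?F"
    hence "B < count_list (map om [0..<i]) z" using cnt(2) z i by blast
    moreover have "count_list (map om [0..<i]) z <= count_list (map om [0..<i]) y" using z yF by blast
    moreover have "count_list (map om [0..<i]) y = c y" using cnt(1)[of y i] yF i by blast
    ultimately show False using cB[OF yF] by linarith
   qed
   moreover have "c z <= c x" if "x : ?F" for x
   proof -
    have "count_list (map om [0..<i]) z <= count_list (map om [0..<i]) x" using z that by blast
    thus ?thesis using cnt(1)[of z i] cnt(1)[of x i] `z : ?F` that i by auto
   qed
   ultimately show "z : ?F & (ALL x:?F. c z <= c x)" by blast
  next
   assume z: "z : ?F & (ALL x:?F. c z <= c x)"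
   have cz: "count_list (map om [0..<i]) z = c z" using cnt(1)[of z i] z i by blast
   have "count_list (map om [0..<i]) z <= count_list (map om [0..<i]) x" if "x : X" for x
   proof (cases "x : ?F")
    case True
    thus ?thesis using cz cnt(1)[OF that i True] z by auto
   next
    case False
    thus ?thesis using cz cnt(2)[OF that i False] cB[of z] z by linarith
   qed
   thus "z : X & (ALL x:X. count_list (map om [0..<i]) z <= count_list (map om [0..<i]) x)" using z by blast
  qed
  thus ?thesis unfolding least_visited_def y_def by (simp only:)
 qed
 thus ?thesis using yF by blast
qed

text \<open>Suppose a vertex of the entered component \<open>X\<close> were visited only finitely
  often. Then the target of the strategy would eventually be a fixed vertex \<open>y\<close> outside
  the limit set, and \<open>progress\<close> would show that \<open>y\<close> recurs.\<close>

lemma reaching_wins: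
 fixes P :: "nat mdp"
 assumes P: "is_mdp P" and Z: "Z \<subseteq> verts P"
  and Zr: "!!u w. u : Z ==> u : randv P ==> (u, w) : edges P ==> w : Z"
  and ZT: "!!u. u : Z ==> EX t:\<Union>{X. good_ec P SP X} Int Z. (u, t) : (edges P Int Z \<times> Z)\<^sup>*" and v: "v : Z"
 shows "EX sg:strategies P. AE om in play_measure P sg v. om : Streett SP"
proof -
 let ?E = "edges P"
 define T where "T = \<Union>{X. good_ec P SP X}"
 define XO where "XO u = \<Union>{X. good_ec P SP X & u : X}" for u
 have XO: "good_ec P SP (XO x)" "x : XO x" "y : XO x ==> XO y = XO x" if "x : T" for x y
 proof -
  have x: "x : \<Union>{X. good_ec P SP X}" using that by (simp add: T_def)
  show "good_ec P SP (XO x)" unfolding XO_def by (rule good_ec_union(1)[OF x])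
  show "x : XO x" unfolding XO_def by (rule good_ec_union(2)[OF x])
  show "y : XO x ==> XO y = XO x" unfolding XO_def by (rule good_ec_union(3)[OF x])
 qed
 have fin: "finite (verts P)" using P by (simp add: is_mdp_def)
 \<comment> \<open>Outside \<open>T\<close> and \<open>Z\<close> any legal move will do.\<close>
 define sg where "sg h = (let u = last h in
  if u : T then nxt (?E Int XO u \<times> XO u) {least_visited (XO u) h} u
  else if u : Z then nxt (?E Int Z \<times> Z) T u else SOME w. (u, w) : ?E)" for h
 have inX: "(u, nxt (?E Int XO u \<times> XO u) Y u) : ?E Int XO u \<times> XO u" if u: "u : T" for u Y
 proof -
  obtain w where "w : XO u" "(u, w) : ?E" using good_ecD(4)[OF XO(1)[OF u] XO(2)[OF u]] by blast
  thus ?thesis using XO(2)[OF u] by (intro nxt_edge[of _ w]) blast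
 qed
 have dec: "EX w. (u, w) : ?E Int Z \<times> Z & rdist (?E Int Z \<times> Z) T w < rdist (?E Int Z \<times> Z) T u" if u: "u : Z" "u ~: T" for u
 proof -
  obtain t where t: "t : T" "(u, t) : (?E Int Z \<times> Z)\<^sup>*" using ZT[OF u(1)] unfolding T_def by blast
  show ?thesis by (rule rdist_decreases[OF t(2,1) u(2)])
 qed
 have inZ: "(u, nxt (?E Int Z \<times> Z) T u) : ?E Int Z \<times> Z" if u: "u : Z" "u ~: T" for u
 proof -
  obtain w where "(u, w) : ?E Int Z \<times> Z" using dec[OF u] by blast
  thus ?thesis by (rule nxt_edge)
 qed
 have strat: "sg : strategies P"
  unfolding strategies_def
 proof (intro CollectI ballI)
  fix h u assume u: "u : player1 P"
  have "u : verts P" using P u by (auto simp: is_mdp_def)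
  hence "EX w. (u, w) : ?E" using P by (auto simp: is_mdp_def)
  hence "(u, SOME w. (u, w) : ?E) : ?E" by (rule someI_ex)
  thus "(u, sg (h @ [u])) : ?E" using inX[of u] inZ[of u] by (auto simp: sg_def)
 qed
 have "AE om in play_measure P sg v. om : Streett SP"
  using AE_prefix[of P sg v] AE_fair[OF P, of sg v]
 proof eventually_elim
  fix om assume pre: "ALL k. map om [0..<k] : set_pmf (hist P sg v k)"
   and fair': "ALL u w. u : Inf_verts om --> u : randv P --> (u, w) : ?E --> w : Inf_verts om"
  have vV: "v : verts P" using v Z by blast
  note pp = path_props[OF P strat vV pre]
  have fair: "w : Inf_verts om" if "u : Inf_verts om" "u : randv P" "(u, w) : ?E" for u w using fair' that by blast
  have last: "last (map om [0..<Suc i]) = om i" for i by simp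
  have mvZ: "om (Suc i) = nxt (?E Int Z \<times> Z) T (om i)" if "om i ~: randv P" "om i : Z" "om i ~: T" for i
   unfolding pp(3)[OF that(1)] sg_def last using that by simp
  have mvX: "om (Suc i) = nxt (?E Int XO (om i) \<times> XO (om i)) {least_visited (XO (om i)) (map om [0..<Suc i])} (om i)"
   if "om i ~: randv P" "om i : T" for i
   unfolding pp(3)[OF that(1)] sg_def last using that by (simp only: Let_def if_True)
  have ne: "Inf_verts om ~= {}" using eventually_Inf[of "verts P" om, OF fin pp(1)] by blast
  have "EX i. om i : T"
  proof (rule ccontr)
   assume no: "~ ?thesis"
   have inZ': "om i : Z" for i
   proof (induction i)
    case 0
    thus ?case using prefix_follows(1)[OF pre] v by simp
   next
    case (Suc i)
    show ?case
    proof (cases "om i : randv P")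
     case True
     thus ?thesis using Zr[OF Suc True pp(2)] by simp
    next
     case False
     thus ?thesis using mvZ[OF False Suc] inZ[OF Suc] no by auto
    qed
   qed
   have IZ: "u : Z" if "u : Inf_verts om" for u using Inf_vertsD[OF that, of 0] inZ' by blast
   have "Inf_verts om Int T ~= {}"
   proof (rule progress[where R = "randv P" and E = ?E and d = "rdist (?E Int Z \<times> Z) T" and nx = "nxt (?E Int Z \<times> Z) T" and s = 0])
    show "Inf_verts om ~= {}" by (rule ne)
    show "w : Inf_verts om" if "u : Inf_verts om" "u : randv P" "(u, w) : ?E" for u w by (rule fair[OF that])
    show "EX w. (u, w) : ?E & rdist (?E Int Z \<times> Z) T w < rdist (?E Int Z \<times> Z) T u" if "u : Inf_verts om" "u ~: T" for u
     using dec[OF IZ[OF that(1)] that(2)] by blast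
    show "rdist (?E Int Z \<times> Z) T (nxt (?E Int Z \<times> Z) T u) < rdist (?E Int Z \<times> Z) T u" if "u : Inf_verts om" "u ~: T" for u
     using nxt_less[OF dec[OF IZ[OF that(1)] that(2)]] by (rule conjunct2)
    show "om (Suc i) = nxt (?E Int Z \<times> Z) T (om i)" if "om i ~: randv P" "om i ~: T" for i
     using mvZ inZ' that by blast
   qed
   then obtain u where u: "u : Inf_verts om" "u : T" by blast
   obtain i where "om i = u" using Inf_vertsD[OF u(1), of 0] by blast
   thus False using no u(2) by blast
  qed
  then obtain a where a: "om a : T" by blast
  define X where "X = XO (om a)"
  have gX: "good_ec P SP X" using XO(1)[OF a] by (simp add: X_def)
  have XT: "X \<subseteq> T" using gX by (auto simp: T_def)
  have XX: "XO u = X" if "u : X" for u using XO(3)[OF a] that by (simp add: X_def)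
  have inX': "om (a + d) : X" for d
  proof (induction d)
   case 0
   thus ?case using XO(2)[OF a] by (simp add: X_def)
  next
   case (Suc d)
   show ?case
   proof (cases "om (a + d) : randv P")
    case True
    thus ?thesis using good_ecD(3)[OF gX Suc True pp(2)] by simp
   next
    case False
    thus ?thesis using mvX[OF False] inX[of "om (a + d)"] XX[OF Suc] XT Suc by (auto simp del: upt_Suc)
   qed
  qed
  have IX: "Inf_verts om \<subseteq> X"
  proof
   fix u assume "u : Inf_verts om"
   then obtain i where "a <= i" "om i = u" using Inf_vertsD[of u om a] by blast
   thus "u : X" using inX'[of "i - a"] by simp
  qed
  have "X \<subseteq> Inf_verts om"
  proof (rule ccontr)
   assume "~ ?thesis"
   hence "X - Inf_verts om ~= {}" by blast
   moreover have "finite X" using good_ecD(2)[OF gX] fin by (rule finite_subset)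
   ultimately obtain y t where y: "y : X" "y ~: Inf_verts om" and t: "!!i. t <= i ==> least_visited X (map om [0..<i]) = y"
    using least_visited_stable[of X om] by blast
   have dX: "EX w. (u, w) : ?E Int X \<times> X & rdist (?E Int X \<times> X) {y} w < rdist (?E Int X \<times> X) {y} u" if "u : X" "u ~= y" for u
    using rdist_decreases[OF good_ecD(5)[OF gX that(1) y(1)], of "{y}"] that(2) by blast
   have "Inf_verts om Int {y} ~= {}"
   proof (rule progress[where R = "randv P" and E = ?E and d = "rdist (?E Int X \<times> X) {y}" and nx = "nxt (?E Int X \<times> X) {y}" and s = "a + t"])
    show "Inf_verts om ~= {}" by (rule ne)
    show "w : Inf_verts om" if "u : Inf_verts om" "u : randv P" "(u, w) : ?E" for u w by (rule fair[OF that])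
    show "EX w. (u, w) : ?E & rdist (?E Int X \<times> X) {y} w < rdist (?E Int X \<times> X) {y} u" if "u : Inf_verts om" "u ~: {y}" for u
     using dX[of u] that IX by blast
    show "rdist (?E Int X \<times> X) {y} (nxt (?E Int X \<times> X) {y} u) < rdist (?E Int X \<times> X) {y} u" if "u : Inf_verts om" "u ~: {y}" for u
    proof -
     have uX: "u : X" "u ~= y" using that IX by auto
     show ?thesis using nxt_less[OF dX[OF uX]] by (rule conjunct2)
    qed
    show "om (Suc i) = nxt (?E Int X \<times> X) {y} (om i)" if "a + t <= i" "om i ~: randv P" for i
    proof -
     have iX: "om i : X" using inX'[of "i - a"] that by simp
     have "om i : T" using iX XT by blast
     show ?thesis using mvX[OF that(2) `om i : T`] t[of "Suc i"] that(1) unfolding XX[OF iX] by (simp del: upt_Suc)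
    qed
   qed
   thus False using y by blast
  qed
  hence "Inf_verts om = X" using IX by blast
  thus "om : Streett SP" using good_ecD(6)[OF gX] by (auto simp: Streett_def)
 qed
 thus ?thesis using strat by blast
qed

text \<open>The right-hand side mentions only the edges and the kind of the vertices. This is why
  the program can do without the probabilities.\<close>

theorem almost_sure_win_Streett:
 fixes P :: "nat mdp"
 assumes P: "is_mdp P"
 shows "almost_sure_win P (Streett SP) = {v. EX Z. Z \<subseteq> verts P &
  (ALL u:Z Int randv P. ALL w. (u, w) : edges P --> w : Z) &
  (ALL u:Z. EX t:\<Union>{X. good_ec P SP X} Int Z. (u, t) : (edges P Int Z \<times> Z)\<^sup>*) & v : Z}"
proof (intro set_eqI iffI)
 fix v
 show "v : {v. EX Z. Z \<subseteq> verts P & (ALL u:Z Int randv P. ALL w. (u, w) : edges P --> w : Z) &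
   (ALL u:Z. EX t:\<Union>{X. good_ec P SP X} Int Z. (u, t) : (edges P Int Z \<times> Z)\<^sup>*) & v : Z}"
  if "v : almost_sure_win P (Streett SP)"
 proof -
  from that obtain sg where "v : verts P" "sg : strategies P" "AE om in play_measure P sg v. om : Streett SP"
   unfolding almost_sure_win_def by blast
  from winning_reaches[OF P this] show ?thesis by (rule CollectI)
 qed
 assume "v : {v. EX Z. Z \<subseteq> verts P & (ALL u:Z Int randv P. ALL w. (u, w) : edges P --> w : Z) &
   (ALL u:Z. EX t:\<Union>{X. good_ec P SP X} Int Z. (u, t) : (edges P Int Z \<times> Z)\<^sup>*) & v : Z}"
 then obtain Z where Z: "Z \<subseteq> verts P" "ALL u:Z Int randv P. ALL w. (u, w) : edges P --> w : Z"
  "ALL u:Z. EX t:\<Union>{X. good_ec P SP X} Int Z. (u, t) : (edges P Int Z \<times> Z)\<^sup>*" "v : Z"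
  unfolding mem_Collect_eq by (elim exE conjE)
 have "EX sg:strategies P. AE om in play_measure P sg v. om : Streett SP"
 proof (rule reaching_wins[OF P Z(1) _ _ Z(4)])
  show "w : Z" if "u : Z" "u : randv P" "(u, w) : edges P" for u w using Z(2)[THEN bspec, of u] that by simp
  show "EX t:\<Union>{X. good_ec P SP X} Int Z. (u, t) : (edges P Int Z \<times> Z)\<^sup>*" if "u : Z" for u using Z(3) that by (rule bspec)
 qed
 moreover have "v : verts P" using Z(1,4) by blast
 ultimately show "v : almost_sure_win P (Streett SP)" unfolding almost_sure_win_def by (intro CollectI conjI)
qed

section \<open>Splitting components\<close>

declare add_2_eq_Suc [simp del] add_2_eq_Suc' [simp del]

abbreviation seq :: "com => com => com" (infixr ";;" 60) where "p ;; q \<equiv> Seq p q"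

text \<open>All programs take a base \<open>bs\<close>, so that they can be run twice on disjoint arrays. Registers 0
 to 3 hold \<open>n\<close>, \<open>m\<close>, \<open>b\<close> and \<open>k\<close>; the arrays \<open>bs + 7\<close> and \<open>bs + 8\<close> hold the component of each
 vertex and the flags of the dead vertices. The sparse sets are, relative to the base:
 0 successors, 1 predecessors, 2 vertices of a component, 3 memberships of a vertex,
 4 and 5 the members of \<open>U\<^sub>i\<close> and \<open>L\<^sub>i\<close> in component \<open>c\<close> (row \<open>c * k + i\<close>), 6 doomed vertices,
 7 and 8 vertices that lost an outgoing or incoming edge, 9 visited vertices, 10 the part to be
 split off, 11 reversed edges.\<close>

definition Doom :: "nat => nat => com" where
 "Doom bs r = Cond (Read (bs+8) (Reg r)) Skip (Insert (bs+6) 0 (Const 0) (Reg r))"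

text \<open>The loss of an edge can harm only its source: a random vertex may not lose any
  successor, any other vertex not its last one. Both ends are queued, as a set can become closed
  only by losing an edge.\<close>

definition Deledge :: "nat => com" where
 "Deledge bs = Delete bs 0 (Reg 10) (Reg 11) ;; Delete (bs+1) 0 (Reg 11) (Reg 10) ;;
   Insert (bs+7) 0 (Const 0) (Reg 10) ;; Insert (bs+8) 0 (Const 0) (Reg 11) ;;
   Cond (Op Add (Read (bs+2) (Reg 10)) (Op Equal (Cnt bs (Reg 10)) (Const 0))) (Doom bs 10) Skip"

definition Cut :: "nat => com" where
 "Cut bs =
   For bs 0 (Reg 12) 17 11 (Cond (Op Equal (Read (bs+7) (Reg 11)) (Read (bs+7) (Reg 12))) Skip
    (Assign 10 (Reg 12) ;; Deledge bs)) ;;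
   For (bs+1) 0 (Reg 12) 17 10 (Cond (Op Equal (Read (bs+7) (Reg 10)) (Read (bs+7) (Reg 12))) Skip
    (Assign 11 (Reg 12) ;; Deledge bs))"

definition Row :: "nat => nat => expr" where
 "Row c i = Op Add (Op Mul (Reg c) (Reg 3)) (Reg i)"

definition Move :: "nat => com" where
 "Move bs = Assign 14 (Read (bs+7) (Reg 12)) ;;
   Delete (bs+2) 0 (Reg 14) (Reg 12) ;; Insert (bs+2) 0 (Reg 13) (Reg 12) ;;
   Write (bs+7) (Reg 12) (Reg 13) ;;
   For (bs+3) 2 (Reg 12) 15 16 (Assign 9 (Read (bs+3) (Reg 16)) ;;
    Cond (Read (bs+5) (Reg 16))
     (Delete (bs+4) 0 (Row 14 9) (Reg 12) ;; Insert (bs+4) 0 (Row 13 9) (Reg 12))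
     (Delete (bs+5) 0 (Row 14 9) (Reg 12) ;; Insert (bs+5) 0 (Row 13 9) (Reg 12)))"

text \<open>Moving \<open>v\<close> can break pair \<open>i\<close> in two ways. If \<open>v\<close>
  was the last member of \<open>U i\<close> in the old component (register 18), then all members of
  \<open>L i\<close> left there are doomed; they are popped, which is paid for by
  \<open>lam\<close>. If \<open>v\<close> lies in \<open>L i\<close> and the new component (register
  13) has no member of \<open>U i\<close>, then \<open>v\<close> itself is doomed.\<close>

definition Check :: "nat => com" where
 "Check bs =
   For (bs+3) 2 (Reg 12) 19 20 (Assign 9 (Read (bs+3) (Reg 20)) ;;
    Cond (Read (bs+5) (Reg 20))
     (Cond (Cnt (bs+4) (Row 18 9)) Skip
      (While (Cnt (bs+5) (Row 18 9)) (Pop (bs+5) 0 (Row 18 9) 21 ;; Doom bs 21)))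
     (Cond (Cnt (bs+4) (Row 13 9)) Skip (Doom bs 12)))"

text \<open>Three rounds, because cutting compares the final component numbers of all moved vertices
  and checking looks at the final rows.\<close>

definition Split :: "nat => com" where
 "Split bs = Assign 13 (Reg 5) ;; Assign 5 (Op Add (Reg 5) (Const 1)) ;;
   For (bs+10) 0 (Const 0) 22 12 (Move bs) ;;
   For (bs+10) 0 (Const 0) 22 12 (Cut bs) ;;
   For (bs+10) 0 (Const 0) 22 12 (Check bs)"

lemmas hw_ends = hw_Skip hw_Assign hw_Write hw_Insert hw_Delete hw_Clear

text \<open>One run on the graph \<open>E\<close>, where membership \<open>j\<close> puts vertex
  \<open>mv j\<close> into pair \<open>mi j\<close>, into its \<open>U\<close> iff
  \<open>mu j\<close> is nonzero. As \<open>m\<close> is an upper bound of the number of edges, the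
  edge list built for the second pass may be used without showing that it has no
  repetitions.\<close>

locale engine =
 fixes bs n m b k :: nat and N :: "nat => nat"
  and E :: "(nat \<times> nat) set" and rn mi mv mu :: "nat => nat"
 assumes bs: "bs <= 50"
  and N_n [simp]: "N bs = n" "N (Suc bs) = n" "N (bs+2) = n" "N (bs+4) = n" "N (bs+5) = n"
   "N (bs+6) = n" "N (bs+7) = n" "N (bs+8) = n" "N (bs+9) = n" "N (bs+10) = n" "N (bs+11) = n"
  and N_b [simp]: "N (bs+3) = b"
  and E: "E \<subseteq> {..<n} \<times> {..<n}" and out: "!!v. v < n ==> EX w. (v, w) : E"
  and m: "card E <= m"
  and mem: "!!j. j < b ==> mi j < k & mv j < n"
begin

lemma bs_less [simp]: "bs+7 < 100" "bs+8 < 100" "bs+2 < 100" "bs+3 < 100" "bs+4 < 100"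
 "bs+5 < 100" "bs+6 < 100" "bs < 100" "Suc bs < 100"
 using bs by auto

definition Rand :: "nat set" where "Rand = {v. v < n & rn v ~= 0}"
definition U :: "nat => nat set" where "U i = {mv j |j. j < b & mi j = i & mu j ~= 0}"
definition L :: "nat => nat set" where "L i = {mv j |j. j < b & mi j = i & mu j = 0}"

abbreviation Out :: "astate => nat => nat set" where "Out x v \<equiv> set (alst x bs v)"
abbreviation In :: "astate => nat => nat set" where "In x v \<equiv> set (alst x (Suc bs) v)"
abbreviation CS :: "astate => nat => nat set" where "CS x c \<equiv> set (alst x (bs+2) c)"
abbreviation MS :: "astate => nat => nat set" where "MS x v \<equiv> set (alst x (bs+3) v)"
abbreviation US :: "astate => nat => nat set" where "US x r \<equiv> set (alst x (bs+4) r)"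
abbreviation LS :: "astate => nat => nat set" where "LS x r \<equiv> set (alst x (bs+5) r)"
abbreviation Dm :: "astate => nat set" where "Dm x \<equiv> set (alst x (bs+6) 0)"
abbreviation QO :: "astate => nat set" where "QO x \<equiv> set (alst x (bs+7) 0)"
abbreviation QI :: "astate => nat set" where "QI x \<equiv> set (alst x (bs+8) 0)"
abbreviation comp :: "astate => nat => nat" where "comp x \<equiv> aarr x (bs+7)"
abbreviation dead :: "astate => nat => nat" where "dead x \<equiv> aarr x (bs+8)"

definition params :: "astate => bool" where
 "params x \<longleftrightarrow> areg x 0 = n & areg x (Suc 0) = m & areg x 2 = b & areg x 3 = k &
   aarr x (bs+2) = rn & aarr x (bs+3) = mi & aarr x (bs+5) = mu &
   (ALL v<n. MS x v = {j. j < b & mv j = v})"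

definition lists_ok :: "astate => bool" where
 "lists_ok x \<longleftrightarrow> (ALL f r. distinct (alst x f r) & set (alst x f r) \<subseteq> {..<N f})"

lemma hw_ok: "(lists_ok x ==> hw N p Q x) ==> hw N p Q x"
 by (rule hw_lists) (auto simp: lists_ok_def)

lemma lists_okD [simp]: "lists_ok x ==> distinct (alst x f r)"
 by (simp add: lists_ok_def)

lemma lists_ok_less: "lists_ok x ==> y : set (alst x f r) ==> y < N f"
 unfolding lists_ok_def by blast

section \<open>Deletion of edges\<close>

definition frame :: "nat set => nat set => astate => astate => bool" where
 "frame A F x y \<longleftrightarrow> (ALL r. r ~: A --> areg y r = areg x r) & aarr y = aarr x &
   (ALL f. f ~: F --> alst y f = alst x f)"

lemma hw_Doom:
 assumes "params x" "areg x r < n"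
  "!!y. frame {} {bs+6} x y ==>
   Dm y = Dm x Un {v. v = areg x r & dead x v = 0} ==> Q 60 y"
 shows "hw N (Doom bs r) Q x"
proof -
 have "hw N (Doom bs r) (%t y. t <= 60 & frame {} {bs+6} x y &
   Dm y = Dm x Un {v. v = areg x r & dead x v = 0}) x"
  unfolding Doom_def using assms(1,2)
  by (intro hw_Cond hw_ends) (auto simp: frame_def params_def)
 thus ?thesis by (rule hw_time) (use assms(3) in auto)
qed

definition deleted :: "(nat \<times> nat) set => astate => astate => bool" where
 "deleted R x y \<longleftrightarrow> frame {10, 11, 12, 17, 22} {bs, Suc bs, bs+6, bs+7, bs+8} x y &
   (ALL u. Out y u = Out x u - {w. (u, w) : R}) & (ALL w. In y w = In x w - {u. (u, w) : R}) &
   QO y = QO x Un fst ` R & QI y = QI x Un snd ` R &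
   Dm y = Dm x Un {u : fst ` R. dead x u = 0 & (u : Rand \<or> Out y u = {})}"

lemma deletedD:
 assumes "deleted R x y"
 shows "frame {10, 11, 12, 17, 22} {bs, Suc bs, bs+6, bs+7, bs+8} x y"
  "Out y u = Out x u - {w. (u, w) : R}" "In y w = In x w - {u. (u, w) : R}"
  "QO y = QO x Un fst ` R" "QI y = QI x Un snd ` R"
  "Dm y = Dm x Un {u : fst ` R. dead x u = 0 & (u : Rand \<or> Out y u = {})}"
proof -
 note d = assms[unfolded deleted_def]
 show "frame {10, 11, 12, 17, 22} {bs, Suc bs, bs+6, bs+7, bs+8} x y"
  using d by (rule conjunct1)
 show "Out y u = Out x u - {w. (u, w) : R}" using d[THEN conjunct2, THEN conjunct1] by (rule spec)
 show "In y w = In x w - {u. (u, w) : R}"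
  using d[THEN conjunct2, THEN conjunct2, THEN conjunct1] by (rule spec)
 note d' = d[THEN conjunct2, THEN conjunct2, THEN conjunct2]
 show "QO y = QO x Un fst ` R" using d' by (rule conjunct1)
 show "QI y = QI x Un snd ` R" using d'[THEN conjunct2] by (rule conjunct1)
 show "Dm y = Dm x Un {u : fst ` R. dead x u = 0 & (u : Rand \<or> Out y u = {})}"
  using d'[THEN conjunct2] by (rule conjunct2)
qed

lemma deleted_refl: "deleted {} x x"
 by (simp add: deleted_def frame_def)

lemma deleted_setr [simp]:
 assumes r: "r : {10, 11, 12, 17, 22}"
 shows "deleted R x (setr y r v) = deleted R x y"
proof -
 have "frame {10, 11, 12, 17, 22} F x (setr y r v) = frame {10, 11, 12, 17, 22} F x y" for F
  unfolding frame_def using r by auto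
 thus ?thesis by (simp only: deleted_def set_simps)
qed

text \<open>The doomed set is described by the final successor lists. This composes: an empty list
  stays empty, and a list that becomes empty only later loses an edge of \<open>S\<close>.\<close>

lemma deleted_trans:
 assumes "deleted R x y" "deleted S y z"
 shows "deleted (R Un S) x z"
proof -
 have d: "dead y = dead x" using assms(1) by (simp add: deleted_def frame_def)
 note Y = deletedD(6)[OF assms(1)] and Z = deletedD(6)[OF assms(2), unfolded d]
  and O = deletedD(2)[OF assms(2)]
 have 1: "Out y u = {} ==> Out z u = {}" for u unfolding O by simp
 have 2: "u : fst ` S" if "Out y u ~= {}" "Out z u = {}" for u
 proof -
  from that(1) obtain w where w: "w : Out y u" by (meson ex_in_conv)
  have "w ~: Out z u" unfolding that(2) by simp
  hence "(u, w) : S" using w unfolding O by simp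
  thus ?thesis by force
 qed
 define A B where "A = (%u. Out y u = {})" and "B = (%u. Out z u = {})"
 have "Dm z = Dm x Un {u : fst ` R. dead x u = 0 & (u : Rand \<or> A u)} Un
   {u : fst ` S. dead x u = 0 & (u : Rand \<or> B u)}"
  unfolding Z Y A_def B_def ..
 also have "... = Dm x Un {u : fst ` (R Un S). dead x u = 0 & (u : Rand \<or> B u)}"
 proof -
  have "A u --> B u" "~ A u --> B u --> u : fst ` S" for u
   unfolding A_def B_def using 1 2 by iprover+
  moreover have "X Un {u : R'. d u & (r u \<or> A u)} Un {u : S'. d u & (r u \<or> B u)} =
    X Un {u : R' Un S'. d u & (r u \<or> B u)}"
   if "!!u. A u --> B u" "!!u. ~ A u --> B u --> u : S'"
   for A B d r :: "nat => bool" and X R' S' :: "nat set"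
   using that by blast
  ultimately show ?thesis unfolding image_Un by blast
 qed
 finally have D: "Dm z = Dm x Un {u : fst ` (R Un S). dead x u = 0 & (u : Rand \<or> Out z u = {})}"
  unfolding B_def .
 show ?thesis
  unfolding deleted_def
 proof (intro conjI allI)
  show "frame {10, 11, 12, 17, 22} {bs, Suc bs, bs+6, bs+7, bs+8} x z"
   using assms by (simp add: deleted_def frame_def)
  show "Out z u = Out x u - {w. (u, w) : R Un S}" for u
   unfolding O deletedD(2)[OF assms(1)] by auto
  show "In z u = In x u - {w. (w, u) : R Un S}" for u
   unfolding deletedD(3)[OF assms(2)] deletedD(3)[OF assms(1)] by auto
  show "QO z = QO x Un fst ` (R Un S)" "QI z = QI x Un snd ` (R Un S)"
   unfolding deletedD(4,5)[OF assms(2)] deletedD(4,5)[OF assms(1)] image_Un by auto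
 qed (rule D)
qed

lemma hw_Deledge:
 assumes "params x" "areg x 10 < n" "areg x 11 < n"
  "!!y. deleted {(areg x 10, areg x 11)} x y ==> areg y = areg x ==>
   alst y bs (areg x 10) = sdel (areg x 11) (alst x bs (areg x 10)) ==>
   alst y (Suc bs) (areg x 11) = sdel (areg x 10) (alst x (Suc bs) (areg x 11)) ==> Q 500 y"
 shows "hw N (Deledge bs) Q x"
proof -
 have "hw N (Deledge bs) (%t y. t <= 500 & deleted {(areg x 10, areg x 11)} x y &
   areg y = areg x & alst y bs (areg x 10) = sdel (areg x 11) (alst x bs (areg x 10)) &
   alst y (Suc bs) (areg x 11) = sdel (areg x 10) (alst x (Suc bs) (areg x 11))) x"
  unfolding Deledge_def
  apply (rule hw_ok)
  using assms(1-3)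
  apply (intro hw_Seq hw_Cond hw_ends hw_Doom)
  apply (simp_all add: params_def)
  apply (auto simp: deleted_def frame_def Rand_def)
  done
 thus ?thesis by (rule hw_time) (use assms(4) in auto)
qed

lemma deletedD2:
 assumes "deleted R x y"
 shows "aarr y = aarr x" "r ~: {10, 11, 12, 17, 22} ==> areg y r = areg x r"
  "f ~: {bs, Suc bs, bs+6, bs+7, bs+8} ==> alst y f = alst x f"
 using deletedD(1)[OF assms] by (auto simp: frame_def)

lemma params_deleted: "deleted R x y ==> params x ==> params y"
 using deletedD2[of R x y] by (simp add: params_def)

lemma params_setr [simp]: "r >= 4 ==> params (setr x r v) = params x"
 by (simp add: params_def)

lemma deleted_setr_left [simp]:
 assumes r: "r : {10, 11, 12, 17, 22}"
 shows "deleted R (setr x r v) y = deleted R x y"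
proof -
 have "frame {10, 11, 12, 17, 22} F (setr x r v) y = frame {10, 11, 12, 17, 22} F x y" for F
  unfolding frame_def using r by auto
 thus ?thesis by (simp only: deleted_def set_simps)
qed

text \<open>A deleted edge disappears from the very list over which the loop is running; this is the
  change that \<open>hw_For\<close> permits.\<close>

lemma hw_Cut:
 assumes par: "params x" and v: "areg x 12 = v" "v < n"
  and sym: "!!u w. w : Out x u \<longleftrightarrow> u : In x w"
  and Q: "!!T y. deleted {(u, w). w : Out x u & (u = v \<or> w = v) & comp x u ~= comp x w} x y ==>
   areg y 12 = v ==> areg y 22 = areg x 22 ==>
   T <= 600 * (1 + card (Out x v) + card (In x v)) ==> Q T y"
 shows "hw N (Cut bs) Q x"
proof (rule hw_ok)
 assume ok: "lists_ok x"
 define cf where "cf = comp x"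
 define R1 where "R1 = (%D. {(v, w) |w. w : D & cf w ~= cf v})"
 define J1 where "J1 = (%D T y. deleted (R1 D) x y & areg y 12 = v & areg y 22 = areg x 22 & T <= 600 * card D)"
 define R2 where "R2 = (%D. {(w, v) |w. w : D & cf w ~= cf v})"
 define J2 where "J2 = (%x D T y. deleted (R2 D) x y & areg y 12 = v & areg y 22 = areg x 22 & T <= 600 * card D)"
 have lt: "w : Out x u ==> w < n" "w : In x u ==> w < n" for u w
  using lists_ok_less[OF ok, of w bs u] lists_ok_less[OF ok, of w "Suc bs" u] by auto
 have p2: "areg y 0 = n" if "params y" for y using that by (simp add: params_def)
 have outv: "finite (Out x v)" "finite (In x v)" by auto
 show "hw N (Cut bs) Q x"
  unfolding Cut_def
 proof (rule hw_Seq, rule hw_For[where J = J1 and ro = v and xi = x])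
  show "J1 {} 0 x" using v deleted_refl by (simp add: J1_def R1_def)
  show "aev y (Reg 12) = v & areg y 0 = N bs" if "J1 D T y" for D T y
   using that params_deleted[OF _ par] p2 by (auto simp: J1_def)
  show "J1 D T (setr y 17 a)" if "J1 D T y" for D T y a using that by (simp add: J1_def)
 next
  fix D w T y a
  assume D: "D \<subseteq> Out x v" and w: "w : Out x v" "w ~: D" and J: "J1 D T y"
  let ?y = "setr (setr y 17 a) 11 w"
  have del: "deleted (R1 D) x y" and r: "areg y 12 = v" "areg y 22 = areg x 22" "T <= 600 * card D" using J by (auto simp: J1_def)
  have par': "params y" using params_deleted[OF del par] .
  have cf: "comp y = cf" using deletedD2(1)[OF del] by (simp add: cf_def)
  have cd: "card (insert w D) = Suc (card D)" using w D finite_subset[OF D] by simp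
  have R: "R1 (insert w D) = (if cf w = cf v then R1 D else R1 D Un {(v, w)})" by (auto simp: R1_def)
  show "hw N (Cond (Op Equal (Read (bs+7) (Reg 11)) (Read (bs+7) (Reg 12))) Skip
    (Assign 10 (Reg 12) ;; Deledge bs))
   (%t x'. J1 (insert w D) (T + 12 + cost (Reg 12) + t) x' & areg x' 17 = a &
    (alst x' bs v = alst y bs v \<or> alst x' bs v = sdel w (alst y bs v))) ?y"
  proof (rule hw_Cond)
   assume "aev ?y (Op Equal (Read (bs+7) (Reg 11)) (Read (bs+7) (Reg 12))) ~= 0"
   hence "cf w = cf v" using cf r by simp
   thus "hw N Skip (%t x'. J1 (insert w D) (T + 12 + cost (Reg 12) + (cost (Op Equal (Read (bs+7) (Reg 11)) (Read (bs+7) (Reg 12))) + 1 + t)) x' & areg x' 17 = a &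
    (alst x' bs v = alst y bs v \<or> alst x' bs v = sdel w (alst y bs v))) ?y"
    using del r R cd by (intro hw_Skip) (simp add: J1_def)
  next
   assume "aev ?y (Op Equal (Read (bs+7) (Reg 11)) (Read (bs+7) (Reg 12))) = 0"
   hence ne: "cf w ~= cf v" using cf r by (auto split: if_splits)
   show "hw N (Assign 10 (Reg 12) ;; Deledge bs) (%t x'. J1 (insert w D) (T + 12 + cost (Reg 12) + (cost (Op Equal (Read (bs+7) (Reg 11)) (Read (bs+7) (Reg 12))) + 1 + t)) x' & areg x' 17 = a &
    (alst x' bs v = alst y bs v \<or> alst x' bs v = sdel w (alst y bs v))) ?y"
   proof (rule hw_Seq, rule hw_Assign, simp, rule hw_Deledge, goal_cases)
    case (4 z)
    hence "deleted {(v, w)} y z" using r by simp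
    from deleted_trans[OF del this] have "deleted (R1 (insert w D)) x z" using R ne by simp
    thus ?case using 4 r cd by (simp add: J1_def)
   qed (use par' r w v lt in auto)
  qed simp
 next
  fix T1 x1 assume J: "J1 (Out x v) T1 x1"
  have del: "deleted (R1 (Out x v)) x x1" and r: "areg x1 12 = v" "areg x1 22 = areg x 22" "T1 <= 600 * card (Out x v)"
   using J by (auto simp: J1_def)
  have par1: "params x1" using params_deleted[OF del par] .
  have cf1: "comp x1 = cf" using deletedD2(1)[OF del] by (simp add: cf_def)
  have In1: "In x1 v = In x v" using deletedD(3)[OF del, of v] by (auto simp: R1_def)
  show "hw N (For (bs+1) 0 (Reg 12) 17 10
      (Cond (Op Equal (Read (bs+7) (Reg 10)) (Read (bs+7) (Reg 12))) Skip
       (Assign 11 (Reg 12);; Deledge bs))) (%t'. Q (T1 + 4 + cost (Reg 12) + t')) x1"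
  proof (rule hw_For[where J = "J2 x1" and ro = v and xi = x1])
   show "J2 x1 {} 0 x1" using r deleted_refl by (simp add: J2_def R2_def)
   show "aev y (Reg 12) = v & areg y 0 = N (bs+1)" if "J2 x1 D T y" for D T y
    using that params_deleted[OF _ par1] p2 by (auto simp: J2_def)
   show "J2 x1 D T (setr y 17 a)" if "J2 x1 D T y" for D T y a using that by (simp add: J2_def)
  next
   fix D w T y a
   assume D: "D \<subseteq> set (alst x1 (bs+1) v)" and w: "w : set (alst x1 (bs+1) v)" "w ~: D" and J: "J2 x1 D T y"
   let ?y = "setr (setr y 17 a) 10 w"
   have del2: "deleted (R2 D) x1 y" and r2: "areg y 12 = v" "areg y 22 = areg x1 22" "T <= 600 * card D" using J by (auto simp: J2_def)
   have par': "params y" using params_deleted[OF del2 par1] .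
   have cf: "comp y = cf" using deletedD2(1)[OF del2] cf1 by simp
   have cd: "card (insert w D) = Suc (card D)" using w D finite_subset[OF D] by simp
   have R: "R2 (insert w D) = (if cf w = cf v then R2 D else R2 D Un {(w, v)})" by (auto simp: R2_def)
   have wn: "w < n" using w(1) In1 lt(2) by simp
   show "hw N (Cond (Op Equal (Read (bs+7) (Reg 10)) (Read (bs+7) (Reg 12))) Skip
     (Assign 11 (Reg 12) ;; Deledge bs))
    (%t x'. J2 x1 (insert w D) (T + 12 + cost (Reg 12) + t) x' & areg x' 17 = a &
     (alst x' (bs+1) v = alst y (bs+1) v \<or> alst x' (bs+1) v = sdel w (alst y (bs+1) v))) ?y"
   proof (rule hw_Cond)
    assume "aev ?y (Op Equal (Read (bs+7) (Reg 10)) (Read (bs+7) (Reg 12))) ~= 0"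
    hence "cf w = cf v" using cf r2 by simp
    thus "hw N Skip (%t x'. J2 x1 (insert w D) (T + 12 + cost (Reg 12) + (cost (Op Equal (Read (bs+7) (Reg 10)) (Read (bs+7) (Reg 12))) + 1 + t)) x' & areg x' 17 = a &
     (alst x' (bs+1) v = alst y (bs+1) v \<or> alst x' (bs+1) v = sdel w (alst y (bs+1) v))) ?y"
     using del2 r2 R cd by (intro hw_Skip) (simp add: J2_def)
   next
    assume "aev ?y (Op Equal (Read (bs+7) (Reg 10)) (Read (bs+7) (Reg 12))) = 0"
    hence ne: "cf w ~= cf v" using cf r2 by (auto split: if_splits)
    show "hw N (Assign 11 (Reg 12) ;; Deledge bs) (%t x'. J2 x1 (insert w D) (T + 12 + cost (Reg 12) + (cost (Op Equal (Read (bs+7) (Reg 10)) (Read (bs+7) (Reg 12))) + 1 + t)) x' & areg x' 17 = a &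
     (alst x' (bs+1) v = alst y (bs+1) v \<or> alst x' (bs+1) v = sdel w (alst y (bs+1) v))) ?y"
    proof (rule hw_Seq, rule hw_Assign, simp, rule hw_Deledge, goal_cases)
     case (4 z)
     hence "deleted {(w, v)} y z" using r2 by simp
     from deleted_trans[OF del2 this] have "deleted (R2 (insert w D)) x1 z" using R ne by simp
     thus ?case using 4 r2 cd by (simp add: J2_def)
    qed (use par' r2 wn v in auto)
   qed simp
  next
   fix T y assume J: "J2 x1 (set (alst x1 (bs+1) v)) T y"
   have del2: "deleted (R2 (In x v)) x1 y" and r2: "areg y 12 = v" "areg y 22 = areg x1 22" "T <= 600 * card (In x v)"
    using J In1 by (auto simp: J2_def)
   have "R1 (Out x v) Un R2 (In x v) = {(u, w). w : Out x u & (u = v \<or> w = v) & cf u ~= cf w}"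
    using sym by (auto simp: R1_def R2_def)
   thus "Q (T1 + 4 + cost (Reg 12) + (T + 4 + cost (Reg 12))) y"
    using deleted_trans[OF del del2] r r2 by (intro Q) (auto simp: cf_def)
  qed (use r in auto)
 qed (use v in auto)
qed

section \<open>Moving a vertex to another component\<close>

lemma Row_simps [simp]: "aev x (Row c i) = areg x c * areg x 3 + areg x i" "plain (Row c i)"
 "abs_ok (Row c i)" "cost (Row c i) = 5"
 by (simp_all add: Row_def)

lemma in_U: "v : U i \<longleftrightarrow> (EX j<b. mv j = v & mi j = i & mu j ~= 0)"
 and in_L: "v : L i \<longleftrightarrow> (EX j<b. mv j = v & mi j = i & mu j = 0)"
 by (auto simp: U_def L_def)

lemma MS: "params x ==> v < n ==> MS x v = {j. j < b & mv j = v}"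
 by (simp add: params_def)

lemma params_setl [simp]: "f ~= bs+3 ==> params (setl x f r l) = params x"
 by (simp add: params_def)

lemma params_seta [simp]: "a ~: {bs+2, bs+3, bs+5} ==> params (seta x a i v) = params x"
 by (simp add: params_def)

definition moved_rows :: "nat => nat => nat => nat set => nat => astate => astate => bool" where
 "moved_rows c c' v I f x y \<longleftrightarrow> (ALL d i. i < k --> set (alst y f (d * k + i)) =
   (if i : I & d = c' then insert v (set (alst x f (d * k + i)))
   else if i : I & d = c then set (alst x f (d * k + i)) - {v}
   else set (alst x f (d * k + i))))"

lemma moved_rows_step:
 assumes "moved_rows c c' v I f x y" "c ~= c'" "i < k"
  and "set (alst z f (c' * k + i)) = insert v (set (alst y f (c' * k + i)))"
  and "set (alst z f (c * k + i)) = set (alst y f (c * k + i)) - {v}"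
  and "!!r. r ~= c * k + i ==> r ~= c' * k + i ==> alst z f r = alst y f r"
 shows "moved_rows c c' v (insert i I) f x z"
 unfolding moved_rows_def
proof (intro allI impI)
 fix d i' assume i': "i' < k"
 have *: "d * k + i' = e * k + i \<longleftrightarrow> d = e & i' = i" for e
  using row_index_eq[OF i' assms(3)] by auto
 have y: "set (alst y f (d * k + i')) = (if i' : I & d = c' then insert v (set (alst x f (d * k + i')))
   else if i' : I & d = c then set (alst x f (d * k + i')) - {v}
   else set (alst x f (d * k + i')))"
  using assms(1) i' by (simp add: moved_rows_def)
 show "set (alst z f (d * k + i')) = (if i' : insert i I & d = c' then insert v (set (alst x f (d * k + i')))
   else if i' : insert i I & d = c then set (alst x f (d * k + i')) - {v}
   else set (alst x f (d * k + i')))"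
 proof (cases "i' = i & (d = c \<or> d = c')")
  case True
  thus ?thesis using y assms(2,4,5) by (auto split: if_splits)
 next
  case False
  hence "alst z f (d * k + i') = alst y f (d * k + i')" using assms(6) * by auto
  thus ?thesis using y False by auto
 qed
qed

lemma moved_rows_refl: "moved_rows c c' v {} f x x"
 by (simp add: moved_rows_def)

lemma moved_rows_cong: "alst x f = alst x' f ==> alst y f = alst y' f ==>
  moved_rows c c' v I f x y = moved_rows c c' v I f x' y'"
 by (simp add: moved_rows_def)

definition moved :: "nat => nat => astate => astate => bool" where
 "moved v c' x y \<longleftrightarrow> (ALL r. r ~: {9, 14, 15, 16} --> areg y r = areg x r) &
   aarr y = (aarr x)(bs+7 := (comp x)(v := c')) &
   (ALL f. f ~: {bs+2, bs+4, bs+5} --> alst y f = alst x f) &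
   (ALL d. CS y d = (if d = c' then insert v (CS x d) else if d = comp x v then CS x d - {v} else CS x d)) &
   moved_rows (comp x v) c' v {i. v : U i} (bs+4) x y &
   moved_rows (comp x v) c' v {i. v : L i} (bs+5) x y"

lemma hw_Move:
 assumes par: "params x" and v: "areg x 12 = v" "v < n" and c': "areg x 13 = c'" "comp x v ~= c'"
  and Q: "!!T y. moved v c' x y ==> T <= 600 * (1 + card (MS x v)) ==> Q T y"
 shows "hw N (Move bs) Q x"
proof (rule hw_ok)
 assume ok: "lists_ok x"
 define c where "c = comp x v"
 define x1 where "x1 = seta (setl (setl (setr x 14 c) (bs+2) c (sdel v (alst x (bs+2) c)))
   (bs+2) c' (lins v (alst x (bs+2) c'))) (bs+7) v c'"
 define J where "J = (%D T y. params y & areg y 12 = v & areg y 13 = c' & areg y 14 = c &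
   (ALL r. r ~: {9, 14, 15, 16} --> areg y r = areg x r) & aarr y = aarr x1 &
   (ALL f. f ~: {bs+4, bs+5} --> alst y f = alst x1 f) &
   moved_rows c c' v (mi ` {j : D. mu j ~= 0}) (bs+4) x y &
   moved_rows c c' v (mi ` {j : D. mu j = 0}) (bs+5) x y & T <= 300 * card D)"
 have par1: "params x1" using par by (simp add: x1_def params_def)
 have MS1: "MS x1 v = MS x v" by (simp add: x1_def)
 have pm: "areg y 0 = n" "areg y 2 = b" "areg y 3 = k" "aarr y (bs+3) = mi" "aarr y (bs+5) = mu"
  if "params y" for y using that by (auto simp: params_def)
 show "hw N (Move bs) Q x"
  unfolding Move_def
 proof (rule hw_Seq, rule hw_Assign, simp, rule hw_Seq, rule hw_Delete, goal_cases)
  case 5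
  show ?case
  proof (rule hw_Seq, rule hw_Insert, goal_cases)
   case 5
   show ?case
   proof (rule hw_Seq, rule hw_Write, goal_cases)
    case 4
    have eq: "seta (setl (setl (setr x 14 (aev x (Read (bs+7) (Reg 12)))) (bs+2)
      (aev (setr x 14 (aev x (Read (bs+7) (Reg 12)))) (Reg 14))
      (sdel (aev (setr x 14 (aev x (Read (bs+7) (Reg 12)))) (Reg 12))
       (alst (setr x 14 (aev x (Read (bs+7) (Reg 12)))) (bs+2)
        (aev (setr x 14 (aev x (Read (bs+7) (Reg 12)))) (Reg 14)))))
      (bs+2) c' (lins v (alst x (bs+2) c'))) (bs+7) v c' = x1"
     using v c' by (simp add: x1_def c_def)
    have hwx1: "hw N (For (bs+3) 2 (Reg 12) 15 16 (Assign 9 (Read (bs+3) (Reg 16)) ;;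
      Cond (Read (bs+5) (Reg 16))
       (Delete (bs+4) 0 (Row 14 9) (Reg 12) ;; Insert (bs+4) 0 (Row 13 9) (Reg 12))
       (Delete (bs+5) 0 (Row 14 9) (Reg 12) ;; Insert (bs+5) 0 (Row 13 9) (Reg 12))))
      (%t'. Q (3 + (80 + (50 + (3 + t'))))) x1"
    proof (rule hw_For[where J = J and ro = v and xi = x1])
     show "J {} 0 x1" using par1 v c' unfolding J_def
      by (simp add: moved_rows_refl moved_rows_cong[of x1 _ x x1 x1]) (simp add: x1_def moved_rows_def)
     show "aev y (Reg 12) = v & areg y 2 = N (bs+3)" if "J D T y" for D T y
      using that pm by (simp add: J_def)
     show "J D T (setr y 15 a)" if "J D T y" for D T y a
      using that by (simp add: J_def moved_rows_def)
    next
     fix D j T y a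
     assume D: "D \<subseteq> MS x1 v" and j: "j : MS x1 v" "j ~: D" and J: "J D T y"
     have jj: "j < b" "mv j = v" using j MS[OF par v(2)] MS1 by auto
     have i: "mi j < k" using mem[OF jj(1)] by simp
     have cd: "card (insert j D) = Suc (card D)" using j D finite_subset[OF D] by simp
     note JD = J[unfolded J_def]
     have pary: "params y" using JD by simp
     let ?y = "setr (setr y 15 a) 16 j"
     let ?P = "%t x'. J (insert j D) (T + 12 + cost (Reg 12) + t) x' & areg x' 15 = a &
      (alst x' (bs+3) v = alst y (bs+3) v \<or> alst x' (bs+3) v = sdel j (alst y (bs+3) v))"
     have rows: "c * k + mi j ~= c' * k + mi j" using row_index_eq[OF i i, of c c'] c' by (auto simp: c_def)
     show "hw N (Assign 9 (Read (bs+3) (Reg 16)) ;;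
       Cond (Read (bs+5) (Reg 16))
       (Delete (bs+4) 0 (Row 14 9) (Reg 12) ;; Insert (bs+4) 0 (Row 13 9) (Reg 12))
       (Delete (bs+5) 0 (Row 14 9) (Reg 12) ;; Insert (bs+5) 0 (Row 13 9) (Reg 12))) ?P ?y"
     proof (rule hw_ok)
      assume "lists_ok ?y"
      hence oky: "distinct (alst y f r)" for f r by (simp add: lists_ok_def)
      show ?thesis
      proof (rule hw_Seq, rule hw_Assign, simp, rule hw_Cond, simp, goal_cases)
       case 1
       let ?z = "setl (setl (setr ?y 9 (mi j)) (bs+4) (c * k + mi j) (sdel v (alst y (bs+4) (c * k + mi j))))
         (bs+4) (c' * k + mi j) (lins v (alst y (bs+4) (c' * k + mi j)))"
       have mu: "mu j ~= 0" using 1 pm[OF pary] by simp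
       have s: "mi ` {j' : insert j D. mu j' ~= 0} = insert (mi j) (mi ` {j : D. mu j ~= 0})"
        "{j' : insert j D. mu j' = 0} = {j : D. mu j = 0}" using mu by auto
       have m4: "moved_rows c c' v (insert (mi j) (mi ` {j : D. mu j ~= 0})) (bs+4) x ?z"
        by (rule moved_rows_step[of c c' v _ _ x y]) (use JD i rows c' oky in \<open>auto simp: c_def\<close>)
       have m5: "moved_rows c c' v (mi ` {j : D. mu j = 0}) (bs+5) x ?z"
        using JD moved_rows_cong[of x "bs+5" x y ?z] by simp
       have "?P (cost (Read (bs+3) (Reg 16)) + 1 + (cost (Read (bs+5) (Reg 16)) + 1 + (160 + 98))) ?z"
        unfolding J_def s using JD m4 m5 cd jj by simp
       thus ?case
        by (intro hw_Seq hw_ends) (use JD pm[OF pary] v rows in \<open>simp_all\<close>)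
      next
       case 2
       let ?z = "setl (setl (setr ?y 9 (mi j)) (bs+5) (c * k + mi j) (sdel v (alst y (bs+5) (c * k + mi j))))
         (bs+5) (c' * k + mi j) (lins v (alst y (bs+5) (c' * k + mi j)))"
       have mu: "mu j = 0" using 2 pm[OF pary] by simp
       have s: "mi ` {j' : insert j D. mu j' = 0} = insert (mi j) (mi ` {j : D. mu j = 0})"
        "{j' : insert j D. mu j' ~= 0} = {j : D. mu j ~= 0}" using mu by auto
       have m4: "moved_rows c c' v (insert (mi j) (mi ` {j : D. mu j = 0})) (bs+5) x ?z"
        by (rule moved_rows_step[of c c' v _ _ x y]) (use JD i rows c' oky in \<open>auto simp: c_def\<close>)
       have m5: "moved_rows c c' v (mi ` {j : D. mu j ~= 0}) (bs+4) x ?z"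
        using JD moved_rows_cong[of x "bs+4" x y ?z] by simp
       have "?P (cost (Read (bs+3) (Reg 16)) + 1 + (cost (Read (bs+5) (Reg 16)) + 1 + (160 + 98))) ?z"
        unfolding J_def s using JD m4 m5 cd jj by simp
       thus ?case
        by (intro hw_Seq hw_ends) (use JD pm[OF pary] v rows in \<open>simp_all\<close>)
      qed
     qed
    next
     fix T y assume J: "J (MS x1 v) T y"
     note JD = J[unfolded J_def]
     have s: "mi ` {j : MS x1 v. mu j ~= 0} = {i. v : U i}" "mi ` {j : MS x1 v. mu j = 0} = {i. v : L i}"
      using MS[OF par v(2)] MS1 by (auto simp: in_U in_L image_iff)
     have "moved v c' x y"
      unfolding moved_def using JD s c' ok
      by (simp add: c_def x1_def)
     thus "Q (3 + (80 + (50 + (3 + (T + 4 + cost (Reg 12)))))) y"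
      using JD MS1 by (intro Q) auto
    qed (use v in \<open>auto simp: x1_def\<close>)
    show ?case using hwx1 v c' by (simp add: x1_def c_def)
   qed (use par v c' in auto)
  qed (use par v c' in \<open>auto simp: params_def\<close>)
 qed (use par v c' in \<open>auto simp: params_def\<close>)
qed

section \<open>Checking the Streett pairs after a move\<close>

lemma L_less: "v : L i ==> v < n"
 using mem by (auto simp: in_L)

text \<open>The memberships in some \<open>L\<close> that are still recorded. Each vertex popped by
  \<open>Check\<close> lowers this number, so the popping loop is paid for by it rather than by the
  size of the moved part.\<close>

definition lam :: "astate => nat" where
 "lam x = card {j. j < b & mu j = 0 & mv j : LS x (comp x (mv j) * k + mi j)}"

lemma hw_DoomRow:
 assumes par: "params x" and c: "areg x 18 = c" and i: "areg x 9 = i" "i < k"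
  and LS: "LS x (c * k + i) \<subseteq> {u : L i. comp x u = c}"
  and Q: "!!T y. frame {21} {bs+5, bs+6} x y ==> alst y (bs+5) (c * k + i) = [] ==>
   (!!r. r ~= c * k + i ==> alst y (bs+5) r = alst x (bs+5) r) ==>
   Dm y = Dm x Un {u : LS x (c * k + i). dead x u = 0} ==>
   T + 200 * lam y <= 200 * lam x + 20 ==> Q T y"
 shows "hw N (While (Cnt (bs+5) (Row 18 9)) (Pop (bs+5) 0 (Row 18 9) 21 ;; Doom bs 21)) Q x"
proof -
 define r where "r = c * k + i"
 define I where "I = (%T y. frame {21} {bs+5, bs+6} x y &
  (ALL r'. r' ~= r --> alst y (bs+5) r' = alst x (bs+5) r') & LS y r \<subseteq> LS x r &
  Dm y = Dm x Un {u : LS x r - LS y r. dead x u = 0} & T + 200 * lam y <= 200 * lam x)"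
 have k: "areg x 0 = n" "areg x 3 = k" using par by (auto simp: params_def)
 have par_y: "params y" if "frame {21} {bs+5, bs+6} x y" for y
  using that par by (simp add: frame_def params_def)
 show ?thesis
 proof (rule hw_While[where I = I and \<mu> = "%y. length (alst y (bs+5) r)"])
  show "I 0 x" by (auto simp: I_def frame_def)
  show "abs_ok (Cnt (bs+5) (Row 18 9))" by simp
 next
  fix T y assume I: "I T y" and z: "aev y (Cnt (bs+5) (Row 18 9)) = 0"
  have f: "frame {21} {bs+5, bs+6} x y" using I by (simp add: I_def)
  have "aev y (Row 18 9) = r" using f c i k by (simp add: frame_def r_def)
  hence "alst y (bs+5) r = []" using z by simp
  thus "Q (T + cost (Cnt (bs+5) (Row 18 9)) + 1) y"
   using I f by (intro Q) (auto simp: I_def r_def)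
 next
  fix T y assume I: "I T y" and nz: "aev y (Cnt (bs+5) (Row 18 9)) ~= 0"
  have f: "frame {21} {bs+5, bs+6} x y" using I by (simp add: I_def)
  have row: "aev y (Row 18 9) = r" using f c i k by (simp add: frame_def r_def)
  hence ne: "alst y (bs+5) r ~= []" using nz by simp
  let ?u = "last (alst y (bs+5) r)"
  have u: "?u : LS y r" using ne by simp
  hence uL: "?u : L i" "comp x ?u = c" "?u : LS x r" using I LS by (auto simp: I_def r_def)
  hence un: "?u < n" by (intro L_less)
  have comp: "comp y = comp x" "dead y = dead x" using f by (auto simp: frame_def)
  let ?e = "Cnt (bs+5) (Row 18 9)"
  show "hw N (Pop (bs+5) 0 (Row 18 9) 21 ;; Doom bs 21)
    (%t x'. I (T + cost ?e + 1 + t) x' &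
     length (alst x' (bs+5) r) < length (alst y (bs+5) r)) y"
  proof (rule hw_ok)
   assume oky: "lists_ok y"
   have bl: "set (butlast (alst y (bs+5) r)) = LS y r - {?u}"
   proof -
    have "distinct (butlast (alst y (bs+5) r) @ [?u])" using oky ne by simp
    moreover have "LS y r = set (butlast (alst y (bs+5) r) @ [?u])" using ne by simp
    ultimately show ?thesis by auto
   qed
   show ?thesis
   proof (rule hw_Seq, rule hw_Pop, goal_cases)
    case 6
    show ?case
    proof (rule hw_Doom, goal_cases)
     case (3 z)
     have z: "areg z = (areg y)(21 := ?u)" "aarr z = aarr y"
      "alst z f = (if f = bs+5 then (alst y f)(r := butlast (alst y f r)) else alst y f)"
      if "f ~= bs+6" for f
      using 3(1) row that by (auto simp: frame_def)
     have Dz: "Dm z = Dm y Un {v. v = ?u & dead x v = 0}" using 3(2) row comp by simp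
     have "LS z r = LS y r - {?u}" using z bl by simp
     moreover have lamz: "lam z < lam y"
     proof -
      obtain j where j: "j < b" "mv j = ?u" "mi j = i" "mu j = 0" using uL(1) by (auto simp: in_L)
      have "{j. j < b & mu j = 0 & mv j : LS z (comp z (mv j) * k + mi j)}
        \<subset> {j. j < b & mu j = 0 & mv j : LS y (comp y (mv j) * k + mi j)}"
      proof (rule psubsetI)
       have "LS z q \<subseteq> LS y q" for q using z(3)[of "bs+5"] bl by auto
       thus "{j. j < b & mu j = 0 & mv j : LS z (comp z (mv j) * k + mi j)}
        \<subseteq> {j. j < b & mu j = 0 & mv j : LS y (comp y (mv j) * k + mi j)}" using z(2)[of bs] by auto
       have "?u ~: LS z r" using calculation by simp
       hence "j ~: {j. j < b & mu j = 0 & mv j : LS z (comp z (mv j) * k + mi j)}"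
        using j z(2)[of bs] comp uL(2) by (simp add: r_def)
       moreover have "j : {j. j < b & mu j = 0 & mv j : LS y (comp y (mv j) * k + mi j)}"
        using j u comp uL(2) by (simp add: r_def)
       ultimately show "{j. j < b & mu j = 0 & mv j : LS z (comp z (mv j) * k + mi j)}
        ~= {j. j < b & mu j = 0 & mv j : LS y (comp y (mv j) * k + mi j)}" by blast
      qed
      thus ?thesis unfolding lam_def by (intro psubset_card_mono) auto
     qed
     moreover have "Dm z = Dm x Un {u : LS x r - LS z r. dead x u = 0}"
     proof -
      have "Dm y = Dm x Un {u : LS x r - LS y r. dead x u = 0}" using I by (simp add: I_def)
      thus ?thesis unfolding Dz calculation(1) using u uL(3) by auto
     qed
     moreover have "frame {21} {bs+5, bs+6} x z" using f z(1,2)[of bs] z(3) by (auto simp: frame_def)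
     ultimately have "I (T + 200) z" using I z(3)[of "bs+5"] bl unfolding I_def by auto
     hence "I (T + cost ?e + 1 + (10 + 4 * cost (Row 18 9) + 60)) z" unfolding I_def by simp
     moreover have "length (alst z (bs+5) r) < length (alst y (bs+5) r)"
      using z(3)[of "bs+5"] ne by simp
     ultimately show ?case by simp
    qed (use par_y[OF f] un row in simp_all)
   qed (use par_y[OF f] un row ne in \<open>simp_all add: params_def\<close>)
  qed
 qed
qed

text \<open>A reason is kept for each new doom, since \<open>hw_Split\<close> has to derive a
  violation from it; conversely it is kept which empty \<open>U\<close> rows have been dealt
  with.\<close>

definition checked :: "nat => nat => nat => nat set => astate => astate => bool" where
 "checked v c c' D x y \<longleftrightarrow> frame {9, 19, 20, 21} {bs+5, bs+6} x y &
   (ALL r. LS y r \<subseteq> LS x r) & Dm x \<subseteq> Dm y &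
   (ALL u:Dm y. u : Dm x \<or> dead x u = 0 & (EX i<k. u : LS x (c * k + i) & US x (c * k + i) = {} \<or>
     u = v & v : L i & US x (c' * k + i) = {})) &
   (ALL r. LS x r \<subseteq> LS y r Un Dm y Un {u. dead x u ~= 0}) &
   (ALL j:D. (mu j ~= 0 --> US x (c * k + mi j) = {} --> LS y (c * k + mi j) = {}) &
    (mu j = 0 --> US x (c' * k + mi j) = {} --> v : Dm y \<or> dead x v ~= 0))"

lemma checkedD:
 assumes "checked v c c' D x y"
 shows "LS y r \<subseteq> LS x r" "Dm x \<subseteq> Dm y"
  "u : Dm y ==> u : Dm x \<or> dead x u = 0 & (EX i<k. u : LS x (c * k + i) & US x (c * k + i) = {} \<or>
     u = v & v : L i & US x (c' * k + i) = {})"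
  "u : LS x r ==> u : LS y r \<or> u : Dm y \<or> dead x u ~= 0"
  "j : D ==> mu j ~= 0 ==> US x (c * k + mi j) = {} ==> LS y (c * k + mi j) = {}"
  "j : D ==> mu j = 0 ==> US x (c' * k + mi j) = {} ==> v : Dm y \<or> dead x v ~= 0"
  "frame {9, 19, 20, 21} {bs+5, bs+6} x y"
proof -
 note a = assms[unfolded checked_def]
 show "LS y r \<subseteq> LS x r" "Dm x \<subseteq> Dm y" "frame {9, 19, 20, 21} {bs+5, bs+6} x y" using a by simp_all
 note a = a[THEN conjunct2, THEN conjunct2, THEN conjunct2]
 show "u : Dm y ==> u : Dm x \<or> dead x u = 0 & (EX i<k. u : LS x (c * k + i) & US x (c * k + i) = {} \<or>
     u = v & v : L i & US x (c' * k + i) = {})"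
  using a[THEN conjunct1] by (rule bspec)
 note a = a[THEN conjunct2]
 show "u : LS x r ==> u : LS y r \<or> u : Dm y \<or> dead x u ~= 0"
  using a[THEN conjunct1, THEN spec, of r] by auto
 note a = a[THEN conjunct2]
 show "j : D ==> mu j ~= 0 ==> US x (c * k + mi j) = {} ==> LS y (c * k + mi j) = {}"
  "j : D ==> mu j = 0 ==> US x (c' * k + mi j) = {} ==> v : Dm y \<or> dead x v ~= 0"
  using bspec[OF a] by simp_all
qed

lemma checked_setr [simp]:
 assumes "r : {9, 19, 20, 21}"
 shows "checked v c c' D x (setr y r a) = checked v c c' D x y"
proof -
 have "frame {9, 19, 20, 21} F x (setr y r a) = frame {9, 19, 20, 21} F x y" for F
  unfolding frame_def using assms by auto
 thus ?thesis by (simp only: checked_def set_simps)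
qed

lemma lam_cong: "alst y (bs+5) = alst x (bs+5) ==> comp y = comp x ==> lam y = lam x"
 by (simp add: lam_def)

lemma hw_Check:
 assumes par: "params x" and v: "areg x 12 = v" "v < n" and c: "areg x 13 = c'" "areg x 18 = c"
  and LS: "!!i. i < k ==> LS x (c * k + i) \<subseteq> {u : L i. comp x u = c}"
  and Q: "!!T y. checked v c c' (MS x v) x y ==>
   T + 200 * lam y <= 200 * lam x + 300 * (1 + card (MS x v)) ==> Q T y"
 shows "hw N (Check bs) Q x"
proof -
 define J where "J = (%D T y. checked v c c' D x y & T + 200 * lam y <= 200 * lam x + 300 * card D)"
 have ck: "params y" "areg y 12 = v" "areg y 13 = c'" "areg y 18 = c" "aarr y = aarr x"
   "alst y (bs+4) = alst x (bs+4)" "alst y (bs+3) = alst x (bs+3)" if "checked v c c' D x y" for D y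
  using that par v c unfolding checked_def frame_def params_def by auto
 have pm: "areg y 0 = n" "areg y 2 = b" "areg y 3 = k" "aarr y (bs+3) = mi" "aarr y (bs+5) = mu"
  if "params y" for y using that by (auto simp: params_def)
 show ?thesis
  unfolding Check_def
 proof (rule hw_For[where J = J and ro = v and xi = x])
  show "J {} 0 x" by (auto simp: J_def checked_def frame_def)
  show "aev y (Reg 12) = v & areg y 2 = N (bs+3)" if "J D T y" for D T y
   using that ck pm by (auto simp: J_def)
  show "J D T (setr y 19 a)" if "J D T y" for D T y a
   using that by (simp add: J_def lam_def)
  show "Q (T + 4 + cost (Reg 12)) y" if "J (MS x v) T y" for T y
   using that by (intro Q) (auto simp: J_def)
 next
  fix D j T y a
  assume D: "D \<subseteq> MS x v" and j: "j : MS x v" "j ~: D" and J: "J D T y"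
  have jj: "j < b" "mv j = v" using j MS[OF par v(2)] by auto
  have i: "mi j < k" using mem[OF jj(1)] by simp
  have cd: "card (insert j D) = Suc (card D)" using j D finite_subset[OF D] by simp
  have chk: "checked v c c' D x y" and T: "T + 200 * lam y <= 200 * lam x + 300 * card D" using J by (auto simp: J_def)
  note ck1 = ck[OF chk]
  let ?y = "setr (setr y 19 a) 20 j"
  let ?P = "%t x'. J (insert j D) (T + 12 + cost (Reg 12) + t) x' & areg x' 19 = a &
      (alst x' (bs+3) v = alst y (bs+3) v \<or> alst x' (bs+3) v = sdel j (alst y (bs+3) v))"
  let ?y9 = "setr ?y 9 (mi j)"
  have c9: "checked v c c' D x ?y9" using chk by simp
  have lam9: "lam ?y9 = lam y" by (simp add: lam_def)
  have fin: "?P t z" if "checked v c c' (insert j D) x z" "frame {9, 20, 21} {bs+5, bs+6} ?y9 z"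
    "t + 200 * lam z <= 200 * lam y + 250" for t z
  proof -
   have "T + 12 + 1 + t + 200 * lam z <= 200 * lam x + 300 * card (insert j D)" using that(3) T cd by simp
   thus ?thesis using that(1,2) by (simp add: J_def frame_def)
  qed
  show "hw N (Assign 9 (Read (bs+3) (Reg 20)) ;;
    Cond (Read (bs+5) (Reg 20))
     (Cond (Cnt (bs+4) (Row 18 9)) Skip
      (While (Cnt (bs+5) (Row 18 9)) (Pop (bs+5) 0 (Row 18 9) 21 ;; Doom bs 21)))
     (Cond (Cnt (bs+4) (Row 13 9)) Skip (Doom bs 12))) ?P ?y"
  proof (rule hw_Seq, rule hw_Assign, simp, rule hw_Cond, simp, goal_cases)
   case 1
   have mu: "mu j ~= 0" using 1 pm[OF ck1(1)] by simp
   have y9: "setr ?y 9 (aev ?y (Read (bs+3) (Reg 20))) = ?y9" using pm[OF ck1(1)] by simp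
   show ?case
    unfolding y9
   proof (rule hw_Cond, simp, goal_cases)
    case 1
    have "US x (c * k + mi j) ~= {}" using 1 ck1 pm[OF ck1(1)] by auto
    hence "checked v c c' (insert j D) x ?y9" using c9 mu unfolding checked_def by simp
    thus ?case using lam9 by (intro hw_Skip fin) (simp_all add: frame_def)
   next
    case 2
    have US: "US x (c * k + mi j) = {}" using 2 ck1 pm[OF ck1(1)] by auto
    have LSy: "LS y r \<subseteq> LS x r" for r using chk by (simp add: checked_def)
    show ?case
    proof (rule hw_DoomRow[where c = c and i = "mi j"], goal_cases)
     case 5
     show ?case using LSy[of "c * k + mi j"] LS[OF i] ck1 by auto
    next
     case (6 U z)
     have LSz: "LS z r = (if r = c * k + mi j then {} else LS y r)" for r using 6(2,3) by simp
     have Dz: "Dm z = Dm y Un {u : LS y (c * k + mi j). dead x u = 0}" using 6(4) ck1 by simp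
     have "checked v c c' (insert j D) x z"
      unfolding checked_def
     proof (intro conjI allI ballI)
      show "frame {9, 19, 20, 21} {bs+5, bs+6} x z" using checkedD(7)[OF chk] 6(1) by (auto simp: frame_def)
      show "LS z r \<subseteq> LS x r" for r using LSz LSy by auto
      show "Dm x \<subseteq> Dm z" using checkedD(2)[OF chk] by (auto simp: Dz)
      show "u : Dm x \<or> dead x u = 0 & (EX i<k. u : LS x (c * k + i) & US x (c * k + i) = {} \<or>
       u = v & v : L i & US x (c' * k + i) = {})" if "u : Dm z" for u
      proof (cases "u : Dm y")
       case True
       thus ?thesis by (rule checkedD(3)[OF chk])
      next
       case False
       hence "u : LS y (c * k + mi j)" "dead x u = 0" using that Dz by auto
       thus ?thesis using US i LSy by blast
      qed
      show "LS x r \<subseteq> LS z r Un Dm z Un {u. dead x u ~= 0}" for r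
      proof
       fix u assume "u : LS x r"
       hence "u : LS y r \<or> u : Dm y \<or> dead x u ~= 0" by (rule checkedD(4)[OF chk])
       thus "u : LS z r Un Dm z Un {u. dead x u ~= 0}"
        by (cases "dead x u = 0") (auto simp: Dz LSz)
      qed
      fix j' assume j': "j' : insert j D"
      show "mu j' ~= 0 --> US x (c * k + mi j') = {} --> LS z (c * k + mi j') = {}"
       using j' checkedD(5)[OF chk, of j'] by (auto simp: LSz)
      show "mu j' = 0 --> US x (c' * k + mi j') = {} --> v : Dm z \<or> dead x v ~= 0"
       using j' checkedD(6)[OF chk, of j'] mu by (auto simp: Dz)
     qed
     thus ?case using 6 lam9 by (intro fin) (auto simp: frame_def)
    qed (use ck1 i in simp_all)
   qed
  next
   case 2
   have mu: "mu j = 0" using 2 pm[OF ck1(1)] by simp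
   have y9: "setr ?y 9 (aev ?y (Read (bs+3) (Reg 20))) = ?y9" using pm[OF ck1(1)] by simp
   show ?case
    unfolding y9
   proof (rule hw_Cond, simp, goal_cases)
    case 1
    have "US x (c' * k + mi j) ~= {}" using 1 ck1 pm[OF ck1(1)] by auto
    hence "checked v c c' (insert j D) x ?y9" using c9 mu unfolding checked_def by simp
    thus ?case using lam9 by (intro hw_Skip fin) (simp_all add: frame_def)
   next
    case 2
    have US: "US x (c' * k + mi j) = {}" using 2 ck1 pm[OF ck1(1)] by auto
    show ?case
    proof (rule hw_Doom, goal_cases)
     case (3 z)
     have LSz: "alst z (bs+5) = alst y (bs+5)" using 3(1) by (simp add: frame_def)
     have Dz: "Dm z = Dm y Un {u. u = v & dead x u = 0}" using 3(2) ck1 by simp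
     have vL: "v : L (mi j)" using jj mu by (auto simp: in_L)
     have "checked v c c' (insert j D) x z"
      unfolding checked_def
     proof (intro conjI allI ballI)
      show "frame {9, 19, 20, 21} {bs+5, bs+6} x z" using checkedD(7)[OF chk] 3(1) by (auto simp: frame_def)
      show "LS z r \<subseteq> LS x r" for r using LSz chk by (simp add: checked_def)
      show "Dm x \<subseteq> Dm z" using checkedD(2)[OF chk] by (auto simp: Dz)
      show "u : Dm x \<or> dead x u = 0 & (EX i<k. u : LS x (c * k + i) & US x (c * k + i) = {} \<or>
       u = v & v : L i & US x (c' * k + i) = {})" if "u : Dm z" for u
      proof (cases "u : Dm y")
       case True
       thus ?thesis by (rule checkedD(3)[OF chk])
      next
       case False
       hence "u = v" "dead x u = 0" using that Dz by auto
       thus ?thesis using US i vL by blast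
      qed
      show "LS x r \<subseteq> LS z r Un Dm z Un {u. dead x u ~= 0}" for r
      proof
       fix u assume "u : LS x r"
       hence "u : LS y r \<or> u : Dm y \<or> dead x u ~= 0" by (rule checkedD(4)[OF chk])
       thus "u : LS z r Un Dm z Un {u. dead x u ~= 0}"
        by (cases "dead x u = 0") (auto simp: Dz LSz)
      qed
      fix j' assume j': "j' : insert j D"
      show "mu j' ~= 0 --> US x (c * k + mi j') = {} --> LS z (c * k + mi j') = {}"
       using j' checkedD(5)[OF chk, of j'] mu by (auto simp: LSz)
      show "mu j' = 0 --> US x (c' * k + mi j') = {} --> v : Dm z \<or> dead x v ~= 0"
       using j' checkedD(6)[OF chk, of j'] mu by (auto simp: Dz)
     qed
     moreover have "lam z = lam y" using LSz 3(1) by (intro lam_cong) (simp_all add: frame_def)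
     ultimately show ?case using 3 by (intro fin) (auto simp: frame_def)
    qed (use ck1 v in simp_all)
   qed
  qed
 qed (use v in auto)
qed

text \<open>The \<open>L\<close> rows are only lower approximations, because \<open>Check\<close>
  empties them; the last clause says that only doomed or dead vertices may be missing.\<close>

definition consistent :: "astate => bool" where
 "consistent x \<longleftrightarrow> (ALL d. CS x d = {v. v < n & comp x v = d}) &
   (ALL d i. i < k --> US x (d * k + i) = {v : U i. comp x v = d}) &
   (ALL d i. i < k --> LS x (d * k + i) \<subseteq> {v : L i. comp x v = d}) &
   (ALL i v. i < k --> v : L i --> v : LS x (comp x v * k + i) \<or> v : Dm x \<or> dead x v ~= 0)"

definition live :: "astate => bool" where
 "live x \<longleftrightarrow> (ALL v. Out x v = {w. (v, w) : E & comp x v = comp x w}) &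
   (ALL v. In x v = {u. (u, v) : E & comp x u = comp x v})"

definition viol :: "(nat => nat) => nat => bool" where
 "viol cf v \<longleftrightarrow> v : Rand & (EX w. (v, w) : E & cf w ~= cf v) \<or> (ALL w. (v, w) : E --> cf w ~= cf v) \<or>
   (EX i<k. v : L i & (ALL u:U i. cf u ~= cf v))"

definition wt :: "astate => nat => nat" where
 "wt x v = 1 + card (Out x v) + card (In x v) + card (MS x v)"

lemma consistentD:
 assumes "consistent x"
 shows "CS x d = {v. v < n & comp x v = d}" "i < k ==> US x (d * k + i) = {v : U i. comp x v = d}"
  "i < k ==> LS x (d * k + i) \<subseteq> {v : L i. comp x v = d}"
  "i < k ==> v : L i ==> v : LS x (comp x v * k + i) \<or> v : Dm x \<or> dead x v ~= 0"
 using assms by (simp_all add: consistent_def)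

lemma liveD:
 assumes "live x"
 shows "Out x v = {w. (v, w) : E & comp x v = comp x w}" "In x v = {u. (u, v) : E & comp x u = comp x v}"
 using assms by (simp_all add: live_def)

lemma moved_simps:
 assumes "moved v c' x y"
 shows "r ~: {9, 14, 15, 16} ==> areg y r = areg x r" "comp y = (comp x)(v := c')"
  "a ~= bs+7 ==> aarr y a = aarr x a" "f ~: {bs+2, bs+4, bs+5} ==> alst y f = alst x f"
  "CS y d = (if d = c' then insert v (CS x d) else if d = comp x v then CS x d - {v} else CS x d)"
  "i < k ==> US y (d * k + i) = (if v : U i & d = c' then insert v (US x (d * k + i))
   else if v : U i & d = comp x v then US x (d * k + i) - {v} else US x (d * k + i))"
  "i < k ==> LS y (d * k + i) = (if v : L i & d = c' then insert v (LS x (d * k + i))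
   else if v : L i & d = comp x v then LS x (d * k + i) - {v} else LS x (d * k + i))"
 using assms unfolding moved_def moved_rows_def by auto

lemma params_moved: "moved v c' x y ==> params x ==> params y"
 by (simp add: params_def moved_simps)

lemma consistent_moved:
 assumes x: "consistent x" and mv: "moved v c' x y" and v: "v < n" "comp x v ~= c'"
 shows "consistent y"
 unfolding consistent_def
proof (intro conjI allI impI)
 note s = moved_simps[OF mv] and c = consistentD[OF x]
 show "CS y d = {u. u < n & comp y u = d}" for d
  unfolding s(2,5) c(1) using v by auto
 show "US y (d * k + i) = {u : U i. comp y u = d}" if "i < k" for d i
  unfolding s(2) s(6)[OF that] c(2)[OF that] using v by auto
 show "LS y (d * k + i) \<subseteq> {u : L i. comp y u = d}" if "i < k" for d i
  unfolding s(2) s(7)[OF that] using v c(3)[OF that, of d] by auto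
 show "u : LS y (comp y u * k + i) \<or> u : Dm y \<or> dead y u ~= 0" if "i < k" "u : L i" for i u
  using c(4)[OF that] that s(3)[of "bs+8"] s(4)[of "bs+6"] unfolding s(2) s(7)[OF that(1)] by auto
qed

text \<open>A move enters the vertex into the \<open>L\<close> rows of its new component even if it
  had been popped from the old ones. The increase is charged to the moved vertex.\<close>

lemma lam_moved:
 assumes mv: "moved v c' x y" and v: "v < n" and par: "params x"
 shows "lam y <= lam x + card (MS x v)"
proof -
 note s = moved_simps[OF mv]
 have "{j. j < b & mu j = 0 & mv j : LS y (comp y (mv j) * k + mi j)} \<subseteq>
   {j. j < b & mu j = 0 & mv j : LS x (comp x (mv j) * k + mi j)} Un MS x v"
  (is "?A \<subseteq> ?B Un _")
 proof
  fix j assume "j : ?A"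
  hence j: "j < b" "mu j = 0" "mv j : LS y (comp y (mv j) * k + mi j)" by auto
  show "j : ?B Un MS x v"
  proof (cases "mv j = v")
   case True
   thus ?thesis using j MS[OF par v] by simp
  next
   case False
   have "mi j < k" using mem j by simp
   thus ?thesis using j False by (auto simp: s split: if_splits)
  qed
 qed
 from card_mono[OF _ this] have "card ?A <= card (?B Un MS x v)" by simp
 also have "... <= card ?B + card (MS x v)" by (rule card_Un_le)
 finally show ?thesis by (simp add: lam_def)
qed

section \<open>The three rounds of a split\<close>

lemma hw_SplitMove:
 assumes par: "params x" and cons: "consistent x" and A: "set (alst x (bs+10) 0) = A" "A \<subseteq> {..<n}"
  and c': "areg x 13 = c'" "!!v. v : A ==> comp x v ~= c'"
  and Q: "!!T y. params y ==> consistent y ==> comp y = (%v. if v : A then c' else comp x v) ==>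
   (!!r. r ~: {9, 12, 14, 15, 16, 22} ==> areg y r = areg x r) ==>
   (!!a. a ~= bs+7 ==> aarr y a = aarr x a) ==>
   (!!f. f ~: {bs+2, bs+4, bs+5} ==> alst y f = alst x f) ==>
   T + 200 * lam y <= 200 * lam x + 10 + (SUM v:A. 900 * wt x v) ==> Q T y"
 shows "hw N (For (bs+10) 0 (Const 0) 22 12 (Move bs)) Q x"
proof -
 define J where "J = (%D T y. params y & consistent y & comp y = (%v. if v : D then c' else comp x v) &
   (ALL r. r ~: {9, 12, 14, 15, 16, 22} --> areg y r = areg x r) &
   (ALL a. a ~= bs+7 --> aarr y a = aarr x a) &
   (ALL f. f ~: {bs+2, bs+4, bs+5} --> alst y f = alst x f) &
   T + 200 * lam y <= 200 * lam x + (SUM v:D. 900 * wt x v))"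
 have cs: "consistent (setr y r a) = consistent y" "lam (setr y r a) = lam y" for y r a
  by (simp_all add: consistent_def lam_def)
 show ?thesis
 proof (rule hw_For[where J = J and ro = 0 and xi = x])
  show "J {} 0 x" using par cons by (simp add: J_def)
  show "aev y (Const 0) = 0 & areg y 0 = N (bs+10)" if "J D T y" for D T y
   using that by (simp add: J_def params_def)
  show "J D T (setr y 22 a)" if "J D T y" for D T y a
   using that by (simp add: J_def cs)
  show "Q (T + 4 + cost (Const 0)) y" if "J (set (alst x (bs+10) 0)) T y" for T y
   using that A by (intro Q) (auto simp: J_def)
 next
  fix D v T y a
  assume D: "D \<subseteq> set (alst x (bs+10) 0)" and v: "v : set (alst x (bs+10) 0)" "v ~: D" and J: "J D T y"
  note JD = J[unfolded J_def]
  let ?y = "setr (setr y 22 a) 12 v"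
  have vA: "v : A" "v < n" using v A by auto
  have cv: "comp y v = comp x v" using JD v(2) by simp
  have sm: "(SUM v:insert v D. 900 * wt x v) = (SUM v:D. 900 * wt x v) + 900 * wt x v"
   using v(2) finite_subset[OF D] by simp
  have MSy: "MS y v = MS x v" using JD by simp
  show "hw N (Move bs) (%t x'. J (insert v D) (T + 12 + cost (Const 0) + t) x' & areg x' 22 = a &
    (alst x' (bs+10) 0 = alst y (bs+10) 0 \<or> alst x' (bs+10) 0 = sdel v (alst y (bs+10) 0))) ?y"
  proof (rule hw_Move[where v = v and c' = c'], goal_cases)
   case (6 U z)
   note s = moved_simps[OF 6(1)]
   have pz: "params z"
    using params_moved[OF 6(1)] JD by simp
   have cz: "consistent z"
    using consistent_moved[OF _ 6(1)] JD vA cv c'(2)[OF vA(1)] by (simp add: cs)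
   have lz: "lam z <= lam y + card (MS x v)"
    using lam_moved[OF 6(1) vA(2)] JD MSy by (simp add: cs)
   \<comment> \<open>600 units per membership pay for the move and 200 for the growth of
     \<open>lam\<close>; the rest of the 900 covers the loop overhead.\<close>
   have "T + 13 + U + 200 * lam z <= T + 13 + 600 * (1 + card (MS x v)) + 200 * lam y + 200 * card (MS x v)"
    using lz 6(2) MSy by simp
   also have "... <= 200 * lam x + (SUM v:D. 900 * wt x v) + 900 * wt x v"
    using JD by (simp add: wt_def)
   finally have "T + 13 + U + 200 * lam z <= 200 * lam x + (SUM v:insert v D. 900 * wt x v)" using sm by simp
   moreover have "comp z = (%u. if u : insert v D then c' else comp x u)"
    using s(2) JD by auto
   ultimately show ?case using JD s pz cz unfolding J_def by simp
  qed (use JD vA c' cv in simp_all)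
 qed (use A in auto)
qed

lemma params_reg0: "params x ==> areg x 0 = n"
 by (simp add: params_def)

lemma hw_SplitCut:
 assumes par: "params x" and A: "set (alst x (bs+10) 0) = A" "A \<subseteq> {..<n}"
  and sym: "!!u w. w : Out x u \<longleftrightarrow> u : In x w"
  and Q: "!!T y. deleted {(u, w). w : Out x u & (u : A \<or> w : A) & comp x u ~= comp x w} x y ==>
   params y ==> T <= 10 + (SUM v:A. 700 * wt x v) ==> Q T y"
 shows "hw N (For (bs+10) 0 (Const 0) 22 12 (Cut bs)) Q x"
proof -
 define R where "R = (%D. {(u, w). w : Out x u & (u : D \<or> w : D) & comp x u ~= comp x w})"
 define J where "J = (%D T y. deleted (R D) x y & T <= (SUM v:D. 700 * wt x v))"
 show ?thesis
 proof (rule hw_For[where J = J and ro = 0 and xi = x])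
  have "R {} = {}" by (simp add: R_def)
  thus "J {} 0 x" using deleted_refl by (simp add: J_def)
  show "aev y (Const 0) = 0 & areg y 0 = N (bs+10)" if "J D T y" for D T y
   using params_deleted[OF _ par] that params_reg0 by (auto simp: J_def)
  show "J D T (setr y 22 a)" if "J D T y" for D T y a
   using that by (simp add: J_def)
  show "Q (T + 4 + cost (Const 0)) y" if "J (set (alst x (bs+10) 0)) T y" for T y
   using that A params_deleted[OF _ par] by (intro Q) (auto simp: J_def R_def)
 next
  fix D v T y a
  assume D: "D \<subseteq> set (alst x (bs+10) 0)" and v: "v : set (alst x (bs+10) 0)" "v ~: D" and J: "J D T y"
  have del: "deleted (R D) x y" and T: "T <= (SUM v:D. 700 * wt x v)" using J by (auto simp: J_def)
  let ?y = "setr (setr y 22 a) 12 v"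
  have vA: "v : A" "v < n" using v A by auto
  note O = deletedD(2)[OF del] and I = deletedD(3)[OF del]
  have cy: "comp y = comp x" using deletedD2(1)[OF del] by simp
  have sm: "(SUM v:insert v D. 700 * wt x v) = (SUM v:D. 700 * wt x v) + 700 * wt x v"
   using v(2) finite_subset[OF D] by simp
  show "hw N (Cut bs) (%t x'. J (insert v D) (T + 12 + cost (Const 0) + t) x' & areg x' 22 = a &
    (alst x' (bs+10) 0 = alst y (bs+10) 0 \<or> alst x' (bs+10) 0 = sdel v (alst y (bs+10) 0))) ?y"
  proof (rule hw_Cut[where v = v], goal_cases)
   case (4 u w)
   show ?case using sym[of w u] by (simp add: O I)
  next
   case (5 V z)
   have d: "deleted {(u, w). w : Out y u & (u = v \<or> w = v) & comp x u ~= comp x w} y z"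
    using 5(1) cy by simp
   have "R D Un {(u, w). w : Out y u & (u = v \<or> w = v) & comp x u ~= comp x w} = R (insert v D)"
    unfolding O by (auto simp: R_def)
   with deleted_trans[OF del d] have dz: "deleted (R (insert v D)) x z" by simp
   have "card (Out y v) <= card (Out x v)" "card (In y v) <= card (In x v)"
    unfolding O I by (auto intro!: card_mono)
   hence "V <= 600 * wt x v" using 5(4) by (simp add: wt_def)
   hence "T + 13 + V <= (SUM v:insert v D. 700 * wt x v)" using T sm by (simp add: wt_def)
   moreover have "alst z (bs+10) = alst y (bs+10)" using deletedD2(3)[OF d, of "bs+10"] by simp
   ultimately show ?case using dz 5 by (simp add: J_def)
  qed (use params_deleted[OF del par] vA in simp_all)
 qed (use A in auto)
qed

text \<open>The checks change no \<open>U\<close> row, so the conclusions for different vertices,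
  all stated for the \<open>U\<close> rows of \<open>x\<close>, can be accumulated.\<close>

definition checked_all :: "nat set => nat => nat => astate => astate => bool" where
 "checked_all D c c' x y \<longleftrightarrow> frame {9, 12, 19, 20, 21, 22} {bs+5, bs+6} x y &
   (ALL r. LS y r \<subseteq> LS x r) & Dm x \<subseteq> Dm y &
   (ALL u. u : Dm y --> u : Dm x \<or> dead x u = 0 & (EX i<k. u : LS x (c * k + i) & US x (c * k + i) = {} \<or>
     u : D & u : L i & US x (c' * k + i) = {})) &
   (ALL r u. u : LS x r --> u : LS y r \<or> u : Dm y \<or> dead x u ~= 0) &
   (ALL v i. v : D --> i < k --> v : U i --> US x (c * k + i) = {} --> LS y (c * k + i) = {}) &
   (ALL v i. v : D --> i < k --> v : L i --> US x (c' * k + i) = {} --> v : Dm y \<or> dead x v ~= 0)"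

lemma checked_allD:
 assumes "checked_all D c c' x y"
 shows "LS y r \<subseteq> LS x r" "Dm x \<subseteq> Dm y"
  "u : Dm y ==> u : Dm x \<or> dead x u = 0 & (EX i<k. u : LS x (c * k + i) & US x (c * k + i) = {} \<or>
     u : D & u : L i & US x (c' * k + i) = {})"
  "u : LS x r ==> u : LS y r \<or> u : Dm y \<or> dead x u ~= 0"
  "v : D ==> i < k ==> v : U i ==> US x (c * k + i) = {} ==> LS y (c * k + i) = {}"
  "v : D ==> i < k ==> v : L i ==> US x (c' * k + i) = {} ==> v : Dm y \<or> dead x v ~= 0"
  "frame {9, 12, 19, 20, 21, 22} {bs+5, bs+6} x y"
proof -
 note a = assms[unfolded checked_all_def]
 show "LS y r \<subseteq> LS x r" "Dm x \<subseteq> Dm y" "frame {9, 12, 19, 20, 21, 22} {bs+5, bs+6} x y" using a by simp_all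
 note a = a[THEN conjunct2, THEN conjunct2, THEN conjunct2]
 show "u : Dm y ==> u : Dm x \<or> dead x u = 0 & (EX i<k. u : LS x (c * k + i) & US x (c * k + i) = {} \<or>
     u : D & u : L i & US x (c' * k + i) = {})"
  using a[THEN conjunct1, THEN spec, THEN mp] .
 note a = a[THEN conjunct2]
 show "u : LS x r ==> u : LS y r \<or> u : Dm y \<or> dead x u ~= 0"
  using a[THEN conjunct1, THEN spec, THEN spec, THEN mp] .
 note a = a[THEN conjunct2]
 show "v : D ==> i < k ==> v : U i ==> US x (c * k + i) = {} ==> LS y (c * k + i) = {}"
  using a[THEN conjunct1] by simp
 show "v : D ==> i < k ==> v : L i ==> US x (c' * k + i) = {} ==> v : Dm y \<or> dead x v ~= 0"
  using a[THEN conjunct2] by simp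
qed

lemma hw_SplitCheck:
 assumes par: "params x" and A: "set (alst x (bs+10) 0) = A" "A \<subseteq> {..<n}"
  and c: "areg x 13 = c'" "areg x 18 = c"
  and LS: "!!i. i < k ==> LS x (c * k + i) \<subseteq> {u : L i. comp x u = c}"
  and Q: "!!T y. checked_all A c c' x y ==> params y ==>
   T + 200 * lam y <= 200 * lam x + 10 + (SUM v:A. 700 * wt x v) ==> Q T y"
 shows "hw N (For (bs+10) 0 (Const 0) 22 12 (Check bs)) Q x"
proof -
 define J where "J = (%D T y. checked_all D c c' x y & T + 200 * lam y <= 200 * lam x + (SUM v:D. 700 * wt x v))"
 have par_y: "params y" if "checked_all D c c' x y" for D y
  using checked_allD(7)[OF that] par by (simp add: frame_def params_def)
 have setr22: "checked_all D c c' x (setr y 22 a) = checked_all D c c' x y" for D y a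
 proof -
  have "frame {9, 12, 19, 20, 21, 22} F x (setr y 22 a) = frame {9, 12, 19, 20, 21, 22} F x y" for F
   unfolding frame_def by auto
  thus ?thesis by (simp only: checked_all_def set_simps)
 qed
 show ?thesis
 proof (rule hw_For[where J = J and ro = 0 and xi = x])
  show "J {} 0 x" by (simp add: J_def checked_all_def frame_def)
  show "aev y (Const 0) = 0 & areg y 0 = N (bs+10)" if "J D T y" for D T y
   using par_y that params_reg0 by (auto simp: J_def)
  show "J D T (setr y 22 a)" if "J D T y" for D T y a
   using that setr22 by (simp add: J_def lam_def)
  show "Q (T + 4 + cost (Const 0)) y" if "J (set (alst x (bs+10) 0)) T y" for T y
   using that A par_y by (intro Q) (auto simp: J_def)
 next
  fix D v T y a
  assume D: "D \<subseteq> set (alst x (bs+10) 0)" and v: "v : set (alst x (bs+10) 0)" "v ~: D" and J: "J D T y"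
  have chk: "checked_all D c c' x y" and T: "T + 200 * lam y <= 200 * lam x + (SUM v:D. 700 * wt x v)"
   using J by (auto simp: J_def)
  let ?y = "setr (setr y 22 a) 12 v"
  have vA: "v : A" "v < n" using v A by auto
  have fr: "areg y 13 = c'" "areg y 18 = c" "aarr y = aarr x" "alst y (bs+4) = alst x (bs+4)"
    "alst y (bs+3) = alst x (bs+3)"
   using checked_allD(7)[OF chk] c by (auto simp: frame_def)
  have sm: "(SUM v:insert v D. 700 * wt x v) = (SUM v:D. 700 * wt x v) + 700 * wt x v"
   using v(2) finite_subset[OF D] by simp
  have LSy: "LS y r \<subseteq> LS x r" for r using checked_allD(1)[OF chk] .
  show "hw N (Check bs) (%t x'. J (insert v D) (T + 12 + cost (Const 0) + t) x' & areg x' 22 = a &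
    (alst x' (bs+10) 0 = alst y (bs+10) 0 \<or> alst x' (bs+10) 0 = sdel v (alst y (bs+10) 0))) ?y"
  proof (rule hw_Check[where v = v and c = c and c' = c'], goal_cases)
   case (6 i)
   show ?case using LS[OF 6] LSy[of "c * k + i"] fr by auto
  next
   case (7 V z)
   note ch = checkedD[OF 7(1), simplified, unfolded fr]
   have frz: "frame {9, 12, 19, 20, 21, 22} {bs+5, bs+6} x z"
    using checked_allD(7)[OF chk] checkedD(7)[OF 7(1)] by (auto simp: frame_def)
   have "checked_all (insert v D) c c' x z"
    unfolding checked_all_def
   proof (intro conjI allI impI)
    show "LS z r \<subseteq> LS x r" for r using ch(1) LSy by (rule subset_trans)
    show "Dm x \<subseteq> Dm z" using checked_allD(2)[OF chk] ch(2) by (rule subset_trans)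
    show "u : Dm x \<or> dead x u = 0 & (EX i<k. u : LS x (c * k + i) & US x (c * k + i) = {} \<or>
      u : insert v D & u : L i & US x (c' * k + i) = {})" if uz: "u : Dm z" for u
    proof (cases "u : Dm y")
     case True
     show ?thesis using checked_allD(3)[OF chk True] by auto
    next
     case False
     then obtain i where "dead x u = 0" "i < k" and i: "u : LS y (c * k + i) & alst x (bs+4) (c * k + i) = [] \<or>
      u = v & v : L i & alst x (bs+4) (c' * k + i) = []" using ch(3)[OF uz] by auto
     thus ?thesis using LSy by auto
    qed
    show "u : LS z r \<or> u : Dm z \<or> dead x u ~= 0" if "u : LS x r" for u r
     using checked_allD(4)[OF chk that] ch(4)[of u r] ch(2) by auto
    show "LS z (c * k + i) = {}" if h: "v' : insert v D" "i < k" "v' : U i" "US x (c * k + i) = {}" for v' i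
    proof (cases "v' = v")
     case True
     then obtain j where "j < b" "mv j = v" "mi j = i" "mu j ~= 0" using h(3) by (auto simp: in_U)
     thus ?thesis using ch(5)[of j] h(4) MS[OF par vA(2)] by simp
    next
     case False
     hence "LS y (c * k + i) = {}" using checked_allD(5)[OF chk _ h(2-4)] h(1) by simp
     thus ?thesis using ch(1)[of "c * k + i"] by simp
    qed
    show "v' : Dm z \<or> dead x v' ~= 0" if h: "v' : insert v D" "i < k" "v' : L i" "US x (c' * k + i) = {}" for v' i
    proof (cases "v' = v")
     case True
     then obtain j where "j < b" "mv j = v" "mi j = i" "mu j = 0" using h(3) by (auto simp: in_L)
     thus ?thesis using ch(6)[of j] h(4) MS[OF par vA(2)] True by simp
    next
     case False
     hence "v' : Dm y \<or> dead x v' ~= 0" using checked_allD(6)[OF chk _ h(2-4)] h(1) by simp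
     thus ?thesis using ch(2) by auto
    qed
   qed (rule frz)
   moreover have "T + 13 + V + 200 * lam z <= 200 * lam x + (SUM v:insert v D. 700 * wt x v)"
    using 7(2) T sm fr by (simp add: lam_def wt_def)
   moreover have "areg z 22 = a" "alst z (bs+10) = alst y (bs+10)"
    using checkedD(7)[OF 7(1)] by (auto simp: frame_def)
   ultimately show ?case by (simp add: J_def)
  qed (use par_y[OF chk] vA fr in simp_all)
 qed (use A in auto)
qed

text \<open>The doomed vertices added by a split violate a condition and belong to the component
  that was split. The latter keeps finished components free of doomed vertices.\<close>

definition split_post :: "nat set => nat => astate => astate => bool" where
 "split_post A c' x y \<longleftrightarrow> params y & consistent y & live y &
   (ALL v. v < n --> dead x v = 0 --> viol (comp y) v --> v : Dm y) &
   areg y 5 = Suc (areg x 5) & (ALL r. r ~: {5, 9, 10, 11, 12, 13, 14, 15, 16, 17, 19, 20, 21, 22} --> areg y r = areg x r) &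
   comp y = (%v. if v : A then c' else comp x v) & (ALL a. a ~= bs+7 --> aarr y a = aarr x a) &
   (ALL f. f ~: {bs, Suc bs, bs+2, bs+4, bs+5, bs+6, bs+7, bs+8} --> alst y f = alst x f) &
   Dm x \<subseteq> Dm y & (ALL u. u : Dm y --> u : Dm x \<or> u < n & dead x u = 0 & viol (comp y) u & (EX v:A. comp x u = comp x v)) &
   QO y = QO x Un {u. EX w. (u, w) : E & comp x u = comp x w & comp y u ~= comp y w} &
   QI y = QI x Un {w. EX u. (u, w) : E & comp x u = comp x w & comp y u ~= comp y w}"

text \<open>A new violation is caused by a cut edge or by the absence of members of some
  \<open>U i\<close> in one of the two parts. The rounds inspect precisely these places, so every
  violation is recorded.\<close>

lemma hw_Split:
 assumes par: "params x" and cons: "consistent x" and live: "live x"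
  and viol: "!!v. v < n ==> dead x v = 0 ==> viol (comp x) v ==> v : Dm x"
  and A: "set (alst x (bs+10) 0) = A" "A \<subseteq> {..<n}" "A ~= {}" "!!v. v : A ==> comp x v = c"
  and c': "areg x 5 = c'" "!!v. v < n ==> comp x v < c'" and c: "areg x 18 = c"
  and Q: "!!T y. split_post A c' x y ==>
   T + 200 * lam y <= 200 * lam x + 50 + (SUM v:A. 2500 * wt x v) ==> Q T y"
 shows "hw N (Split bs) Q x"
 unfolding Split_def
proof (rule hw_Seq, rule hw_Assign, simp, rule hw_Seq, rule hw_Assign, simp, rule hw_Seq,
  rule hw_SplitMove[where A = A and c' = c'], goal_cases)
 case (7 T1 x1)
 let ?x = "setr (setr x 13 (aev x (Reg 5))) 5 (aev (setr x 13 (aev x (Reg 5))) (Op Add (Reg 5) (Const 1)))"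
 have cx: "c < c'" using A c'(2) by (metis all_not_in_conv lessThan_iff subsetD)
 define cf where "cf = (%v. if v : A then c' else comp x v)"
 have par1: "params x1" and cons1: "consistent x1" and cf1: "comp x1 = cf"
  using 7(1-3) by (auto simp: cf_def)
 have reg1: "areg x1 r = areg ?x r" if "r ~: {9, 12, 14, 15, 16, 22}" for r using 7(4) that by simp
 have arr1: "aarr x1 a = aarr x a" if "a ~= bs+7" for a using 7(5) that by simp
 have lst1: "alst x1 f = alst x f" if "f ~: {bs+2, bs+4, bs+5}" for f using 7(6) that by simp
 have wt1: "wt x1 v = wt x v" for v using lst1[of bs] lst1[of "Suc bs"] lst1[of "bs+3"] by (simp add: wt_def)
 have T1: "T1 + 200 * lam x1 <= 200 * lam x + 10 + (SUM v:A. 900 * wt x v)"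
  using 7(7) by (simp add: lam_def wt_def)
 have O1: "Out x1 v = {w. (v, w) : E & comp x v = comp x w}" "In x1 v = {u. (u, v) : E & comp x u = comp x v}" for v
  using liveD[OF live, of v] lst1[of bs] lst1[of "Suc bs"] by simp_all
 show ?case
 proof (rule hw_Seq, rule hw_SplitCut[where A = A], goal_cases)
  case (5 T2 x2)
  define R where "R = {(u, w). (u, w) : E & comp x u = comp x w & cf u ~= cf w}"
  have "{(u, w). w : Out x1 u & (u : A \<or> w : A) & comp x1 u ~= comp x1 w} = R"
   unfolding O1 cf1 R_def by (auto simp: cf_def split: if_splits)
  hence del: "deleted R x1 x2" using 5(1) by simp
  have arr2: "aarr x2 = aarr x1" using deletedD2(1)[OF del] .
  have cf2: "comp x2 = cf" using arr2 cf1 by simp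
  have lst2: "alst x2 f = alst x1 f" if "f ~: {bs, Suc bs, bs+6, bs+7, bs+8}" for f
   using deletedD2(3)[OF del that] .
  have O2: "Out x2 v = {w. (v, w) : E & cf v = cf w}" "In x2 v = {u. (u, v) : E & cf u = cf v}" for v
  proof -
   have *: "comp x u = comp x w" if "u < n" "w < n" "cf u = cf w" for u w
    using that A(4) c'(2)[of u] c'(2)[of w] by (auto simp: cf_def split: if_splits)
   have "u < n & w < n" if "(u, w) : E" for u w using that E by auto
   thus "Out x2 v = {w. (v, w) : E & cf v = cf w}" "In x2 v = {u. (u, v) : E & cf u = cf v}"
    unfolding deletedD(2,3)[OF del] O1 R_def using * by auto
  qed
  have D2: "Dm x2 = Dm x Un {u : fst ` R. dead x u = 0 & (u : Rand \<or> Out x2 u = {})}"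
   using deletedD(6)[OF del] lst1[of "bs+6"] arr1[of "bs+8"] by simp
  have reg2: "areg x2 13 = c'" "areg x2 18 = c" "areg x2 5 = Suc c'"
   using deletedD2(2)[OF del, of 13] deletedD2(2)[OF del, of 18] deletedD2(2)[OF del, of 5]
    reg1[of 13] reg1[of 18] reg1[of 5] c' c by simp_all
  have US2: "US x2 (d * k + i) = {v : U i. cf v = d}" if "i < k" for d i
   using consistentD(2)[OF cons1 that, of d] lst2[of "bs+4"] cf1 by simp
  have LS2: "LS x2 (d * k + i) \<subseteq> {v : L i. cf v = d}" if "i < k" for d i
   using consistentD(3)[OF cons1 that, of d] lst2[of "bs+5"] cf1 by simp
  have lam2: "lam x2 = lam x1" using lst2[of "bs+5"] arr2 by (simp add: lam_def)
  have wt2: "wt x2 v <= wt x v" for v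
  proof -
   have "card (Out x2 v) <= card (Out x1 v)" "card (In x2 v) <= card (In x1 v)"
    unfolding deletedD(2,3)[OF del] by (auto intro!: card_mono)
   thus ?thesis using wt1[of v] lst2[of "bs+3"] by (simp add: wt_def)
  qed
  show ?case
  proof (rule hw_SplitCheck[where A = A and c = c and c' = c'], goal_cases)
   case (6 i)
   thus ?case using LS2[OF 6, of c] cf2 by simp
  next
   case (7 T3 y)
   note ch = checked_allD[OF 7(1)]
   have arr3: "aarr y = aarr x2" using ch(7) by (simp add: frame_def)
   have cf3: "comp y = cf" using arr3 cf2 by simp
   have lst3: "alst y f = alst x2 f" if "f ~: {bs+5, bs+6}" for f using ch(7) that by (simp add: frame_def)
   have dd: "dead x2 = dead x" "dead y = dead x" using arr1[of "bs+8"] arr2 arr3 by simp_all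
   have US3: "US y r = US x2 r" for r using lst3[of "bs+4"] by simp
   have inR: "u < n & viol cf u & (EX v:A. comp x u = comp x v)" if uR: "u : fst ` R" and uo: "u : Rand \<or> Out x2 u = {}" for u
   proof -
    obtain w where w: "(u, w) : E" "comp x u = comp x w" "cf u ~= cf w" using uR by (auto simp: R_def)
    hence "u : A \<or> w : A" by (auto simp: cf_def split: if_splits)
    hence "EX v:A. comp x u = comp x v" using w(2) by metis
    moreover have "u < n" using w(1) E by auto
    moreover have "viol cf u" using uo w unfolding viol_def O2 by auto
    ultimately show ?thesis by simp
   qed
   have "split_post A c' x y"
    unfolding split_post_def cf3
   proof (intro conjI allI impI)
    show "params y" by (rule 7(2))
    show "live y" unfolding live_def cf3 using O2 lst3[of bs] lst3[of "Suc bs"] by simp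
    show "consistent y"
     unfolding consistent_def cf3 dd
    proof (intro conjI allI impI)
     show "CS y d = {v. v < n & cf v = d}" for d
      using consistentD(1)[OF cons1, of d] lst2[of "bs+2"] lst3[of "bs+2"] cf1 by simp
     show "US y (d * k + i) = {v : U i. cf v = d}" if "i < k" for d i
      using US2[OF that] US3 by simp
     show "LS y (d * k + i) \<subseteq> {v : L i. cf v = d}" if "i < k" for d i
      using LS2[OF that, of d] ch(1) by (rule order_trans[rotated])
     show "v : LS y (cf v * k + i) \<or> v : Dm y \<or> dead x v ~= 0" if "i < k" "v : L i" for i v
     proof -
      have "v : LS x1 (cf v * k + i) \<or> v : Dm x1 \<or> dead x1 v ~= 0"
       using consistentD(4)[OF cons1 that] cf1 by simp
      hence "v : LS x2 (cf v * k + i) \<or> v : Dm x2 \<or> dead x v ~= 0"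
       using lst2[of "bs+5"] D2 lst1[of "bs+6"] arr1[of "bs+8"] by auto
      thus ?thesis using ch(4)[of v "cf v * k + i"] ch(2) dd by auto
     qed
    qed
    show "areg y 5 = Suc (areg x 5)" using ch(7) reg2(3) c' by (simp add: frame_def)
    show "areg y r = areg x r" if "r ~: {5, 9, 10, 11, 12, 13, 14, 15, 16, 17, 19, 20, 21, 22}" for r
     using that ch(7) deletedD2(2)[OF del, of r] reg1[of r] by (simp add: frame_def)
    show "cf = (%v. if v : A then c' else comp x v)" by (simp add: cf_def)
    show "aarr y a = aarr x a" if "a ~= bs+7" for a using that arr1 arr2 arr3 by simp
    show "alst y f = alst x f" if "f ~: {bs, Suc bs, bs+2, bs+4, bs+5, bs+6, bs+7, bs+8}" for f
     using that lst1[of f] lst2[of f] lst3[of f] by simp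
    show "Dm x \<subseteq> Dm y" using D2 ch(2) by auto
    have img: "fst ` R = {u. EX w. (u, w) : E & comp x u = comp x w & cf u ~= cf w}"
     "snd ` R = {w. EX u. (u, w) : E & comp x u = comp x w & cf u ~= cf w}"
     by (force simp: R_def)+
    show "QO y = QO x Un {u. EX w. (u, w) : E & comp x u = comp x w & cf u ~= cf w}"
     using deletedD(4)[OF del] lst1[of "bs+7"] lst3[of "bs+7"] img by simp
    show "QI y = QI x Un {w. EX u. (u, w) : E & comp x u = comp x w & cf u ~= cf w}"
     using deletedD(5)[OF del] lst1[of "bs+8"] lst3[of "bs+8"] img by simp
    show "v : Dm y" if v: "v < n" "dead x v = 0" "viol cf v" for v
    proof (cases "viol (comp x) v")
     case True
     thus ?thesis using viol v D2 ch(2) by auto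
    next
     case False
     \<comment> \<open>The vertex had no violation before the split. In the first two cases it has
       lost an edge of \<open>R\<close>. In the third either it moved and its new component has no
       member of \<open>U i\<close>, or it stayed and the last member moved away.\<close>
     consider (r) w where "v : Rand" "(v, w) : E" "cf w ~= cf v" | (o) "!!w. (v, w) : E ==> cf w ~= cf v"
      | (l) i where "i < k" "v : L i" "!!u. u : U i ==> cf u ~= cf v"
      using v(3) unfolding viol_def by blast
     thus ?thesis
     proof cases
      case r
      hence "comp x w = comp x v" using False unfolding viol_def by auto
      hence "v : fst ` R" using r img by auto
      thus ?thesis using r v D2 ch(2) by auto
     next
      case o
      have o': "cf v ~= cf w" if "(v, w) : E" for w using o[OF that] by simp
      hence "Out x2 v = {}" unfolding O2 by auto
      moreover obtain w where "(v, w) : E" "comp x w = comp x v" using False unfolding viol_def by auto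
      hence "v : fst ` R" using o' unfolding img by fastforce
      ultimately show ?thesis using v D2 ch(2) by auto
     next
      case l
      obtain u where u: "u : U i" "comp x u = comp x v" using False l unfolding viol_def by auto
      show ?thesis
      proof (cases "v : A")
       case True
       hence "US x2 (c' * k + i) = {}" unfolding US2[OF l(1)] using l(3) by (auto simp: cf_def)
       thus ?thesis using ch(6)[OF True l(1,2)] v(2) dd by auto
      next
       case vA: False
       have "cf u ~= cf v" using l(3) u by simp
       hence uA: "u : A" using vA u by (auto simp: cf_def split: if_splits)
       hence cv: "cf v = c" using u A(4) vA by (simp add: cf_def)
       have "US x2 (c * k + i) = {}" unfolding US2[OF l(1)] using l(3) cv by auto
       hence "LS y (c * k + i) = {}" using ch(5)[OF uA l(1) u(1)] by simp
       moreover have "v : LS x2 (c * k + i) \<or> v : Dm x2"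
        using consistentD(4)[OF cons1 l(1,2)] cf1 cv lst2[of "bs+5"] D2 lst1[of "bs+6"] arr1[of "bs+8"] v(2) by auto
       ultimately show ?thesis using ch(4)[of v "c * k + i"] ch(2) dd v(2) by auto
      qed
     qed
    qed
    show "u : Dm x \<or> u < n & dead x u = 0 & viol cf u & (EX v:A. comp x u = comp x v)" if uy: "u : Dm y" for u
    proof (cases "u : Dm x2")
     case True
     thus ?thesis using D2 inR[of u] by auto
    next
     case False
     then obtain i where i: "dead x u = 0" "i < k" "u : LS x2 (c * k + i) & US x2 (c * k + i) = {} \<or>
      u : A & u : L i & US x2 (c' * k + i) = {}" using ch(3)[OF uy] dd by auto
     have uL: "u : L i" and ex: "EX v:A. comp x u = comp x v"
      and d: "EX d. cf u = d & US x2 (d * k + i) = {}"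
     proof -
      show "u : L i" using i(3) LS2[OF i(2), of c] by auto
      have "u : A \<or> u : L i & cf u = c" using i(3) LS2[OF i(2), of c] by auto
      moreover have "comp x u = c" if "cf u = c" using that cx A(4) by (auto simp: cf_def split: if_splits)
      ultimately show "EX v:A. comp x u = comp x v" using A(3,4) by auto
      show "EX d. cf u = d & US x2 (d * k + i) = {}" using i(3) LS2[OF i(2), of c] by (auto simp: cf_def)
     qed
     have "ALL w:U i. cf w ~= cf u" using d unfolding US2[OF i(2)] by auto
     hence "viol cf u" using uL i(2) unfolding viol_def by blast
     thus ?thesis using i(1) ex L_less[OF uL] by simp
    qed
   qed
   \<comment> \<open>The rounds cost 900, 700 and 700 per unit of weight; 2500 bounds the
     sum.\<close>
   moreover have "T1 + T2 + T3 + 200 * lam y <= 200 * lam x + 30 + (SUM v:A. 2500 * wt x v)"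
   proof -
    have "(SUM v:A. 700 * wt x2 v) <= (SUM v:A. 700 * wt x v)"
     using wt2 by (intro sum_mono mult_left_mono) auto
    hence "T1 + T2 + T3 + 200 * lam y <=
      200 * lam x + 30 + (SUM v:A. 900 * wt x v) + (SUM v:A. 700 * wt x v) + (SUM v:A. 700 * wt x v)"
     using T1 5(3) 7(3) lam2 wt1 by simp
    also have "... <= 200 * lam x + 30 + (SUM v:A. 2500 * wt x v)" by (simp flip: sum_distrib_left)
    finally show ?thesis .
   qed
   ultimately show ?case by (intro Q) auto
  qed (use 5 reg2 A lst1[of "bs+10"] lst2[of "bs+10"] in auto)
 qed (use par1 A lst1[of "bs+10"] O1 in auto)
next
 case (6 v)
 thus ?case using A(2) c'(2) by fastforce
qed (use par cons A c' in \<open>auto simp: consistent_def\<close>)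

end

section \<open>Searching for closed sets\<close>

text \<open>The list of visited vertices serves as its own queue, register 30 being the index of the
  next vertex to scan. Register 33 is the remaining budget of arcs, and register 31 becomes 0 when
  it does not suffice.\<close>

definition BFS :: "nat => nat => com" where
 "BFS bs af = Assign 30 (Const 0) ;; Assign 31 (Const 1) ;;
   While (Op Mul (Reg 31) (Op Less (Reg 30) (Cnt (bs+9) (Const 0))))
    (Assign 32 (Elt (bs+9) 0 (Const 0) (Reg 30)) ;;
    Cond (Op Less (Reg 33) (Cnt af (Reg 32))) (Assign 31 (Const 0))
     (Assign 33 (Op Sub (Reg 33) (Cnt af (Reg 32))) ;;
      For af 0 (Reg 32) 35 36 (Insert (bs+9) 0 (Const 0) (Reg 36)) ;;
      Assign 30 (Op Add (Reg 30) (Const 1))))"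

definition BFS_from :: "nat => nat => nat => com" where
 "BFS_from bs af r = Clear (bs+9) (Const 0) ;; Insert (bs+9) 0 (Const 0) (Reg r) ;; BFS bs af"

text \<open>The budget \<open>m\<close> always suffices. If both searches from one vertex visit the
  whole component, it is strongly connected; otherwise the visited set is closed in one direction.
  Register 38 becomes 1 if a closed set was found and 0 if the component is strongly
  connected.\<close>

definition Decide :: "nat => com" where
 "Decide bs = Assign 37 (Elt (bs+2) 0 (Reg 18) (Const 0)) ;;
   Assign 33 (Reg 1) ;; BFS_from bs bs 37 ;;
   Cond (Op Less (Cnt (bs+9) (Const 0)) (Cnt (bs+2) (Reg 18))) (Assign 38 (Const 1))
   (Assign 33 (Reg 1) ;; BFS_from bs (Suc bs) 37 ;;
    Cond (Op Less (Cnt (bs+9) (Const 0)) (Cnt (bs+2) (Reg 18))) (Assign 38 (Const 1))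
     (Assign 38 (Const 0)))"

text \<open>The smaller of the visited set and its complement is collected. If it is the complement,
  the whole component is scanned, but then it has less than twice as many vertices as the visited
  set.\<close>

definition MakePart :: "nat => com" where
 "MakePart bs = Clear (bs+10) (Const 0) ;;
   Cond (Op Less (Cnt (bs+2) (Reg 18)) (Op Add (Cnt (bs+9) (Const 0)) (Cnt (bs+9) (Const 0))))
    (For (bs+2) 0 (Reg 18) 45 46 (Cond (Member (bs+9) 0 (Const 0) (Reg 46)) Skip
     (Insert (bs+10) 0 (Const 0) (Reg 46))))
    (For (bs+9) 0 (Const 0) 45 46 (Insert (bs+10) 0 (Const 0) (Reg 46)))"

context engine
begin

section \<open>Search with a budget\<close>

abbreviation VS :: "astate => nat set" where "VS x \<equiv> set (alst x (bs+9) 0)"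
abbreviation PS :: "astate => nat set" where "PS x \<equiv> set (alst x (bs+10) 0)"

definition adj :: "nat => astate => nat => nat set" where "adj f x v = set (alst x f v)"

definition arcs :: "nat => astate => (nat \<times> nat) set" where "arcs f x = {(u, v). v : adj f x u}"

text \<open>\<open>Sc\<close> is the set of scanned vertices. After a failure the last clause
  provides a visited vertex whose arcs together with the scanned ones exceed the budget.\<close>

definition bfs_post :: "nat => nat => nat set => nat set => astate => astate => bool" where
 "bfs_post af B V0 Sc x y \<longleftrightarrow> frame {30, 31, 32, 33, 35, 36} {bs+9} x y &
   Sc \<subseteq> VS y & VS y = V0 Un \<Union> (adj af x ` Sc) & (ALL v:VS y. EX u:V0. (u, v) : (arcs af x)\<^sup>*) &
   (SUM v:Sc. card (adj af x v)) <= B & (areg y 31 ~= 0 --> Sc = VS y) &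
   (areg y 31 = 0 --> (EX v:VS y - Sc. B < (SUM v:Sc. card (adj af x v)) + card (adj af x v)))"

lemma hw_BFS:
 assumes par: "params x" and af: "af ~= bs+9" "N af = n" and B: "areg x 33 = B"
  and Q: "!!T y Sc. bfs_post af B (VS x) Sc x y ==>
   T <= 100 + (SUM v:Sc. 100 * (1 + card (adj af x v))) ==> Q T y"
 shows "hw N (BFS bs af) Q x"
proof (rule hw_ok)
 assume ok: "lists_ok x"
 let ?G = "adj af x"
 have G: "w < n" if "w : ?G u" for u w using lists_ok_less[OF ok, of w af u] that af by (simp add: adj_def)
 have finG: "finite (?G u)" for u by (simp add: adj_def)
 have cG: "length (alst x af u) = card (?G u)" for u
  using ok by (simp add: adj_def distinct_card)
 define x1 where "x1 = setr (setr x 30 0) 31 1"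
 define I where "I = (%T y. EX i l. alst y (bs+9) 0 = l & areg y 30 = i & i <= length l & distinct l &
   frame {30, 31, 32, 33, 35, 36} {bs+9} x y & set l = VS x Un \<Union> (?G ` set (take i l)) &
   (ALL v:set l. EX u:VS x. (u, v) : (arcs af x)\<^sup>*) &
   (SUM v:set (take i l). card (?G v)) + areg y 33 = B & areg y 31 <= 1 &
   (areg y 31 = 0 --> i < length l & areg y 33 < card (?G (l ! i))) &
   T <= (SUM v:set (take i l). 100 * (1 + card (?G v))) + 50 * (1 - areg y 31))"
 let ?e = "Op Mul (Reg 31) (Op Less (Reg 30) (Cnt (bs+9) (Const 0)))"
 have par_y: "params y" if "frame {30, 31, 32, 33, 35, 36} {bs+9} x y" for y
  using that par by (simp add: frame_def params_def)
 show ?thesis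
  unfolding BFS_def
 proof (rule hw_Seq, rule hw_Assign, simp, rule hw_Seq, rule hw_Assign, simp,
   rule hw_While[where I = I and \<mu> = "%y. areg y 31 * (Suc n - areg y 30)"], goal_cases)
  case 1
  show ?case by simp
 next
  case (2 T y)
  then obtain i l where l: "alst y (bs+9) 0 = l" "areg y 30 = i" "i <= length l" and dl: "distinct l"
   and fr: "frame {30, 31, 32, 33, 35, 36} {bs+9} x y" and sl: "set l = VS x Un \<Union> (?G ` set (take i l))"
   and re: "ALL v:set l. EX u:VS x. (u, v) : (arcs af x)\<^sup>*"
   and Bd: "(SUM v:set (take i l). card (?G v)) + areg y 33 = B" and r31: "areg y 31 <= 1"
   and T: "T <= (SUM v:set (take i l). 100 * (1 + card (?G v))) + 50 * (1 - areg y 31)"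
   by (auto simp: I_def)
  have r1: "areg y 31 = 1" and il: "i < length l" using 2(2) l r31 by (auto split: if_splits)
  let ?v = "l ! i"
  have lst: "alst y f = alst x f" if "f ~= bs+9" for f using fr that by (simp add: frame_def)
  have r0: "areg y 0 = n" using par_y[OF fr] params_reg0 by simp
  have vl: "?v : set l" using il by simp
  show ?case
  proof (rule hw_ok)
   assume oky: "lists_ok y"
   have ln: "length l <= n"
   proof -
    have "set l \<subseteq> {..<n}" using lists_ok_less[OF oky, of _ "bs+9" 0] l by auto
    from card_mono[OF _ this] show ?thesis using distinct_card[OF dl] by simp
   qed
   have ni: "?v ~: set (take i l)"
    using dl il by (metis id_take_nth_drop distinct_append not_distinct_conv_prefix)
   have tk: "set (take (Suc i) l) = insert ?v (set (take i l))" using il by (simp add: take_Suc_conv_app_nth)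
   let ?y = "setr y 32 ?v"
   show ?thesis
   proof (rule hw_Seq, rule hw_Elt, goal_cases)
    case 5
    have eqy: "setr y 32 (alst y (bs+9) (aev y (Const 0)) ! aev y (Reg 30)) = ?y" using l by simp
    show ?case
     unfolding eqy
    proof (rule hw_Cond, simp, goal_cases)
     case 1
     hence lt: "areg y 33 < card (?G ?v)" using lst[OF af(1)] cG by (auto split: if_splits)
     show ?case
     proof (rule hw_Assign, simp, intro conjI, goal_cases)
      case 1
      have "frame {30, 31, 32, 33, 35, 36} {bs+9} x (setr ?y 31 0)" using fr by (auto simp: frame_def)
      thus ?case using l sl re Bd il lt T r1 dl unfolding I_def by simp
     next
      case 2
      show ?case using r1 l il ln by simp
     qed
    next
     case 2
     hence le: "card (?G ?v) <= areg y 33" using lst[OF af(1)] cG by (auto split: if_splits)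
     define y2 where "y2 = setr ?y 33 (areg y 33 - card (?G ?v))"
     have y2: "setr ?y 33 (aev ?y (Op Sub (Reg 33) (Cnt af (Reg 32)))) = y2"
      using lst[OF af(1)] cG by (simp add: y2_def)
     define J where "J = (%D U z. frame {35, 36} {bs+9} y2 z &
       (EX zs. alst z (bs+9) 0 = l @ zs) & distinct (alst z (bs+9) 0) & VS z = set l Un D & U <= 70 * card D)"
     have Gv: "set (alst y2 af ?v) = ?G ?v" using lst[OF af(1)] by (simp add: y2_def adj_def)
     show ?case
     proof (rule hw_Seq, rule hw_Assign, simp, unfold y2, rule hw_Seq,
       rule hw_For[where J = J and ro = ?v and xi = y2], goal_cases)
      case 3
      show ?case using l dl by (simp add: J_def frame_def y2_def)
     next
      case (4 D U z)
      thus ?case using r0 af by (simp add: J_def frame_def y2_def)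
     next
      case (10 D U z a)
      thus ?case by (simp add: J_def frame_def)
     next
      case (11 D w U z a)
      have wn: "w < n" using G Gv 11(2) by auto
      have cd: "card (insert w D) = Suc (card D)" using 11(1,3) finite_subset[OF 11(1)] by simp
      obtain zs where zs: "alst z (bs+9) 0 = l @ zs" using 11(4) by (auto simp: J_def)
      have r0z: "areg z 0 = n" using 11(4) r0 by (simp add: J_def frame_def y2_def)
      have ex: "EX zs'. lins w (l @ zs) = l @ zs'" by (auto simp: lins_def)
      show ?case
       by (rule hw_Insert) (use 11(4) wn cd r0z zs ex af in \<open>auto simp: J_def frame_def\<close>)
     next
      case (12 U z)
      then obtain zs where zs: "alst z (bs+9) 0 = l @ zs" and dz: "distinct (l @ zs)" and frz: "frame {35, 36} {bs+9} y2 z"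
       and Vz: "VS z = set l Un ?G ?v" and U: "U <= 70 * card (?G ?v)" using Gv by (auto simp: J_def)
      let ?z = "setr z 30 (areg z 30 + 1)"
      have rz: "areg z 30 = i" "areg z 33 = areg y 33 - card (?G ?v)" "areg z 31 = 1"
       using frz l r1 by (auto simp: frame_def y2_def)
      have tkz: "set (take (Suc i) (l @ zs)) = insert ?v (set (take i l))" using tk il by simp
      have fz: "frame {30, 31, 32, 33, 35, 36} {bs+9} x ?z" using fr frz by (auto simp: frame_def y2_def)
      have sm: "(SUM v:insert ?v (set (take i l)). h v) = h ?v + (SUM v:set (take i l). h v)" for h :: "nat => nat"
       using ni by simp
      have s1: "set (l @ zs) = VS x Un \<Union> (?G ` insert ?v (set (take i l)))"
      proof -
       have "set (l @ zs) = set l Un ?G ?v" using Vz unfolding zs .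
       also have "... = VS x Un \<Union> (?G ` set (take i l)) Un ?G ?v" using sl by simp
       finally show ?thesis by auto
      qed
      have re': "EX u:VS x. (u, w) : (arcs af x)\<^sup>*" if "w : set (l @ zs)" for w
      proof (cases "w : set l")
       case True
       thus ?thesis using re by simp
      next
       case False
       hence "w : ?G ?v" using that Vz zs by auto
       hence "(?v, w) : arcs af x" by (simp add: arcs_def)
       moreover obtain u where "u : VS x" "(u, ?v) : (arcs af x)\<^sup>*" using re vl by blast
       ultimately show ?thesis by (meson rtrancl.rtrancl_into_rtrancl)
      qed
      have "I (T + 100 * (1 + card (?G ?v))) ?z"
       unfolding I_def
       by (rule exI[of _ "Suc i"], rule exI[of _ "l @ zs"])
        (use zs dz rz fz s1 re' Bd le il T r1 tkz in \<open>simp add: sm\<close>)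
      hence "I (T + cost ?e + 1 + ((5 + cost (Const 0) + cost (Reg 30)) + (cost (Op Less (Reg 33) (Cnt af (Reg 32))) + 1
        + (cost (Op Sub (Reg 33) (Cnt af (Reg 32))) + 1 + (U + 4 + cost (Reg 32) + (cost (Op Add (Reg 30) (Const 1)) + 1)))))) ?z"
       using U unfolding I_def by (elim exE) (intro exI, auto)
      moreover have "areg ?z 31 * (Suc n - areg ?z 30) < areg y 31 * (Suc n - areg y 30)"
       using rz r1 l il ln by simp
      ultimately show ?case by (intro hw_Assign) simp_all
     qed (use l in \<open>auto simp: y2_def\<close>)
    qed
   qed (use r0 l il in \<open>auto\<close>)
  qed
 next
  case (3 T y)
  then obtain i l where l: "alst y (bs+9) 0 = l" "areg y 30 = i" "i <= length l" and dl: "distinct l"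
   and fr: "frame {30, 31, 32, 33, 35, 36} {bs+9} x y" and sl: "set l = VS x Un \<Union> (?G ` set (take i l))"
   and re: "ALL v:set l. EX u:VS x. (u, v) : (arcs af x)\<^sup>*"
   and Bd: "(SUM v:set (take i l). card (?G v)) + areg y 33 = B" and r31: "areg y 31 <= 1"
   and z: "areg y 31 = 0 --> i < length l & areg y 33 < card (?G (l ! i))"
   and T: "T <= (SUM v:set (take i l). 100 * (1 + card (?G v))) + 50 * (1 - areg y 31)"
   by (auto simp: I_def)
  have ex: "areg y 31 = 0 \<or> i = length l" using 3(2) l r31 by (auto split: if_splits)
  have post: "bfs_post af B (VS x) (set (take i l)) x y"
   unfolding bfs_post_def
  proof (intro conjI impI)
   show "set (take i l) \<subseteq> VS y" using l by (auto dest: in_set_takeD)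
   show "VS y = VS x Un \<Union> (?G ` set (take i l))" using l sl by simp
   show "ALL v:VS y. EX u:VS x. (u, v) : (arcs af x)\<^sup>*" using l re by simp
   show "(SUM v:set (take i l). card (?G v)) <= B" using Bd by simp
   show "set (take i l) = VS y" if "areg y 31 ~= 0" using ex that l by simp
   show "EX v:VS y - set (take i l). B < (SUM v:set (take i l). card (?G v)) + card (?G v)" if "areg y 31 = 0"
   proof
    have il: "i < length l" and lt: "areg y 33 < card (?G (l ! i))" using z that by auto
    have "l ! i ~: set (take i l)"
     using dl il by (metis id_take_nth_drop distinct_append not_distinct_conv_prefix)
    thus "l ! i : VS y - set (take i l)" using il l by simp
    show "B < (SUM v:set (take i l). card (?G v)) + card (?G (l ! i))" using Bd lt by simp
   qed
  qed (rule fr)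
  show ?case by (rule Q[OF post]) (use T r31 in simp)
 next
  case 4
  have "frame {30, 31, 32, 33, 35, 36} {bs+9} x x1" by (simp add: frame_def x1_def)
  thus ?case using B ok unfolding I_def x1_def by auto
 qed
qed

text \<open>A search that stops because its budget is exhausted proves that every closed set containing
 its sources has more outgoing arcs than the budget allows.\<close>

lemma bfs_closed:
 assumes "bfs_post af B V0 Sc x y" "V0 \<subseteq> X" "!!v. v : X ==> adj af x v \<subseteq> X"
 shows "VS y \<subseteq> X"
proof -
 have "v : X" if "(u, v) : (arcs af x)\<^sup>*" "u : X" for u v
  using that by induction (use assms(3) in \<open>auto simp: arcs_def\<close>)
 thus ?thesis using assms(1,2) unfolding bfs_post_def by blast
qed

text \<open>Otherwise the scanned vertices and the one at which the search stopped would form a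
  subset of the closed set \<open>S\<close> with more than \<open>B\<close> arcs.\<close>

lemma bfs_done:
 assumes p: "bfs_post af B V0 Sc x y" and S: "V0 \<subseteq> S" "finite S" "!!v. v : S ==> adj af x v \<subseteq> S"
  and B: "(SUM v:S. card (adj af x v)) <= B"
 shows "areg y 31 ~= 0" "Sc = VS y"
proof -
 have VS: "VS y \<subseteq> S" using bfs_closed[OF p S(1)] S(3) by blast
 show *: "areg y 31 ~= 0"
 proof
  assume "areg y 31 = 0"
  then obtain v where v: "v : VS y - Sc" "B < (SUM v:Sc. card (adj af x v)) + card (adj af x v)"
   using p by (auto simp: bfs_post_def)
  have "Sc \<subseteq> VS y" using p unfolding bfs_post_def by (elim conjE)
  hence "insert v Sc \<subseteq> S" using v VS by auto
  hence "(SUM v:insert v Sc. card (adj af x v)) <= (SUM v:S. card (adj af x v))"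
   using S(2) by (intro sum_mono2) auto
  moreover have "finite Sc" using `Sc \<subseteq> VS y` finite_subset by blast
  ultimately show False using v B by simp
 qed
 have "areg y 31 ~= 0 --> Sc = VS y" using p unfolding bfs_post_def by (elim conjE)
 thus "Sc = VS y" using * by simp
qed

lemma bfs_done_closed:
 assumes "bfs_post af B V0 Sc x y" "areg y 31 ~= 0" "v : VS y"
 shows "adj af x v \<subseteq> VS y"
proof -
 have 1: "VS y = V0 Un \<Union> (adj af x ` Sc)" using assms(1) unfolding bfs_post_def by (elim conjE)
 have "areg y 31 ~= 0 --> Sc = VS y" using assms(1) unfolding bfs_post_def by (elim conjE)
 hence "v : Sc" using assms(2,3) by simp
 thus ?thesis by (subst 1) auto
qed

lemma hw_BFS_from:
 assumes par: "params x" and af: "af ~= bs+9" "N af = n" and B: "areg x 33 = B" and r: "areg x r = v" "v < n"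
  and Q: "!!T y Sc. bfs_post af B {v} Sc x y ==>
   T <= 160 + (SUM v:Sc. 100 * (1 + card (adj af x v))) ==> Q T y"
 shows "hw N (BFS_from bs af r) Q x"
 unfolding BFS_from_def
proof (rule hw_Seq, rule hw_Clear, simp, rule hw_Seq, rule hw_Insert, goal_cases)
 case 5
 let ?x = "setl (setl x (bs+9) 0 []) (bs+9) 0 [v]"
 have eq: "setl (setl x (bs+9) (aev x (Const 0)) []) (bs+9) (aev (setl x (bs+9) (aev x (Const 0)) []) (Const 0))
   (lins (aev (setl x (bs+9) (aev x (Const 0)) []) (Reg r)) (alst (setl x (bs+9) (aev x (Const 0)) []) (bs+9) (aev (setl x (bs+9) (aev x (Const 0)) []) (Const 0)))) = ?x"
  using r by (simp add: lins_def)
 have adj: "adj af ?x = adj af x" "arcs af ?x = arcs af x" using af by (auto simp: adj_def arcs_def)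
 show ?case
  unfolding eq
 proof (rule hw_BFS[where af = af and B = B], goal_cases)
  case (5 T y Sc)
  have "frame {30, 31, 32, 33, 35, 36} {bs+9} ?x y" using 5(1) unfolding bfs_post_def by (elim conjE)
  hence fr: "frame {30, 31, 32, 33, 35, 36} {bs+9} x y" by (simp add: frame_def)
  have V: "VS ?x = {v}" by simp
  have "bfs_post af B {v} Sc x y"
   using 5(1) fr unfolding bfs_post_def adj V by (elim conjE) (intro conjI, assumption+)
  thus ?case using 5(2) unfolding adj by (intro Q) auto
 qed (use par B af in auto)
qed (use par r in \<open>auto simp: params_def\<close>)

section \<open>Testing a component for strong connectedness\<close>

definition out_closed :: "astate => nat set => bool" where "out_closed x X \<longleftrightarrow> (ALL v:X. Out x v \<subseteq> X)"
definition in_closed :: "astate => nat set => bool" where "in_closed x X \<longleftrightarrow> (ALL v:X. In x v \<subseteq> X)"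

definition sconn :: "astate => nat set => bool" where
 "sconn x S \<longleftrightarrow> (ALL u:S. ALL w:S. (u, w) : (E Int S \<times> S)\<^sup>*)"

lemma sum_out_le:
 assumes "live x" "S \<subseteq> {..<n}"
 shows "(SUM v:S. card (Out x v)) <= m" "(SUM v:S. card (In x v)) <= m"
proof -
 have fE: "finite E" using E finite_subset by blast
 have fS: "finite S" using assms(2) finite_subset by blast
 have "(SUM v:S. card (Out x v)) = card (SIGMA v:S. Out x v)" using fS by simp
 also have "... <= card E" using fE by (intro card_mono) (auto simp: liveD[OF assms(1)])
 finally show "(SUM v:S. card (Out x v)) <= m" using m by simp
 have "(SUM v:S. card (In x v)) = card (SIGMA v:S. In x v)" using fS by simp
 also have "... = card (prod.swap ` (SIGMA v:S. In x v))" by (simp add: card_image)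
 also have "... <= card E" using fE by (intro card_mono) (auto simp: liveD[OF assms(1)])
 finally show "(SUM v:S. card (In x v)) <= m" using m by simp
qed

lemma CS_closed:
 assumes "live x" "consistent x" "v : CS x c"
 shows "Out x v \<subseteq> CS x c" "In x v \<subseteq> CS x c"
 using assms(3) E unfolding liveD[OF assms(1)] consistentD(1)[OF assms(2)] by auto

lemma adj_bs: "adj bs x = Out x" "adj (Suc bs) x = In x"
 by (auto simp: adj_def)

lemma arcs_in_CS:
 assumes "live x" "consistent x" "r : CS x c"
 shows "(r, v) : (arcs bs x)\<^sup>* ==> v : CS x c & (r, v) : (E Int CS x c \<times> CS x c)\<^sup>*"
  "(r, v) : (arcs (Suc bs) x)\<^sup>* ==> v : CS x c & (v, r) : (E Int CS x c \<times> CS x c)\<^sup>*"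
proof -
 show "(r, v) : (arcs bs x)\<^sup>* ==> v : CS x c & (r, v) : (E Int CS x c \<times> CS x c)\<^sup>*"
 proof (induction rule: rtrancl_induct)
  case (step y z)
  hence "z : Out x y" by (simp add: arcs_def adj_bs)
  hence "z : CS x c" "(y, z) : E" using CS_closed(1)[OF assms(1,2), of y c] step liveD(1)[OF assms(1), of y] by auto
  thus ?case using step by (meson IntI SigmaI rtrancl.rtrancl_into_rtrancl)
 qed (use assms in auto)
 show "(r, v) : (arcs (Suc bs) x)\<^sup>* ==> v : CS x c & (v, r) : (E Int CS x c \<times> CS x c)\<^sup>*"
 proof (induction rule: rtrancl_induct)
  case (step y z)
  hence "z : In x y" by (simp add: arcs_def adj_bs)
  hence "z : CS x c" "(z, y) : E" using CS_closed(2)[OF assms(1,2), of y c] step liveD(2)[OF assms(1), of y] by auto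
  thus ?case using step by (meson IntI SigmaI converse_rtrancl_into_rtrancl)
 qed (use assms in auto)
qed

lemma length_CS: "lists_ok x ==> length (alst x f r) = card (set (alst x f r))"
 by (simp add: distinct_card)

text \<open>Closedness of the complement is included because \<open>Level\<close> visits the
  complement of a closed set.\<close>

definition decided :: "nat set => astate => astate => bool" where
 "decided S x y \<longleftrightarrow> areg y 38 = 1 & VS y ~= {} & VS y \<subset> S &
    (out_closed x (VS y) \<or> in_closed x (VS y) \<or> out_closed x (S - VS y) \<or> in_closed x (S - VS y)) \<or>
   areg y 38 = 0 & sconn x S"

lemma hw_Decide:
 assumes par: "params x" and cons: "consistent x" and live: "live x"
  and c: "areg x 18 = c" and S: "CS x c = S" "S ~= {}"
  and Q: "!!T y. frame {30, 31, 32, 33, 35, 36, 37, 38} {bs+9} x y ==> decided S x y ==>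
   T <= 600 * (SUM v:S. 1 + card (Out x v) + card (In x v)) ==> Q T y"
 shows "hw N (Decide bs) Q x"
proof (rule hw_ok)
 assume ok: "lists_ok x"
 have Sn: "S \<subseteq> {..<n}" using S consistentD(1)[OF cons, of c] by auto
 hence finS: "finite S" using finite_subset by blast
 define r where "r = alst x (bs+2) c ! 0"
 have rS: "r : S" using S by (cases "alst x (bs+2) c") (auto simp: r_def)
 hence rn: "r < n" using Sn by auto
 have lenS: "length (alst x (bs+2) c) = card S" using length_CS[OF ok] S by simp
 have ne: "alst x (bs+2) c ~= []" using S by auto
 have cl: "Out x v \<subseteq> S" "In x v \<subseteq> S" if "v : S" for v using CS_closed[OF live cons, of v c] that S by auto
 define W where "W = (SUM v:S. 1 + card (Out x v) + card (In x v))"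
 have W: "card S <= W" "(SUM v:S. 100 * (1 + card (Out x v))) <= 100 * W" "(SUM v:S. 100 * (1 + card (In x v))) <= 100 * W"
  unfolding W_def using sum_mono[of S "%_. 1" "%v. 1 + card (Out x v) + card (In x v)"]
  by (auto simp: sum_distrib_left intro!: sum_mono)
 have W1: "1 <= W" using W(1) S finS card_gt_0_iff[of S] by linarith
 show ?thesis
  unfolding Decide_def
 proof (rule hw_Seq, rule hw_Elt, goal_cases)
  case 5
  let ?x1 = "setr (setr x 37 r) 33 m"
  have eq1: "setr x 37 (alst x (bs+2) (aev x (Reg 18)) ! aev x (Const 0)) = setr x 37 r" using c by (simp add: r_def)
  have eq2: "setr (setr x 37 r) 33 (aev (setr x 37 r) (Reg 1)) = ?x1" using par by (simp add: params_def)
  have a1: "adj f ?x1 = adj f x" "arcs f ?x1 = arcs f x" for f by (auto simp: adj_def arcs_def)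
  show ?case
   unfolding eq1
  proof (rule hw_Seq, rule hw_Assign, simp, unfold eq2, rule hw_Seq,
    rule hw_BFS_from[where v = r and B = m], goal_cases)
   case (7 T y Sc)
   have bp: "bfs_post bs m {r} Sc ?x1 y" using 7(1) .
   have dn: "areg y 31 ~= 0" "Sc = VS y"
    by (rule bfs_done[OF bp, of S]; use rS finS cl sum_out_le(1)[OF live Sn] a1 adj_bs in simp)+
   have fr: "frame {30, 31, 32, 33, 35, 36, 37} {bs+9} x y" using bp by (auto simp: bfs_post_def frame_def)
   have VS: "VS y \<subseteq> S" by (rule bfs_closed[OF bp]) (use rS cl a1 adj_bs in auto)
   have rV: "r : VS y" using bp by (auto simp: bfs_post_def)
   have y37: "areg y 37 = r" using bp by (auto simp: bfs_post_def frame_def)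
   have cst: "alst y (bs+2) = alst x (bs+2)" "areg y 18 = c" using fr c by (auto simp: frame_def)
   have T: "T <= 160 + 100 * W"
   proof -
    have "(SUM v:VS y. 100 * (1 + card (adj bs ?x1 v))) <= (SUM v:S. 100 * (1 + card (Out x v)))"
     unfolding a1 adj_bs using VS finS by (intro sum_mono2) auto
    thus ?thesis using 7(2) dn W by simp
   qed
   show ?case
   proof (rule hw_ok)
    assume oky: "lists_ok y"
    have lV: "length (alst y (bs+9) 0) = card (VS y)" using length_CS[OF oky] .
    show ?thesis
    proof (rule hw_Cond, simp, goal_cases)
     case 1
     hence lt: "card (VS y) < card S" using lV lenS cst by (auto split: if_splits)
     have "out_closed x (VS y)"
      unfolding out_closed_def using bfs_done_closed[OF bp dn(1)] a1 adj_bs by simp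
     hence "decided S x (setr y 38 1)" using lt VS rV by (auto simp: decided_def out_closed_def)
     moreover have "frame {30, 31, 32, 33, 35, 36, 37, 38} {bs+9} x (setr y 38 1)" using fr by (auto simp: frame_def)
     ultimately show ?case using T W1 by (intro hw_Assign Q) (auto simp: W_def)
    next
     case 2
     hence "~ card (VS y) < card S" using lV lenS cst by (auto split: if_splits)
     hence VSS: "VS y = S" using VS finS by (meson psubsetI psubset_card_mono)
     have reach: "(r, v) : (E Int S \<times> S)\<^sup>*" if "v : S" for v
     proof -
      have "(r, v) : (arcs bs x)\<^sup>*" using bp that VSS a1 by (auto simp: bfs_post_def)
      thus ?thesis using arcs_in_CS(1)[OF live cons, of r c v] rS S by auto
     qed
     let ?y1 = "setr y 33 m"
     have par_y: "params y" using fr par by (simp add: frame_def params_def)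
     have eq3: "setr y 33 (aev y (Reg 1)) = ?y1" using par_y by (simp add: params_def)
     have a2: "adj f ?y1 = adj f x" "arcs f ?y1 = arcs f x" if "f ~= bs+9" for f
      using fr that by (auto simp: adj_def arcs_def frame_def)
     have a2': "adj (Suc bs) ?y1 = In x" "arcs (Suc bs) ?y1 = arcs (Suc bs) x" using a2[of "Suc bs"] adj_bs by auto
     show ?case
     proof (rule hw_Seq, rule hw_Assign, simp, unfold eq3, rule hw_Seq,
       rule hw_BFS_from[where v = r and B = m], goal_cases)
      case (7 T' z Sc')
      have bz: "bfs_post (Suc bs) m {r} Sc' ?y1 z" using 7(1) .
      have dz: "areg z 31 ~= 0" "Sc' = VS z"
       by (rule bfs_done[OF bz, of S]; use rS finS cl sum_out_le(2)[OF live Sn] a2' in simp)+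
      have frz: "frame {30, 31, 32, 33, 35, 36, 37} {bs+9} x z" using bz fr by (auto simp: bfs_post_def frame_def)
      have VSz: "VS z \<subseteq> S" by (rule bfs_closed[OF bz]) (use rS cl a2' in auto)
      have rVz: "r : VS z" using bz by (auto simp: bfs_post_def)
      have cstz: "alst z (bs+2) = alst x (bs+2)" "areg z 18 = c" using frz c by (auto simp: frame_def)
      have T': "T' <= 160 + 100 * W"
      proof -
       have "(SUM v:VS z. 100 * (1 + card (adj (Suc bs) ?y1 v))) <= (SUM v:S. 100 * (1 + card (In x v)))"
        unfolding a2' using VSz finS by (intro sum_mono2) auto
       thus ?thesis using 7(2) dz W by simp
      qed
      show ?case
      proof (rule hw_ok)
       assume okz: "lists_ok z"
       have lVz: "length (alst z (bs+9) 0) = card (VS z)" using length_CS[OF okz] .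
       show ?thesis
       proof (rule hw_Cond, simp, goal_cases)
        case 1
        hence lt: "card (VS z) < card S" using lVz lenS cstz by (auto split: if_splits)
        have "in_closed x (VS z)"
         unfolding in_closed_def using bfs_done_closed[OF bz dz(1)] a2' by simp
        hence "decided S x (setr z 38 1)" using lt VSz rVz by (auto simp: decided_def in_closed_def)
        moreover have "frame {30, 31, 32, 33, 35, 36, 37, 38} {bs+9} x (setr z 38 1)" using frz by (auto simp: frame_def)
        ultimately show ?case using T T' W1 by (intro hw_Assign Q) (auto simp: W_def)
       next
        case 2
        hence "~ card (VS z) < card S" using lVz lenS cstz by (auto split: if_splits)
        hence VSSz: "VS z = S" using VSz finS by (meson psubsetI psubset_card_mono)
        have bck: "(v, r) : (E Int S \<times> S)\<^sup>*" if "v : S" for v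
        proof -
         have "(r, v) : (arcs (Suc bs) x)\<^sup>*" using bz that VSSz a2' by (auto simp: bfs_post_def)
         thus ?thesis using arcs_in_CS(2)[OF live cons, of r c v] rS S by auto
        qed
        have "sconn x S" unfolding sconn_def using reach bck by (meson rtrancl_trans)
        hence "decided S x (setr z 38 0)" by (simp add: decided_def)
        moreover have "frame {30, 31, 32, 33, 35, 36, 37, 38} {bs+9} x (setr z 38 0)" using frz by (auto simp: frame_def)
        ultimately show ?case using T T' W1 by (intro hw_Assign Q) (auto simp: W_def)
       qed
      qed
     qed (use par_y rn y37 in simp_all)
    qed
   qed
  qed (use par rn in auto)
 qed (use par ne c in \<open>auto simp: params_def\<close>)
qed

lemma hw_MakePart:
 assumes par: "params x" and c: "areg x 18 = c" and S: "CS x c = S" and V: "VS x \<subset> S" "VS x ~= {}"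
  and Q: "!!T y A. frame {45, 46} {bs+10} x y ==> PS y = A ==> A ~= {} ==> A \<subset> S ==> 2 * card A <= card S ==>
   A = VS x \<or> A = S - VS x ==> T <= 400 * card (VS x) ==> Q T y"
 shows "hw N (MakePart bs) Q x"
proof (rule hw_ok)
 assume ok: "lists_ok x"
 have lenS: "length (alst x (bs+2) c) = card S" using length_CS[OF ok] S by simp
 have lenV: "length (alst x (bs+9) 0) = card (VS x)" using length_CS[OF ok] .
 have Sn: "w < n" if "w : S" for w using lists_ok_less[OF ok, of w "bs+2" c] S that by auto
 have finS: "finite S" using S by auto
 have V1: "1 <= card (VS x)" using V(2) card_gt_0_iff[of "VS x"] by auto
 have cd: "card (S - VS x) = card S - card (VS x)" using V(1) by (intro card_Diff_subset) auto
 define x1 where "x1 = setl x (bs+10) 0 []"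
 have eq: "setl x (bs+10) (aev x (Const 0)) [] = x1" by (simp add: x1_def)
 have r0: "areg x 0 = n" using par params_reg0 by simp
 show ?thesis
  unfolding MakePart_def
 proof (rule hw_Seq, rule hw_Clear, simp, unfold eq, rule hw_Cond, simp, goal_cases)
  case 1
  hence lt: "card S < 2 * card (VS x)" using c lenS lenV by (auto simp: x1_def split: if_splits)
  define J where "J = (%D T y. frame {45, 46} {bs+10} x y & PS y = D - VS x & T <= 150 * card D)"
  show ?case
  proof (rule hw_For[where J = J and ro = c and xi = x1], goal_cases)
   case (11 D w T y a)
   have wS: "w : S" "w < n" using 11(2) S Sn by (auto simp: x1_def)
   have cD: "card (insert w D) = Suc (card D)" using 11(1,3) finite_subset[OF 11(1)] by simp
   have fr: "frame {45, 46} {bs+10} x y" and PSy: "PS y = D - VS x" and T: "T <= 150 * card D"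
    using 11(4) by (auto simp: J_def)
   have r0y: "areg y 0 = n" and V9: "alst y (bs+9) = alst x (bs+9)" using fr r0 by (auto simp: frame_def)
   show ?case
   proof (rule hw_Member, goal_cases)
    case 5
    hence "w : VS x" using V9 by simp
    hence "J (insert w D) (T + 150) (setr (setr y 45 a) 46 w)"
     using fr PSy T cD by (auto simp: J_def frame_def)
    thus ?case by (intro hw_Skip) (auto simp: J_def Member_def Pos_def Elt_def Idx_def)
   next
    case 6
    hence "w ~: VS x" using V9 by simp
    hence "J (insert w D) (T + 150) (setl (setr (setr y 45 a) 46 w) (bs+10) 0 (lins w (alst y (bs+10) 0)))"
     using fr PSy T cD by (auto simp: J_def frame_def)
    thus ?case using r0y wS
     by (intro hw_Insert) (auto simp: J_def Member_def Pos_def Elt_def Idx_def)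
   qed (use r0y wS in auto)
  next
   case (12 T y)
   have 2: "set (alst x1 (bs+2) c) = S" using S by (simp add: x1_def)
   have "S - VS x ~= {}" using V by auto
   moreover obtain v where "v : VS x" using V(2) by (meson ex_in_conv)
   hence "S - VS x \<subset> S" using V(1) by blast
   moreover have "2 * card (S - VS x) <= card S" using cd lt by simp
   ultimately show ?case using 12 lt V1 unfolding 2 by (intro Q[of _ "S - VS x"]) (auto simp: J_def)
  qed (use c r0 in \<open>auto simp: J_def x1_def frame_def\<close>)
 next
  case 2
  hence ge: "2 * card (VS x) <= card S" using c lenS lenV by (auto simp: x1_def split: if_splits)
  define J where "J = (%D T y. frame {45, 46} {bs+10} x y & PS y = D & T <= 150 * card D)"
  show ?case
  proof (rule hw_For[where J = J and ro = 0 and xi = x1], goal_cases)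
   case (11 D w T y a)
   have wS: "w < n" using 11(2) V(1) Sn by (auto simp: x1_def)
   have cD: "card (insert w D) = Suc (card D)" using 11(1,3) finite_subset[OF 11(1)] by simp
   have fr: "frame {45, 46} {bs+10} x y" and PSy: "PS y = D" and T: "T <= 150 * card D"
    using 11(4) by (auto simp: J_def)
   have r0y: "areg y 0 = n" using fr r0 by (auto simp: frame_def)
   have "J (insert w D) (T + 150) (setl (setr (setr y 45 a) 46 w) (bs+10) 0 (lins w (alst y (bs+10) 0)))"
    using fr PSy T cD by (auto simp: J_def frame_def)
   thus ?case using r0y wS by (intro hw_Insert) (auto simp: J_def)
  next
   case (12 T y)
   have 2: "set (alst x1 (bs+9) 0) = VS x" by (simp add: x1_def)
   show ?case using 12 V V1 ge unfolding 2 by (intro Q[of _ "VS x"]) (auto simp: J_def)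
  qed (use c r0 in \<open>auto simp: J_def x1_def frame_def\<close>)
 qed
qed

end

text \<open>With threshold \<open>h\<close>, the vertices of degree greater than \<open>h\<close> and all vertices that can reach
 them are visited. The other vertices form a closed set; if there are none, then every nonempty
 closed set contains a vertex of degree greater than \<open>h\<close> and hence more than \<open>h\<close> vertices.\<close>

definition Level :: "nat => nat => com" where
 "Level bs af = Clear (bs+9) (Const 0) ;;
   For (bs+2) 0 (Reg 18) 40 41 (Clear (bs+11) (Reg 41)) ;;
   For (bs+2) 0 (Reg 18) 40 41
    (Cond (Op Less (Reg 39) (Cnt af (Reg 41))) (Insert (bs+9) 0 (Const 0) (Reg 41))
     (For af 0 (Reg 41) 42 43 (Insert (bs+11) 0 (Reg 43) (Reg 41)))) ;;
   Cond (Cnt (bs+9) (Const 0))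
    (Assign 33 (Reg 1) ;; BFS bs (bs+11) ;;
    Cond (Op Less (Cnt (bs+9) (Const 0)) (Cnt (bs+2) (Reg 18))) (Assign 38 (Const 1)) (Assign 38 (Const 2)))
    (Decide bs)"

text \<open>The threshold in register 39 is doubled by repeated increments, since a
  \<open>slow\<close> expression may add only 1. Register 38 is 2 as long as nothing is
  decided.\<close>

definition FindDense :: "nat => com" where
 "FindDense bs = Assign 39 (Const 1) ;; Assign 38 (Const 2) ;;
   While (Op Equal (Reg 38) (Const 2))
    (Level bs bs ;; Cond (Op Equal (Reg 38) (Const 2)) (Level bs (Suc bs)) Skip ;;
    Assign 44 (Reg 39) ;; While (Reg 44) (Assign 39 (Op Add (Reg 39) (Const 1)) ;; Assign 44 (Op Sub (Reg 44) (Const 1))))"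

context engine
begin

section \<open>Searching with degree thresholds\<close>

lemma sum_out_eq_in:
 assumes "live x" "consistent x"
 shows "(SUM v:CS x c. card (Out x v)) = (SUM v:CS x c. card (In x v))"
proof -
 have "(SUM v:CS x c. card (Out x v)) = card (SIGMA v:CS x c. Out x v)" by simp
 also have "(SIGMA v:CS x c. Out x v) = prod.swap ` (SIGMA v:CS x c. In x v)"
 proof -
  have *: "u : CS x c & v : Out x u \<longleftrightarrow> v : CS x c & u : In x v" for u v
   unfolding liveD[OF assms(1)] consistentD(1)[OF assms(2)] using E by auto
  have "(u, v) : prod.swap ` X \<longleftrightarrow> (v, u) : X" for u v :: nat and X by force
  thus ?thesis by (simp add: set_eq_iff split_paired_all *)
 qed
 also have "card ... = card (SIGMA v:CS x c. In x v)" by (simp add: card_image)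
 also have "... = (SUM v:CS x c. card (In x v))" by simp
 finally show ?thesis .
qed

definition adj_closed :: "nat => astate => nat set => bool" where
 "adj_closed af x X \<longleftrightarrow> (ALL v:X. adj af x v \<subseteq> X)"

text \<open>Arcs are reversed only for vertices of degree at most \<open>h\<close>, since the others
  are visited from the start; so there are at most \<open>card S * h\<close> of them. If no vertex
  has a larger degree, then \<open>Decide\<close> stays within the same bound, also in the opposite
  direction because both degree sums agree.\<close>

lemma hw_Level:
 assumes par: "params x" and cons: "consistent x" and live: "live x"
  and c: "areg x 18 = c" and S: "CS x c = S" "S ~= {}" and h: "areg x 39 = h" "1 <= h" and af: "af = bs \<or> af = Suc bs"
  and Q: "!!T y. frame {30, 31, 32, 33, 35, 36, 37, 38, 40, 41, 42, 43} {bs+9, bs+11} x y ==>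
   decided S x y \<or> areg y 38 = 2 & (\<forall>X\<subseteq>S. X ~= {} --> adj_closed af x X --> h < card X) ==>
   T <= 3000 * (card S * h) ==> Q T y"
 shows "hw N (Level bs af) Q x"
proof (rule hw_ok)
 assume ok: "lists_ok x"
 have Naf: "N af = n" and afne: "af ~= bs+9" "af ~= bs+11" "af ~= bs+2" using af by auto
 have Sn: "S \<subseteq> {..<n}" using S consistentD(1)[OF cons, of c] by auto
 hence finS: "finite S" using finite_subset by blast
 define G where "G = adj af x"
 have cl: "G v \<subseteq> S" if "v : S" for v
  using CS_closed[OF live cons, of v c] that S af adj_bs by (auto simp: G_def)
 have cG: "length (alst x af v) = card (G v)" for v using length_CS[OF ok] by (simp add: G_def adj_def)
 have setG: "set (alst x af v) = G v" for v by (simp add: G_def adj_def)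
 have finG: "finite (G v)" for v by (simp add: G_def adj_def)
 have S1: "1 <= card S" using S(2) finS card_gt_0_iff[of S] by linarith
 have Sh: "card S <= card S * h" "1 <= card S * h" using h(2) S1 by auto
 have r0: "areg x 0 = n" using par params_reg0 by simp
 define rev where "rev = (%D w. {v : D. card (G v) <= h & w : G v})"
 define blue where "blue = (%D. {v : D. h < card (G v)})"
 define FR where "FR = frame {40, 41, 42, 43} {bs+9, bs+11} x"
 have FRD: "areg y 18 = c" "areg y 39 = h" "areg y 0 = n" "alst y af = alst x af" "alst y (bs+2) = alst x (bs+2)"
   "params y" if "FR y" for y
  using that par afne c h r0 by (auto simp: FR_def frame_def params_def)
 define J1 where "J1 = (%D T y. FR y & alst y (bs+9) 0 = [] & (ALL w:D. alst y (bs+11) w = []) & T <= 20 * card D)"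
 define J2 where "J2 = (%D T y. FR y & VS y = blue D & (ALL w:S. set (alst y (bs+11) w) = rev D w) &
   T <= 170 * (card D * h))"
 define x0 where "x0 = setl x (bs+9) 0 []"
 have eq0: "setl x (bs+9) (aev x (Const 0)) [] = x0" by (simp add: x0_def)
 have FR0: "FR x0" by (simp add: FR_def frame_def x0_def)
 have FRsetr: "FR (setr y r a)" if "FR y" "r : {40, 41, 42, 43}" for y r a
  using that by (auto simp: FR_def frame_def)
 have CS0: "set (alst y (bs+2) c) = S" if "FR y" for y using FRD[OF that] S by simp
 show ?thesis
  unfolding Level_def
 proof (rule hw_Seq, rule hw_Clear, simp, unfold eq0, rule hw_Seq,
   rule hw_For[where J = J1 and ro = c and xi = x0], goal_cases)
  case (11 D w T y a)
  have cD: "card (insert w D) = Suc (card D)" using 11(1,3) finite_subset[OF 11(1)] by simp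
  show ?case
   by (rule hw_Clear) (use 11(4) cD in \<open>auto simp: J1_def FR_def frame_def\<close>)
 next
  case (12 T1 x1)
  have F1: "FR x1" and V1: "alst x1 (bs+9) 0 = []" and R1: "!!w. w : S ==> alst x1 (bs+11) w = []"
   and T1: "T1 <= 20 * card S" using 12 CS0[OF FR0] by (auto simp: J1_def)
  show ?case
  proof (rule hw_Seq, rule hw_For[where J = J2 and ro = c and xi = x1], goal_cases)
   case 3
   show ?case using F1 V1 R1 by (simp add: J2_def blue_def rev_def)
  next
   case (10 D T y a)
   thus ?case using FRsetr by (simp add: J2_def)
  next
   case (11 D v T y a)
   have D: "D \<subseteq> S" and v: "v : S" "v ~: D" using 11(1-3) CS0[OF F1] by auto
   hence vn: "v < n" using Sn by auto
   have cD: "card (insert v D) = Suc (card D)" using v finite_subset[OF D finS] by simp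
   have Fy: "FR y" and Vy: "VS y = blue D" and Ry: "!!w. w : S ==> set (alst y (bs+11) w) = rev D w"
    and T: "T <= 170 * (card D * h)" using 11(4) by (auto simp: J2_def)
   let ?y = "setr (setr y 40 a) 41 v"
   have Fy': "FR ?y" using FRsetr Fy by simp
   have Th: "170 * (card (insert v D) * h) = 170 * (card D * h) + 170 * h" using cD by simp
   show ?case
   proof (rule hw_Cond, simp, goal_cases)
    case 1
    hence gt: "h < card (G v)" using FRD[OF Fy] cG by (auto split: if_splits)
    have b: "blue (insert v D) = insert v (blue D)" and rv: "rev (insert v D) w = rev D w" for w
     using gt by (auto simp: blue_def rev_def)
    have "J2 (insert v D) (T + 100) (setl ?y (bs+9) 0 (lins v (alst y (bs+9) 0)))"
     unfolding J2_def b rv Th using Fy Vy Ry T h(2) by (auto simp: FR_def frame_def)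
    thus ?case using FRD[OF Fy] vn by (intro hw_Insert) (auto simp: J2_def)
   next
    case 2
    hence le: "card (G v) <= h" using FRD[OF Fy] cG by (auto split: if_splits)
    have b: "blue (insert v D) = blue D" using le by (auto simp: blue_def)
    define J3 where "J3 = (%D' U z. FR z & areg z 40 = a & areg z 41 = v & VS z = blue D &
      (ALL w:S. set (alst z (bs+11) w) = rev D w Un {u. u = v & w : D'}) & U <= 110 * card D')"
    have Gv: "set (alst ?y af v) = G v" using FRD(4)[OF Fy] setG by simp
    show ?case
    proof (rule hw_For[where J = J3 and ro = v and xi = ?y], goal_cases)
     case 3
     show ?case using Fy' Vy Ry by (auto simp: J3_def)
    next
     case (4 D' U z)
     thus ?case using FRD Naf by (auto simp: J3_def)
    next
     case (10 D' U z a')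
     thus ?case using FRsetr by (simp add: J3_def)
    next
     case (11 D' w U z a')
     have cD': "card (insert w D') = Suc (card D')" using 11(1,3) finite_subset[OF 11(1)] by simp
     have Fz: "FR z" and z: "areg z 40 = a" "areg z 41 = v" "VS z = blue D" "U <= 110 * card D'"
      and Rz: "!!w'. w' : S ==> set (alst z (bs+11) w') = rev D w' Un {u. u = v & w' : D'}"
      using 11(4) by (auto simp: J3_def)
     let ?z = "setl (setr (setr z 42 a') 43 w) (bs+11) w (lins v (alst z (bs+11) w))"
     have "J3 (insert w D') (U + 110) ?z"
      unfolding J3_def
     proof (intro conjI ballI)
      show "FR ?z" using Fz by (auto simp: FR_def frame_def)
      show "set (alst ?z (bs+11) w') = rev D w' Un {u. u = v & w' : insert w D'}" if "w' : S" for w'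
       using Rz[OF that] by auto
     qed (use z cD' in auto)
     thus ?case using FRD[OF Fz] z vn afne
      by (intro hw_Insert) (auto simp: J3_def)
    next
     case (12 U z)
     have Fz: "FR z" and z: "areg z 40 = a" "areg z 41 = v" "VS z = blue D" "U <= 110 * card (G v)"
      and Rz: "!!w'. w' : S ==> set (alst z (bs+11) w') = rev D w' Un {u. u = v & w' : G v}"
      using 12 unfolding Gv by (auto simp: J3_def)
     have "rev (insert v D) w = rev D w Un {u. u = v & w : G v}" for w using le by (auto simp: rev_def)
     hence "J2 (insert v D) (T + 60 + 110 * h) z"
      unfolding J2_def b Th using Fz z Rz T h(2) by auto
     moreover have "U <= 110 * h" using z(4) le by (meson mult_le_mono2 order_trans)
     ultimately show ?case using z FRD[OF Fz] FRD[OF Fy] by (auto simp: J2_def)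
    qed (use FRD(4)[OF Fy] in auto)
   qed
  next
   case (12 T2 x2)
   have F2: "FR x2" and V2: "VS x2 = blue S" and R2: "!!w. w : S ==> set (alst x2 (bs+11) w) = rev S w"
    and T2: "T2 <= 170 * (card S * h)" using 12 CS0[OF F1] by (auto simp: J2_def)
   have par2: "params x2" using FRD(6)[OF F2] .
   have fr2: "frame {40, 41, 42, 43} {bs+9, bs+11} x x2" using F2 by (simp add: FR_def)
   have T12: "T1 + T2 <= 190 * (card S * h)" using T1 T2 Sh(1) by linarith
   show ?case
   proof (rule hw_ok)
    assume ok2: "lists_ok x2"
    show ?thesis
    proof (rule hw_Cond, simp, goal_cases)
     case 1
     hence bne: "blue S ~= {}" using V2 by auto
     let ?y1 = "setr x2 33 m"
     have eq3: "setr x2 33 (aev x2 (Reg 1)) = ?y1" using par2 by (simp add: params_def)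
     define RV where "RV = adj (bs+11) ?y1"
     have RV: "RV w = rev S w" if "w : S" for w using R2[OF that] by (simp add: RV_def adj_def)
     have RVS: "RV w \<subseteq> S" if "w : S" for w using RV[OF that] by (auto simp: rev_def)
     have sumR: "(SUM w:S. card (RV w)) <= (SUM v:{v : S. card (G v) <= h}. card (G v))"
     proof -
      have "(SUM w:S. card (RV w)) = card (SIGMA w:S. rev S w)"
       using RV finS by (simp add: rev_def)
      also have "... = card (prod.swap ` (SIGMA w:S. rev S w))" by (simp add: card_image)
      also have "... <= card (SIGMA v:{v : S. card (G v) <= h}. G v)"
       using finS finG by (intro card_mono) (auto simp: rev_def)
      also have "... = (SUM v:{v : S. card (G v) <= h}. card (G v))" using finS finG by simp
      finally show ?thesis .
     qed
     have sumR_m: "(SUM w:S. card (RV w)) <= m"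
     proof -
      have "(SUM v:{v : S. card (G v) <= h}. card (G v)) <= (SUM v:S. card (G v))" using finS by (intro sum_mono2) auto
      also have "... <= m" using sum_out_le[OF live Sn] af adj_bs by (auto simp: G_def)
      finally show ?thesis using sumR by simp
     qed
     have sumR_h: "(SUM w:S. card (RV w)) <= card S * h"
     proof -
      have "(SUM v:{v : S. card (G v) <= h}. card (G v)) <= card {v : S. card (G v) <= h} * h"
       by (rule sum_bounded_above[where K = h, simplified]) simp
      also have "... <= card S * h" using finS by (intro mult_le_mono1 card_mono) auto
      finally show ?thesis using sumR by simp
     qed
     have Vy1: "VS ?y1 = blue S" using V2 by simp
     show ?case
     proof (rule hw_Seq, rule hw_Assign, simp, unfold eq3, rule hw_Seq,
       rule hw_BFS[where B = m], goal_cases)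
      case (5 T3 z Sc)
      have bp: "bfs_post (bs+11) m (blue S) Sc ?y1 z" using 5(1) unfolding Vy1 .
      have bS: "blue S \<subseteq> S" by (auto simp: blue_def)
      have dn: "areg z 31 ~= 0" "Sc = VS z"
       by (rule bfs_done[OF bp bS finS]; use RVS sumR_m in \<open>simp add: RV_def\<close>)+
      have VSz: "VS z \<subseteq> S" by (rule bfs_closed[OF bp bS]) (use RVS in \<open>simp add: RV_def\<close>)
      have bV: "blue S \<subseteq> VS z" using bp unfolding bfs_post_def by (elim conjE) simp
      have frz0: "frame {30, 31, 32, 33, 35, 36} {bs+9} ?y1 z" using bp unfolding bfs_post_def by (elim conjE)
      hence frz: "frame {30, 31, 32, 33, 35, 36, 37, 38, 40, 41, 42, 43} {bs+9, bs+11} x z"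
       using fr2 by (auto simp: frame_def)
      have cstz: "alst z (bs+2) = alst x (bs+2)" "areg z 18 = c" using frz c by (auto simp: frame_def)
      have T3: "T3 <= 300 * (card S * h)"
      proof -
       have "(SUM v:VS z. 100 * (1 + card (RV v))) <= (SUM v:S. 100 * (1 + card (RV v)))"
        using VSz finS by (intro sum_mono2) auto
       also have "... = 100 * card S + 100 * (SUM v:S. card (RV v))" by (simp add: sum.distrib sum_distrib_left)
       also have "... <= 200 * (card S * h)" using sumR_h Sh(1) by linarith
       finally have "(SUM v:VS z. 100 * (1 + card (RV v))) <= 200 * (card S * h)" .
       moreover have "T3 <= 100 + (SUM v:VS z. 100 * (1 + card (RV v)))"
        using 5(2) unfolding dn(2) RV_def .
       ultimately show ?thesis using Sh(2) by linarith
      qed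
      show ?case
      proof (rule hw_ok)
       assume okz: "lists_ok z"
       have lV: "length (alst z (bs+9) 0) = card (VS z)" using length_CS[OF okz] .
       have lenS: "length (alst x (bs+2) c) = card S" using length_CS[OF ok] S by simp
       have fin: "Q t (setr z 38 a)" if "decided S x (setr z 38 a) \<or> a = 2 & (\<forall>X\<subseteq>S. X ~= {} --> adj_closed af x X --> h < card X)"
         "t <= T1 + T2 + T3 + 100" for t a
       proof (rule Q)
        show "frame {30, 31, 32, 33, 35, 36, 37, 38, 40, 41, 42, 43} {bs+9, bs+11} x (setr z 38 a)"
         using frz by (auto simp: frame_def)
        show "decided S x (setr z 38 a) \<or> areg (setr z 38 a) 38 = 2 &
         (\<forall>X\<subseteq>S. X ~= {} --> adj_closed af x X --> h < card X)"
         using that(1) by (simp only: set_simps fun_upd_same)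
        show "t <= 3000 * (card S * h)" using that(2) T3 T12 Sh(2) by linarith
       qed
       show ?thesis
       proof (rule hw_Cond, simp, goal_cases)
        case 1
        hence lt: "card (VS z) < card S" using lV lenS cstz by (auto split: if_splits)
        \<comment> \<open>An unvisited vertex has degree at most \<open>h\<close>, so all its arcs
          were reversed. If one of them led to a visited vertex, the search would have visited its
          source.\<close>
        have "adj_closed af x (S - VS z)"
         unfolding adj_closed_def
        proof (intro ballI subsetI)
         fix v w assume v: "v : S - VS z" and w: "w : adj af x v"
         have wG: "w : G v" using w by (simp add: G_def)
         have "w ~: VS z"
         proof
         assume wV: "w : VS z"
         have "v : rev S w" using v wG bV by (auto simp: rev_def blue_def)
         hence "v : adj (bs+11) ?y1 w" using RV VSz wV by (auto simp: RV_def)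
         thus False using bfs_done_closed[OF bp dn(1) wV] v by auto
         qed
         thus "w : S - VS z" using cl v wG by auto
        qed
        hence "out_closed x (S - VS z) \<or> in_closed x (S - VS z)"
         using af unfolding adj_closed_def out_closed_def in_closed_def by (metis adj_bs)
        moreover have "VS z ~= {}" using bne bV by auto
        moreover have "VS z \<subset> S" using VSz lt by auto
        ultimately have "decided S x (setr z 38 1)" by (auto simp: decided_def out_closed_def in_closed_def)
        thus ?case by (intro hw_Assign fin) simp_all
       next
        case 2
        hence "~ card (VS z) < card S" using lV lenS cstz by (auto split: if_splits)
        hence VSS: "VS z = S" using VSz finS by (meson psubsetI psubset_card_mono)
        have re: "ALL v:VS z. EX u:blue S. (u, v) : (arcs (bs+11) ?y1)\<^sup>*"
         using bp unfolding bfs_post_def by (elim conjE)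
        have "h < card X" if X: "X \<subseteq> S" "X ~= {}" "adj_closed af x X" for X
        proof -
         obtain v where v: "v : X" using X(2) by auto
         then obtain u where u: "u : blue S" "(u, v) : (arcs (bs+11) ?y1)\<^sup>*" using re X(1) VSS by blast
         \<comment> \<open>The search path runs against the arcs. Read from its end \<open>v\<close>
           in \<open>X\<close> it follows arcs of the graph, so it stays in the closed set
           \<open>X\<close>.\<close>
         from u(2) v u(1) have "u : X"
         proof (induction rule: rtrancl_induct)
         case (step y z)
         from step.hyps(1) u(1) have "y : S"
         proof (induction rule: rtrancl_induct)
         case (step p q)
         thus ?case using RVS by (auto simp: arcs_def RV_def)
         qed (auto simp: blue_def)
         hence "z : rev S y" using step.hyps(2) RV by (auto simp: arcs_def RV_def)
         hence "y : X" using X(3) step.prems by (auto simp: rev_def adj_closed_def G_def)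
         thus ?case using step by simp
         qed
         hence "G u \<subseteq> X" using X(3) by (auto simp: adj_closed_def G_def)
         moreover have "finite X" using X(1) finS finite_subset by blast
         ultimately have "card (G u) <= card X" by (intro card_mono)
         thus ?thesis using u(1) by (simp add: blue_def)
        qed
        thus ?case by (intro hw_Assign fin) simp_all
       qed
      qed
     qed (use par2 in auto)
    next
     case 2
     hence bE: "blue S = {}" using V2 by auto
     have le: "card (G v) <= h" if "v : S" for v using that bE by (force simp: blue_def)
     have eqs: "Out x2 v = Out x v" "In x2 v = In x v" "comp x2 = comp x" "CS x2 v = CS x v" for v using fr2 by (auto simp: frame_def)
     have W: "(SUM v:S. 1 + card (Out x v) + card (In x v)) <= 3 * (card S * h)"
     proof -
      have "(SUM v:S. card (G v)) <= card S * h"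
       by (rule sum_bounded_above[where K = h, simplified]) (use le in simp)
      moreover have "(SUM v:S. card (Out x v)) = (SUM v:S. card (G v))" "(SUM v:S. card (In x v)) = (SUM v:S. card (G v))"
       using sum_out_eq_in[OF live cons, of c] S(1) af adj_bs by (auto simp: G_def)
      moreover have "(SUM v:S. 1 + card (Out x v) + card (In x v)) = card S + (SUM v:S. card (Out x v)) + (SUM v:S. card (In x v))"
       by (simp only: sum.distrib) simp
      ultimately show ?thesis using Sh(1) by linarith
     qed
     show ?case
     proof (rule hw_Decide[where c = c and S = S], goal_cases)
      case 2
      show ?case using cons fr2 by (simp add: consistent_def frame_def)
     next
      case 3
      show ?case using live unfolding live_def eqs .
     next
      case (7 T3 z)
      have "decided S x z" using 7(2) unfolding decided_def out_closed_def in_closed_def sconn_def eqs .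
      moreover have "frame {30, 31, 32, 33, 35, 36, 37, 38, 40, 41, 42, 43} {bs+9, bs+11} x z"
       using 7(1) fr2 by (auto simp: frame_def)
      moreover have "T1 + T2 + T3 + 100 <= 3000 * (card S * h)" using 7(3) W T12 Sh(2) unfolding eqs by linarith
      ultimately show ?case by (intro Q) auto
     qed (use par2 FRD[OF F2] S in auto)
    qed
   qed
  qed (use FRD F1 in \<open>auto simp: J2_def\<close>)
 qed (use FRD FR0 FRsetr in \<open>auto simp: J1_def x0_def c\<close>)
qed

text \<open>A threshold \<open>h\<close> that fails in both directions shows that all closed sets
  have more than \<open>h\<close> vertices. When a closed set is found, it and its complement are
  each closed in some direction, so \<open>h\<close> is at most twice the size of the smaller one.
  The costs of the earlier thresholds form a geometric series.\<close>

lemma hw_FindDense: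
 assumes par: "params x" and cons: "consistent x" and live: "live x"
  and c: "areg x 18 = c" and S: "CS x c = S" "S ~= {}"
  and Q: "!!T y. frame {30, 31, 32, 33, 35, 36, 37, 38, 39, 40, 41, 42, 43, 44} {bs+9, bs+11} x y ==>
   decided S x y ==> (areg y 38 = 1 ==> T <= 40000 * (card S * min (card (VS y)) (card (S - VS y)))) ==>
   (areg y 38 = 0 ==> T <= 40000 * (card S * card S)) ==> Q T y"
 shows "hw N (FindDense bs) Q x"
proof -
 have Sn: "S \<subseteq> {..<n}" using S consistentD(1)[OF cons, of c] by auto
 hence finS: "finite S" using finite_subset by blast
 have S1: "1 <= card S" using S(2) finS card_gt_0_iff[of S] by linarith
 let ?A = "{30, 31, 32, 33, 35, 36, 37, 38, 39, 40, 41, 42, 43, 44} :: nat set"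
 have frame_trans: "frame A F x z" if "frame A F x y" "frame B G y z" "B \<subseteq> A" "G \<subseteq> F" for A F B G y z
  unfolding frame_def
 proof (intro conjI allI impI)
  fix r assume r: "r ~: A"
  hence "areg z r = areg y r" using that(2,3) unfolding frame_def by (meson subsetD)
  thus "areg z r = areg x r" using that(1) r unfolding frame_def by simp
 next
  show "aarr z = aarr x" using that(1,2) unfolding frame_def by simp
 next
  fix f assume f: "f ~: F"
  hence "alst z f = alst y f" using that(2,4) unfolding frame_def by (meson subsetD)
  thus "alst z f = alst x f" using that(1) f unfolding frame_def by simp
 qed
 define FR where "FR = frame ?A {bs+9, bs+11} x"
 define big where "big = (%h. \<forall>X\<subseteq>S. X ~= {} --> out_closed x X \<or> in_closed x X --> h <= 2 * card X)"
 define I where "I = (%T y. FR y & (EX h>=1. big h &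
   (areg y 38 = 2 & areg y 39 = h & T <= 8000 * (card S * h) \<or> decided S x y & T <= 16000 * (card S * h))))"
 have FRD: "params y" "consistent y" "live y" "areg y 18 = c" "CS y c = S" "Out y v = Out x v" "In y v = In x v"
  "adj bs y v = Out x v" "adj (Suc bs) y v = In x v" if "FR y" for y v
  using that par cons live c S unfolding FR_def frame_def params_def consistent_def live_def adj_def by auto
 have dec_eq: "decided S y z \<longleftrightarrow> decided S x z" if "FR y" for y z
  unfolding decided_def out_closed_def in_closed_def sconn_def FRD(6,7)[OF that] ..
 have FR_trans: "FR z" if "FR y" "frame B F y z" "B \<subseteq> ?A" "F \<subseteq> {bs+9, bs+11}" for y z B F
  using frame_trans[of ?A "{bs+9, bs+11}" y B F z] that unfolding FR_def by simp
 have FR_setr: "FR (setr y r a)" if "FR y" "r : ?A" for y r a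
  using that(1) by (rule FR_trans[of _ "{r}" "{}"]) (use that(2) in \<open>auto simp: frame_def\<close>)
 have bigS: "h <= 2 * card S" if "big h" for h
 proof -
  have "out_closed x S" using CS_closed(1)[OF live cons, of _ c] S by (auto simp: out_closed_def)
  thus ?thesis using that S(2) unfolding big_def by blast
 qed
 have swap: "out_closed x X ==> X \<subseteq> S ==> in_closed x (S - X)" "in_closed x X ==> X \<subseteq> S ==> out_closed x (S - X)" for X
 proof -
  have sym: "w : Out x u \<longleftrightarrow> u : In x w" for u w unfolding liveD[OF live] by auto
  have "Out x v \<subseteq> S" "In x v \<subseteq> S" if "v : S" for v using CS_closed[OF live cons, of v c] that S by auto
  thus "out_closed x X ==> X \<subseteq> S ==> in_closed x (S - X)" "in_closed x X ==> X \<subseteq> S ==> out_closed x (S - X)"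
   unfolding out_closed_def in_closed_def using sym by blast+
 qed
 have dec38: "areg y 38 ~= 2" if "decided S x y" for y using that by (auto simp: decided_def)
 have dbl: "hw N (While (Reg 44) (Assign 39 (Op Add (Reg 39) (Const 1)) ;; Assign 44 (Op Sub (Reg 44) (Const 1))))
   Q' y" if y: "FR y" "areg y 44 = h'" and Q': "!!T z. FR z ==> areg z 39 = areg y 39 + h' ==> areg z 38 = areg y 38 ==>
     VS z = VS y ==> T <= 20 * h' + 5 ==> Q' T z" for Q' y h'
 proof (rule hw_While[where I = "%T z. FR z & areg z 39 + areg z 44 = areg y 39 + h' & areg z 38 = areg y 38 &
    VS z = VS y & areg z 44 <= h' & T + 20 * areg z 44 <= 20 * h'" and \<mu> = "%z. areg z 44"], goal_cases)
  case (2 T z)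
  hence "T + 10 + 20 * (areg z 44 - 1) <= 20 * h'" "areg z 44 - 1 <= h'" by auto
  thus ?case using 2 by (intro hw_Seq hw_Assign) (simp_all add: FR_setr)
 next
  case (3 T z)
  thus ?case by (intro Q') auto
 qed (use y in auto)
 let ?e = "Op Equal (Reg 38) (Const 2)"
 show ?thesis
  unfolding FindDense_def
 proof (rule hw_Seq, rule hw_Assign, simp, rule hw_Seq, rule hw_Assign, simp,
   rule hw_While[where I = I and \<mu> = "%y. if areg y 38 = 2 then Suc (2 * card S - areg y 39) else 0"], goal_cases)
  case 4
  let ?x = "setr (setr x 39 (aev x (Const 1))) 38 (aev (setr x 39 (aev x (Const 1))) (Const 2))"
  have "big 1"
   unfolding big_def
  proof (intro allI impI)
   fix X assume "X \<subseteq> S" "X ~= {}"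
   hence "0 < card X" using finS finite_subset card_gt_0_iff by blast
   thus "1 <= 2 * card X" by simp
  qed
  moreover have "FR ?x" by (simp add: FR_def frame_def)
  ultimately show ?case unfolding I_def by auto
 next
  case 1
  show ?case by simp
 next
  case (3 T y)
  have "areg y 38 ~= 2" using 3(2) by (auto split: if_splits)
  then obtain h where Fy: "FR y" and h: "1 <= h" "T <= 16000 * (card S * h)" "big h" and d: "decided S x y"
   using 3(1) by (auto simp: I_def)
  show ?case
  proof (rule Q)
   show "frame ?A {bs+9, bs+11} x y" using Fy by (simp add: FR_def)
   assume "areg y 38 = 1"
   hence V: "VS y ~= {}" "VS y \<subset> S" and cl: "out_closed x (VS y) \<or> in_closed x (VS y) \<or> out_closed x (S - VS y) \<or> in_closed x (S - VS y)"
    using d by (auto simp: decided_def)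
   have Vd: "S - (S - VS y) = VS y" using V by auto
   have a: "out_closed x (VS y) \<or> in_closed x (VS y)" "out_closed x (S - VS y) \<or> in_closed x (S - VS y)"
    using cl swap[of "VS y"] swap[of "S - VS y"] V(2) unfolding Vd by auto
   have ne: "S - VS y ~= {}" using V(2) by auto
   have "h <= 2 * card (VS y)" using h(3) V a(1) unfolding big_def by (meson psubset_imp_subset)
   moreover have "h <= 2 * card (S - VS y)" using h(3) ne a(2) unfolding big_def by (meson Diff_subset)
   ultimately have "h <= 2 * min (card (VS y)) (card (S - VS y))" by simp
   moreover have "1 <= min (card (VS y)) (card (S - VS y))"
   proof -
    have "0 < card (VS y)" "0 < card (S - VS y)" using V(1) ne finS by (auto simp: card_gt_0_iff)
    thus ?thesis by simp
   qed
   ultimately have "T + 100 <= 16000 * (card S * (2 * min (card (VS y)) (card (S - VS y)))) + 100 * (card S * min (card (VS y)) (card (S - VS y)))"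
    using h(2) S1 by (intro add_mono order_trans[OF h(2)] mult_le_mono2 ) (simp_all add: Suc_le_eq)
   thus "cost (Const 1) + 1 + (cost (Const 2) + 1 + (T + cost ?e + 1)) <= 40000 * (card S * min (card (VS y)) (card (S - VS y)))"
    by simp
  next
   assume "areg y 38 = 0"
   have "T + 100 <= 16000 * (card S * (2 * card S)) + 100 * (card S * card S)"
    using bigS[OF h(3)] S1 by (intro add_mono order_trans[OF h(2)] mult_le_mono2) (simp_all add: Suc_le_eq)
   thus "cost (Const 1) + 1 + (cost (Const 2) + 1 + (T + cost ?e + 1)) <= 40000 * (card S * card S)"
    by simp
  qed (rule d)
 next
  case (2 T y)
  have r38: "areg y 38 = 2" using 2(2) by (auto split: if_splits)
  then obtain h where Fy: "FR y" and h: "1 <= h" "T <= 8000 * (card S * h)" "big h" "areg y 39 = h"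
   using 2(1) dec38 by (auto simp: I_def)
  have h1: "1 <= card S * h" using h(1) S1 by simp
  have hS: "h <= card S * h" using S1 by simp
  have fin: "I (T + cost ?e + 1 + U) z & (if areg z 38 = 2 then Suc (2 * card S - areg z 39) else 0) <
     (if areg y 38 = 2 then Suc (2 * card S - areg y 39) else 0)"
   if "FR z" "decided S x z \<or> areg z 38 = 2 & areg z 39 = h + h & big (h + h)" "U <= 6000 * (card S * h) + 20 * h + 100" for U z
  proof -
   have U: "T + cost ?e + 1 + U <= 16000 * (card S * h)"
   proof -
    have "T + 100 + U <= 16000 * (card S * h)" using h(2) that(3) h1 hS by linarith
    thus ?thesis by simp
   qed
   show ?thesis
   proof (cases "decided S x z")
    case True
    have "I (T + cost ?e + 1 + U) z"
     unfolding I_def using that(1) U True h(1,3) by blast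
    thus ?thesis using dec38[OF True] r38 by simp
   next
    case False
    hence z: "areg z 38 = 2" "areg z 39 = h + h" "big (h + h)" using that(2) by auto
    have "T + cost ?e + 1 + U <= 8000 * (card S * (h + h))" using U by (simp add: algebra_simps)
    hence "I (T + cost ?e + 1 + U) z"
     unfolding I_def using that(1) z h(1) by (intro conjI exI[of _ "h + h"]) auto
    thus ?thesis using z bigS[OF z(3)] h r38 by simp
   qed
  qed
  define P where "P = (%U z. I (T + cost ?e + 1 + U) z & (if areg z 38 = 2 then Suc (2 * card S - areg z 39) else 0) <
     (if areg y 38 = 2 then Suc (2 * card S - areg y 39) else 0))"
  have tail: "hw N (Assign 44 (Reg 39) ;; While (Reg 44) (Assign 39 (Op Add (Reg 39) (Const 1)) ;; Assign 44 (Op Sub (Reg 44) (Const 1))))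
    (%t. P (U + t)) z" if z: "FR z" "areg z 39 = h" "decided S x z \<or> areg z 38 = 2 & big (h + h)" "U <= 6000 * (card S * h) + 50" for U z
  proof (rule hw_Seq, rule hw_Assign, simp, rule dbl[where h' = h], goal_cases)
   case (3 V w)
   have "decided S x w \<longleftrightarrow> decided S x z" using 3(3,4) by (simp add: decided_def)
   thus ?case unfolding P_def using 3 z by (intro fin) auto
  qed (use z FR_setr in auto)
  have Psimp: "(%t x'. I (T + cost ?e + 1 + t) x' & (if areg x' 38 = 2 then Suc (2 * card S - areg x' 39) else 0) <
     (if areg y 38 = 2 then Suc (2 * card S - areg y 39) else 0)) = P" by (simp add: P_def)
  show ?case
   unfolding Psimp
  proof (rule hw_Seq, rule hw_Level[where c = c and S = S and h = h and af = bs], goal_cases)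
   case (10 T1 y1)
   have F1: "FR y1" by (rule FR_trans[OF Fy 10(1)]) auto
   have r39: "areg y1 39 = h" using 10(1) h(4) by (simp add: frame_def)
   have d1: "decided S x y1 \<or> areg y1 38 = 2 & (\<forall>X\<subseteq>S. X ~= {} --> out_closed x X --> h < card X)"
    using 10(2) unfolding dec_eq[OF Fy] adj_closed_def FRD(8)[OF Fy] out_closed_def .
   show ?case
   proof (rule hw_Seq, rule hw_Cond, simp, goal_cases)
    case 1
    hence r38': "areg y1 38 = 2" by (auto split: if_splits)
    hence o: "\<forall>X\<subseteq>S. X ~= {} --> out_closed x X --> h < card X" using d1 dec38 by blast
    show ?case
    proof (rule hw_Level[where c = c and S = S and h = h and af = "Suc bs"], goal_cases)
     case (10 T2 y2)
     have F2: "FR y2" by (rule FR_trans[OF F1 10(1)]) auto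
     have r39': "areg y2 39 = h" using 10(1) r39 by (simp add: frame_def)
     have d2: "decided S x y2 \<or> areg y2 38 = 2 & (\<forall>X\<subseteq>S. X ~= {} --> in_closed x X --> h < card X)"
      using 10(2) unfolding dec_eq[OF F1] adj_closed_def FRD(9)[OF F1] in_closed_def .
     have "big (h + h)" if i: "\<forall>X\<subseteq>S. X ~= {} --> in_closed x X --> h < card X"
      unfolding big_def
     proof (intro allI impI)
      fix X assume X: "X \<subseteq> S" "X ~= {}" "out_closed x X \<or> in_closed x X"
      hence "h < card X" using o i by metis
      thus "h + h <= 2 * card X" by simp
     qed
     hence d2': "decided S x y2 \<or> areg y2 38 = 2 & big (h + h)" using d2 by metis
     have "hw N (Assign 44 (Reg 39) ;; While (Reg 44) (Assign 39 (Op Add (Reg 39) (Const 1)) ;; Assign 44 (Op Sub (Reg 44) (Const 1))))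
       (%t. P ((T1 + (cost ?e + 1 + T2)) + t)) y2"
      by (rule tail[OF F2 r39' d2']) (use `T1 <= 3000 * (card S * h)` 10(3) in simp)
     thus ?case by (simp add: algebra_simps)
    qed (use FRD[OF F1] S r39 h in auto)
   next
    case 2
    hence "areg y1 38 ~= 2" by (auto split: if_splits)
    hence d1': "decided S x y1 \<or> areg y1 38 = 2 & big (h + h)" using d1 by metis
    have "hw N (Assign 44 (Reg 39) ;; While (Reg 44) (Assign 39 (Op Add (Reg 39) (Const 1)) ;; Assign 44 (Op Sub (Reg 44) (Const 1))))
       (%t. P ((T1 + (cost ?e + 1 + 1)) + t)) y1"
     by (rule tail[OF F1 r39 d1']) (use 10(3) in simp)
    thus ?case by (intro hw_Skip) (simp add: algebra_simps)
   qed
  qed (use FRD[OF Fy] S h in auto)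
 qed
qed

end

section \<open>Potentials\<close>

context engine
begin

definition cls :: "(nat => nat) => nat => nat set" where "cls cf c = {w. w < n & cf w = c}"
definition oe :: "(nat => nat) => nat => nat set" where "oe cf v = {w. (v, w) : E & cf v = cf w}"
definition ie :: "(nat => nat) => nat => nat set" where "ie cf v = {u. (u, v) : E & cf u = cf v}"
definition dg :: "nat => nat" where "dg v = card {w. (v, w) : E} + card {u. (u, v) : E}"
definition mm :: "nat => nat" where "mm v = card {j. j < b & mv j = v}"
definition csz :: "(nat => nat) => nat => nat" where "csz cf v = card (cls cf (cf v))"

text \<open>A vertex that goes to the smaller half pays \<open>q v\<close>, since the logarithm of
  its class size drops by at least 1.\<close>

definition pot_log :: "(nat => nat) => (nat => nat) => real" where
 "pot_log q cf = (SUM v<n. real (q v) * log 2 (real (csz cf v)))"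
text \<open>The sum of the squares of the sizes of the classes from number \<open>cur\<close> on.
  Splitting a class into parts of sizes a and b lowers it by 2 a b, finishing a class lowers it by
  the square of its size.\<close>

definition pot_sq :: "nat => (nat => nat) => nat" where
 "pot_sq cur cf = (SUM v | v < n & cur <= cf v. csz cf v)"
definition pot_live :: "(nat => nat) => nat" where "pot_live cf = (SUM v<n. card (oe cf v))"
definition cedges :: "(nat => nat) => nat => nat" where "cedges cf c = (SUM v:cls cf c. card (oe cf v))"
text \<open>The function max 0 (x - 1) is superadditive, and it gains 1 when both summands are at
  least 1. So each split into two parts with more than \<open>D\<close> edges lowers this sum by at
  least 1, while its initial value is at most m / D.\<close>

definition pot_big :: "nat => nat => (nat => nat) => real" where
 "pot_big D nid cf = (SUM c<nid. max 0 (real (cedges cf c) / real D - 1))"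
definition pot_todo :: "nat => (nat => nat) => nat" where
 "pot_todo cur cf = (SUM v | v < n & cur <= cf v. 1 + card (oe cf v) + card (ie cf v))"

lemma fin_nbh [simp]: "finite {w. (v, w) : E}" "finite {u. (u, v) : E}" "finite E"
 "finite (oe cf v)" "finite (ie cf v)" "finite (cls cf c)"
proof -
 have *: "{w. (v, w) : E} \<subseteq> {..<n}" "{u. (u, v) : E} \<subseteq> {..<n}" using E by auto
 show "finite {w. (v, w) : E}" "finite {u. (u, v) : E}" using *[THEN finite_subset] by auto
 thus "finite (oe cf v)" "finite (ie cf v)" unfolding oe_def ie_def
  by (auto elim: rev_finite_subset)
 show "finite E" using E finite_subset by blast
 show "finite (cls cf c)" by (simp add: cls_def)
qed

lemma oe_le: "card (oe cf v) + card (ie cf v) <= dg v"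
 unfolding dg_def by (intro add_mono card_mono) (auto simp: oe_def ie_def)

lemma cls_mem: "v < n ==> v : cls cf (cf v)"
 by (simp add: cls_def)

lemma csz_pos: "v < n ==> 1 <= csz cf v"
 unfolding csz_def using cls_mem[of v cf] card_gt_0_iff[of "cls cf (cf v)"] by (auto simp: Suc_le_eq)

lemma live_eq: "live x ==> Out x v = oe (comp x) v" "live x ==> In x v = ie (comp x) v"
 by (auto simp: liveD oe_def ie_def)

lemma CS_eq: "consistent x ==> CS x c = cls (comp x) c"
 by (auto simp: consistentD cls_def)

lemma MS_eq: "params x ==> v < n ==> card (MS x v) = mm v"
 by (simp add: MS mm_def)

lemma cedges_in: "cedges cf c = (SUM v:cls cf c. card (ie cf v))"
proof -
 have "cedges cf c = card (SIGMA v:cls cf c. oe cf v)" by (simp add: cedges_def)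
 also have "(SIGMA v:cls cf c. oe cf v) = prod.swap ` (SIGMA v:cls cf c. ie cf v)"
 proof -
  have *: "u : cls cf c & v : oe cf u \<longleftrightarrow> v : cls cf c & u : ie cf v" for u v
   using E by (auto simp: cls_def oe_def ie_def)
  have "(u, v) : prod.swap ` X \<longleftrightarrow> (v, u) : X" for u v :: nat and X by force
  thus ?thesis by (simp add: set_eq_iff split_paired_all *)
 qed
 also have "card ... = card (SIGMA v:cls cf c. ie cf v)" by (simp add: card_image)
 finally show ?thesis by simp
qed

lemma pot_live_le: "pot_live cf <= m"
proof -
 have "pot_live cf = card (SIGMA v:{..<n}. oe cf v)" by (simp add: pot_live_def)
 also have "... <= card E" by (intro card_mono) (auto simp: oe_def)
 finally show ?thesis using m by simp
qed

lemma sum_dg: "(SUM v<n. dg v) <= 2 * m"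
proof -
 have "(SUM v<n. card {w. (v, w) : E}) = card (SIGMA v:{..<n}. {w. (v, w) : E})" by simp
 also have "... <= card E" by (intro card_mono) auto
 finally have 1: "(SUM v<n. card {w. (v, w) : E}) <= m" using m by simp
 have "(SUM v<n. card {u. (u, v) : E}) = card (SIGMA v:{..<n}. {u. (u, v) : E})" by simp
 also have "... = card (prod.swap ` (SIGMA v:{..<n}. {u. (u, v) : E}))" by (simp add: card_image)
 also have "... <= card E" by (intro card_mono) auto
 finally have "(SUM v<n. card {u. (u, v) : E}) <= m" using m by simp
 with 1 show ?thesis by (simp add: dg_def sum.distrib)
qed

lemma sum_mm: "(SUM v<n. mm v) <= b"
proof -
 have "(SUM v<n. mm v) = card (\<Union>v<n. {j. j < b & mv j = v})"
  unfolding mm_def by (rule card_UN_disjoint[symmetric]) auto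
 also have "... <= card {..<b}" by (intro card_mono) auto
 finally show ?thesis by simp
qed

lemma n_le_m: "n <= m"
proof -
 obtain f where f: "!!v. v < n ==> (v, f v) : E" using out by metis
 have "n = card ((%v. (v, f v)) ` {..<n})" by (simp add: card_image inj_on_def)
 also have "... <= card E" using f by (intro card_mono) auto
 finally show ?thesis using m by simp
qed

section \<open>Effect of one split on the potentials\<close>

context
 fixes cf cf' :: "nat => nat" and A :: "nat set" and c c' :: nat
 assumes A: "A \<subseteq> cls cf c" "A ~= {}" and c': "!!v. v < n ==> cf v < c'"
  and cf': "cf' = (%v. if v : A then c' else cf v)"
begin

lemma split_A: "A \<subseteq> {..<n}" "!!v. v : A ==> cf v = c" "c < c'" "finite A"
proof -
 show "A \<subseteq> {..<n}" "!!v. v : A ==> cf v = c" using A by (auto simp: cls_def)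
 thus "c < c'" using A(2) c' by fastforce
 show "finite A" by (rule finite_subset[OF A(1)]) simp
qed

lemma split_cls: "cls cf' d = (if d = c' then A else if d = c then cls cf c - A else cls cf d)"
proof (rule set_eqI)
 fix v
 have "v < n ==> cf v ~= c'" using c'[of v] by simp
 moreover have "v : A ==> v < n & cf v = c" using split_A(1,2) by auto
 moreover have "c ~= c'" using split_A(3) by simp
 ultimately show "v : cls cf' d \<longleftrightarrow> v : (if d = c' then A else if d = c then cls cf c - A else cls cf d)"
  by (cases "v : A"; cases "v < n"; simp add: cls_def cf')
qed

lemma split_csz: "v < n ==> csz cf' v = (if v : A then card A else if cf v = c then card (cls cf c) - card A else csz cf v)"
proof -
 assume "v < n"
 hence "cf v ~= c'" using c'[of v] by simp
 moreover have "v : A ==> cf v = c" using split_A(2) by simp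
 ultimately show ?thesis unfolding csz_def split_cls
  by (simp add: cf' card_Diff_subset[OF split_A(4) A(1)])
qed

lemma split_csz_le: "v < n ==> csz cf' v <= csz cf v"
proof -
 assume v: "v < n"
 have "card A <= card (cls cf c)" using card_mono[OF _ A(1)] by simp
 moreover have "v : A ==> cf v = c" using split_A(2) by simp
 ultimately show ?thesis using split_csz[OF v] by (auto simp: csz_def)
qed

lemma split_eq_cf: "u < n ==> w < n ==> cf' u = cf' w ==> cf u = cf w"
proof -
 assume "u < n" "w < n" and eq: "cf' u = cf' w"
 hence "cf u ~= c'" "cf w ~= c'" using c'[of u] c'[of w] by auto
 moreover have "u : A ==> cf u = c" "w : A ==> cf w = c" using split_A(2) by auto
 ultimately show ?thesis using eq by (cases "u : A"; cases "w : A"; simp add: cf')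
qed

lemma split_oe: "oe cf' v \<subseteq> oe cf v" "ie cf' v \<subseteq> ie cf v"
proof -
 have "u < n & w < n" if "(u, w) : E" for u w using that E by auto
 thus "oe cf' v \<subseteq> oe cf v" "ie cf' v \<subseteq> ie cf v"
  unfolding oe_def ie_def using split_eq_cf by blast+
qed

lemma pot_log_split: "pot_log q cf' <= pot_log q cf"
 unfolding pot_log_def
proof (intro sum_mono mult_left_mono)
 fix v assume v: "v : {..<n}"
 show "log 2 (real (csz cf' v)) <= log 2 (real (csz cf v))"
  using csz_pos[of v cf'] split_csz_le[of v] v by simp
qed simp

lemma pot_log_split_half:
 assumes "2 * card A <= card (cls cf c)"
 shows "pot_log q cf' + (SUM v:A. real (q v)) <= pot_log q cf"
proof -
 have "(SUM v:A. real (q v)) = (SUM v<n. if v : A then real (q v) else 0)"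
  using split_A(1) by (simp add: sum.If_cases Int_absorb1)
 hence "pot_log q cf' + (SUM v:A. real (q v)) =
   (SUM v<n. real (q v) * log 2 (real (csz cf' v)) + (if v : A then real (q v) else 0))"
  by (simp add: pot_log_def sum.distrib)
 also have "... <= pot_log q cf"
  unfolding pot_log_def
 proof (intro sum_mono)
  fix v assume v: "v : {..<n}"
  have le: "log 2 (real (csz cf' v)) <= log 2 (real (csz cf v))"
   using csz_pos[of v cf'] split_csz_le[of v] v by simp
  show "real (q v) * log 2 (real (csz cf' v)) + (if v : A then real (q v) else 0) <= real (q v) * log 2 (real (csz cf v))"
  proof (cases "v : A")
   case True
   have cA: "0 < card A" using A(2) split_A(4) card_gt_0_iff by blast
   have "log 2 (real (csz cf' v)) + 1 = log 2 (2 * real (card A))"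
    using True v cA by (simp add: split_csz log_mult)
   also have "... <= log 2 (real (csz cf v))"
    using assms cA True split_A(2) by (simp add: csz_def)
   finally have "real (q v) * (log 2 (real (csz cf' v)) + 1) <= real (q v) * log 2 (real (csz cf v))"
    by (intro mult_left_mono) auto
   thus ?thesis using True by (simp add: algebra_simps)
  next
   case False
   thus ?thesis using le by (simp add: mult_left_mono)
  qed
 qed
 finally show ?thesis .
qed

lemma sum_cls_split:
 fixes f g :: "nat => nat"
 assumes cur: "cur <= c"
 shows "(SUM v | v < n & cur <= cf' v. f v) = (SUM v | v < n & cur <= cf v. f v)"
proof (rule sum.cong)
 show "{v. v < n & cur <= cf' v} = {v. v < n & cur <= cf v}"
  using cur split_A(2,3) unfolding cf' by (force split: if_splits)
qed simp

lemma pot_sq_split: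
 assumes cur: "cur <= c"
 shows "pot_sq cur cf' + 2 * (card A * card (cls cf c - A)) = pot_sq cur cf"
proof -
 let ?V = "{v. v < n & cur <= cf v}" and ?S = "cls cf c"
 have S: "?S \<subseteq> ?V" using cur by (auto simp: cls_def)
 have fV: "finite ?V" by simp
 have cd: "card (?S - A) = card ?S - card A" "card A <= card ?S"
  using card_Diff_subset[OF split_A(4) A(1)] card_mono[OF _ A(1)] by auto
 have sp: "sum f ?V = sum f (?V - ?S) + (sum f (?S - A) + sum f A)" for f :: "nat => nat"
  using sum.subset_diff[OF S fV, of f] sum.subset_diff[OF A(1), of f] by simp
 have 1: "sum (csz cf') (?V - ?S) = sum (csz cf) (?V - ?S)"
  using split_A(2) by (intro sum.cong) (auto simp: split_csz cls_def)
 have 2: "sum (csz cf') (?S - A) = card (?S - A) * card (?S - A)"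
 proof -
  have "sum (csz cf') (?S - A) = (SUM v:?S - A. card (?S - A))"
  proof (rule sum.cong)
   fix v assume v: "v : ?S - A"
   hence "v < n" "cf v = c" by (auto simp: cls_def)
   thus "csz cf' v = card (?S - A)" using v cd(1) by (simp add: split_csz)
  qed simp
  thus ?thesis by simp
 qed
 have 3: "sum (csz cf') A = card A * card A"
 proof -
  have "sum (csz cf') A = (SUM v:A. card A)" using split_A(1) by (intro sum.cong) (auto simp: split_csz)
  thus ?thesis by simp
 qed
 have 4: "sum (csz cf) (?S - A) = card (?S - A) * card ?S"
 proof -
  have "sum (csz cf) (?S - A) = (SUM v:?S - A. card ?S)" by (intro sum.cong) (auto simp: csz_def cls_def)
  thus ?thesis by simp
 qed
 have 5: "sum (csz cf) A = card A * card ?S"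
 proof -
  have "sum (csz cf) A = (SUM v:A. card ?S)" using split_A(2) by (intro sum.cong) (auto simp: csz_def)
  thus ?thesis by simp
 qed
 have cS: "card ?S = card (?S - A) + card A" using cd by simp
 have "pot_sq cur cf' = sum (csz cf') ?V" unfolding pot_sq_def by (rule sum_cls_split[OF cur])
 also have "... + 2 * (card A * card (?S - A)) = sum (csz cf) ?V"
  unfolding sp[of "csz cf'"] sp[of "csz cf"] 1 2 3 4 5 cS by (simp add: algebra_simps)
 finally show ?thesis by (simp add: pot_sq_def)
qed

lemma pot_todo_split:
 assumes cur: "cur <= c"
 shows "pot_todo cur cf' <= pot_todo cur cf"
proof -
 have "pot_todo cur cf' = (SUM v | v < n & cur <= cf v. 1 + card (oe cf' v) + card (ie cf' v))"
  unfolding pot_todo_def by (rule sum_cls_split[OF cur])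
 also have "... <= pot_todo cur cf"
  unfolding pot_todo_def using split_oe by (intro sum_mono add_mono card_mono) auto
 finally show ?thesis .
qed

text \<open>A cut edge adds at most one vertex to each queue and is no longer live, which explains
  the factor 2.\<close>

lemma pot_live_split:
 assumes "Q1' = Q1 Un {u. EX w. (u, w) : E & cf u = cf w & cf' u ~= cf' w}"
  "Q2' = Q2 Un {w. EX u. (u, w) : E & cf u = cf w & cf' u ~= cf' w}"
 shows "card Q1' + card Q2' + 2 * pot_live cf' <= card Q1 + card Q2 + 2 * pot_live cf"
proof -
 define R where "R = {(u, w). (u, w) : E & cf u = cf w & cf' u ~= cf' w}"
 have fR: "finite R" by (rule finite_subset[OF _ fin_nbh(3)]) (auto simp: R_def)
 have "{u. EX w. (u, w) : E & cf u = cf w & cf' u ~= cf' w} = fst ` R" by (force simp: R_def)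
 hence 1: "card Q1' <= card Q1 + card R"
  unfolding assms using card_Un_le[of Q1 "fst ` R"] card_image_le[OF fR, of fst] by simp
 have "{w. EX u. (u, w) : E & cf u = cf w & cf' u ~= cf' w} = snd ` R" by (force simp: R_def)
 hence 2: "card Q2' <= card Q2 + card R"
  unfolding assms using card_Un_le[of Q2 "snd ` R"] card_image_le[OF fR, of snd] by simp
 have "pot_live cf = card (SIGMA v:{..<n}. oe cf v)" by (simp add: pot_live_def)
 also have "(SIGMA v:{..<n}. oe cf v) = (SIGMA v:{..<n}. oe cf' v) Un R"
 proof -
  have "u < n & w < n" if "(u, w) : E" for u w using that E by auto
  thus ?thesis unfolding R_def oe_def using split_eq_cf by blast
 qed
 also have "card ... = card (SIGMA v:{..<n}. oe cf' v) + card R"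
  using fR by (intro card_Un_disjoint) (auto simp: R_def oe_def)
 also have "card (SIGMA v:{..<n}. oe cf' v) = pot_live cf'" by (simp add: pot_live_def)
 finally show ?thesis using 1 2 by simp
qed

lemma cedges_split: "cedges cf' c + cedges cf' c' <= cedges cf c" "d ~= c ==> d < c' ==> cedges cf' d = cedges cf d"
proof -
 have "cedges cf' c + cedges cf' c' = (SUM v:cls cf c - A. card (oe cf' v)) + (SUM v:A. card (oe cf' v))"
  unfolding cedges_def split_cls using split_A(3) by simp
 also have "... = (SUM v:cls cf c. card (oe cf' v))" by (rule sum.subset_diff[OF A(1) fin_nbh(6), symmetric])
 also have "... <= cedges cf c" unfolding cedges_def using split_oe by (intro sum_mono card_mono) auto
 finally show "cedges cf' c + cedges cf' c' <= cedges cf c" .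
 assume d: "d ~= c" "d < c'"
 have "oe cf' v = oe cf v" if "v : cls cf d" for v
 proof -
  have v: "v < n" "cf v = d" using that by (auto simp: cls_def)
  have "v ~: A" using split_A(2) v d by auto
  hence cv: "cf' v = d" using v by (simp add: cf')
  have "w < n" "w : A ==> cf w = c" if "(v, w) : E" for w using that E split_A(2) by auto
  thus ?thesis unfolding oe_def cv v using d(1) `d < c'` split_A(3) by (auto simp: cf')
 qed
 thus "cedges cf' d = cedges cf d" unfolding cedges_def split_cls using d by (auto intro: sum.cong)
qed

lemma pot_big_split:
 shows "pot_big D (Suc c') cf' <= pot_big D c' cf"
  and "0 < D ==> D < cedges cf' c ==> D < cedges cf' c' ==> pot_big D (Suc c') cf' + 1 <= pot_big D c' cf"
proof -
 define g where "g = (%q::nat. max 0 (real q / real D - 1))"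
 have sp: "(SUM d<c'. f d) = (SUM d:{..<c'} - {c}. f d) + f c" for f :: "nat => real"
  using split_A(3) by (subst sum.remove[of _ c]) auto
 have pb: "pot_big D M q = (SUM d<M. g (cedges q d))" for M q by (simp add: pot_big_def g_def)
 have 1: "pot_big D (Suc c') cf' = (SUM d:{..<c'} - {c}. g (cedges cf d)) + g (cedges cf' c) + g (cedges cf' c')"
 proof -
  have "(SUM d:{..<c'} - {c}. g (cedges cf' d)) = (SUM d:{..<c'} - {c}. g (cedges cf d))"
   using cedges_split(2) by (intro sum.cong) auto
  thus ?thesis unfolding pb by (simp add: sp)
 qed
 have 2: "pot_big D c' cf = (SUM d:{..<c'} - {c}. g (cedges cf d)) + g (cedges cf c)"
  unfolding pb by (rule sp)
 have arith: "max 0 (a - 1) + max 0 (q - 1) <= max 0 (s - 1)" "1 <= a ==> 1 <= q ==> max 0 (a - 1) + max 0 (q - 1) + 1 <= max 0 (s - 1)"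
  if "a + q <= s" "0 <= a" "0 <= q" for a q s :: real using that by (auto simp: max_def)
 have div: "real (cedges cf' c) / real D + real (cedges cf' c') / real D <= real (cedges cf c) / real D"
  using cedges_split(1) by (simp add: divide_right_mono flip: add_divide_distrib)
 have nn: "0 <= real q / real D" for q :: nat by simp
 show "pot_big D (Suc c') cf' <= pot_big D c' cf"
  unfolding 1 2 using arith(1)[OF div nn nn] by (simp add: g_def)
 assume D: "0 < D" "D < cedges cf' c" "D < cedges cf' c'"
 have "1 <= real (cedges cf' c) / real D" "1 <= real (cedges cf' c') / real D" using D by auto
 thus "pot_big D (Suc c') cf' + 1 <= pot_big D c' cf"
  unfolding 1 2 using arith(2)[OF div nn nn] by (simp add: g_def)
qed

end

end

section \<open>The main loop\<close>

definition PartSplit :: "nat => com" where "PartSplit bs = MakePart bs ;; Split bs"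

definition Kill :: "nat => com" where
 "Kill bs = Pop (bs+6) 0 (Const 0) 37 ;; Write (bs+8) (Reg 37) (Const 1) ;;
   Assign 18 (Read (bs+7) (Reg 37)) ;; Clear (bs+10) (Const 0) ;;
   Insert (bs+10) 0 (Const 0) (Reg 37) ;; Split bs"

text \<open>Register 7 holds the budget. The result is used only if the search was completed and has
  not visited the whole component.\<close>

definition PopSearch :: "nat => nat => nat => com" where
 "PopSearch bs q af = Pop q 0 (Const 0) 37 ;; Assign 18 (Read (bs+7) (Reg 37)) ;; Assign 33 (Reg 7) ;;
   BFS_from bs af 37 ;;
   Cond (Op Mul (Reg 31) (Op Less (Cnt (bs+9) (Const 0)) (Cnt (bs+2) (Reg 18)))) (PartSplit bs) Skip"

text \<open>Register 4 is the cursor, below which all components are settled. A component can be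
  empty: \<open>Kill\<close> splits off a vertex even if it is alone, and without vertices the
  initial component is empty.\<close>

definition Process :: "nat => com" where
 "Process bs = Assign 18 (Reg 4) ;;
   Cond (Cnt (bs+2) (Reg 18))
    (Assign 37 (Elt (bs+2) 0 (Reg 18) (Const 0)) ;;
    Cond (Read (bs+8) (Reg 37)) (Assign 38 (Const 0)) (Cond (Reg 6) (FindDense bs) (Decide bs)) ;;
    Cond (Reg 38) (PartSplit bs) (Assign 4 (Op Add (Reg 4) (Const 1))))
    (Assign 4 (Op Add (Reg 4) (Const 1)))"

text \<open>A component is examined as a whole only when no vertex is doomed and, in the sparse
  variant (register 6 is 0), both queues are empty; by \<open>qinv\<close> a split then found has
  two large parts.\<close>

definition Main :: "nat => com" where
 "Main bs = While (Op Less (Reg 4) (Reg 5))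
   (Cond (Cnt (bs+6) (Const 0)) (Kill bs)
    (Cond (Op Mul (Op Equal (Reg 6) (Const 0)) (Cnt (bs+7) (Const 0))) (PopSearch bs (bs+7) bs)
     (Cond (Op Mul (Op Equal (Reg 6) (Const 0)) (Cnt (bs+8) (Const 0))) (PopSearch bs (bs+8) (Suc bs))
      (Process bs))))"

context engine
begin

section \<open>Invariants of the main loop\<close>

definition gec :: "nat set => bool" where
 "gec X \<longleftrightarrow> X ~= {} & X \<subseteq> {..<n} & (ALL v:X Int Rand. ALL w. (v, w) : E --> w : X) &
   (ALL v:X. EX w:X. (v, w) : E) & (ALL u:X. ALL w:X. (u, w) : (E Int X \<times> X)\<^sup>*) &
   (ALL i<k. L i Int X ~= {} --> U i Int X ~= {})"

definition lost :: "nat => bool" where "lost v \<longleftrightarrow> (ALL X. gec X --> v ~: X)"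

definition ocl :: "(nat => nat) => nat set => bool" where "ocl cf X \<longleftrightarrow> (ALL v:X. oe cf v \<subseteq> X)"
definition icl :: "(nat => nat) => nat set => bool" where "icl cf X \<longleftrightarrow> (ALL v:X. ie cf v \<subseteq> X)"

text \<open>A set becomes closed or small only by losing an edge, and the vertex that lost it is
  queued. If both queues are empty, every closed proper part of a class has more than
  \<open>D\<close> edges.\<close>

definition qinv :: "nat => (nat => nat) => nat set => nat set => bool" where
 "qinv D cf Q1 Q2 \<longleftrightarrow> (ALL c X. X ~= {} --> X \<subset> cls cf c -->
   (ocl cf X --> (SUM v:X. card (oe cf v)) <= D --> X Int Q1 ~= {}) &
   (icl cf X --> (SUM v:X. card (ie cf v)) <= D --> X Int Q2 ~= {}))"

lemma closed_eq: "live x ==> out_closed x X = ocl (comp x) X" "live x ==> in_closed x X = icl (comp x) X"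
 by (simp_all add: out_closed_def in_closed_def ocl_def icl_def live_eq)

text \<open>Register 4 is the cursor and register 5 the next free component number. The classes
  never separate a good end component, which makes every violation within a class a proof that the
  vertex is lost.\<close>

definition core :: "astate => bool" where
 "core x \<longleftrightarrow> params x & consistent x & live x &
   (ALL v. v < n --> dead x v = 0 --> viol (comp x) v --> v : Dm x) &
   (ALL v. v < n --> comp x v < areg x 5) & areg x 4 <= areg x 5 &
   (ALL v. v : Dm x --> v < n & dead x v = 0 & lost v) & (ALL v. v < n --> dead x v ~= 0 --> lost v) &
   (ALL X. gec X --> (ALL u:X. ALL w:X. comp x u = comp x w)) &
   (ALL v. v < n --> comp x v < areg x 4 --> dead x v = 0 --> v ~: Dm x & sconn x (cls (comp x) (comp x v)))"

text \<open>Kept apart from \<open>core\<close> because \<open>Kill\<close> marks the vertex as dead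
  before it is split off.\<close>

definition dead_single :: "astate => bool" where
 "dead_single x \<longleftrightarrow> (ALL v. v < n --> dead x v ~= 0 --> cls (comp x) (comp x v) = {v})"

lemma coreD:
 assumes "core x"
 shows "params x" "consistent x" "live x" "v < n ==> dead x v = 0 ==> viol (comp x) v ==> v : Dm x"
  "v < n ==> comp x v < areg x 5" "areg x 4 <= areg x 5"
  "v : Dm x ==> v < n" "v : Dm x ==> dead x v = 0" "v : Dm x ==> lost v"
  "v < n ==> dead x v ~= 0 ==> lost v" "gec X ==> u : X ==> w : X ==> comp x u = comp x w"
  "v < n ==> comp x v < areg x 4 ==> dead x v = 0 ==> v ~: Dm x"
  "v < n ==> comp x v < areg x 4 ==> dead x v = 0 ==> sconn x (cls (comp x) (comp x v))"
 using assms unfolding core_def by blast+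

lemma viol_lost:
 assumes "!!X u w. gec X ==> u : X ==> w : X ==> cf u = cf w" "viol cf v"
 shows "lost v"
 unfolding lost_def
proof (intro allI impI notI)
 fix X assume X: "gec X" "v : X"
 have cst: "cf w = cf v" if "w : X" for w using assms(1)[OF X(1)] X(2) that by blast
 from assms(2) show False
  unfolding viol_def
 proof (elim disjE exE conjE bexE)
  fix w assume "v : Rand" "(v, w) : E" "cf w ~= cf v"
  thus False using X cst unfolding gec_def by blast
 next
  assume "ALL w. (v, w) : E --> cf w ~= cf v"
  moreover obtain w where "w : X" "(v, w) : E" using X unfolding gec_def by blast
  ultimately show False using cst by blast
 next
  fix i assume i: "i < k" "v : L i" and u: "ALL u:U i. cf u ~= cf v"
  have "L i Int X ~= {}" using i X by blast
  then obtain u where "u : U i" "u : X" using X(1) i(1) unfolding gec_def by blast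
  thus False using u cst by blast
 qed
qed

text \<open>A strongly connected set inside one class cannot cross the border of a set that is
  closed within the classes. This makes splits along closed sets sound.\<close>

lemma gec_closed:
 assumes X: "gec X" and cst: "!!u w. u : X ==> w : X ==> cf u = cf w" and V: "ocl cf V \<or> icl cf V"
 shows "X \<subseteq> V \<or> X Int V = {}"
proof (rule ccontr)
 assume "~ ?thesis"
 then obtain u w where u: "u : X" "u : V" and w: "w : X" "w ~: V" by blast
 have conn: "(a, q) : (E Int X \<times> X)\<^sup>*" if "a : X" "q : X" for a q using X that unfolding gec_def by blast
 from V show False
 proof
  assume o: "ocl cf V"
  have "(u, w) : (E Int X \<times> X)\<^sup>* ==> w : V"
  proof (induction rule: rtrancl_induct)
   case (step y z)
   hence "z : oe cf y" using cst by (auto simp: oe_def)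
   thus ?case using o step by (auto simp: ocl_def)
  qed (rule u)
  thus False using conn u w by blast
 next
  assume i: "icl cf V"
  have "(w, u) : (E Int X \<times> X)\<^sup>* ==> w : V"
  proof (induction rule: converse_rtrancl_induct)
   case (step y z)
   hence "y : ie cf z" using cst by (auto simp: ie_def)
   thus ?case using i step by (auto simp: icl_def)
  qed (rule u)
  thus False using conn u w by blast
 qed
qed

lemma sconn_closed:
 assumes S: "sconn x (cls cf c)" and V: "V \<subseteq> cls cf c" "V ~= {}" "ocl cf V \<or> icl cf V"
 shows "V = cls cf c"
proof -
 let ?S = "cls cf c"
 obtain u where u: "u : V" using V(2) by blast
 have "w : V" if w: "w : ?S" for w
 proof -
  have conn: "(u, w) : (E Int ?S \<times> ?S)\<^sup>*" "(w, u) : (E Int ?S \<times> ?S)\<^sup>*" using S u w V(1) unfolding sconn_def by blast+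
  from V(3) show ?thesis
  proof
   assume o: "ocl cf V"
   from conn(1) show ?thesis
   proof (induction rule: rtrancl_induct)
    case (step y z)
    hence "z : oe cf y" by (auto simp: oe_def cls_def)
    thus ?case using o step by (auto simp: ocl_def)
   qed (rule u)
  next
   assume i: "icl cf V"
   from conn(2) show ?thesis
   proof (induction rule: converse_rtrancl_induct)
    case (step y z)
    hence "y : ie cf z" by (auto simp: ie_def cls_def)
    thus ?case using i step by (auto simp: icl_def)
   qed (rule u)
  qed
 qed
 thus ?thesis using V(1) by blast
qed

lemma split_postD:
 assumes "split_post A c' x y"
 shows "params y" "consistent y" "live y" "v < n ==> dead x v = 0 ==> viol (comp y) v ==> v : Dm y"
  "areg y 5 = Suc (areg x 5)" "r ~: {5, 9, 10, 11, 12, 13, 14, 15, 16, 17, 19, 20, 21, 22} ==> areg y r = areg x r"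
  "comp y = (%v. if v : A then c' else comp x v)" "a ~= bs+7 ==> aarr y a = aarr x a"
  "Dm x \<subseteq> Dm y"
  "u : Dm y ==> u : Dm x \<or> u < n & dead x u = 0 & viol (comp y) u & (EX v:A. comp x u = comp x v)"
  "QO y = QO x Un {u. EX w. (u, w) : E & comp x u = comp x w & comp y u ~= comp y w}"
  "QI y = QI x Un {w. EX u. (u, w) : E & comp x u = comp x w & comp y u ~= comp y w}"
 using assms unfolding split_post_def by (elim conjE; simp)+

text \<open>By \<open>gA\<close> the part contains or avoids each good end component, so the classes
  still do not separate them. Classes below the cursor are untouched, since new doomed vertices lie
  in the class being split.\<close>

lemma core_split:
 assumes x: "core x" and sp: "split_post A (areg x 5) x y" and A: "A \<subseteq> cls (comp x) c" "A ~= {}"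
  and cur: "areg x 4 <= c" and gA: "!!X. gec X ==> X \<subseteq> A \<or> X Int A = {}"
 shows "core y"
proof -
 note C = coreD[OF x] and P = split_postD[OF sp]
 note SA = split_A[OF A C(5) P(7)]
 have cls: "cls (comp y) d = (if d = areg x 5 then A else if d = c then cls (comp x) c - A else cls (comp x) d)" for d
  by (rule split_cls[OF A _ P(7)]) (rule C(5))
 have dd: "dead y = dead x" using P(8)[of "bs+8"] by simp
 have r4: "areg y 4 = areg x 4" using P(6)[of 4] by simp
 have cst: "comp y u = comp y w" if X: "gec X" "u : X" "w : X" for X u w
  using gA[OF X(1)] C(11)[OF X] X(2,3) unfolding P(7) by auto
 show ?thesis
  unfolding core_def dd r4
 proof (intro conjI allI impI ballI)
  show "params y" "consistent y" "live y" by (rule P)+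
  show "v : Dm y" if "v < n" "dead x v = 0" "viol (comp y) v" for v using P(4) that .
  show "comp y v < areg y 5" if "v < n" for v using C(5)[OF that] unfolding P(5,7) by auto
  show "areg x 4 <= areg y 5" using C(6) P(5) by simp
  show "v < n" "dead x v = 0" if "v : Dm y" for v using P(10)[OF that] C(7,8)[of v] by auto
  show "lost v" if "v : Dm y" for v using P(10)[OF that] C(9)[of v] viol_lost[of "comp y" v] cst by metis
  show "lost v" if "v < n" "dead x v ~= 0" for v using C(10) that .
  show "comp y u = comp y w" if "gec X" "u : X" "w : X" for X u w using cst that .
  fix v assume v: "v < n" "comp y v < areg x 4" "dead x v = 0"
  have vA: "v ~: A" using v(2) C(6) unfolding P(7) by auto
  hence cv: "comp y v = comp x v" unfolding P(7) by simp
  hence lt: "comp x v < areg x 4" using v(2) by simp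
  show "v ~: Dm y"
  proof
   assume "v : Dm y"
   then obtain a where "a : A" "comp x v = comp x a" using P(10) C(12)[OF v(1) lt v(3)] by blast
   thus False using SA(2) lt cur by simp
  qed
  have "cls (comp y) (comp y v) = cls (comp x) (comp x v)"
   unfolding cv cls using lt cur C(5)[OF v(1)] by simp
  thus "sconn y (cls (comp y) (comp y v))" using C(13)[OF v(1) lt v(3)] by (simp add: sconn_def)
 qed
qed

text \<open>If \<open>X\<close> contains no vertex that has just lost an edge of the kind in
  question, then its closedness and its degrees are the same as before the split, and the old
  invariant applies.\<close>

lemma qinv_split:
 assumes q: "qinv D cf Q1 Q2" and A: "A \<subseteq> cls cf c" "A ~= {}" and c': "!!v. v < n ==> cf v < c'"
  and cf': "cf' = (%v. if v : A then c' else cf v)"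
 shows "qinv D cf' (Q1 Un {u. EX w. (u, w) : E & cf u = cf w & cf' u ~= cf' w})
   (Q2 Un {w. EX u. (u, w) : E & cf u = cf w & cf' u ~= cf' w})"
 unfolding qinv_def
proof (intro allI impI)
 fix d X assume X: "X ~= {}" "X \<subset> cls cf' d"
 have "cls cf' d \<subseteq> cls cf d \<or> cls cf' d \<subseteq> cls cf c" by (subst split_cls[OF A c' cf'], assumption, subst split_cls[OF A c' cf'], assumption) (use A(1) in auto)
 then obtain d0 where Xd: "X \<subset> cls cf d0" using X(2) by blast
 have eq: "oe cf' v = oe cf v" if "v : X" "X Int {u. EX w. (u, w) : E & cf u = cf w & cf' u ~= cf' w} = {}" for v
  using that split_oe(1)[OF A c' cf', of v] unfolding oe_def by blast
 have eq': "ie cf' v = ie cf v" if "v : X" "X Int {w. EX u. (u, w) : E & cf u = cf w & cf' u ~= cf' w} = {}" for v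
  using that split_oe(2)[OF A c' cf', of v] unfolding ie_def by blast
 show "(ocl cf' X --> (SUM v:X. card (oe cf' v)) <= D --> X Int (Q1 Un {u. EX w. (u, w) : E & cf u = cf w & cf' u ~= cf' w}) ~= {}) &
    (icl cf' X --> (SUM v:X. card (ie cf' v)) <= D --> X Int (Q2 Un {w. EX u. (u, w) : E & cf u = cf w & cf' u ~= cf' w}) ~= {})"
 proof (intro conjI impI)
  assume o: "ocl cf' X" "(SUM v:X. card (oe cf' v)) <= D"
  show "X Int (Q1 Un {u. EX w. (u, w) : E & cf u = cf w & cf' u ~= cf' w}) ~= {}"
  proof (cases "X Int {u. EX w. (u, w) : E & cf u = cf w & cf' u ~= cf' w} = {}")
   case True
   have "ocl cf X" "(SUM v:X. card (oe cf v)) <= D" using o eq[OF _ True] by (auto simp: ocl_def)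
   hence "X Int Q1 ~= {}" using q X(1) Xd unfolding qinv_def by blast
   thus ?thesis by blast
  next
   case False
   thus ?thesis by blast
  qed
 next
  assume o: "icl cf' X" "(SUM v:X. card (ie cf' v)) <= D"
  show "X Int (Q2 Un {w. EX u. (u, w) : E & cf u = cf w & cf' u ~= cf' w}) ~= {}"
  proof (cases "X Int {w. EX u. (u, w) : E & cf u = cf w & cf' u ~= cf' w} = {}")
   case True
   have "icl cf X" "(SUM v:X. card (ie cf v)) <= D" using o eq'[OF _ True] by (auto simp: icl_def)
   hence "X Int Q2 ~= {}" using q X(1) Xd unfolding qinv_def by blast
   thus ?thesis by blast
  next
   case False
   thus ?thesis by blast
  qed
 qed
qed

section \<open>The potential of the main loop\<close>

definition alive_wt :: "astate => nat" where "alive_wt x = (SUM v | v < n & dead x v = 0. 2 + dg v + mm v)"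

text \<open>The first term pays for the steps of the cursor, hence a split, which creates a number,
  costs 1000. \<open>alive_wt\<close> pays for splitting off dead vertices, where
  \<open>pot_log\<close> is of no use if the vertex is alone in its class. \<open>pot_log mm\<close>
  pays for moved memberships. In the dense variant \<open>pot_sq\<close> pays for edges and
  searches. In the sparse variant the second \<open>pot_log\<close> pays for moved edges, the term
  with the queues for searches with budget \<open>D\<close>, and \<open>pot_big\<close> and
  \<open>pot_todo\<close> for searches of whole components.\<close>

definition Phi0 :: "nat => nat => astate => real" where
 "Phi0 dn D x = 1000 * (real (areg x 5) - real (areg x 4)) + 3000 * real (alive_wt x) + 3000 * pot_log mm (comp x) +
   (if dn ~= 0 then 60000 * real (pot_sq (areg x 4) (comp x))
   else 3000 * pot_log (%v. 1 + dg v) (comp x) + 3000 * real D * real (card (QO x) + card (QI x) + 2 * pot_live (comp x)) +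
    5000 * real m * pot_big D (areg x 5) (comp x) + 2000 * real (pot_todo (areg x 4) (comp x)))"

definition Phi :: "nat => nat => astate => real" where "Phi dn D x = Phi0 dn D x + 200 * real (lam x)"

lemma pot_log_nonneg: "0 <= pot_log q cf"
proof -
 have "0 <= log 2 (real (csz cf v))" if "v < n" for v
  using csz_pos[OF that, of cf] by simp
 thus ?thesis unfolding pot_log_def by (intro sum_nonneg mult_nonneg_nonneg) auto
qed

lemma pot_big_nonneg: "0 <= pot_big D c cf"
 unfolding pot_big_def by (intro sum_nonneg) simp

lemma Phi0_nonneg: "areg x 4 <= areg x 5 ==> 0 <= Phi0 dn D x"
 unfolding Phi0_def using pot_log_nonneg pot_big_nonneg by simp

text \<open>Any split creates a component number, which costs 1000. If the smaller half moves, the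
  logarithmic or quadratic terms are released. With two parts of more than \<open>D\<close> edges
  \<open>pot_big\<close> releases another \<open>5000 * real m\<close>.\<close>

lemma Phi0_split:
 assumes x: "core x" and sp: "split_post A (areg x 5) x y" and A: "A \<subseteq> cls (comp x) c" "A ~= {}"
  and cur: "areg x 4 <= c"
 defines "S \<equiv> cls (comp x) c"
 shows "Phi0 dn D y <= Phi0 dn D x + 1000"
  and "2 * card A <= card S ==> Phi0 dn D y + 3000 * (SUM v:A. real (mm v)) +
    (if dn ~= 0 then 120000 * real (card A * card (S - A)) else 3000 * (SUM v:A. real (1 + dg v))) <= Phi0 dn D x + 1000"
  and "2 * card A <= card S ==> dn = 0 ==> 0 < D ==> D < cedges (comp y) c ==> D < cedges (comp y) (areg x 5) ==>
    Phi0 dn D y + 3000 * (SUM v:A. real (mm v)) + 3000 * (SUM v:A. real (1 + dg v)) + 5000 * real m <= Phi0 dn D x + 1000"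
proof -
 note C = coreD[OF x] and P = split_postD[OF sp]
 have r4: "areg y 4 = areg x 4" using P(6)[of 4] by simp
 have dd: "dead y = dead x" using P(8)[of "bs+8"] by simp
 have aw: "alive_wt y = alive_wt x" by (simp add: alive_wt_def dd)
 note A' = A C(5) P(7)
 have sq: "real (pot_sq (areg x 4) (comp y)) + 2 * real (card A * card (S - A)) = real (pot_sq (areg x 4) (comp x))"
  using pot_sq_split[OF A' cur] unfolding S_def by (simp flip: of_nat_add of_nat_mult)
 have td: "real (pot_todo (areg x 4) (comp y)) <= real (pot_todo (areg x 4) (comp x))" using pot_todo_split[OF A' cur] by simp
 have lv: "real D * real (card (QO y) + card (QI y) + 2 * pot_live (comp y)) <= real D * real (card (QO x) + card (QI x) + 2 * pot_live (comp x))"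
  using pot_live_split[OF A' P(11,12)] by (intro mult_left_mono of_nat_mono) auto
 have lg: "pot_log q (comp y) <= pot_log q (comp x)" for q using pot_log_split[OF A'] .
 have bg: "real m * pot_big D (areg y 5) (comp y) <= real m * pot_big D (areg x 5) (comp x)"
  using pot_big_split(1)[OF A'] P(5) by (intro mult_left_mono) auto
 show "Phi0 dn D y <= Phi0 dn D x + 1000"
 proof (cases "dn = 0")
  case True
  have F: "Phi0 dn D z = 1000 * (real (areg z 5) - real (areg z 4)) + 3000 * real (alive_wt z) + 3000 * pot_log mm (comp z) +
    (3000 * pot_log (%v. 1 + dg v) (comp z) + 3000 * (real D * real (card (QO z) + card (QI z) + 2 * pot_live (comp z))) +
     5000 * (real m * pot_big D (areg z 5) (comp z)) + 2000 * real (pot_todo (areg z 4) (comp z)))" for z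
   by (simp add: Phi0_def True)
  have r5: "real (areg y 5) = real (areg x 5) + 1" using P(5) by simp
  show ?thesis unfolding F r4 aw using td lv lg[of mm] lg[of "%v. 1 + dg v"] bg r5 by argo
 next
  case False
  have F: "Phi0 dn D z = 1000 * (real (areg z 5) - real (areg z 4)) + 3000 * real (alive_wt z) + 3000 * pot_log mm (comp z) +
    60000 * real (pot_sq (areg z 4) (comp z))" for z
   by (simp add: Phi0_def False)
  have r5: "real (areg y 5) = real (areg x 5) + 1" using P(5) by simp
  have "real (pot_sq (areg x 4) (comp y)) <= real (pot_sq (areg x 4) (comp x))" using sq by (metis le_add_same_cancel1 mult_nonneg_nonneg of_nat_0_le_iff zero_le_numeral)
  thus ?thesis unfolding F r4 aw using lg[of mm] r5 by argo
 qed
 assume half: "2 * card A <= card S"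
 have lh: "pot_log q (comp y) + (SUM v:A. real (q v)) <= pot_log q (comp x)" for q
  using pot_log_split_half[OF A'] half unfolding S_def by simp
 show "Phi0 dn D y + 3000 * (SUM v:A. real (mm v)) +
    (if dn ~= 0 then 120000 * real (card A * card (S - A)) else 3000 * (SUM v:A. real (1 + dg v))) <= Phi0 dn D x + 1000"
  unfolding Phi0_def r4 aw using sq td lv lh[of mm] lh[of "%v. 1 + dg v"] bg P(5) by (simp only: split: if_split) (simp; linarith)
 assume dn: "dn = 0" and D: "0 < D" "D < cedges (comp y) c" "D < cedges (comp y) (areg x 5)"
 have "real m * (pot_big D (areg y 5) (comp y) + 1) <= real m * pot_big D (areg x 5) (comp x)"
  using pot_big_split(2)[OF A' D] P(5) by (intro mult_left_mono) auto
 hence bg2: "real m * pot_big D (areg y 5) (comp y) + real m <= real m * pot_big D (areg x 5) (comp x)"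
  by (simp add: algebra_simps)
 show "Phi0 dn D y + 3000 * (SUM v:A. real (mm v)) + 3000 * (SUM v:A. real (1 + dg v)) + 5000 * real m <= Phi0 dn D x + 1000"
  unfolding Phi0_def r4 aw dn using td lv lh[of mm] lh[of "%v. 1 + dg v"] bg2 P(5) by simp
qed

definition inv :: "nat => nat => astate => bool" where
 "inv dn D x \<longleftrightarrow> core x & dead_single x & areg x 6 = dn & areg x 7 = D &
   (dn = 0 --> qinv D (comp x) (QO x) (QI x))"

lemma core_cong:
 assumes "core x" "!!r. r <= 5 ==> areg y r = areg x r" "aarr y = aarr x"
  "!!f. f : {bs, Suc bs, bs+2, bs+3, bs+4, bs+5, bs+6} ==> alst y f = alst x f"
 shows "core y" "dead_single y = dead_single x" "lam y = lam x" "wt y v = wt x v"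
proof -
 have e: "areg y 0 = areg x 0" "areg y (Suc 0) = areg x (Suc 0)" "areg y 2 = areg x 2" "areg y 3 = areg x 3"
  "areg y 4 = areg x 4" "areg y 5 = areg x 5" "alst y bs = alst x bs" "alst y (Suc bs) = alst x (Suc bs)"
  "alst y (bs+2) = alst x (bs+2)" "alst y (bs+3) = alst x (bs+3)" "alst y (bs+4) = alst x (bs+4)"
  "alst y (bs+5) = alst x (bs+5)" "alst y (bs+6) = alst x (bs+6)"
  using assms(2,4) by auto
 show "core y"
  using assms(1) unfolding core_def params_def consistent_def live_def sconn_def e assms(3) .
 show "dead_single y = dead_single x" "lam y = lam x" "wt y v = wt x v"
  unfolding dead_single_def lam_def wt_def e assms(3) by auto
qed

lemma Phi0_cong:
 assumes "areg y 4 = areg x 4" "areg y 5 = areg x 5" "aarr y = aarr x"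
  "alst y (bs+7) = alst x (bs+7)" "alst y (bs+8) = alst x (bs+8)"
 shows "Phi0 dn D y = Phi0 dn D x"
 unfolding Phi0_def alive_wt_def assms ..

section \<open>Amortised cost of the steps of the main loop\<close>

lemma qinvD:
 assumes "qinv D cf Q1 Q2" "X ~= {}" "X \<subset> cls cf c"
 shows "ocl cf X ==> (SUM v:X. card (oe cf v)) <= D ==> X Int Q1 ~= {}"
  "icl cf X ==> (SUM v:X. card (ie cf v)) <= D ==> X Int Q2 ~= {}"
 using assms(1)[unfolded qinv_def, THEN spec, THEN spec, THEN mp, OF assms(2), THEN mp, OF assms(3)] by simp_all

lemma qinv_mono:
 assumes q: "qinv D cf Q1 Q2" and sub: "Q1 \<subseteq> Q1'" "Q2 \<subseteq> Q2'"
 shows "qinv D cf Q1' Q2'"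
 unfolding qinv_def
proof (intro allI impI conjI)
 fix c X assume X: "X ~= {}" "X \<subset> cls cf c"
 show "X Int Q1' ~= {}" if "ocl cf X" "(SUM v:X. card (oe cf v)) <= D"
  using qinvD(1)[OF q X that] sub(1) by blast
 show "X Int Q2' ~= {}" if "icl cf X" "(SUM v:X. card (ie cf v)) <= D"
  using qinvD(2)[OF q X that] sub(2) by blast
qed

lemma dead_single_split:
 assumes x: "core x" and ds: "!!v. v < n ==> dead x v ~= 0 ==> v ~: A ==> cls (comp x) (comp x v) = {v}"
  and dA: "!!v. v : A ==> dead x v ~= 0 ==> A = {v}"
  and sp: "split_post A (areg x 5) x y" and A: "A \<subseteq> cls (comp x) c" "A ~= {}"
 shows "dead_single y"
 unfolding dead_single_def
proof (intro allI impI)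
 note C = coreD[OF x] and P = split_postD[OF sp]
 have cls: "cls (comp y) d = (if d = areg x 5 then A else if d = c then cls (comp x) c - A else cls (comp x) d)" for d
  by (rule split_cls[OF A _ P(7)]) (rule C(5))
 fix v assume v: "v < n" "dead y v ~= 0"
 have dv: "dead x v ~= 0" using v(2) P(8)[of "bs+8"] by simp
 show "cls (comp y) (comp y v) = {v}"
 proof (cases "v : A")
  case True
  hence cv: "comp y v = areg x 5" by (simp add: P(7))
  show ?thesis unfolding cv cls using dA[OF True dv] by simp
 next
  case False
  have s: "cls (comp x) (comp x v) = {v}" using ds[OF v(1) dv False] .
  have "comp x v ~= c"
  proof
   assume "comp x v = c"
   hence "A \<subseteq> {v}" using A(1) s by simp
   thus False using False A(2) by blast
  qed
  moreover have cv: "comp y v = comp x v" using False by (simp add: P(7))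
  ultimately show ?thesis unfolding cv cls using s C(5)[OF v(1)] by simp
 qed
qed

text \<open>Each vertex dies at most once, so its whole weight can be charged to
  \<open>alive_wt\<close>, whether or not it is the smaller part. In between the vertex is dead but
  not yet alone, and only \<open>core\<close> is known to hold.\<close>

lemma hw_Kill:
 assumes inv: "inv dn D x" and ne: "alst x (bs+6) 0 ~= []"
 shows "hw N (Kill bs) (%t y. inv dn D y & real t + 100 + Phi dn D y <= Phi dn D x) x"
proof (rule hw_ok)
 assume ok: "lists_ok x"
 have core: "core x" and ds: "dead_single x" and r67: "areg x 6 = dn" "areg x 7 = D"
  and q: "dn = 0 ==> qinv D (comp x) (QO x) (QI x)" using inv by (auto simp: inv_def)
 note C = coreD[OF core]
 define v where "v = last (alst x (bs+6) 0)"
 have vD: "v : Dm x" using ne by (simp add: v_def)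
 have v: "v < n" "dead x v = 0" "lost v" using C(7-9)[OF vD] by auto
 have bl: "set (butlast (alst x (bs+6) 0)) = Dm x - {v}"
 proof -
  have "distinct (butlast (alst x (bs+6) 0) @ [v])" using ok ne by (simp add: v_def)
  moreover have "Dm x = set (butlast (alst x (bs+6) 0) @ [v])" using ne by (simp add: v_def)
  ultimately show ?thesis by auto
 qed
 define c where "c = comp x v"
 define x5 where "x5 = setl (setl (setr (seta (setr (setl x (bs+6) 0 (butlast (alst x (bs+6) 0))) 37 v) (bs+8) v 1) 18 c)
   (bs+10) 0 []) (bs+10) 0 [v]"
 have cur: "areg x 4 <= c" using C(12)[OF v(1) _ v(2)] vD unfolding c_def by (metis not_le)
 have e: "areg x5 = (areg x)(37 := v, 18 := c)" "comp x5 = comp x" "dead x5 = (dead x)(v := 1)"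
  "!!a. a ~= bs+8 ==> aarr x5 a = aarr x a" "!!f. f ~: {bs+6, bs+10} ==> alst x5 f = alst x f"
  "Dm x5 = Dm x - {v}" "PS x5 = {v}"
  using bl by (auto simp: x5_def)
 have core5: "core x5"
  unfolding core_def
 proof (intro conjI allI impI ballI)
  show "params x5" using C(1) by (simp add: params_def e)
  show "consistent x5"
   unfolding consistent_def e(2,6)
  proof (intro conjI allI impI)
   show "CS x5 d = {v. v < n & comp x v = d}" for d using consistentD(1)[OF C(2)] by (simp add: e)
   show "US x5 (d * k + i) = {v : U i. comp x v = d}" if "i < k" for d i using consistentD(2)[OF C(2) that] by (simp add: e)
   show "LS x5 (d * k + i) \<subseteq> {v : L i. comp x v = d}" if "i < k" for d i using consistentD(3)[OF C(2) that] by (simp add: e)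
   show "u : LS x5 (comp x u * k + i) \<or> u : Dm x - {v} \<or> dead x5 u ~= 0" if "i < k" "u : L i" for i u
    using consistentD(4)[OF C(2) that] by (auto simp: e)
  qed
  show "live x5" using liveD[OF C(3)] by (simp add: live_def e)
  show "u : Dm x5" if "u < n" "dead x5 u = 0" "viol (comp x5) u" for u
   using that C(4)[of u] by (auto simp: e split: if_splits)
  show "comp x5 u < areg x5 5" if "u < n" for u using C(5)[OF that] by (simp add: e)
  show "areg x5 4 <= areg x5 5" using C(6) by (simp add: e)
  show "u < n" "lost u" if "u : Dm x5" for u using that C(7,9)[of u] by (auto simp: e)
  show "dead x5 u = 0" if "u : Dm x5" for u using that C(8)[of u] by (auto simp: e)
  show "lost u" if "u < n" "dead x5 u ~= 0" for u using that C(10)[of u] v(3) by (auto simp: e split: if_splits)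
  show "comp x5 u = comp x5 w" if "gec X" "u : X" "w : X" for X u w using C(11)[OF that] by (simp add: e)
  show "u ~: Dm x5" if "u < n" "comp x5 u < areg x5 4" "dead x5 u = 0" for u
   using that C(12)[of u] by (auto simp: e split: if_splits)
  show "sconn x5 (cls (comp x5) (comp x5 u))" if "u < n" "comp x5 u < areg x5 4" "dead x5 u = 0" for u
   using that C(13)[of u] by (auto simp: e sconn_def split: if_splits)
 qed
 note C5 = coreD[OF core5]
 have A: "{v} \<subseteq> cls (comp x5) c" "{v} ~= {}" using v(1) by (auto simp: cls_def e c_def)
 have aw: "alive_wt x = alive_wt x5 + (2 + dg v + mm v)"
 proof -
  have "{u. u < n & dead x u = 0} = insert v {u. u < n & dead x5 u = 0}" using v by (auto simp: e split: if_splits)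
  thus ?thesis unfolding alive_wt_def by (simp add: e)
 qed
 have Phi5: "Phi0 dn D x5 + 3000 * real (2 + dg v + mm v) = Phi0 dn D x"
  unfolding Phi0_def aw by (simp add: e)
 have lam5: "lam x5 = lam x" by (simp add: lam_def e)
 have wt5: "wt x5 v <= 1 + dg v + mm v"
  using oe_le[of "comp x5" v] MS_eq[OF C5(1) v(1)] by (simp add: wt_def live_eq[OF C5(3)])
 have r0: "areg x 0 = n" using params_reg0[OF C(1)] .
 have fin: "inv dn D y & real (T + 100) + 100 + Phi dn D y <= Phi dn D x" if sp: "split_post {v} (areg x5 5) x5 y"
  and T: "T + 200 * lam y <= 200 * lam x5 + 50 + 2500 * wt x5 v" for T y
 proof -
  note P = split_postD[OF sp]
  have "core y" by (rule core_split[OF core5 sp A]) (use cur v(3) in \<open>auto simp: e lost_def\<close>)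
  moreover have "dead_single y"
   by (rule dead_single_split[OF core5 _ _ sp A]) (use ds in \<open>auto simp: e dead_single_def split: if_splits\<close>)
  moreover have "qinv D (comp y) (QO y) (QI y)" if "dn = 0"
   unfolding P(11,12) by (rule qinv_split[OF _ A C5(5) P(7)]) (use q[OF that] in \<open>simp add: e\<close>)
  moreover have "areg y 6 = dn" "areg y 7 = D" using P(6)[of 6] P(6)[of 7] r67 by (auto simp: e)
  moreover have "real (T + 100) + 100 + Phi dn D y <= Phi dn D x"
  proof -
   have "Phi0 dn D y <= Phi0 dn D x5 + 1000" by (rule Phi0_split(1)[OF core5 sp A]) (use cur in \<open>simp add: e\<close>)
   moreover have "real T + 200 * real (lam y) <= 200 * real (lam x) + 50 + 2500 * real (1 + dg v + mm v)"
   proof -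
    have "T + 200 * lam y <= 200 * lam x + 50 + 2500 * (1 + dg v + mm v)" using T wt5 lam5 by simp
    hence "real (T + 200 * lam y) <= real (200 * lam x + 50 + 2500 * (1 + dg v + mm v))" by (rule of_nat_mono)
    thus ?thesis by simp
   qed
   ultimately show ?thesis using Phi5 unfolding Phi_def by simp
  qed
  ultimately show ?thesis by (simp add: inv_def)
 qed
 show ?thesis
  unfolding Kill_def
 proof (rule hw_Seq, rule hw_Pop, goal_cases)
  case 6
  show ?case
  proof (rule hw_Seq, rule hw_Write, goal_cases)
   case 4
   show ?case
   proof (rule hw_Seq, rule hw_Assign, simp, rule hw_Seq, rule hw_Clear, simp, rule hw_Seq, rule hw_Insert, goal_cases)
    case 5
    have eq: "setl (setl (setr (seta (setr (setl x (bs+6) 0 (butlast (alst x (bs+6) 0))) 37 v) (bs+8) v 1) 18 c)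
       (bs+10) 0 []) (bs+10) 0 (lins v []) = x5" by (simp add: x5_def lins_def)
    have "hw N (Split bs) (%t y. inv dn D y & real (t + 100) + 100 + Phi dn D y <= Phi dn D x) x5"
    proof (rule hw_Split[where A = "{v}" and c = c and c' = "areg x5 5"], goal_cases)
     case (12 T y)
     thus ?case using fin by simp
    next
     case 4
     thus ?case by (rule C5(4))
    next
     case (8 u)
     thus ?case by (simp add: e c_def)
    next
     case 10
     thus ?case by (rule C5(5))
    qed (use C5(1-3) v e(1,7) in \<open>simp_all\<close>)
    hence "hw N (Split bs) (%t y. inv dn D y & real (14 + (3 + (3 + (3 + (50 + t))))) + 100 + Phi dn D y <= Phi dn D x) x5"
     by (rule hw_mono) auto
    thus ?case using eq by (simp add: v_def[symmetric] c_def)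
   qed (use r0 v in \<open>auto simp: v_def[symmetric]\<close>)
  qed (use bs in auto)
 qed (use ne r0 in auto)
qed

lemma ocl_swap:
 shows "ocl cf V ==> V \<subseteq> cls cf c ==> icl cf (cls cf c - V)"
  and "icl cf V ==> V \<subseteq> cls cf c ==> ocl cf (cls cf c - V)"
proof -
 have lt: "u < n" "w < n" if "(u, w) : E" for u w using that E by auto
 assume V: "V \<subseteq> cls cf c"
 show "icl cf (cls cf c - V)" if o: "ocl cf V"
  unfolding icl_def
 proof (intro ballI subsetI)
  fix v u assume v: "v : cls cf c - V" and u: "u : ie cf v"
  hence uv: "(u, v) : E" "cf u = cf v" by (auto simp: ie_def)
  hence "v : oe cf u" by (simp add: oe_def)
  hence "u ~: V" using o v unfolding ocl_def by blast
  thus "u : cls cf c - V" using lt[OF uv(1)] uv(2) v by (simp add: cls_def)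
 qed
 show "ocl cf (cls cf c - V)" if i: "icl cf V"
  unfolding ocl_def
 proof (intro ballI subsetI)
  fix v w assume v: "v : cls cf c - V" and w: "w : oe cf v"
  hence vw: "(v, w) : E" "cf w = cf v" by (auto simp: oe_def)
  hence "v : ie cf w" by (simp add: ie_def)
  hence "w ~: V" using i v unfolding icl_def by blast
  thus "w : cls cf c - V" using lt[OF vw(1)] vw(2) v by (simp add: cls_def)
 qed
qed

text \<open>The three time bounds serve a split after a search with budget, a split into two large
  parts, and the dense variant. The clause on \<open>qinv\<close> joins the old queues to the new
  ones because the caller may have popped a vertex whose removal is not yet justified.\<close>

lemma hw_PartSplit:
 assumes core: "core x" and ds: "dead_single x" and c: "areg x 18 = c" "areg x 4 <= c"
 defines "S \<equiv> cls (comp x) c"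
 assumes V: "VS x ~= {}" "VS x \<subset> S"
  and cl: "ocl (comp x) (VS x) \<or> icl (comp x) (VS x) \<or> ocl (comp x) (S - VS x) \<or> icl (comp x) (S - VS x)"
  and Q: "!!T y A. core y ==> dead_single y ==> areg y 6 = areg x 6 ==> areg y 7 = areg x 7 ==>
   (!!D Q1 Q2. qinv D (comp x) Q1 Q2 ==> qinv D (comp y) (Q1 Un QO y) (Q2 Un QI y)) ==>
   QO x \<subseteq> QO y ==> QI x \<subseteq> QI y ==> comp y = (%v. if v : A then areg x 5 else comp x v) ==>
   (!!u w. (u, w) : E ==> comp x u = comp x w ==> comp y u ~= comp y w ==> u : QO y & w : QI y) ==>
   A ~= {} ==> A \<subset> S ==> 2 * card A <= card S ==> A = VS x \<or> A = S - VS x ==>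
   (!!D. real T + Phi 0 D y <= Phi 0 D x + 1100 + 400 * real (card (VS x))) ==>
   (!!D. 0 < D ==> D < cedges (comp y) c ==> D < cedges (comp y) (areg x 5) ==>
    real T + Phi 0 D y + 5000 * real m <= Phi 0 D x + 1100 + 400 * real (card (VS x))) ==>
   (!!dn D. dn ~= 0 ==> real T + Phi dn D y + 107500 * real (card A * card (S - A)) <=
    Phi dn D x + 1100 + 400 * real (card (VS x))) ==> Q T y"
 shows "hw N (PartSplit bs) Q x"
 unfolding PartSplit_def
proof (rule hw_Seq, rule hw_MakePart[where c = c and S = S], goal_cases)
 note C = coreD[OF core]
 case 1 show ?case by (rule C)
next
 case 2 show ?case by (rule c)
next
 case 3 show ?case unfolding S_def by (rule CS_eq[OF coreD(2)[OF core]])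
next
 case 4 show ?case by (rule V)
next
 case 5 show ?case by (rule V)
next
 case (6 T1 x1 A)
 note C = coreD[OF core]
 have fr: "areg x1 r = areg x r" if "r ~: {45, 46}" for r using 6(1) that by (simp add: frame_def)
 have ar: "aarr x1 = aarr x" using 6(1) by (simp add: frame_def)
 have ls: "alst x1 f = alst x f" if "f ~= bs+10" for f using 6(1) that by (simp add: frame_def)
 have cg: "core x1" "dead_single x1 = dead_single x" "lam x1 = lam x" "wt x1 v = wt x v" for v
  by (rule core_cong[OF core]; use fr ar ls in auto)+
 note C1 = coreD[OF cg(1)]
 have cx: "comp x1 = comp x" "dead x1 = dead x" using ar by auto
 have P01: "Phi0 dn D x1 = Phi0 dn D x" for dn D by (rule Phi0_cong) (use fr ar ls in auto)
 have A: "A \<subseteq> cls (comp x1) c" "A ~= {}" using 6(3,4) unfolding S_def cx by auto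
 have An: "A \<subseteq> {..<n}" using A(1) by (auto simp: cls_def)
 have finA: "finite A" using An finite_subset by blast
 have r5: "areg x1 5 = areg x 5" "areg x1 4 = areg x 4" using fr by auto
 have clA: "(ocl (comp x) A \<or> icl (comp x) A) \<or> (ocl (comp x) (S - A) \<or> icl (comp x) (S - A))"
 proof -
  have "S - (S - VS x) = VS x" using V(2) by blast
  thus ?thesis using 6(6) cl by auto
 qed
 have gA: "X \<subseteq> A \<or> X Int A = {}" if X: "gec X" for X
 proof -
  have cst: "comp x u = comp x w" if "u : X" "w : X" for u w using C(11)[OF X that] .
  from clA show ?thesis
  proof
   assume "ocl (comp x) A \<or> icl (comp x) A"
   thus ?thesis using gec_closed[where cf = "comp x", OF X cst] by blast
  next
   assume "ocl (comp x) (S - A) \<or> icl (comp x) (S - A)"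
   hence *: "X \<subseteq> S - A \<or> X Int (S - A) = {}" using gec_closed[where cf = "comp x", OF X cst] by blast
   show ?thesis
   proof (rule ccontr)
    assume "~ ?thesis"
    then obtain a u where a: "a : X" "a : A" and u: "u : X" "u ~: A" by blast
    have "X \<subseteq> {..<n}" using X by (simp add: gec_def)
    hence "u < n" using u by auto
    moreover have "comp x u = c" using cst[OF u(1) a(1)] a(2) 6(4) by (auto simp: S_def cls_def)
    ultimately have "u : S - A" using u by (simp add: S_def cls_def)
    thus False using * u a by blast
   qed
  qed
 qed
 show ?case
 proof (rule hw_Split[where A = A and c = c and c' = "areg x 5"], goal_cases)
  case (12 T2 y)
  have sp: "split_post A (areg x1 5) x1 y" using 12(1) unfolding r5 .
  note P = split_postD[OF sp]
  have cy: "core y" by (rule core_split[OF cg(1) sp A]) (use gA c r5 in auto)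
  \<comment> \<open>A dead vertex is alone in its class, and such a class has no nonempty proper
    part.\<close>
  have nodead: "dead x v = 0" if "v : A" for v
  proof (rule ccontr)
   assume "dead x v ~= 0"
   moreover have v: "v < n" "comp x v = c" using that A(1) by (auto simp: cls_def cx)
   ultimately have "S = {v}" using ds unfolding dead_single_def S_def by auto
   thus False using 6(3,4) by blast
  qed
  have dsy: "dead_single y"
   by (rule dead_single_split[OF cg(1) _ _ sp A]) (use ds nodead in \<open>auto simp: cx dead_single_def\<close>)
  have q: "qinv D (comp y) (Q1 Un QO y) (Q2 Un QI y)" if "qinv D (comp x) Q1 Q2" for D Q1 Q2
   by (rule qinv_mono[OF qinv_split[OF _ A C1(5) P(7)]]) (use that in \<open>auto simp: cx P(11,12)\<close>)
  have Sx: "cls (comp x1) c = S" by (simp add: S_def cx)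
  have card_le: "card A <= card (S - A)" "1 <= card (S - A)" "card S = card A + card (S - A)"
  proof -
   have "A \<subseteq> S" using 6(4) by auto
   hence "card (S - A) = card S - card A" "card A <= card S" using card_Diff_subset[OF finA] card_mono[of S A] by (auto simp: S_def)
   thus "card A <= card (S - A)" "card S = card A + card (S - A)" using 6(5) by auto
   have "0 < card A" using A(2) finA by (simp add: card_gt_0_iff)
   thus "1 <= card (S - A)" using `card A <= card (S - A)` by simp
  qed
  have T2: "real T2 + 200 * real (lam y) <= 200 * real (lam x) + 50 + 2500 * (SUM v:A. real (wt x v))"
  proof -
   have "T2 + 200 * lam y <= 200 * lam x + 50 + 2500 * (SUM v:A. wt x v)" using 12(2) cg by (simp add: sum_distrib_left)
   hence "real (T2 + 200 * lam y) <= real (200 * lam x + 50 + 2500 * (SUM v:A. wt x v))" by (rule of_nat_mono)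
   thus ?thesis by simp
  qed
  have wtv: "wt x v = 1 + card (oe (comp x) v) + card (ie (comp x) v) + mm v" if "v < n" for v
   using MS_eq[OF C(1) that] by (simp add: wt_def live_eq[OF C(3)])
  have W0: "(SUM v:A. real (wt x v)) <= (SUM v:A. real (mm v)) + (SUM v:A. real (1 + dg v))"
  proof -
   have "real (wt x v) <= real (mm v) + real (1 + dg v)" if "v : A" for v
    using wtv[of v] oe_le[of "comp x" v] An that by auto
   thus ?thesis unfolding sum.distrib[symmetric] by (rule sum_mono)
  qed
  \<comment> \<open>For the dense variant: degrees within the class are at most
    \<open>card S\<close>, hence at most \<open>2 * card (S - A)\<close>, so that the loss of
    \<open>pot_sq\<close> covers the edges of the moved vertices.\<close>
  have W1: "(SUM v:A. real (wt x v)) <= (SUM v:A. real (mm v)) + 5 * real (card A * card (S - A))"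
  proof -
   have sub: "oe (comp x) v \<subseteq> S" "ie (comp x) v \<subseteq> S" if "v : A" for v
    using that A(1) E unfolding oe_def ie_def S_def cls_def cx by auto
   have "real (wt x v) <= real (mm v) + 5 * real (card (S - A))" if "v : A" for v
   proof -
    have "card (oe (comp x) v) <= card S" "card (ie (comp x) v) <= card S"
     using sub[OF that] by (auto intro!: card_mono simp: S_def)
    hence "wt x v <= mm v + 5 * card (S - A)" using wtv[of v] An that card_le by auto
    thus ?thesis using of_nat_mono[where 'a = real] by fastforce
   qed
   hence "(SUM v:A. real (wt x v)) <= (SUM v:A. real (mm v) + 5 * real (card (S - A)))" by (rule sum_mono)
   thus ?thesis by (simp add: sum.distrib)
  qed
  have T1: "real T1 <= 400 * real (card (VS x))" using of_nat_mono[OF 6(7), where 'a = real] by simp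
  note Phi2 = Phi0_split(2,3)[OF cg(1) sp A, unfolded P01 r5 Sx]
  have cur: "areg x 4 <= c" by (rule c)
  have nn: "0 <= (SUM v:A. real (mm v))" "0 <= (SUM v:A. real (1 + dg v))" by (simp_all add: sum_nonneg)
  have r: "real (T1 + T2) = real T1 + real T2" by simp
  show ?case
  proof (rule Q[where A = A], goal_cases)
   case 3 thus ?case using P(6)[of 6] fr[of 6] by simp
  next
   case 4 thus ?case using P(6)[of 7] fr[of 7] by simp
  next
   case 6 thus ?case using P(11) ls[of "bs+7"] by auto
  next
   case 7 thus ?case using P(12) ls[of "bs+8"] by auto
  next
   case 8 show ?case unfolding P(7) cx r5 ..
  next
   case (9 u w)
   thus ?case using P(11,12) cx by auto
  next
   case (14 D)
   have "Phi0 0 D y + 3000 * (SUM v:A. real (mm v)) + 3000 * (SUM v:A. real (1 + dg v)) <= Phi0 0 D x + 1000"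
    using Phi2(1)[of 0 D] cur 6(5) by simp
   thus ?case unfolding Phi_def r using T1 T2 W0 nn by argo
  next
   case (15 D)
   have "Phi0 0 D y + 3000 * (SUM v:A. real (mm v)) + 3000 * (SUM v:A. real (1 + dg v)) + 5000 * real m <= Phi0 0 D x + 1000"
    using Phi2(2)[of 0 D] cur 6(5) 15 by simp
   thus ?case unfolding Phi_def r using T1 T2 W0 nn by argo
  next
   case (16 dn D)
   \<comment> \<open>107500 = 120000 - 5 * 2500, where 2500 is the cost of a split per unit of
     weight and 5 the factor in \<open>W1\<close>.\<close>
   have "Phi0 dn D y + 3000 * (SUM v:A. real (mm v)) + 120000 * real (card A * card (S - A)) <= Phi0 dn D x + 1000"
    using Phi2(1)[of dn D] cur 6(5) 16 by simp
   thus ?case unfolding Phi_def r using T1 T2 W1 nn by argo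
  qed (rule cy dsy 6(3) 6(4) 6(5) 6(6) | erule q)+
 next
  case 4
  thus ?case by (rule C1(4))
 next
  case (8 v)
  thus ?case using A(1) by (auto simp: cls_def)
 next
  case 10
  thus ?case using C1(5) r5 by simp
 next
  case 11
  show ?case using fr[of 18] c by simp
 qed (use C1(1-3) A(2) An 6(2) r5 in \<open>simp_all\<close>)
qed

text \<open>\<open>True\<close> stands for the forward direction, with list 7 as queue, and
  \<open>False\<close> for the backward direction, with list 8; one proof covers both.\<close>

definition nb :: "bool => (nat => nat) => nat => nat set" where "nb d cf = (if d then oe cf else ie cf)"

text \<open>Removing \<open>v\<close> from its queue releases \<open>3000 * D\<close>, which pays
  for the search. If the search is cut off or visits the whole class, no closed proper part with at
  most \<open>D\<close> edges contains \<open>v\<close>, so \<open>v\<close> may be forgotten.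
  Otherwise the visited set is the least closed set containing \<open>v\<close>; it becomes the
  class of \<open>v\<close> and is then no proper part any more.\<close>

lemma hw_PopSearch:
 fixes d :: bool
 defines "q \<equiv> (if d then bs+7 else bs+8)" and "af \<equiv> (if d then bs else Suc bs)"
 assumes inv: "inv 0 D x" and ne: "alst x q 0 ~= []" and D: "0 < D"
 shows "hw N (PopSearch bs q af) (%t y. inv 0 D y & real t + 100 + Phi 0 D y <= Phi 0 D x) x"
proof (rule hw_ok)
 assume ok: "lists_ok x"
 have core: "core x" and ds: "dead_single x" and r67: "areg x 6 = 0" "areg x 7 = D"
  and qi: "qinv D (comp x) (QO x) (QI x)" using inv by (auto simp: inv_def)
 note C = coreD[OF core]
 define cf where "cf = comp x"
 have Nq: "N q = n" and Naf: "N af = n" and afne: "af ~= bs+9" "af ~= q" "q ~= bs+9" by (auto simp: q_def af_def)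
 define v where "v = last (alst x q 0)"
 have vq: "v : set (alst x q 0)" using ne by (simp add: v_def)
 have v: "v < n" using lists_ok_less[OF ok vq] Nq by simp
 define Qs where "Qs = set (alst x q 0)"
 have bl: "set (butlast (alst x q 0)) = Qs - {v}"
 proof -
  have "distinct (butlast (alst x q 0) @ [v])" using ok ne by (simp add: v_def)
  moreover have "Qs = set (butlast (alst x q 0) @ [v])" using ne by (simp add: v_def Qs_def)
  ultimately show ?thesis by auto
 qed
 define c where "c = cf v"
 define S where "S = cls cf c"
 have vS: "v : S" using v by (simp add: S_def c_def cls_def)
 have finS: "finite S" by (simp add: S_def)
 define x1 where "x1 = setr (setr (setr (setl x q 0 (butlast (alst x q 0))) 37 v) 18 c) 33 D"
 have adj1: "adj af x1 u = nb d cf u" for u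
  using live_eq[OF C(3), of u] afne by (simp add: adj_def x1_def nb_def af_def cf_def)
 have e1: "areg x1 r = areg x r" if "r ~: {18, 33, 37}" for r using that by (simp add: x1_def)
 have l1: "alst x1 f = alst x f" if "f ~= q" for f using that by (simp add: x1_def)
 have a1: "aarr x1 = aarr x" by (simp add: x1_def)
 have r0: "areg x 0 = n" using params_reg0[OF C(1)] .
 have par1: "params x1" using C(1) by (simp add: x1_def q_def)
 have drop: "Phi0 0 D x1 + 3000 * real D = Phi0 0 D x"
 proof -
  have cq: "card (set (butlast (alst x q 0))) + 1 = card (set (alst x q 0))"
   unfolding bl using card_Suc_Diff1[of Qs v] vq by (simp add: Qs_def)
  have c2: "card (QO x1) + card (QI x1) + 1 = card (QO x) + card (QI x)"
   using cq by (cases d) (simp_all add: x1_def q_def)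
  have "3000 * real D * real (card (QO x1) + card (QI x1) + 2 * pot_live (comp x)) + 3000 * real D =
    3000 * real D * real ((card (QO x1) + card (QI x1) + 1) + 2 * pot_live (comp x))" by (simp add: algebra_simps)
  hence "3000 * real D * real (card (QO x1) + card (QI x1) + 2 * pot_live (comp x)) + 3000 * real D =
    3000 * real D * real (card (QO x) + card (QI x) + 2 * pot_live (comp x))" unfolding c2 .
  thus ?thesis unfolding Phi0_def alive_wt_def a1 using e1[of 4] e1[of 5] by simp
 qed
 show ?thesis
  unfolding PopSearch_def
 proof (rule hw_Seq, rule hw_Pop, goal_cases)
  case 6
  have eqs: "setl x q (aev x (Const 0)) (butlast (alst x q (aev x (Const 0)))) = setl x q 0 (butlast (alst x q 0))"
   "last (alst x q (aev x (Const 0))) = v" by (simp_all add: v_def)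
  let ?x2 = "setr (setr (setl x q 0 (butlast (alst x q 0))) 37 v) 18 c"
  have eq2: "setr (setr (setl x q 0 (butlast (alst x q 0))) 37 v) 18 (aev (setr (setl x q 0 (butlast (alst x q 0))) 37 v) (Read (bs+7) (Reg 37))) = ?x2"
   by (simp add: c_def cf_def)
  have eq3: "setr ?x2 33 (aev ?x2 (Reg 7)) = x1" using r67 by (simp add: x1_def)
  show ?case
   unfolding eqs
  proof (rule hw_Seq, rule hw_Assign, simp, unfold eq2, rule hw_Seq, rule hw_Assign, simp, unfold eq3, rule hw_Seq,
    rule hw_BFS_from[where v = v and B = D], goal_cases)
   case (7 T y Sc)
   have bp: "bfs_post af D {v} Sc x1 y" using 7(1) .
   have fr: "frame {30, 31, 32, 33, 35, 36} {bs+9} x1 y" using bp unfolding bfs_post_def by (elim conjE)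
   have ey: "areg y r = areg x r" if "r ~: {18, 30, 31, 32, 33, 35, 36, 37}" for r using fr e1[of r] that by (simp add: frame_def)
   have ay: "aarr y = aarr x" using fr a1 by (simp add: frame_def)
   have ly: "alst y f = alst x f" if "f ~= q" "f ~= bs+9" for f using fr l1 that by (simp add: frame_def)
   have y18: "areg y 18 = c" using fr by (simp add: frame_def x1_def)
   have cy: "core y" "dead_single y = dead_single x" "lam y = lam x"
    by (rule core_cong[OF core]; use ey ay ly in \<open>auto simp: q_def\<close>)+
   have cfy: "comp y = cf" using ay by (simp add: cf_def)
   have Py: "Phi0 0 D y = Phi0 0 D x1"
    by (rule Phi0_cong) (use fr in \<open>auto simp: frame_def\<close>)
   have Qy: "set (alst y q 0) = Qs - {v}" using fr bl afne by (simp add: frame_def x1_def)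
   have Qy': "QO y = (if d then Qs - {v} else QO x)" "QI y = (if d then QI x else Qs - {v})"
    using Qy ly[of "bs+7"] ly[of "bs+8"] by (cases d; simp add: q_def)+
   have Qx: "QO x = (if d then Qs else QO x)" "QI x = (if d then QI x else Qs)" by (cases d; simp add: Qs_def q_def)+
   have sub: "nb d cf u \<subseteq> S" if "u : S" for u
    using that E unfolding nb_def oe_def ie_def S_def cls_def by auto
   have VS: "VS y \<subseteq> S" by (rule bfs_closed[OF bp]) (use vS sub adj1 in auto)
   have vV: "v : VS y"
   proof -
    have "VS y = {v} Un \<Union> (adj af x1 ` Sc)" using bp unfolding bfs_post_def by (elim conjE)
    thus ?thesis by blast
   qed
   have sumSc: "(SUM u:Sc. card (adj af x1 u)) <= D" using bp unfolding bfs_post_def by (elim conjE)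
   have ScV: "Sc \<subseteq> VS y" using bp unfolding bfs_post_def by (elim conjE)
   have finSc: "finite Sc" using ScV finite_subset by blast
   \<comment> \<open>Each visited vertex except \<open>v\<close> is the end of a scanned
     arc.\<close>
   have cV: "card (VS y) <= 1 + D"
   proof -
    have "VS y = {v} Un \<Union> (adj af x1 ` Sc)" using bp unfolding bfs_post_def by (elim conjE)
    hence "card (VS y) <= card {v} + card (\<Union> (adj af x1 ` Sc))" by (metis card_Un_le)
    also have "card (\<Union> (adj af x1 ` Sc)) <= (SUM u:Sc. card (adj af x1 u))" using finSc by (rule card_UN_le)
    finally show ?thesis using sumSc by simp
   qed
   have T: "T <= 300 + 200 * D"
   proof -
    have "(SUM u:Sc. 100 * (1 + card (adj af x1 u))) = 100 * card Sc + 100 * (SUM u:Sc. card (adj af x1 u))"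
     by (simp add: sum.distrib sum_distrib_left)
    moreover have "card Sc <= card (VS y)" using ScV by (intro card_mono) auto
    ultimately show ?thesis using 7(2) sumSc cV by linarith
   qed
   have reach: "VS y \<subseteq> X" if "v : X" "(if d then ocl cf X else icl cf X)" for X
    by (rule bfs_closed[OF bp]) (use that adj1 in \<open>auto simp: nb_def ocl_def icl_def split: if_splits\<close>)
   show ?case
   proof (rule hw_ok)
    assume oky: "lists_ok y"
    have lens: "length (alst y (bs+9) 0) = card (VS y)" "length (alst y (bs+2) c) = card S"
     using length_CS[OF oky] CS_eq[OF coreD(2)[OF cy(1)], of c] by (auto simp: cfy S_def)
    show ?thesis
    proof (rule hw_Cond, simp, goal_cases)
     case 1
     hence o31: "areg y 31 ~= 0" and lt: "card (VS y) < card S" using y18 lens by (auto split: if_splits)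
     have VSp: "VS y \<subset> S" using VS lt by auto
     have clV: "ocl cf (VS y) \<or> icl cf (VS y)"
      using bfs_done_closed[OF bp o31] adj1 by (cases d) (auto simp: nb_def ocl_def icl_def)
     \<comment> \<open>A finished class is strongly connected or a dead singleton, so it has no
       nonempty closed proper part.\<close>
     have cur: "areg y 4 <= c"
     proof (rule ccontr)
      assume "~ areg y 4 <= c"
      hence lt': "comp x v < areg x 4" using ey[of 4] by (simp add: c_def cf_def)
      show False
      proof (cases "dead x v = 0")
       case True
       have "VS y = cls cf c"
        by (rule sconn_closed[where x = x]) (use C(13)[OF v lt' True] VS vV clV in \<open>auto simp: S_def c_def cf_def\<close>)
       thus False using VSp S_def by blast
      next
       case False
       hence "S = {v}" using ds v unfolding dead_single_def S_def c_def cf_def by blast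
       thus False using VSp vV by blast
      qed
     qed
     show ?case
     proof (rule hw_PartSplit[OF cy(1) _ y18 cur], goal_cases)
      case (5 T2 z A)
      have cz: "comp z = (%u. if u : A then areg y 5 else comp y u)" by (rule 5(8))
      have A: "A \<subseteq> cls cf c" "A ~= {}" using 5(10,11) unfolding cfy by auto
      have c': "cf u < areg y 5" if "u < n" for u using coreD(5)[OF cy(1) that] unfolding cfy .
      have cz': "comp z = (%u. if u : A then areg y 5 else cf u)" using cz unfolding cfy .
      have clsz: "cls (comp z) e = (if e = areg y 5 then A else if e = c then cls cf c - A else cls cf e)" for e
       by (rule split_cls[OF A _ cz']) (rule c')
      have qz0: "qinv D (comp z) (QO x Un QO z) (QI x Un QI z)"
       by (rule 5(5)) (use qi in \<open>simp add: cfy cf_def\<close>)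
      have Qyz: "QO y \<subseteq> QO z" "QI y \<subseteq> QI z" by (rule 5(6), rule 5(7))
      \<comment> \<open>Whichever half receives the new number, the class of \<open>v\<close> is the
        visited set.\<close>
      have vcls: "cls (comp z) e = VS y" if "v : cls (comp z) e" for e
      proof -
       have "A = VS y \<or> A = S - VS y" using 5(13) unfolding cfy S_def .
       moreover have "v ~: S - VS y" using vV by blast
       moreover have "S - (S - VS y) = VS y" using VS by blast
       moreover have "v : cls cf e ==> e = c" by (simp add: cls_def c_def)
       ultimately show ?thesis using that vV vS unfolding clsz S_def[symmetric] by (auto split: if_splits)
      qed
      have act: "X Int (if d then QO z else QI z) ~= {}"
       if X: "X ~= {}" "X \<subset> cls (comp z) e" and o: "if d then ocl (comp z) X else icl (comp z) X"
        "(SUM a:X. card (nb d (comp z) a)) <= D" for X e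
      proof (rule ccontr)
       assume no: "~ ?thesis"
       have "X Int ((if d then QO x else QI x) Un (if d then QO z else QI z)) ~= {}"
        using qinvD[OF qz0 X] o by (cases d) (simp_all add: nb_def)
       hence "X Int Qs ~= {}" using no Qx by (cases d) auto
       moreover have "Qs - {v} \<subseteq> (if d then QO z else QI z)" using Qy' Qyz by (cases d) auto
       ultimately have vX: "v : X" using no by blast
       have "nb d (comp z) a = nb d cf a" if a: "a : X" for a
       proof -
        have "nb d (comp z) a \<subseteq> nb d cf a" using split_oe[OF A c' cz'] by (cases d) (auto simp: nb_def)
        moreover have "u : nb d (comp z) a" if u: "u : nb d cf a" for u
        proof (rule ccontr)
         assume "u ~: nb d (comp z) a"
         hence "a : (if d then QO z else QI z)"
         using u 5(9)[of a u] 5(9)[of u a] unfolding cfy by (cases d) (auto simp: nb_def oe_def ie_def)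
         thus False using a no by blast
        qed
        ultimately show ?thesis by blast
       qed
       hence "if d then ocl cf X else icl cf X" using o(1) by (cases d) (auto simp: nb_def ocl_def icl_def)
       hence "VS y \<subseteq> X" using reach[OF vX] by blast
       moreover have "cls (comp z) e = VS y" using vcls vX X(2) by blast
       ultimately show False using X(2) by blast
      qed
      have qz: "qinv D (comp z) (QO z) (QI z)"
       unfolding qinv_def
      proof (intro allI impI conjI)
       fix e X assume X: "X ~= {}" "X \<subset> cls (comp z) e"
       show "X Int QO z ~= {}" if o: "ocl (comp z) X" "(SUM v:X. card (oe (comp z) v)) <= D"
       proof (cases d)
        case True
        thus ?thesis using act[OF X] o by (simp add: nb_def)
       next
        case False
        hence "QO x \<subseteq> QO z" using Qy' Qyz by simp
        thus ?thesis using qinvD(1)[OF qz0 X o] by blast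
       qed
       show "X Int QI z ~= {}" if o: "icl (comp z) X" "(SUM v:X. card (ie (comp z) v)) <= D"
       proof (cases d)
        case False
        thus ?thesis using act[OF X] o by (simp add: nb_def)
       next
        case True
        hence "QI x \<subseteq> QI z" using Qy' Qyz by simp
        thus ?thesis using qinvD(2)[OF qz0 X o] by blast
       qed
      qed
      have "inv 0 D z" using 5(1-4) qz ey[of 6] ey[of 7] r67 by (simp add: inv_def)
      moreover have "real (27 + T + T2) + 100 + Phi 0 D z <= Phi 0 D x"
      proof -
       have 1: "real T2 + Phi 0 D z <= Phi 0 D y + 1100 + 400 * real (card (VS y))" by (rule 5(14))
       have 2: "Phi 0 D y + 3000 * real D = Phi 0 D x" unfolding Phi_def Py cy(3) using drop by simp
       have 3: "real T <= 300 + 200 * real D" using of_nat_mono[OF T, where 'a = real] by simp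
       have 4: "real (card (VS y)) <= 1 + real D" using of_nat_mono[OF cV, where 'a = real] by simp
       have 5: "1 <= real D" using D by simp
       show ?thesis using 1 2 3 4 5 by simp
      qed
      ultimately show ?case by (simp add: eval_nat_numeral)
     qed (use cy ds VSp vV clV in \<open>auto simp: cfy S_def\<close>)
    next
     case 2
     hence ex: "areg y 31 = 0 \<or> ~ card (VS y) < card S" using y18 lens by (auto split: if_splits)
     have act: "X Int (Qs - {v}) ~= {}"
      if X: "X ~= {}" "X \<subset> cls cf e" and o: "if d then ocl cf X else icl cf X" "(SUM a:X. card (nb d cf a)) <= D" for X e
     proof (rule ccontr)
      assume no: "~ ?thesis"
      have "X Int (if d then QO x else QI x) ~= {}"
       using qinvD[OF qi[folded cf_def] X] o by (cases d) (simp_all add: nb_def)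
      hence "X Int Qs ~= {}" using Qx by (cases d) auto
      hence vX: "v : X" using no by blast
      have VX: "VS y \<subseteq> X" by (rule reach[OF vX o(1)])
      have ec: "e = c" using vX X(2) by (auto simp: cls_def c_def)
      have finX: "finite X" using X(2) finite_subset[of X "cls cf e"] by auto
      show False
      proof (cases "areg y 31 = 0")
       case True
       then obtain u where u: "u : VS y - Sc" "D < (SUM a:Sc. card (adj af x1 a)) + card (adj af x1 u)"
        using bp unfolding bfs_post_def by blast
       have "(SUM a:insert u Sc. card (nb d cf a)) <= (SUM a:X. card (nb d cf a))"
        using u VX ScV finX by (intro sum_mono2) auto
       thus False using u o(2) finSc unfolding adj1 by simp
      next
       case False
       hence "VS y = S" using ex VS finS by (meson psubsetI psubset_card_mono)
       thus False using VX X(2) unfolding ec S_def by blast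
      qed
     qed
     have qy: "qinv D cf (QO y) (QI y)"
      unfolding qinv_def
     proof (intro allI impI conjI)
      fix e X assume X: "X ~= {}" "X \<subset> cls cf e"
      show "X Int QO y ~= {}" if o: "ocl cf X" "(SUM v:X. card (oe cf v)) <= D"
      proof (cases d)
       case True
       thus ?thesis using act[OF X] o Qy' by (simp add: nb_def)
      next
       case False
       thus ?thesis using qinvD(1)[OF qi[folded cf_def] X o] Qy' by simp
      qed
      show "X Int QI y ~= {}" if o: "icl cf X" "(SUM v:X. card (ie cf v)) <= D"
      proof (cases d)
       case False
       thus ?thesis using act[OF X] o Qy' by (simp add: nb_def)
      next
       case True
       thus ?thesis using qinvD(2)[OF qi[folded cf_def] X o] Qy' by simp
      qed
     qed
     have "inv 0 D y" using cy ds qy ey[of 6] ey[of 7] r67 by (simp add: inv_def cfy)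
     moreover have "real (28 + T) + 100 + Phi 0 D y <= Phi 0 D x"
     proof -
      have 2: "Phi 0 D y + 3000 * real D = Phi 0 D x" unfolding Phi_def Py cy(3) using drop by simp
      have 3: "real T <= 300 + 200 * real D" using of_nat_mono[OF T, where 'a = real] by simp
      have 5: "1 <= real D" using D by simp
      show ?thesis using 2 3 5 by simp
     qed
     ultimately show ?case by (intro hw_Skip) (simp add: eval_nat_numeral)
    qed
   qed
  qed (use par1 Naf afne v in \<open>auto simp: x1_def\<close>)
 qed (use ne r0 Nq in auto)
qed

lemma sum_todo_split:
 fixes f :: "nat => nat"
 shows "(SUM v | v < n & c <= cf v. f v) = (SUM v | v < n & Suc c <= cf v. f v) + (SUM v:cls cf c. f v)"
proof -
 have "{v. v < n & c <= cf v} = {v. v < n & Suc c <= cf v} Un cls cf c" by (auto simp: cls_def)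
 moreover have "{v. v < n & Suc c <= cf v} Int cls cf c = {}" by (auto simp: cls_def)
 ultimately show ?thesis by (simp add: sum.union_disjoint)
qed

text \<open>A settled class leaves the sums over unfinished classes, and its share pays for the
  search that settled it.\<close>

lemma advance:
 assumes inv: "inv dn D x" and cur: "areg x 4 < areg x 5" and Dm: "Dm x = {}"
  and S: "!!v. v : cls (comp x) (areg x 4) ==> dead x v = 0 ==> sconn x (cls (comp x) (areg x 4))"
 defines "y \<equiv> setr x 4 (areg x 4 + 1)"
 shows "inv dn D y"
  "Phi dn D y + 1000 + (if dn ~= 0 then 60000 * real (card (cls (comp x) (areg x 4)) * card (cls (comp x) (areg x 4)))
    else 2000 * real (SUM v:cls (comp x) (areg x 4). 1 + card (oe (comp x) v) + card (ie (comp x) v))) = Phi dn D x"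
proof -
 have core: "core x" using inv by (simp add: inv_def)
 note C = coreD[OF core]
 have "core y"
  unfolding core_def
 proof (intro conjI allI impI ballI)
  show "params y" using C(1) unfolding y_def by simp
  show "consistent y" "live y" using C(2,3) unfolding y_def consistent_def live_def by simp_all
  show "v : Dm y" if "v < n" "dead y v = 0" "viol (comp y) v" for v using C(4)[of v] that by (simp add: y_def)
  show "comp y v < areg y 5" if "v < n" for v using C(5)[OF that] by (simp add: y_def)
  show "areg y 4 <= areg y 5" using cur by (simp add: y_def)
  show "v < n" "dead y v = 0" "lost v" if "v : Dm y" for v using C(7-9)[of v] that by (simp_all add: y_def)
  show "lost v" if "v < n" "dead y v ~= 0" for v using C(10)[of v] that by (simp add: y_def)
  show "comp y u = comp y w" if "gec X" "u : X" "w : X" for X u w using C(11)[OF that] by (simp add: y_def)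
  fix v assume v: "v < n" "comp y v < areg y 4" "dead y v = 0"
  show "v ~: Dm y" using Dm by (simp add: y_def)
  show "sconn y (cls (comp y) (comp y v))"
  proof (cases "comp x v < areg x 4")
   case True
   thus ?thesis using C(13)[of v] v by (simp add: y_def sconn_def)
  next
   case False
   hence "comp x v = areg x 4" using v(2) by (simp add: y_def)
   thus ?thesis using S[of v] v by (simp add: y_def sconn_def cls_def)
  qed
 qed
 thus "inv dn D y" using inv unfolding inv_def dead_single_def y_def by simp
 let ?S = "cls (comp x) (areg x 4)"
 have sq: "pot_sq (areg x 4) (comp x) = pot_sq (Suc (areg x 4)) (comp x) + card ?S * card ?S"
 proof -
  have "(SUM v:?S. csz (comp x) v) = (SUM v:?S. card ?S)" by (intro sum.cong) (auto simp: csz_def cls_def)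
  thus ?thesis unfolding pot_sq_def sum_todo_split[where c = "areg x 4"] by simp
 qed
 have td: "pot_todo (areg x 4) (comp x) = pot_todo (Suc (areg x 4)) (comp x) + (SUM v:?S. 1 + card (oe (comp x) v) + card (ie (comp x) v))"
  unfolding pot_todo_def by (rule sum_todo_split)
 have lam: "lam y = lam x" "alive_wt y = alive_wt x" by (simp_all add: y_def lam_def alive_wt_def)
 show "Phi dn D y + 1000 + (if dn ~= 0 then 60000 * real (card ?S * card ?S)
    else 2000 * real (SUM v:?S. 1 + card (oe (comp x) v) + card (ie (comp x) v))) = Phi dn D x"
  unfolding Phi_def Phi0_def lam sq td by (simp add: y_def algebra_simps)
qed

text \<open>With empty queues \<open>qinv\<close> forces more than \<open>D\<close> edges at a
  closed proper part. As the part is closed in that direction, these edges stay inside the new class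
  and are counted by \<open>cedges\<close>.\<close>

lemma cedges_part:
 assumes X: "cls cf' d = X" "ocl cf X \<or> icl cf X" and sub: "!!v. oe cf' v \<subseteq> oe cf v" "!!v. ie cf' v \<subseteq> ie cf v"
  and q: "qinv D cf {} {}" "X ~= {}" "X \<subset> cls cf c"
 shows "D < cedges cf' d"
proof -
 have cX: "cf' v = d" if "v : X" for v using that X(1) by (auto simp: cls_def)
 from X(2) show ?thesis
 proof
  assume o: "ocl cf X"
  have "oe cf' v = oe cf v" if "v : X" for v
  proof
   show "oe cf v \<subseteq> oe cf' v"
   proof
    fix w assume w: "w : oe cf v"
    hence "w : X" using o that unfolding ocl_def by blast
    thus "w : oe cf' v" using w cX that by (simp add: oe_def)
   qed
  qed (rule sub)
  hence "cedges cf' d = (SUM v:X. card (oe cf v))" unfolding cedges_def X(1) by simp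
  thus ?thesis using qinvD(1)[OF q o] by force
 next
  assume i: "icl cf X"
  have "ie cf' v = ie cf v" if "v : X" for v
  proof
   show "ie cf v \<subseteq> ie cf' v"
   proof
    fix w assume w: "w : ie cf v"
    hence "w : X" using i that unfolding icl_def by blast
    thus "w : ie cf' v" using w cX that by (simp add: ie_def)
   qed
  qed (rule sub)
  hence "cedges cf' d = (SUM v:X. card (ie cf v))" unfolding cedges_in X(1) by simp
  thus ?thesis using qinvD(2)[OF q i] by force
 qed
qed

text \<open>If the component turns out to be strongly connected, its share in \<open>pot_sq\<close>
  or \<open>pot_todo\<close> pays for the search. Otherwise a split follows: in the dense variant
  the search costs at most a multiple of the loss of \<open>pot_sq\<close>, in the sparse variant
  both parts have more than \<open>D\<close> edges and \<open>pot_big\<close> releases a multiple of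
  \<open>m\<close>.\<close>

lemma hw_Process:
 assumes inv: "inv dn D x" and cur: "areg x 4 < areg x 5" and Dm: "Dm x = {}"
  and QE: "dn = 0 ==> QO x = {} & QI x = {}" and D: "0 < n ==> 0 < D"
 shows "hw N (Process bs) (%t y. inv dn D y & real t + 100 + Phi dn D y <= Phi dn D x) x"
proof (rule hw_ok)
 assume ok: "lists_ok x"
 have core: "core x" and ds: "dead_single x" and r67: "areg x 6 = dn" "areg x 7 = D"
  and qi: "dn = 0 ==> qinv D (comp x) {} {}" using inv QE by (auto simp: inv_def)
 note C = coreD[OF core]
 define c where "c = areg x 4"
 define cf where "cf = comp x"
 define S where "S = cls cf c"
 have finS: "finite S" by (simp add: S_def)
 have Sn: "S \<subseteq> {..<n}" by (auto simp: S_def cls_def)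
 have CSc: "CS x c = S" using CS_eq[OF C(2)] by (simp add: S_def cf_def)
 have lenS: "length (alst x (bs+2) c) = card S" using length_CS[OF ok] CSc by simp
 have r0: "areg x 0 = n" using params_reg0[OF C(1)] .
 define W where "W = (SUM v:S. 1 + card (oe cf v) + card (ie cf v))"
 let ?P = "%t y. inv dn D y & real t + 100 + Phi dn D y <= Phi dn D x"
 have inv_cong: "inv dn D z & Phi dn D z = Phi dn D x & core z & dead_single z"
  if "!!r. r <= 7 ==> areg z r = areg x r" "aarr z = aarr x" "!!f. f ~: {bs+9, bs+11} ==> alst z f = alst x f" for z
 proof -
  have cg: "core z" "dead_single z = dead_single x" "lam z = lam x"
   by (rule core_cong[OF core]; use that in auto)+
  have "Phi0 dn D z = Phi0 dn D x" by (rule Phi0_cong) (use that in auto)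
  thus ?thesis using cg ds inv that unfolding inv_def Phi_def by simp
 qed
 have adv: "hw N (Assign 4 (Op Add (Reg 4) (Const 1))) (%t. ?P (T + t)) z"
  if z: "!!r. r <= 7 ==> areg z r = areg x r" "aarr z = aarr x" "!!f. f ~: {bs+9, bs+11} ==> alst z f = alst x f"
   and sc: "!!v. v : S ==> dead x v = 0 ==> sconn x S"
   and T: "real T <= 800 + (if dn ~= 0 then 60000 * real (card S * card S) else 2000 * real W)" for z T
 proof -
  have iz: "inv dn D z" "Phi dn D z = Phi dn D x" using inv_cong[OF z] by auto
  have ez: "areg z 4 = c" "areg z 5 = areg x 5" "comp z = cf" "dead z = dead x" "Dm z = {}"
   using z Dm by (auto simp: c_def cf_def)
  have sc': "sconn z (cls (comp z) (areg z 4))" if "v : cls (comp z) (areg z 4)" "dead z v = 0" for v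
   using sc[of v] that unfolding ez S_def sconn_def by simp
  note ad = advance[OF iz(1) _ ez(5) sc']
  have 1: "inv dn D (setr z 4 (areg z 4 + 1))" by (rule ad(1)) (use cur ez in \<open>simp_all add: c_def\<close>)
  have 2: "Phi dn D (setr z 4 (areg z 4 + 1)) + 1000 + (if dn ~= 0 then 60000 * real (card S * card S) else 2000 * real W) = Phi dn D x"
   using ad(2) cur unfolding ez iz(2) S_def[symmetric] W_def by (simp add: c_def)
  show ?thesis using 1 2 T by (intro hw_Assign) (auto split: if_splits)
 qed
 define x1 where "x1 = setr x 18 c"
 have eq1: "setr x 18 (aev x (Reg 4)) = x1" by (simp add: x1_def c_def)
 have z1: "!!r. r <= 7 ==> areg x1 r = areg x r" "aarr x1 = aarr x" "alst x1 = alst x" by (auto simp: x1_def)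
 show ?thesis
  unfolding Process_def
 proof (rule hw_Seq, rule hw_Assign, simp, unfold eq1, rule hw_Cond, simp, goal_cases)
  case 2
  hence "S = {}" using lenS finS by (simp add: x1_def)
  have "hw N (Assign 4 (Op Add (Reg 4) (Const 1))) (%t. ?P (5 + t)) x1"
   by (rule adv) (use z1 `S = {}` in \<open>auto split: if_splits\<close>)
  thus ?case by (simp add: eval_nat_numeral)
 next
  case 1
  hence ne: "S ~= {}" "alst x (bs+2) c ~= []" using lenS by (auto simp: x1_def)
  have S1: "1 <= card S" using ne(1) finS card_gt_0_iff[of S] by linarith
  have npos: "0 < n" using ne(1) Sn by auto
  have m1: "1 <= m" using npos n_le_m by simp
  define r where "r = alst x (bs+2) c ! 0"
  have rS: "r : S" using ne(2) CSc by (metis length_greater_0_conv nth_mem r_def)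
  show ?case
  proof (rule hw_Seq, rule hw_Elt, goal_cases)
   case 5
   define x2 where "x2 = setr x1 37 r"
   have eq2: "setr x1 37 (alst x1 (bs+2) (aev x1 (Reg 18)) ! aev x1 (Const 0)) = x2" by (simp add: x2_def x1_def r_def)
   have z2: "!!r. r <= 7 ==> areg x2 r = areg x r" "aarr x2 = aarr x" "alst x2 = alst x" "areg x2 18 = c" by (auto simp: x2_def x1_def)
   have i2: "core x2" "dead_single x2" "Phi dn D x2 = Phi dn D x" using inv_cong[of x2] z2 by auto
   note C2 = coreD[OF i2(1)]
   have CSc2: "CS x2 c = S" using CSc z2(3) by simp
   have live_cf: "Out x2 v = oe cf v" "In x2 v = ie cf v" for v
    using live_eq[OF C2(3), of v] z2(2) by (simp_all add: cf_def)
   let ?rest = "Cond (Reg 38) (PartSplit bs) (Assign 4 (Op Add (Reg 4) (Const 1)))"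
   have rest: "hw N ?rest (%t. ?P (T + t)) z"
    if fr: "frame {30, 31, 32, 33, 35, 36, 37, 38, 39, 40, 41, 42, 43, 44} {bs+9, bs+11} x2 z"
     and dec: "areg z 38 = 1 & VS z ~= {} & VS z \<subset> S &
       (ocl cf (VS z) \<or> icl cf (VS z) \<or> ocl cf (S - VS z) \<or> icl cf (S - VS z)) \<or>
      areg z 38 = 0 & (ALL v:S. dead x v = 0 --> sconn x S)"
     and T1: "areg z 38 = 1 ==> real T <= 100 + (if dn ~= 0 then 40000 * real (card S * min (card (VS z)) (card (S - VS z))) else 600 * real W)"
     and T0: "areg z 38 = 0 ==> real T <= 100 + (if dn ~= 0 then 40000 * real (card S * card S) else 600 * real W)" for z T
   proof -
    have z: "!!r. r <= 7 ==> areg z r = areg x r" "aarr z = aarr x" "!!f. f ~: {bs+9, bs+11} ==> alst z f = alst x f"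
     "areg z 18 = c"
     using fr z2 by (auto simp: frame_def)
    have iz: "core z" "dead_single z" "Phi dn D z = Phi dn D x" "inv dn D z" using inv_cong[of z] z by auto
    have cz: "comp z = cf" using z(2) by (simp add: cf_def)
    show ?thesis
    proof (rule hw_Cond, simp, goal_cases)
     case 2
     hence z38: "areg z 38 = 0" by simp
     hence sc: "sconn x S" if "v : S" "dead x v = 0" for v using dec that by auto
     have "hw N (Assign 4 (Op Add (Reg 4) (Const 1))) (%t. ?P ((T + 2) + t)) z"
      by (rule adv[OF z(1-3) sc]) (use T0[OF z38] in \<open>auto split: if_splits\<close>)
     thus ?case by (simp add: eval_nat_numeral)
    next
     case 1
     hence z38: "areg z 38 = 1" and V: "VS z ~= {}" "VS z \<subset> S"
      and cl: "ocl cf (VS z) \<or> icl cf (VS z) \<or> ocl cf (S - VS z) \<or> icl cf (S - VS z)"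
      using dec by auto
     have r4: "areg z 4 <= c" using z(1)[of 4] by (simp add: c_def)
     show ?case
     proof (rule hw_PartSplit[OF iz(1,2) z(4) r4], goal_cases)
      case (4 T2 y A)
      note h = 4[unfolded cz S_def[symmetric]]
      have iy: "inv dn D y"
      proof -
       have "qinv D (comp y) (QO y) (QI y)" if "dn = 0" using h(5)[OF qi[OF that, folded cf_def]] by simp
       thus ?thesis using h(1-4) z(1)[of 6] z(1)[of 7] r67 by (simp add: inv_def)
      qed
      have A: "A \<subseteq> cls cf c" "A ~= {}" using h(10,11) unfolding S_def by auto
      have finA: "finite A" using finite_subset[OF A(1)] by simp
      have AS: "A \<subseteq> S" using h(11) by blast
      have c': "cf u < areg z 5" if "u < n" for u using coreD(5)[OF iz(1) that] unfolding cz .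
      have cA: "card (S - A) = card S - card A" "card A <= card S" using card_Diff_subset[OF finA AS] card_mono[OF finS AS] by auto
      have A1: "1 <= card A" using A(2) finA card_gt_0_iff[of A] by linarith
      have B1: "card A <= card (S - A)" "card S <= 2 * card (S - A)" using cA h(12) by auto
      have cV: "card (VS z) <= card S" using card_mono[OF finS] V(2) by blast
      have "real (T + 2 + T2) + 100 + Phi dn D y <= Phi dn D x"
      proof (cases "dn = 0")
       case True
       have cls_y: "cls (comp y) e = (if e = areg z 5 then A else if e = c then cls cf c - A else cls cf e)" for e
        by (rule split_cls[OF A _ h(8)]) (rule c')
       have c_lt: "c < areg z 5" using z(1)[of 5] cur by (simp add: c_def)
       have sw: "ocl cf X \<or> icl cf X ==> X \<subseteq> S ==> ocl cf (S - X) \<or> icl cf (S - X)" for X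
        using ocl_swap[of cf X c] unfolding S_def by blast
       have VV: "S - (S - VS z) = VS z" using V(2) by blast
       have clV: "ocl cf (VS z) \<or> icl cf (VS z)" "ocl cf (S - VS z) \<or> icl cf (S - VS z)"
        using cl sw[of "VS z"] sw[of "S - VS z"] V(2) unfolding VV by blast+
       have clA: "ocl cf A \<or> icl cf A" "ocl cf (S - A) \<or> icl cf (S - A)" using clV h(13) VV by auto
       have sub: "oe (comp y) v \<subseteq> oe cf v" "ie (comp y) v \<subseteq> ie cf v" for v using split_oe[OF A c' h(8)] by auto
       have qE: "qinv D cf {} {}" using qi[OF True] by (simp add: cf_def)
       have e1: "D < cedges (comp y) (areg z 5)"
        by (rule cedges_part[OF _ clA(1) sub qE A(2)]) (use h(11) cls_y in \<open>auto simp: S_def\<close>)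
       have "S - A ~= {}" "S - A \<subset> S" using h(11) A(2) by blast+
       hence e2: "D < cedges (comp y) c"
        by (intro cedges_part[OF _ clA(2) sub qE]) (use cls_y c_lt in \<open>auto simp: S_def\<close>)
       have P: "real T2 + Phi 0 D y + 5000 * real m <= Phi 0 D x + 1100 + 400 * real (card (VS z))"
        using h(15)[OF D[OF npos] e2 e1] iz(3) True by simp
       have "W <= 3 * m"
       proof -
        have "W = card S + (SUM v:S. card (oe cf v)) + (SUM v:S. card (ie cf v))"
         unfolding W_def by (simp only: sum.distrib) simp
        moreover have "card S <= n" using card_mono[OF _ Sn] by simp
        moreover have "(SUM v:S. card (oe cf v)) <= m" "(SUM v:S. card (ie cf v)) <= m"
         using sum_out_le[OF C2(3) Sn] unfolding live_cf .
        ultimately show ?thesis using n_le_m by linarith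
       qed
       hence "real W <= 3 * real m" using of_nat_mono[where 'a = real] by fastforce
       moreover have "real (card (VS z)) <= real m"
        using cV card_mono[OF _ Sn] n_le_m by simp
       moreover have "real T <= 100 + 600 * real W" using T1[OF z38] True by simp
       moreover have "1 <= real m" using m1 by simp
       ultimately show ?thesis using P True by simp
      next
       case False
       have P: "real T2 + Phi dn D y + 107500 * real (card A * card (S - A)) <= Phi dn D x + 1100 + 400 * real (card (VS z))"
        using h(16)[OF False, of D] iz(3) by simp
       define q where "q = card A * card (S - A)"
       have q1: "card (S - A) <= q" "1 <= q" using A1 B1(1) by (simp_all add: q_def)
       have "min (card (VS z)) (card (S - VS z)) = card A"
       proof -
        have "card (S - VS z) = card S - card (VS z)" using V(2) finS by (intro card_Diff_subset) (auto intro: finite_subset)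
        moreover have "S - (S - VS z) = VS z" using V(2) by blast
        ultimately show ?thesis using h(13) B1(1) cA by (elim disjE) (auto simp: min_def)
       qed
       hence "real T <= 100 + 40000 * real (card S * card A)" using T1[OF z38] False by simp
       \<comment> \<open>\<open>card S <= 2 * card (S - A)\<close> because \<open>A\<close> is the
         smaller half.\<close>
       moreover have "card S * card A <= 2 * q" using B1(2) by (simp add: q_def mult.commute[of "card A"] mult_le_mono1 flip: mult.assoc)
       hence "real (card S * card A) <= 2 * real q" using of_nat_mono[where 'a = real] by fastforce
       moreover have "card (VS z) <= 2 * q" using cV B1(2) q1 by linarith
       hence "real (card (VS z)) <= 2 * real q" using of_nat_mono[where 'a = real] by fastforce
       moreover have "1 <= real q" using q1 by simp
       ultimately show ?thesis using P unfolding q_def[symmetric] by simp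
      qed
      thus ?case using iy by (simp add: eval_nat_numeral)
     qed (use V cl in \<open>auto simp: cz S_def\<close>)
    qed
   qed
   show ?case
    unfolding eq2
   proof (rule hw_Seq, rule hw_Cond, simp, goal_cases)
    case 1
    hence dr: "dead x r ~= 0" using z2 by (simp add: x2_def)
    have Sr: "S = {r}"
    proof -
     have "r < n" "cf r = c" using rS by (auto simp: S_def cls_def)
     thus ?thesis using ds dr unfolding dead_single_def S_def cf_def by auto
    qed
    have "hw N ?rest (%t. ?P (17 + t)) (setr x2 38 (aev x2 (Const 0)))"
     by (rule rest) (use Sr dr in \<open>auto simp: frame_def\<close>)
    thus ?case by (intro hw_Assign) simp_all
   next
    case 2
    show ?case
    proof (rule hw_Cond, simp, goal_cases)
     case 1
     hence dn: "dn ~= 0" using z2(1)[of 6] r67 by simp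
     show ?case
     proof (rule hw_FindDense[where c = c and S = S], goal_cases)
      case (7 T z)
      have dec: "areg z 38 = 1 & VS z ~= {} & VS z \<subset> S &
       (ocl cf (VS z) \<or> icl cf (VS z) \<or> ocl cf (S - VS z) \<or> icl cf (S - VS z)) \<or>
       areg z 38 = 0 & (ALL v:S. dead x v = 0 --> sconn x S)"
       using 7(2) z2(2) unfolding decided_def closed_eq[OF C2(3)] sconn_def by (auto simp: cf_def)
      have "hw N ?rest (%t. ?P ((T + 20) + t)) z"
      proof (rule rest[OF 7(1) dec])
       show "real (T + 20) <= 100 + (if dn ~= 0 then 40000 * real (card S * min (card (VS z)) (card (S - VS z))) else 600 * real W)" if "areg z 38 = 1"
        using of_nat_mono[OF 7(3)[OF that], where 'a = real] dn by simp
       show "real (T + 20) <= 100 + (if dn ~= 0 then 40000 * real (card S * card S) else 600 * real W)" if "areg z 38 = 0"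
        using of_nat_mono[OF 7(4)[OF that], where 'a = real] dn by simp
      qed
      thus ?case by (rule hw_mono) simp
     qed (rule C2(1) C2(2) C2(3) z2(4) CSc2 ne(1))+
    next
     case 2
     hence dn: "dn = 0" using z2(1)[of 6] r67 by simp
     show ?case
     proof (rule hw_Decide[where c = c and S = S], goal_cases)
      case (7 T z)
      have fr: "frame {30, 31, 32, 33, 35, 36, 37, 38, 39, 40, 41, 42, 43, 44} {bs+9, bs+11} x2 z"
       using 7(1) by (simp add: frame_def)
      have dec: "areg z 38 = 1 & VS z ~= {} & VS z \<subset> S &
       (ocl cf (VS z) \<or> icl cf (VS z) \<or> ocl cf (S - VS z) \<or> icl cf (S - VS z)) \<or>
       areg z 38 = 0 & (ALL v:S. dead x v = 0 --> sconn x S)"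
       using 7(2) z2(2) unfolding decided_def closed_eq[OF C2(3)] sconn_def by (auto simp: cf_def)
      have TW: "real T <= 600 * real W" using of_nat_mono[OF 7(3)[unfolded live_cf, folded W_def], where 'a = real] by simp
      have "hw N ?rest (%t. ?P ((T + 20) + t)) z"
       by (rule rest[OF fr dec]) (use TW dn in simp_all)
      thus ?case by (rule hw_mono) simp
     qed (rule C2(1) C2(2) C2(3) z2(4) CSc2 ne(1))+
    qed
   qed
  qed (use r0 ne in \<open>auto simp: x1_def\<close>)
 qed
qed

text \<open>Every branch lowers the real potential by more than its cost, and by at least 1, so the
  rounded potential also serves as the measure for termination.\<close>

lemma hw_Main:
 assumes inv: "inv dn D x" and D: "0 < n ==> 0 < D"
  and Q: "!!T y. inv dn D y ==> areg y 5 <= areg y 4 ==> real T <= Phi dn D x + 10 ==> Q T y"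
 shows "hw N (Main bs) Q x"
proof -
 have nonneg: "0 <= Phi dn D y" if "inv dn D y" for y
  using that Phi0_nonneg[of y dn D] coreD(6)[of y] by (auto simp: inv_def Phi_def)
 let ?e = "Op Less (Reg 4) (Reg 5)"
 show ?thesis
  unfolding Main_def
 proof (rule hw_While[where I = "%T y. inv dn D y & real T + Phi dn D y <= Phi dn D x" and \<mu> = "%y. nat \<lfloor>Phi dn D y\<rfloor>"], goal_cases)
  case (3 T y)
  thus ?case using nonneg[of y] by (intro Q) (auto split: if_splits)
 next
  case (2 T y)
  hence iy: "inv dn D y" and Ty: "real T + Phi dn D y <= Phi dn D x" and lt: "areg y 4 < areg y 5" by (auto split: if_splits)
  have r6: "areg y 6 = dn" using iy by (simp add: inv_def)
  let ?P = "%t x'. (inv dn D x' & real (T + cost ?e + 1 + t) + Phi dn D x' <= Phi dn D x) & nat \<lfloor>Phi dn D x'\<rfloor> < nat \<lfloor>Phi dn D y\<rfloor>"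
  have fin: "?P t z" if "inv dn D z & real t' + 100 + Phi dn D z <= Phi dn D y" "t <= t' + 50" for t t' z
  proof -
   have "Phi dn D z + 1 <= Phi dn D y" using that(1) by linarith
   hence "\<lfloor>Phi dn D z\<rfloor> + 1 <= \<lfloor>Phi dn D y\<rfloor>" by linarith
   moreover have "0 <= \<lfloor>Phi dn D z\<rfloor>" using nonneg that(1) by simp
   moreover have "real t <= real t' + 50" using of_nat_mono[OF that(2), where 'a = real] by simp
   ultimately show ?thesis using that(1) Ty by simp
  qed
  have D0: "0 < D" if "dn = 0" "alst y f 0 ~= []" "N f = n" "lists_ok y" for f
  proof -
   have "last (alst y f 0) < n" using lists_ok_less[OF that(4), of "last (alst y f 0)" f 0] that by simp
   thus ?thesis using D by simp
  qed
  show ?case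
  proof (rule hw_ok)
   assume oky: "lists_ok y"
   show ?thesis
   proof (rule hw_Cond, simp, goal_cases)
    case 1
    hence "alst y (bs+6) 0 ~= []" by simp
    from hw_Kill[OF iy this] show ?case by (rule hw_mono) (rule fin, assumption, simp)
   next
    case 2
    hence Dm: "Dm y = {}" by simp
    show ?case
    proof (rule hw_Cond, simp, goal_cases)
     case 1
     hence h: "dn = 0" "alst y (bs+7) 0 ~= []" using r6 by (auto split: if_splits)
     from hw_PopSearch[of D y True] iy h D0[OF h _ oky]
     have "hw N (PopSearch bs (bs+7) bs) (%t z. inv dn D z & real t + 100 + Phi dn D z <= Phi dn D y) y" by simp
     thus ?case by (rule hw_mono) (rule fin, assumption, simp)
    next
     case 2
     hence Q7: "dn = 0 ==> QO y = {}" using r6 by (auto split: if_splits)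
     show ?case
     proof (rule hw_Cond, simp, goal_cases)
      case 1
      hence h: "dn = 0" "alst y (bs+8) 0 ~= []" using r6 by (auto split: if_splits)
      from hw_PopSearch[of D y False] iy h D0[OF h _ oky]
      have "hw N (PopSearch bs (bs+8) (Suc bs)) (%t z. inv dn D z & real t + 100 + Phi dn D z <= Phi dn D y) y" by simp
      thus ?case by (rule hw_mono) (rule fin, assumption, simp)
     next
      case 2
      hence Q8: "dn = 0 ==> QI y = {}" using r6 by (auto split: if_splits)
      have "hw N (Process bs) (%t z. inv dn D z & real t + 100 + Phi dn D z <= Phi dn D y) y"
       by (rule hw_Process[OF iy lt Dm]) (use Q7 Q8 D in auto)
      thus ?case by (rule hw_mono) (rule fin, assumption, simp)
     qed
    qed
   qed
  qed
 qed (use inv in auto)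
qed

end

section \<open>Loading the input and running the engine\<close>

definition Upto :: "nat => expr => com => com" where
 "Upto c e p = Assign c (Const 0) ;; While (Op Less (Reg c) e) (p ;; Assign c (Op Add (Reg c) (Const 1)))"

lemma hw_Upto:
 assumes e: "abs_ok e" "!!i y. J i y ==> aev y e = M"
  and init: "J 0 (setr x c 0)"
  and step: "!!i y. i < M ==> J i y ==> areg y c = i ==>
   hw N p (%t z. t <= K & areg z c = i & J (Suc i) (setr z c (Suc i))) y"
  and Q: "!!T y. J M y ==> T <= M * (K + cost e + 10) + cost e + 10 ==> Q T y"
 shows "hw N (Upto c e p) Q x"
proof -
 let ?c = "K + cost e + 10"
 have "hw N (While (Op Less (Reg c) e) (p ;; Assign c (Op Add (Reg c) (Const 1)))) (%t. Q (2 + t)) (setr x c 0)"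
 proof (rule hw_While[where I = "%T y. J (areg y c) y & areg y c <= M & T <= areg y c * ?c" and \<mu> = "%y. M - areg y c"], goal_cases)
  case 1
  show ?case using e(1) by simp
 next
  case (2 T y)
  let ?i = "areg y c"
  have lt: "?i < M" using 2 e(2)[of ?i y] by (auto split: if_splits)
  have J: "J ?i y" using 2 by simp
  show ?case
  proof (rule hw_Seq, rule hw_mono[OF step[OF lt J refl]], rule hw_Assign, goal_cases)
   case (2 t z)
   have "T + 2 + cost e + 1 + t + 5 <= Suc ?i * ?c" using 2 `_ & _ & T <= areg y c * ?c` by simp
   thus ?case using 2 lt by (simp add: ac_simps)
  qed simp
 next
  case (3 T y)
  have "areg y c = M" using 3 e(2)[of "areg y c" y] by (auto split: if_splits)
  thus ?case using 3 by (intro Q) auto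
 next
  case 4
  show ?case using init by simp
 qed
 thus ?thesis unfolding Upto_def by (intro hw_Seq hw_Assign) (simp_all add: eval_nat_numeral)
qed

text \<open>At the beginning all vertices form component 0, so that the row of pair \<open>i\<close>
  is just \<open>i\<close>, and all vertices are in both queues. The last loop needs the complete
  \<open>U\<close> rows; it dooms the members of \<open>L i\<close> for which \<open>U i\<close> is
  empty.\<close>

definition Load :: "nat => com" where
 "Load bs =
   Upto 8 (Reg 1) (Insert bs 0 (Read bs (Reg 8)) (Read (Suc bs) (Reg 8)) ;;
    Insert (Suc bs) 0 (Read (Suc bs) (Reg 8)) (Read bs (Reg 8))) ;;
   Upto 8 (Reg 0) (Insert (bs+2) 0 (Const 0) (Reg 8) ;; Insert (bs+7) 0 (Const 0) (Reg 8) ;;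
    Insert (bs+8) 0 (Const 0) (Reg 8)) ;;
   Upto 8 (Reg 2) (Assign 12 (Read (bs+4) (Reg 8)) ;; Insert (bs+3) 2 (Reg 12) (Reg 8) ;;
    Assign 9 (Read (bs+3) (Reg 8)) ;;
    Cond (Read (bs+5) (Reg 8)) (Insert (bs+4) 0 (Reg 9) (Reg 12)) (Insert (bs+5) 0 (Reg 9) (Reg 12))) ;;
   Upto 8 (Reg 2) (Cond (Op Add (Read (bs+5) (Reg 8)) (Cnt (bs+4) (Read (bs+3) (Reg 8)))) Skip
    (Assign 9 (Read (bs+4) (Reg 8)) ;; Doom bs 9))"

text \<open>Register 6 selects the bound: it is nonzero if \<open>n\<^sup>2 \<le> m powr (3/2)\<close>. Register 7 becomes the
 square root of \<open>m\<close>, rounded up.\<close>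

definition Setup :: "com" where
 "Setup = Assign 6 (Op Equal (Op Less (Op Mul (Op Mul (Reg 1) (Reg 1)) (Reg 1))
    (Op Mul (Op Mul (Op Mul (Reg 0) (Reg 0)) (Reg 0)) (Reg 0))) (Const 0)) ;;
   Assign 7 (Const 0) ;; While (Op Less (Op Mul (Reg 7) (Reg 7)) (Reg 1)) (Assign 7 (Op Add (Reg 7) (Const 1))) ;;
   Assign 4 (Const 0) ;; Assign 5 (Const 1)"

definition Engine :: "nat => com" where
 "Engine bs = Load bs ;; Setup ;; Main bs"

context engine
begin

definition start :: "astate => bool" where
 "start x \<longleftrightarrow> areg x 0 = n & areg x (Suc 0) = m & areg x 2 = b & areg x 3 = k &
   aarr x (bs+2) = rn & aarr x (bs+3) = mi & aarr x (bs+4) = mv & aarr x (bs+5) = mu &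
   (ALL v. comp x v = 0) & (ALL v. dead x v = 0) &
   (ALL f r. bs <= f --> f <= bs+11 --> alst x f r = []) &
   E = (%e. (aarr x bs e, aarr x (Suc bs) e)) ` {..<m}"

lemma startD:
 assumes "start x"
 shows "areg x 0 = n" "areg x (Suc 0) = m" "areg x 2 = b" "areg x 3 = k" "aarr x (bs+2) = rn"
  "aarr x (bs+3) = mi" "aarr x (bs+4) = mv" "aarr x (bs+5) = mu" "comp x v = 0" "dead x v = 0"
  "bs <= f ==> f <= bs+11 ==> alst x f r = []"
  "E = (%e. (aarr x bs e, aarr x (Suc bs) e)) ` {..<m}"
 using assms unfolding start_def by simp_all

definition loaded :: "astate => bool" where
 "loaded x \<longleftrightarrow> params x & consistent x & live x & (ALL v. comp x v = 0) & (ALL v. dead x v = 0) &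
   Dm x = {v. EX i<k. v : L i & U i = {}} & QO x = {..<n} & QI x = {..<n}"

lemma hw_Load:
 assumes x: "start x" and Q: "!!T y. loaded y ==> T <= 300 * (m + n + 2 * b) + 100 ==> Q T y"
 shows "hw N (Load bs) Q x"
proof -
 note S = startD[OF x]
 define src where "src = aarr x bs"
 define dst where "dst = aarr x (Suc bs)"
 have E': "E = (%e. (src e, dst e)) ` {..<m}" using S(12) by (simp add: src_def dst_def)
 have sd: "src e < n" "dst e < n" if "e < m" for e using E E' that by auto
 define J1 where "J1 i y \<longleftrightarrow> frame {8} {bs, Suc bs} x y & (ALL v. Out y v = {w. EX e<i. src e = v & dst e = w}) &
  (ALL v. In y v = {u. EX e<i. src e = u & dst e = v})" for i y
 have l1: "hw N (Upto 8 (Reg 1) (Insert bs 0 (Read bs (Reg 8)) (Read (Suc bs) (Reg 8)) ;;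
    Insert (Suc bs) 0 (Read (Suc bs) (Reg 8)) (Read bs (Reg 8)))) (%T y. J1 m y & T <= 300 * m + 20) x"
 proof (rule hw_Upto[where J = J1 and M = m and K = 200], goal_cases)
  case (2 i y)
  thus ?case using S(2) by (simp add: J1_def frame_def)
 next
  case 3
  show ?case using S(11)[of bs] S(11)[of "Suc bs"] by (simp add: J1_def frame_def)
 next
  case (4 i y)
  have y: "areg y 0 = n" "aarr y bs = src" "aarr y (Suc bs) = dst" using 4(2) S(1) by (auto simp: J1_def frame_def src_def dst_def)
  have J: "frame {8} {bs, Suc bs} x y" "!!v. Out y v = {w. EX e<i. src e = v & dst e = w}"
   "!!v. In y v = {u. EX e<i. src e = u & dst e = v}" using 4(2) by (auto simp: J1_def)
  let ?z = "setr (setl (setl y bs (src i) (lins (dst i) (alst y bs (src i)))) (Suc bs) (dst i)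
   (lins (src i) (alst y (Suc bs) (dst i)))) 8 (Suc i)"
  have ex: "(EX e<Suc i. P e) \<longleftrightarrow> P i \<or> (EX e<i. P e)" for P by (auto simp: less_Suc_eq)
  have "J1 (Suc i) ?z"
   unfolding J1_def
  proof (intro conjI allI)
   show "frame {8} {bs, Suc bs} x ?z" using J(1) by (simp add: frame_def)
   show "Out ?z v = {w. EX e<Suc i. src e = v & dst e = w}" for v
    unfolding ex by (cases "v = src i") (simp_all add: J(2), blast+)
   show "In ?z v = {u. EX e<Suc i. src e = u & dst e = v}" for v
    unfolding ex by (cases "v = dst i") (simp_all add: J(3), blast+)
  qed
  thus ?case
   by (intro hw_Seq hw_Insert) (use y 4(1,3) sd[OF 4(1)] bs in simp_all)
 qed auto
 define J2 where "J2 x i y \<longleftrightarrow> frame {8} {bs+2, bs+7, bs+8} x y & (ALL d. CS y d = (if d = 0 then {..<i} else {})) &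
  QO y = {..<i} & QI y = {..<i}" for x i y
 have l2: "hw N (Upto 8 (Reg 0) (Insert (bs+2) 0 (Const 0) (Reg 8) ;; Insert (bs+7) 0 (Const 0) (Reg 8) ;;
    Insert (bs+8) 0 (Const 0) (Reg 8))) (%T y. J2 x1 n y & T <= 300 * n + 20) x1" if x1: "J1 m x1" for x1
 proof (rule hw_Upto[where J = "J2 x1" and M = n and K = 200], goal_cases)
  case (2 i y)
  thus ?case using S(1) x1 by (simp add: J1_def J2_def frame_def)
 next
  case 3
  show ?case using S(11)[of "bs+2"] S(11)[of "bs+7"] S(11)[of "bs+8"] x1 by (simp add: J1_def J2_def frame_def)
 next
  case (4 i y)
  have y: "areg y 0 = n" using 4(2) S(1) x1 by (auto simp: J1_def J2_def frame_def)
  show ?case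
   by (intro hw_Seq hw_Insert) (use y 4 in \<open>auto simp: J2_def frame_def\<close>)
 qed auto
 define J3 where "J3 x i y \<longleftrightarrow> frame {8, 9, 12} {bs+3, bs+4, bs+5} x y & (ALL v. MS y v = {j. j < i & mv j = v}) &
  (ALL r. US y r = {v. EX j<i. mv j = v & mi j = r & mu j ~= 0}) & (ALL r. LS y r = {v. EX j<i. mv j = v & mi j = r & mu j = 0})" for x i y
 have l3: "hw N (Upto 8 (Reg 2) (Assign 12 (Read (bs+4) (Reg 8)) ;; Insert (bs+3) 2 (Reg 12) (Reg 8) ;;
    Assign 9 (Read (bs+3) (Reg 8)) ;;
    Cond (Read (bs+5) (Reg 8)) (Insert (bs+4) 0 (Reg 9) (Reg 12)) (Insert (bs+5) 0 (Reg 9) (Reg 12))))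
    (%T y. J3 x2 b y & T <= 300 * b + 20) x2" if x1: "J1 m x1" and x2: "J2 x1 n x2" for x1 x2
 proof (rule hw_Upto[where J = "J3 x2" and M = b and K = 200], goal_cases)
  case (2 i y)
  thus ?case using S(3) x1 x2 by (simp add: J1_def J2_def J3_def frame_def)
 next
  case 3
  show ?case using S(11)[of "bs+3"] S(11)[of "bs+4"] S(11)[of "bs+5"] x1 x2 by (simp add: J1_def J2_def J3_def frame_def)
 next
  case (4 i y)
  have y: "areg y 0 = n" "areg y 2 = b" "aarr y (bs+3) = mi" "aarr y (bs+4) = mv" "aarr y (bs+5) = mu"
   using 4(2) S(1,3,6,7,8) x1 x2 by (auto simp: J1_def J2_def J3_def frame_def)
  show ?case
   by (intro hw_Seq hw_Cond hw_Assign hw_Insert) (use y 4 mem[of i] in \<open>auto simp: J3_def frame_def less_Suc_eq\<close>)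
 qed auto
 define J4 where "J4 x i y \<longleftrightarrow> frame {8, 9} {bs+6} x y & Dm y = {v. EX j<i. mv j = v & mu j = 0 & alst x (bs+4) (mi j) = []}" for x i y
 have l4: "hw N (Upto 8 (Reg 2) (Cond (Op Add (Read (bs+5) (Reg 8)) (Cnt (bs+4) (Read (bs+3) (Reg 8)))) Skip
    (Assign 9 (Read (bs+4) (Reg 8)) ;; Doom bs 9)))
    (%T y. J4 x3 b y & T <= 300 * b + 20) x3" if x1: "J1 m x1" and x2: "J2 x1 n x2" and x3: "J3 x2 b x3" for x1 x2 x3
 proof (rule hw_Upto[where J = "J4 x3" and M = b and K = 200], goal_cases)
  case (2 i y)
  thus ?case using S(3) x1 x2 x3 by (simp add: J1_def J2_def J3_def J4_def frame_def)
 next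
  case 3
  show ?case using S(11)[of "bs+6"] x1 x2 x3 by (simp add: J1_def J2_def J3_def J4_def frame_def)
 next
  case (4 i y)
  have y: "areg y 0 = n" "areg y (Suc 0) = m" "areg y 2 = b" "areg y 3 = k" "aarr y (bs+3) = mi" "aarr y (bs+4) = mv"
   "aarr y (bs+5) = mu" "aarr y (bs+2) = rn" "!!v. dead y v = 0" "alst y (bs+4) = alst x3 (bs+4)"
   "!!v. MS y v = {j. j < b & mv j = v}"
   using 4(2) S(1-10) x1 x2 x3 by (auto simp: J1_def J2_def J3_def J4_def frame_def)
  have J: "frame {8, 9} {bs+6} x3 y" "Dm y = {v. EX j<i. mv j = v & mu j = 0 & alst x3 (bs+4) (mi j) = []}"
   using 4(2) by (auto simp: J4_def)
  show ?case
  proof (intro hw_Cond hw_Skip hw_Seq hw_Assign hw_Doom, goal_cases)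
   case 2
   thus ?case using J y 4(3) by (auto simp: J4_def frame_def less_Suc_eq)
  next
   case 4
   thus ?case using y by (simp add: params_def)
  next
   case 5
   thus ?case using y mem[OF `i < b`] `areg y 8 = i` by simp
  next
   case (6 z)
   have z: "frame {8, 9} {bs+6} x3 (setr z 8 (Suc i))" using 6(2) J(1) by (simp add: frame_def)
   have "Dm z = Dm y Un {mv i}" using 6 y `areg y 8 = i` by auto
   hence "Dm z = {v. EX j<Suc i. mv j = v & mu j = 0 & alst x3 (bs+4) (mi j) = []}"
    using 6(1) J(2) y `areg y 8 = i` by (auto simp: less_Suc_eq)
   thus ?case using z 6(2) `areg y 8 = i` by (simp add: J4_def frame_def)
  qed simp_all
 qed auto
 have fin: "loaded y" if x1: "J1 m x1" and x2: "J2 x1 n x2" and x3: "J3 x2 b x3" and x4: "J4 x3 b y" for x1 x2 x3 y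
 proof -
  have fr: "areg y 0 = n" "areg y (Suc 0) = m" "areg y 2 = b" "areg y 3 = k" "aarr y = aarr x"
   using S(1-4) x1 x2 x3 x4 by (auto simp: J1_def J2_def J3_def J4_def frame_def)
  have l: "alst y bs = alst x1 bs" "alst y (Suc bs) = alst x1 (Suc bs)" "alst y (bs+2) = alst x2 (bs+2)"
   "alst y (bs+7) = alst x2 (bs+7)" "alst y (bs+8) = alst x2 (bs+8)" "alst y (bs+3) = alst x3 (bs+3)"
   "alst y (bs+4) = alst x3 (bs+4)" "alst y (bs+5) = alst x3 (bs+5)"
   using x2 x3 x4 by (auto simp: J2_def J3_def J4_def frame_def)
  have cd: "comp y v = 0" "dead y v = 0" for v using S(9,10) fr(5) by simp_all
  have us: "US y r = U r" "LS y r = L r" for r using x3 l by (auto simp: J3_def U_def L_def)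
  have UL: "U i = {}" "L i = {}" if "k <= i" for i using that mem unfolding U_def L_def by fastforce+
  have row: "d * k + i < k \<longleftrightarrow> d = 0" if "i < k" for d i using that by (cases d) auto
  have "params y" using fr S(5-8) x3 l by (auto simp: params_def J3_def)
  moreover have "consistent y" unfolding consistent_def
  proof (intro conjI allI impI)
   show "CS y d = {v. v < n & comp y v = d}" for d using x2 l cd by (auto simp: J2_def)
   show "US y (d * k + i) = {v : U i. comp y v = d}" if "i < k" for d i
    using row[OF that, of d] UL(1)[of "d * k + i"] by (cases "d = 0") (auto simp: us cd not_less)
   show "LS y (d * k + i) \<subseteq> {v : L i. comp y v = d}" if "i < k" for d i
    using row[OF that, of d] UL(2)[of "d * k + i"] by (cases "d = 0") (auto simp: us cd not_less)
   show "v : LS y (comp y v * k + i) \<or> v : Dm y \<or> dead y v ~= 0" if "i < k" "v : L i" for i v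
    using that by (simp add: us cd)
  qed
  moreover have "live y"
  proof -
   have "(u, w) : E \<longleftrightarrow> (EX e<m. src e = u & dst e = w)" for u w unfolding E' by auto
   thus ?thesis using x1 l(1,2) cd(1) by (simp add: live_def J1_def)
  qed
  moreover have "Dm y = {v. EX i<k. v : L i & U i = {}}"
  proof -
   have "alst x3 (bs+4) r = [] \<longleftrightarrow> U r = {}" for r using us(1)[of r] l(7) by (metis set_empty)
   thus ?thesis using x4 mem by (auto simp: J4_def L_def)
  qed
  ultimately show ?thesis using x2 l cd by (simp add: loaded_def J2_def)
 qed
 show ?thesis
  unfolding Load_def
 proof (rule hw_Seq, rule hw_mono[OF l1], rule hw_Seq, rule hw_mono[OF l2], erule conjunct1, rule hw_Seq, goal_cases)
  case (1 T1 x1 T2 x2)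
  note j1 = 1[THEN conjunct1]
  show ?case
  proof (rule hw_mono[OF l3[OF j1]], rule hw_mono[OF l4[OF j1]], goal_cases)
   case (2 T3 x3 T4 x4)
   show ?case using 1 2 by (intro Q fin[of x1 x2 x3]) auto
  qed auto
 qed
qed

definition isqrt :: "nat => bool" where "isqrt d \<longleftrightarrow> m <= d * d & (d ~= 0 --> (d - 1) * (d - 1) < m)"

lemma hw_Setup:
 assumes x: "loaded x"
  and Q: "!!T y dn D. inv dn D y ==> isqrt D ==> (dn = 0 \<longleftrightarrow> m * m * m < n * n * n * n) ==> T <= 50 + 20 * D ==>
   areg y 4 = 0 ==> areg y 5 = 1 ==> (!!v. comp y v = 0) ==> QO y = {..<n} ==> QI y = {..<n} ==> Q T y"
 shows "hw N Setup Q x"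
proof -
 define dn where "dn = (of_bool (~ m * m * m < n * n * n * n) :: nat)"
 have X: "params x" "consistent x" "live x" "!!v. comp x v = 0" "!!v. dead x v = 0"
   "Dm x = {v. EX i<k. v : L i & U i = {}}" "QO x = {..<n}" "QI x = {..<n}"
  using x by (auto simp: loaded_def)
 have r: "areg x 0 = n" "areg x (Suc 0) = m" using X(1) by (auto simp: params_def)
 define y where "y D = setr (setr (setr (setr x 6 dn) 7 D) 4 0) 5 1" for D
 have vl: "viol (comp x) v \<longleftrightarrow> (EX i<k. v : L i & U i = {})" if "v < n" for v
  using out[OF that] X(4) by (auto simp: viol_def)
 have Ln: "v < n" if "v : L i" for v i using that mem by (auto simp: L_def)
 have core: "core (y D)" for D
  unfolding core_def
 proof (intro conjI allI impI ballI)
  show "params (y D)" using X(1) by (simp add: y_def params_def)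
  show "consistent (y D)" using X(2) by (simp add: y_def consistent_def)
  show "live (y D)" using X(3) by (simp add: y_def live_def)
  show "v : Dm (y D)" if "v < n" "viol (comp (y D)) v" for v
   using vl[OF that(1)] that(2) X(6) by (simp add: y_def)
  fix v assume v: "v : Dm (y D)"
  hence "EX i<k. v : L i & U i = {}" using X(6) by (simp add: y_def)
  thus "v < n" "lost v" using Ln vl viol_lost[of "comp x" v] X(4) by auto
 qed (use X in \<open>auto simp: y_def\<close>)
 have inv: "inv dn D (y D)" for D
  unfolding inv_def
 proof (intro conjI impI)
  show "qinv D (comp (y D)) (QO (y D)) (QI (y D))"
   unfolding qinv_def using X(7,8) by (auto simp: y_def cls_def)
 qed (use core[of D] X(5) in \<open>simp_all add: y_def dead_single_def\<close>)
 have loop: "hw N (While (Op Less (Op Mul (Reg 7) (Reg 7)) (Reg 1)) (Assign 7 (Op Add (Reg 7) (Const 1))))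
   (%t z. EX D. z = setr (setr x 6 dn) 7 D & isqrt D & t <= 20 * D + 10) (setr (setr x 6 dn) 7 0)"
 proof (rule hw_While[where I = "%T z. EX D. z = setr (setr x 6 dn) 7 D & (D ~= 0 --> (D - 1) * (D - 1) < m) & T <= 20 * D"
    and \<mu> = "%z. m - areg z 7"], goal_cases)
  case 1
  show ?case by simp
 next
  case (2 T z)
  then obtain D where z: "z = setr (setr x 6 dn) 7 D" and D: "T <= 20 * D" and lt: "D * D < m"
   using r(2) by (auto split: if_splits)
  have "D < m" using lt le_square[of D] by linarith
  thus ?case
   by (intro hw_Assign) (use z D lt in \<open>auto simp: setr_def intro!: exI[of _ "Suc D"]\<close>)
 next
  case (3 T z)
  then obtain D where z: "z = setr (setr x 6 dn) 7 D" "D ~= 0 --> (D - 1) * (D - 1) < m" and D: "T <= 20 * D" and "~ D * D < m"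
   using r(2) by (auto split: if_splits)
  thus ?case by (intro exI[of _ D]) (auto simp: isqrt_def)
 next
  case 4
  show ?case by (intro exI[of _ 0]) simp
 qed
 have e6: "setr x 6 (aev x (Op Equal (Op Less (Op Mul (Op Mul (Reg 1) (Reg 1)) (Reg 1))
    (Op Mul (Op Mul (Op Mul (Reg 0) (Reg 0)) (Reg 0)) (Reg 0))) (Const 0))) = setr x 6 dn"
  using r by (simp add: dn_def)
 show ?thesis
  unfolding Setup_def
 proof (rule hw_Seq, rule hw_Assign, simp, unfold e6, rule hw_Seq, rule hw_Assign, simp, rule hw_Seq, unfold aev.simps, rule hw_mono[OF loop], goal_cases)
  case (1 T z)
  then obtain D where z: "z = setr (setr x 6 dn) 7 D" "isqrt D" "T <= 20 * D + 10" by blast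
  show ?case
   by (intro hw_Seq hw_Assign Q[of dn D])
    (use z inv[of D] X(4,7,8) in \<open>auto simp: y_def dn_def eval_nat_numeral\<close>)
 qed
qed

lemma sum_if_all: "{v. v < n & (0::nat) <= cf v} = {..<n}" by auto

text \<open>There is one class of \<open>n\<close> vertices, each queue has \<open>n\<close>
  entries, and at most \<open>m\<close> edges are live; every term of the potential is estimated for
  this situation.\<close>

lemma Phi_start:
 assumes inv: "inv dn D y" and y: "areg y 4 = 0" "areg y 5 = 1" "!!v. comp y v = 0" "QO y = {..<n}" "QI y = {..<n}"
 shows "Phi dn D y <= 1000 + 12000 * real m + 3200 * real b + 3000 * real b * log 2 (real n) +
  (if dn ~= 0 then 60000 * real n ^ 2
   else 9000 * real m * log 2 (real n) + 12000 * real D * real m + 5000 * real m * (real m / real D) + 6000 * real m)"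
proof -
 have c: "comp y = (%_. 0)" using y(3) by auto
 have csz: "csz (%_. 0) v = n" for v by (simp add: csz_def cls_def)
 have lg: "0 <= log 2 (real n)" by (cases "n = 0") (auto simp: log_def)
 have dg: "(SUM v<n. real (dg v)) <= 2 * real m" using of_nat_mono[OF sum_dg, where 'a = real] by simp
 have mm: "(SUM v<n. real (mm v)) <= real b" using of_nat_mono[OF sum_mm, where 'a = real] by simp
 have nm: "real n <= real m" using n_le_m by simp
 have aw: "real (alive_wt y) <= 4 * real m + real b"
 proof -
  have "real (alive_wt y) <= real (SUM v<n. 2 + dg v + mm v)" unfolding alive_wt_def by (intro of_nat_mono sum_mono2) auto
  also have "... = 2 * real n + (SUM v<n. real (dg v)) + (SUM v<n. real (mm v))" by (simp add: sum.distrib)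
  finally show ?thesis using dg mm nm by linarith
 qed
 have p1: "pot_log mm (comp y) <= real b * log 2 (real n)"
  unfolding pot_log_def c csz sum_distrib_right[symmetric] using mm lg by (intro mult_right_mono)
 have p2: "pot_log (%v. 1 + dg v) (comp y) <= 3 * real m * log 2 (real n)"
  unfolding pot_log_def c csz sum_distrib_right[symmetric] using dg nm lg by (intro mult_right_mono) (simp_all add: sum.distrib)
 have p3: "pot_sq 0 (comp y) = n * n" unfolding pot_sq_def sum_if_all c csz by simp
 have lm: "lam y <= b" unfolding lam_def using card_mono[of "{..<b}" "{j. j < b & mu j = 0 & mv j : LS y (comp y (mv j) * k + mi j)}"] by auto
 have pl: "real (pot_live (comp y)) <= real m" using pot_live_le by simp
 have pb: "pot_big D 1 (comp y) <= real m / real D"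
 proof -
  have "cls (%_. 0) 0 = {..<n}" by (auto simp: cls_def)
  hence "cedges (comp y) 0 = pot_live (comp y)" by (simp add: cedges_def pot_live_def c)
  hence "real (cedges (comp y) 0) / real D <= real m / real D" using pl by (intro divide_right_mono) auto
  thus ?thesis unfolding pot_big_def by simp
 qed
 have pt: "real (pot_todo 0 (comp y)) <= 3 * real m"
 proof -
  have "pot_todo 0 (comp y) = (SUM v<n. 1 + dg v)" unfolding pot_todo_def sum_if_all c by (simp add: dg_def oe_def ie_def)
  thus ?thesis using dg nm by (simp add: sum.distrib)
 qed
 have q: "real (card (QO y) + card (QI y) + 2 * pot_live (comp y)) <= 4 * real m" using y(4,5) pl nm by simp
 define X1 where "X1 = real D * real (card (QO y) + card (QI y) + 2 * pot_live (comp y))"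
 define X2 where "X2 = real m * pot_big D 1 (comp y)"
 define X3 where "X3 = real m * (real m / real D)"
 define X4 where "X4 = real m * log 2 (real n)"
 have X1: "X1 <= 4 * (real D * real m)"
  unfolding X1_def using mult_left_mono[OF q, of "real D"] by simp
 have X2: "X2 <= X3" unfolding X2_def X3_def using pb by (intro mult_left_mono) auto
 have lb: "real (lam y) <= real b" using lm by simp
 have "Phi dn D y = 1000 + 3000 * real (alive_wt y) + 3000 * pot_log mm (comp y) + (if dn ~= 0 then 60000 * real n ^ 2 else
   3000 * pot_log (%v. 1 + dg v) (comp y) + 3000 * X1 + 5000 * X2 + 2000 * real (pot_todo 0 (comp y))) + 200 * real (lam y)"
  unfolding Phi_def Phi0_def y(1,2) p3 X1_def X2_def by (simp add: power2_eq_square)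
 moreover have "pot_log (%v. 1 + dg v) (comp y) <= 3 * X4" using p2 by (simp add: X4_def)
 ultimately have "Phi dn D y <= 1000 + 12000 * real m + 3200 * real b + 3000 * (real b * log 2 (real n)) +
  (if dn ~= 0 then 60000 * real n ^ 2 else 9000 * X4 + 12000 * (real D * real m) + 5000 * X3 + 6000 * real m)"
  using aw p1 pt X1 X2 lb by (cases "dn = 0") simp_all
 thus ?thesis unfolding X3_def X4_def by (simp only: mult.assoc)
qed

text \<open>At the end every class lies below the cursor. The class of a vertex that is not dead
  contains no dead vertex, is strongly connected and free of violations, so it is itself a good end
  component. Conversely dead vertices are lost.\<close>

lemma alive_gec:
 assumes inv: "inv dn D y" and e: "areg y 5 <= areg y 4"
 shows "{v. v < n & dead y v = 0} = \<Union>{X. gec X}"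
proof (intro set_eqI iffI)
 have core: "core y" and ds: "dead_single y" using inv by (auto simp: inv_def)
 note C = coreD[OF core]
 fix v
 show "v : {v. v < n & dead y v = 0}" if v: "v : \<Union>{X. gec X}"
 proof -
  from v obtain X where X: "gec X" "v : X" by blast
  hence "v < n" unfolding gec_def by blast
  moreover have "~ lost v" using X by (auto simp: lost_def)
  ultimately show ?thesis using C(10)[of v] by auto
 qed
 assume "v : {v. v < n & dead y v = 0}"
 hence v: "v < n" "dead y v = 0" by auto
 let ?X = "cls (comp y) (comp y v)"
 have lt: "comp y w < areg y 4" if "w < n" for w using C(5)[OF that] e by linarith
 have w: "w < n" "dead y w = 0" "comp y w = comp y v" if "w : ?X" for w
 proof -
  show "w < n" "comp y w = comp y v" using that by (auto simp: cls_def)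
  show "dead y w = 0"
  proof (rule ccontr)
   assume "dead y w ~= 0"
   hence "cls (comp y) (comp y w) = {w}" using ds `w < n` unfolding dead_single_def by simp
   moreover have "v : cls (comp y) (comp y w)" using v `comp y w = comp y v` by (simp add: cls_def)
   ultimately show False using v `dead y w ~= 0` by auto
  qed
 qed
 have nv: "~ viol (comp y) w" if "w : ?X" for w
  using C(4)[of w] C(12)[of w] w[OF that] lt[of w] by blast
 have cl: "w' : ?X" if "w : ?X" "(w, w') : E" "comp y w' = comp y w" for w w'
  using that E by (auto simp: cls_def)
 have "gec ?X"
  unfolding gec_def
 proof (intro conjI ballI allI impI)
  show "?X ~= {}" "?X \<subseteq> {..<n}" using v by (auto simp: cls_def)
  show "w' : ?X" if "w : ?X Int Rand" "(w, w') : E" for w w'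
   using nv[of w] cl[of w w'] that unfolding viol_def by auto
  show "EX w':?X. (w, w') : E" if "w : ?X" for w
   using nv[OF that] cl[OF that] unfolding viol_def by blast
  show "(u, w) : (E Int ?X \<times> ?X)\<^sup>*" if "u : ?X" "w : ?X" for u w
   using C(13)[OF v(1) lt[OF v(1)] v(2)] that unfolding sconn_def by blast
  show "U i Int ?X ~= {}" if i: "i < k" "L i Int ?X ~= {}" for i
  proof -
   from i(2) obtain w where wX: "w : L i" "w : ?X" by blast
   then obtain u where u: "u : U i" "comp y u = comp y w" using nv[OF wX(2)] i(1) unfolding viol_def by blast
   moreover have "u < n" using u(1) mem by (auto simp: U_def)
   ultimately have "u : ?X" using w(3)[OF wX(2)] by (simp add: cls_def)
   thus ?thesis using u by blast
  qed
 qed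
 thus "v : \<Union>{X. gec X}" using v by (auto simp: cls_def)
qed

theorem hw_Engine:
 assumes x: "start x"
  and Q: "!!T y. params y ==> {v. v < n & dead y v = 0} = \<Union>{X. gec X} ==>
   real T <= 100000 * (1 + real m + real b + real b * log 2 (real n) + min (real n ^ 2) (real m * sqrt (real m))) ==> Q T y"
 shows "hw N (Engine bs) Q x"
 unfolding Engine_def
proof (rule hw_Seq, rule hw_Load[OF x], rule hw_Seq, rule hw_Setup, assumption, rule hw_Main, assumption, goal_cases)
 case (1 T1 x1 T2 x2 dn D)
 thus ?case using n_le_m by (cases D) (auto simp: isqrt_def)
next
 case (2 T1 x1 T2 x2 dn D T3 y)
 note h = 2
 have D1: "real D <= sqrt (real m) + 1"
 proof (cases "D = 0")
  case False
  hence "(D - 1) * (D - 1) < m" using h(4) by (simp add: isqrt_def)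
  hence "real ((D - 1) * (D - 1)) <= real m" by (intro of_nat_mono less_imp_le)
  hence "real (D - 1) ^ 2 <= real m" by (simp add: power2_eq_square)
  hence "real (D - 1) <= sqrt (real m)" by (rule real_le_rsqrt)
  thus ?thesis using False by (simp add: of_nat_diff)
 qed simp
 have D2: "real m / real D <= sqrt (real m)"
 proof (cases "D = 0")
  case False
  have "m <= D * D" using h(4) by (simp add: isqrt_def)
  hence "real m <= real (D * D)" by (rule of_nat_mono)
  hence "sqrt (real m) <= real D" by (intro real_le_lsqrt) (simp_all add: power2_eq_square)
  hence "sqrt (real m) * sqrt (real m) <= sqrt (real m) * real D" by (intro mult_left_mono) auto
  thus ?thesis using False by (simp add: divide_le_eq)
 qed simp
 have sm: "sqrt (real m) <= real m" by (cases "m = 0") (auto intro: real_le_lsqrt simp: power2_eq_square)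
 \<comment> \<open>This lets m sqrt m absorb the term m log n of the logarithmic potential.\<close>
 have lg: "log 2 (real n) <= 3 * sqrt (real m)" "0 <= log 2 (real n)"
 proof -
  show "0 <= log 2 (real n)" by (cases "n = 0") (auto simp: log_def)
  show "log 2 (real n) <= 3 * sqrt (real m)"
  proof (cases "n = 0")
   case False
   hence n0: "0 < real n" "real n <= real m" using n_le_m by auto
   have "log 2 (real n) <= log 2 (real m)" using n0 by simp
   also have "... = log 2 (sqrt (real m) ^ 2)" by simp
   also have "... = 2 * log 2 (sqrt (real m))" using n0 by (subst log_nat_power) auto
   also have "log 2 (sqrt (real m)) <= 3 / 2 * sqrt (real m)"
   proof -
    have "ln (sqrt (real m)) <= sqrt (real m)" using ln_bound[of "sqrt (real m)"] n0 by simp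
    moreover have "sqrt (real m) * (2 / 3) <= sqrt (real m) * ln 2" using ln2_ge_two_thirds by (intro mult_left_mono) auto
    ultimately show ?thesis by (simp add: log_def divide_le_eq)
   qed
   finally show ?thesis by simp
  qed (simp add: log_def)
 qed
 let ?M = "min (real n ^ 2) (real m * sqrt (real m))"
 \<comment> \<open>The test in \<open>Setup\<close> compares the squares of n^2 and m sqrt m, so the
   chosen variant attains the minimum.\<close>
 have P: "(if dn ~= 0 then 60000 * real n ^ 2
   else 9000 * real m * log 2 (real n) + 12000 * real D * real m + 5000 * real m * (real m / real D) + 6000 * real m) <= 60000 * ?M + 18000 * real m"
 proof (cases "dn = 0")
  case False
  hence "n * n * n * n <= m * m * m" using h(5) by simp
  hence "real (n * n * n * n) <= real (m * m * m)" by (rule of_nat_mono)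
  hence "(real n ^ 2)\<^sup>2 <= (real m * sqrt (real m))\<^sup>2" by (simp add: power_mult_distrib) (simp add: power2_eq_square power4_eq_xxxx ac_simps)
  hence "real n ^ 2 <= real m * sqrt (real m)" by (rule power2_le_imp_le) simp
  thus ?thesis using False by simp
 next
  case True
  hence "m * m * m <= n * n * n * n" using h(5) by simp
  hence "real (m * m * m) <= real (n * n * n * n)" by (rule of_nat_mono)
  hence "(real m * sqrt (real m))\<^sup>2 <= (real n ^ 2)\<^sup>2" by (simp add: power_mult_distrib) (simp add: power2_eq_square power4_eq_xxxx ac_simps)
  hence "real m * sqrt (real m) <= real n ^ 2" by (rule power2_le_imp_le) simp
  hence M: "?M = real m * sqrt (real m)" by simp
  have "real m * log 2 (real n) <= real m * (3 * sqrt (real m))" using lg by (intro mult_left_mono) auto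
  moreover have "real m * real D <= real m * (sqrt (real m) + 1)" using D1 by (intro mult_left_mono) auto
  moreover have "real m * (real m / real D) <= real m * sqrt (real m)" using D2 by (intro mult_left_mono) auto
  moreover have "0 <= real m * sqrt (real m)" by simp
  moreover have aux: "9000 * a * l + 12000 * d * a + 5000 * a * q + 6000 * a <= 60000 * (a * s) + 18000 * a"
   if "a * l <= a * (3 * s)" "a * d <= a * (s + 1)" "a * q <= a * s" "0 <= a * s" for a l d q s :: real
   using that by (simp add: algebra_simps)
  ultimately have "9000 * real m * log 2 (real n) + 12000 * real D * real m + 5000 * real m * (real m / real D) + 6000 * real m
   <= 60000 * (real m * sqrt (real m)) + 18000 * real m"
   by blast
  thus ?thesis unfolding M using True by simp
 qed
 have T1: "real T1 <= 300 * (real m + real n + 2 * real b) + 100" using of_nat_mono[OF h(2), where 'a = real] by simp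
 have T2: "real T2 <= 50 + 20 * real D" using of_nat_mono[OF h(6), where 'a = real] by simp
 have nm: "real n <= real m" using n_le_m by simp
 define B where "B = real b * log 2 (real n)"
 define M where "M = ?M"
 have aux: "t1 + (t2 + t3) <= 100000 * (1 + m' + b' + B + M)"
  if "0 <= M" "0 <= B" "p <= 1000 + 12000 * m' + 3200 * b' + 3000 * B + (60000 * M + 18000 * m')" "t3 <= p + 10"
   "t1 <= 300 * (m' + n' + 2 * b') + 100" "t2 <= 50 + 20 * d" "n' <= m'" "d <= s + 1" "s <= m'" "0 <= m'" "0 <= b'"
  for t1 t2 t3 m' n' b' B M p d s :: real
  using that by argo
 have "0 <= M" unfolding M_def by (intro min.boundedI) auto
 moreover have "0 <= B" using lg(2) unfolding B_def by (intro mult_nonneg_nonneg) auto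
 moreover have "Phi dn D x2 <= 1000 + 12000 * real m + 3200 * real b + 3000 * B + (60000 * M + 18000 * real m)"
  using order_trans[OF Phi_start[OF h(3,7-11)] add_left_mono[OF P]] unfolding B_def M_def by (simp only: mult.assoc)
 ultimately have "real T1 + (real T2 + real T3) <= 100000 * (1 + real m + real b + B + M)"
  by (rule aux[OF _ _ _ h(14) T1 T2 nm D1 sm of_nat_0_le_iff of_nat_0_le_iff])
 hence "real (T1 + (T2 + T3)) <= 100000 * (1 + real m + real b + real b * log 2 (real n) + ?M)"
  unfolding B_def M_def by (simp only: of_nat_add)
 from Q[OF coreD(1)[OF h(12)[unfolded inv_def, THEN conjunct1]] alive_gec[OF h(12,13)] this] show ?case .
qed

end

section \<open>The two passes\<close>

fun writes :: "com => nat set" where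
 "writes Skip = {}"
| "writes (Assign r e) = {}"
| "writes (Write a d e) = {a}"
| "writes (Seq p q) = writes p Un writes q"
| "writes (Cond e p q) = writes p Un writes q"
| "writes (While e p) = writes p"

lemma run_writes: "run p s t s' ==> a ~: writes p ==> arrs s' a = arrs s a"
 by (induction rule: run.induct) auto

text \<open>The contract of a program does not say which memory remains untouched; this is read off
  its text. For the lists only the lengths are carried over, which is enough because the lists in
  question are empty.\<close>

lemma hw_writes:
 assumes "hw N p Q x"
 shows "hw N p (%T y. Q T y & (ALL a<100. a ~: writes p --> aarr y a = aarr x a) &
  (ALL f r. 101 + 3 * f ~: writes p --> length (alst y f r) = length (alst x f r))) x"
 unfolding hw_def
proof (intro allI impI)
 fix s assume s: "rep N s x"
 then obtain t T s' y where h: "run p s t s'" "t <= T" "rep N s' y" "Q T y" using assms unfolding hw_def by blast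
 have "aarr y a = aarr x a" if "a < 100" "a ~: writes p" for a
  using run_writes[OF h(1) that(2)] s h(3) that(1) unfolding rep_def by auto
 moreover have "length (alst y f r) = length (alst x f r)" if "101 + 3 * f ~: writes p" for f r
  using run_writes[OF h(1) that] s h(3) unfolding rep_def by metis
 ultimately show "EX t T s' y. run p s t s' & t <= T & rep N s' y & Q T y &
  (ALL a<100. a ~: writes p --> aarr y a = aarr x a) &
  (ALL f r. 101 + 3 * f ~: writes p --> length (alst y f r) = length (alst x f r))"
  using h by blast
qed

lemmas list_programs = Insert_def Delete_def Clear_def Pop_def For_def
lemmas programs = Doom_def Deledge_def Cut_def Move_def Check_def Split_def BFS_def BFS_from_def Decide_def
 MakePart_def Level_def FindDense_def PartSplit_def Kill_def PopSearch_def Process_def Main_def Upto_def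
 Load_def Setup_def Engine_def

text \<open>With base 0 the lists 0 to 11 occupy the arrays 100 to 135, and besides them only the
  arrays 7 and 8 are written. So the lists of the second pass, which has base 20, are still
  empty.\<close>

lemma writes_Engine: "writes (Engine 0) \<subseteq> {a. a = 7 \<or> a = 8 \<or> 100 <= a & a <= 135}"
 by (simp add: programs list_programs)

text \<open>The second pass computes the vertices from which the union of the good end components can be
 reached almost surely. It runs the same algorithm on the graph with an additional player-1 vertex
 \<open>n\<close>, a successor of all surviving vertices with edges to all vertices, and the single pair
 \<open>({..<n}, {n})\<close>.\<close>

definition Prepare :: com where
 "Prepare =
   Upto 8 (Reg 1) (Write 20 (Reg 8) (Read 0 (Reg 8)) ;; Write 21 (Reg 8) (Read 1 (Reg 8))) ;;
   Upto 8 (Reg 0) (Write 22 (Reg 8) (Read 2 (Reg 8)) ;; Write 24 (Reg 8) (Reg 8) ;;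
    Write 20 (Reg 1) (Reg 0) ;; Write 21 (Reg 1) (Reg 8) ;; Assign 1 (Op Add (Reg 1) (Const 1)) ;;
    Cond (Read 8 (Reg 8)) Skip
     (Write 20 (Reg 1) (Reg 8) ;; Write 21 (Reg 1) (Reg 0) ;; Assign 1 (Op Add (Reg 1) (Const 1)))) ;;
   Write 20 (Reg 1) (Reg 0) ;; Write 21 (Reg 1) (Reg 0) ;; Assign 1 (Op Add (Reg 1) (Const 1)) ;;
   Write 24 (Reg 0) (Reg 0) ;; Write 25 (Reg 0) (Const 1) ;;
   Assign 0 (Op Add (Reg 0) (Const 1)) ;; Assign 2 (Reg 0) ;; Assign 3 (Const 1)"

definition Program :: com where
 "Program = Engine 0 ;; Prepare ;; Engine 20 ;;
   Upto 8 (Reg 0) (Write 6 (Reg 8) (Op Equal (Read 28 (Reg 8)) (Const 0)))"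

definition hub_edges :: "nat => (nat \<times> nat) set => nat set => (nat \<times> nat) set" where
 "hub_edges n E T = E Un {n} \<times> {..n} Un T \<times> {n}"

lemma edge_list_snoc:
 "(%e. ((f(M := a)) e, (g(M := b)) e)) ` {..<Suc M} = insert (a, b) ((%e. (f e, g e)) ` {..<M})"
 for f g :: "nat => nat"
proof -
 have "(%e. ((f(M := a)) e, (g(M := b)) e)) ` {..<M} = (%e. (f e, g e)) ` {..<M}" by (intro image_cong) auto
 thus ?thesis by (simp add: lessThan_Suc)
qed

text \<open>The edge list grows by at most \<open>2 * n + 1\<close>: \<open>n\<close> edges from the
  additional vertex, at most \<open>n\<close> edges to it, and its loop, which gives it a successor
  even if \<open>n = 0\<close>.\<close>

lemma hw_Prepare:
 fixes x :: astate
 assumes x: "areg x 0 = n" "areg x (Suc 0) = m" "aarr x 2 = rn"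
  "aarr x 22 = (%_. 0)" "aarr x 23 = (%_. 0)" "aarr x 24 = (%_. 0)" "aarr x 25 = (%_. 0)"
  and E: "E = (%e. (aarr x 0 e, aarr x (Suc 0) e)) ` {..<m}"
  and Q: "!!T y. areg y 0 = Suc n ==> areg y 2 = Suc n ==> areg y 3 = 1 ==> areg y (Suc 0) <= m + 2 * n + 1 ==>
   aarr y 22 = (%v. if v < n then rn v else 0) ==> aarr y 23 = (%_. 0) ==> aarr y 24 = (%v. if v <= n then v else 0) ==>
   aarr y 25 = (%v. of_bool (v = n)) ==> (!!a. a ~: {20, 21, 22, 24, 25} ==> aarr y a = aarr x a) ==> alst y = alst x ==>
   (%e. (aarr y 20 e, aarr y 21 e)) ` {..<areg y (Suc 0)} = hub_edges n E {v. v < n & aarr x 8 v = 0} ==>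
   T <= 100 * (m + n) + 200 ==> Q T y"
 shows "hw N Prepare Q x"
proof -
 define J1 where "J1 i y \<longleftrightarrow> (ALL r. r ~= 8 --> areg y r = areg x r) & alst y = alst x &
  (ALL a. a ~= 20 --> a ~= 21 --> aarr y a = aarr x a) &
  (ALL e<i. aarr y 20 e = aarr x 0 e & aarr y 21 e = aarr x (Suc 0) e)" for i and y :: astate
 have l1: "hw N (Upto 8 (Reg 1) (Write 20 (Reg 8) (Read 0 (Reg 8)) ;; Write 21 (Reg 8) (Read 1 (Reg 8))))
  (%T y. J1 m y & T <= 100 * m + 20) x"
 proof (rule hw_Upto[where J = J1 and M = m and K = 50], goal_cases)
  case (4 i y)
  have y: "aarr y 0 = aarr x 0" "aarr y (Suc 0) = aarr x (Suc 0)" using 4(2) by (auto simp: J1_def)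
  show ?case by (intro hw_Seq hw_Write) (use y 4 in \<open>auto simp: J1_def less_Suc_eq\<close>)
 qed (use x in \<open>auto simp: J1_def\<close>)
 define ed where "ed y = (%e. (aarr y 20 e, aarr y 21 e)) ` {..<areg y (Suc 0)}" for y :: astate
 define D where "D i = {v. v < i & aarr x 8 v = 0}" for i
 define J2 where "J2 i y \<longleftrightarrow> areg y 0 = n & alst y = alst x &
  (ALL a. a ~= 20 --> a ~= 21 --> a ~= 22 --> a ~= 24 --> aarr y a = aarr x a) &
  aarr y 22 = (%v. if v < i then rn v else 0) & aarr y 24 = (%v. if v < i then v else 0) &
  areg y (Suc 0) <= m + 2 * i & ed y = E Un {n} \<times> {..<i} Un D i \<times> {n}" for i and y :: astate
 have J2D: "areg y 0 = n" "alst y = alst x" "a ~= 20 ==> a ~= 21 ==> a ~= 22 ==> a ~= 24 ==> aarr y a = aarr x a"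
  "aarr y 22 = (%v. if v < i then rn v else 0)" "aarr y 24 = (%v. if v < i then v else 0)"
  "areg y (Suc 0) <= m + 2 * i" "ed y = E Un {n} \<times> {..<i} Un D i \<times> {n}" if "J2 i y" for i y a
  using that unfolding J2_def by simp_all
 have l2: "hw N (Upto 8 (Reg 0) (Write 22 (Reg 8) (Read 2 (Reg 8)) ;; Write 24 (Reg 8) (Reg 8) ;;
    Write 20 (Reg 1) (Reg 0) ;; Write 21 (Reg 1) (Reg 8) ;; Assign 1 (Op Add (Reg 1) (Const 1)) ;;
    Cond (Read 8 (Reg 8)) Skip
     (Write 20 (Reg 1) (Reg 8) ;; Write 21 (Reg 1) (Reg 0) ;; Assign 1 (Op Add (Reg 1) (Const 1)))))
  (%T y. J2 n y & T <= 100 * n + 20) x1" if x1: "J1 m x1" for x1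
 proof (rule hw_Upto[where J = J2 and M = n and K = 60], goal_cases)
  case (2 i y)
  thus ?case by (simp add: J2_def)
 next
  case 3
  have "ed (setr x1 8 0) = E" unfolding ed_def E using x1 x by (intro image_cong) (auto simp: J1_def)
  thus ?case using x x1 by (auto simp: J2_def J1_def D_def)
 next
  case (4 i y)
  note Y = J2D[OF 4(2)]
  let ?M = "areg y (Suc 0)"
  define f where "f = aarr y 20"
  define g where "g = aarr y 21"
  have e0: "(%e. (f e, g e)) ` {..<?M} = E Un {n} \<times> {..<i} Un D i \<times> {n}" using Y(7) by (simp add: ed_def f_def g_def)
  have e1: "(%e. ((f(?M := n)) e, (g(?M := i)) e)) ` {..<Suc ?M} = E Un {n} \<times> {..<Suc i} Un D i \<times> {n}"
   unfolding edge_list_snoc e0 by (auto simp: less_Suc_eq)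
  have e2: "(%e. ((f(?M := n, Suc ?M := i)) e, (g(?M := i, Suc ?M := n)) e)) ` {..<Suc (Suc ?M)} =
    E Un {n} \<times> {..<Suc i} Un insert i (D i) \<times> {n}"
   unfolding edge_list_snoc[of "f(?M := n)" "Suc ?M" i "g(?M := i)" n] e1 by auto
  have D: "D (Suc i) = (if aarr x 8 i = 0 then insert i (D i) else D i)" by (auto simp: D_def less_Suc_eq)
  have a22: "(%v. if v < i then rn v else 0)(i := rn i) = (%v. if v < Suc i then rn v else 0)" by auto
  have a24: "(%v. if v < i then v else 0)(i := i) = (%v. if v < Suc i then v else 0)" by auto
  have a8: "aarr y 8 = aarr x 8" "aarr y 2 = rn" using Y(3)[of 8] Y(3)[of 2] x(3) by simp_all
  show ?case
   by (intro hw_Seq hw_Cond hw_Skip hw_Write hw_Assign)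
    (use Y(1-6) 4(1,3) e1 e2 in \<open>simp_all add: J2_def ed_def a22 a24 D a8 flip: f_def g_def\<close>)
 qed auto
 show ?thesis
  unfolding Prepare_def
 proof (rule hw_Seq, rule hw_mono[OF l1], rule hw_Seq, rule hw_mono[OF l2], erule conjunct1, goal_cases)
  case (1 T1 x1 T2 y)
  hence J: "J2 n y" and T: "T1 <= 100 * m + 20" "T2 <= 100 * n + 20" by auto
  note Y = J2D[OF J]
  let ?M = "areg y (Suc 0)"
  have e: "(%e. (((aarr y 20)(?M := n)) e, ((aarr y 21)(?M := n)) e)) ` {..<Suc ?M} = hub_edges n E {v. v < n & aarr x 8 v = 0}"
   unfolding edge_list_snoc using Y(7) by (auto simp: ed_def hub_edges_def D_def)
  have a24: "(%v. if v < n then v else 0)(n := n) = (%v. if v <= n then v else 0)" by auto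
  have a25: "(%_. 0)(n := 1) = (%v. of_bool (v = n) :: nat)" by auto
  have a: "aarr y 23 = (%_. 0)" "aarr y 25 = (%_. 0)" using Y(3)[of 23] Y(3)[of 25] x by simp_all
  show ?case
   by (intro hw_Seq hw_Write hw_Assign Q) (use Y(1-6) T e a a24 a25 in simp_all)
 qed
qed

text \<open>A path in \<open>X\<close> to \<open>n\<close> enters \<open>n\<close> from a vertex of
  \<open>T\<close>, so every other vertex of \<open>X\<close> reaches \<open>T\<close> inside
  \<open>X - {n}\<close>. Conversely all of \<open>Z\<close> reaches \<open>n\<close> through
  \<open>T\<close>, and \<open>n\<close> has edges to everything. The extra edge of a random vertex
  in \<open>T\<close> does no harm, as \<open>n\<close> belongs to the component.\<close>

lemma hub_ec:
 assumes E: "E \<subseteq> {..<n} \<times> {..<n}" and T: "T \<subseteq> {..<n}" and R: "R \<subseteq> {..<n}" and v: "v < n"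
 defines "E' \<equiv> hub_edges n E T"
 shows "(EX X. X \<subseteq> {..n} & (ALL v:X Int R. ALL w. (v, w) : E' --> w : X) & (ALL v:X. EX w:X. (v, w) : E') &
   (ALL u:X. ALL w:X. (u, w) : (E' Int X \<times> X)\<^sup>*) & n : X & v : X) \<longleftrightarrow>
  (EX Z. Z \<subseteq> {..<n} & (ALL u:Z Int R. ALL w. (u, w) : E --> w : Z) &
   (ALL u:Z. EX t:T Int Z. (u, t) : (E Int Z \<times> Z)\<^sup>*) & v : Z)" (is "?L \<longleftrightarrow> ?R")
proof
 assume ?L
 then obtain X where X: "X \<subseteq> {..n}" "ALL v:X Int R. ALL w. (v, w) : E' --> w : X"
  "ALL u:X. ALL w:X. (u, w) : (E' Int X \<times> X)\<^sup>*" "n : X" "v : X" by blast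
 let ?Z = "X - {n}"
 have reach: "u ~= n --> (EX t:T Int ?Z. (u, t) : (E Int ?Z \<times> ?Z)\<^sup>*)" if "(u, n) : (E' Int X \<times> X)\<^sup>*" for u
  using that
 proof (induction rule: converse_rtrancl_induct)
  case (step u w)
  show ?case
  proof
   assume un: "u ~= n"
   show "EX t:T Int ?Z. (u, t) : (E Int ?Z \<times> ?Z)\<^sup>*"
   proof (cases "w = n")
    case True
    hence "u : T" using step(1) un E by (auto simp: E'_def hub_edges_def)
    thus ?thesis using step(1) un by (intro bexI[of _ u]) auto
   next
    case False
    hence uw: "(u, w) : E Int ?Z \<times> ?Z" using step(1) un by (auto simp: E'_def hub_edges_def)
    obtain t where "t : T Int ?Z" "(w, t) : (E Int ?Z \<times> ?Z)\<^sup>*" using step(3) False by blast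
    thus ?thesis using converse_rtrancl_into_rtrancl[OF uw] by blast
   qed
  qed
 qed simp
 have r1: "?Z \<subseteq> {..<n}" using X(1) by force
 have r2: "ALL u:?Z Int R. ALL w. (u, w) : E --> w : ?Z"
 proof (intro ballI allI impI)
  fix u w assume u: "u : ?Z Int R" and w: "(u, w) : E"
  have "(u, w) : E'" using w by (simp add: E'_def hub_edges_def)
  hence "w : X" using X(2) u by blast
  moreover have "w ~= n" using w E by auto
  ultimately show "w : ?Z" by simp
 qed
 have r3: "ALL u:?Z. EX t:T Int ?Z. (u, t) : (E Int ?Z \<times> ?Z)\<^sup>*"
 proof
  fix u assume u: "u : ?Z"
  hence "(u, n) : (E' Int X \<times> X)\<^sup>*" using X(3,4) by blast
  from reach[OF this] u show "EX t:T Int ?Z. (u, t) : (E Int ?Z \<times> ?Z)\<^sup>*" by blast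
 qed
 show ?R by (intro exI[of _ ?Z] conjI r1 r2 r3) (use X(5) v in auto)
next
 assume ?R
 then obtain Z where Z: "Z \<subseteq> {..<n}" "ALL u:Z Int R. ALL w. (u, w) : E --> w : Z"
  "ALL u:Z. EX t:T Int Z. (u, t) : (E Int Z \<times> Z)\<^sup>*" "v : Z" by blast
 let ?X = "insert n Z"
 let ?G = "E' Int ?X \<times> ?X"
 have sub: "E Int Z \<times> Z \<subseteq> ?G" by (auto simp: E'_def hub_edges_def)
 have to: "(u, n) : ?G\<^sup>+" if u: "u : ?X" for u
 proof (cases "u = n")
  case True
  hence "(u, n) : ?G" by (auto simp: E'_def hub_edges_def)
  thus ?thesis by blast
 next
  case False
  then obtain t where t: "t : T Int Z" "(u, t) : (E Int Z \<times> Z)\<^sup>*" using Z(3) u by blast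
  have "(u, t) : ?G\<^sup>*" using rtrancl_mono[OF sub] t(2) by blast
  moreover have "(t, n) : ?G" using t(1) by (auto simp: E'_def hub_edges_def)
  ultimately show ?thesis by (rule rtrancl_into_trancl1)
 qed
 have from_n: "(n, w) : ?G" if "w : ?X" for w using that Z(1) by (auto simp: E'_def hub_edges_def)
 have c1: "?X \<subseteq> {..n}" using Z(1) by auto
 have c2: "ALL v:?X Int R. ALL w. (v, w) : E' --> w : ?X"
 proof (intro ballI allI impI)
  fix u w assume u: "u : ?X Int R" and w: "(u, w) : E'"
  have "u ~= n" using u R by auto
  hence "(u, w) : E \<or> w = n" using w by (auto simp: E'_def hub_edges_def)
  thus "w : ?X" using Z(2) u `u ~= n` by auto
 qed
 have c3: "ALL v:?X. EX w:?X. (v, w) : E'"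
 proof
  fix u assume "u : ?X"
  then obtain w where "(u, w) : ?G" using to[of u] by (metis tranclD)
  thus "EX w:?X. (u, w) : E'" by blast
 qed
 have c4: "ALL u:?X. ALL w:?X. (u, w) : ?G\<^sup>*"
 proof (intro ballI)
  fix u w assume u: "u : ?X" and w: "w : ?X"
  show "(u, w) : ?G\<^sup>*" by (rule rtrancl_into_rtrancl[OF trancl_into_rtrancl[OF to[OF u]] from_n[OF w]])
 qed
 show ?L by (intro exI[of _ ?X] conjI c1 c2 c3 c4) (use Z(4) in auto)
qed

section \<open>The whole program\<close>

definition work :: "nat => nat => nat => real" where
 "work n m b = 1 + real m + real b + real b * log 2 (real n) + min (real n ^ 2) (real m * sqrt (real m))"

lemma work_mono:
 assumes "m <= m'"
 shows "work n m b <= work n m' b"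
proof -
 have "min (real n ^ 2) (real m * sqrt (real m)) <= min (real n ^ 2) (real m' * sqrt (real m'))"
  using assms by (intro min.mono mult_mono real_sqrt_le_mono) auto
 moreover have "real m <= real m'" using assms by simp
 ultimately show ?thesis unfolding work_def by (intro add_mono order_refl)
qed

text \<open>In the second pass vertices and memberships both number \<open>Suc n\<close>, hence a
  single size in \<open>N\<close> for all families from 20 on.\<close>

lemma hw_Program:
 assumes N: "N = (%f. if f = 3 then b else if f < 20 then n else Suc n)"
  and e1: "engine 0 n m b k N E mi mv" and st: "engine.start 0 n m b k E rn mi mv mu x"
  and empty: "!!a. 20 <= a ==> a < 40 ==> aarr x a = (%_. 0)" "!!f r. alst x f r = []"
  and Q: "!!T y. {v. v < n & aarr y 6 v ~= 0} = {v. v < n & (EX Z. Z \<subseteq> {..<n} &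
    (ALL u:Z Int engine.Rand n rn. ALL w. (u, w) : E --> w : Z) &
    (ALL u:Z. EX t:\<Union>{X. engine.gec n b k E rn mi mv mu X} Int Z. (u, t) : (E Int Z \<times> Z)\<^sup>*) & v : Z)} ==>
   real T <= 200000 * (work n m b + work (Suc n) (m + 2 * n + 1) (Suc n)) ==> Q T y"
 shows "hw N Program Q x"
proof -
 let ?gec1 = "engine.gec n b k E rn mi mv mu" and ?R1 = "engine.Rand n rn"
 note S = engine.startD[OF e1 st]
 note gec1 = engine.gec_def[OF e1] and R1 = engine.Rand_def[OF e1] and E1 = engine.E[OF e1]
 define TG where "TG = \<Union>{X. ?gec1 X}"
 have TGn: "TG \<subseteq> {..<n}"
 proof
  fix v assume "v : TG"
  then obtain X where X: "?gec1 X" "v : X" unfolding TG_def by blast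
  have "X \<subseteq> {..<n}" using X(1)[unfolded gec1] by (elim conjE)
  thus "v : {..<n}" using X(2) by blast
 qed
 have eng1: "hw N (Engine 0) (%T y. areg y 0 = n & areg y (Suc 0) = m & {v. v < n & aarr y 8 v = 0} = TG &
   real T <= 100000 * work n m b & (ALL a. a < 100 --> a ~= 7 --> a ~= 8 --> aarr y a = aarr x a) & (ALL f r. 20 <= f --> alst y f r = [])) x"
 proof (rule hw_mono[OF hw_writes[OF engine.hw_Engine[OF e1 st, where Q = "%T y. areg y 0 = n & areg y (Suc 0) = m &
   {v. v < n & aarr y 8 v = 0} = TG & real T <= 100000 * work n m b"]]], goal_cases)
  case (1 T y)
  thus ?case by (simp add: engine.params_def[OF e1] TG_def work_def)
 next
  case (2 T y)
  have "aarr y a = aarr x a" if "a < 100" "a ~= 7" "a ~= 8" for a using 2 that writes_Engine by auto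
  moreover have "alst y f r = []" if "20 <= f" for f r
  proof -
   have "101 + 3 * f ~: writes (Engine 0)" using that writes_Engine by auto
   hence "length (alst y f r) = length (alst x f r)" using 2 by blast
   thus ?thesis using empty(2) by simp
  qed
  ultimately show ?case using 2 by blast
 qed
 show ?thesis
  unfolding Program_def
 proof (rule hw_Seq, rule hw_mono[OF eng1], goal_cases)
  case (1 T1 y1)
  hence y1: "areg y1 0 = n" "areg y1 (Suc 0) = m" "{v. v < n & aarr y1 8 v = 0} = TG" "real T1 <= 100000 * work n m b"
   "!!a. a < 100 ==> a ~= 7 ==> a ~= 8 ==> aarr y1 a = aarr x a" "!!f r. 20 <= f ==> alst y1 f r = []" by auto
  have Ey: "E = (%e. (aarr y1 0 e, aarr y1 (Suc 0) e)) ` {..<m}" using S(12) y1(5)[of 0] y1(5)[of "Suc 0"] by simp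
  have z: "aarr y1 a = (%_. 0)" if "20 <= a" "a < 40" for a using y1(5)[of a] empty(1)[OF that] that by simp
  have r2: "aarr y1 2 = rn" using y1(5)[of 2] S(5) by simp
  show ?case
  proof (rule hw_Seq, rule hw_Prepare[OF y1(1,2) r2 z z z z Ey], simp_all, goal_cases)
   case (1 T2 y2)
   define m' where "m' = areg y2 (Suc 0)"
   define E' where "E' = hub_edges n E TG"
   have m': "m' <= m + 2 * n + 1" using 1 by (simp add: m'_def)
   have E': "(%e. (aarr y2 20 e, aarr y2 21 e)) ` {..<m'} = E'" using 1 y1(3) by (simp add: m'_def E'_def)
   let ?rn = "%v. if v < n then rn v else 0" and ?mi = "%_::nat. 0::nat" and ?mv = "%v. if v <= n then v else 0"
    and ?mu = "%v. of_bool (v = n) :: nat"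
   let ?gec2 = "engine.gec (Suc n) (Suc n) 1 E' ?rn ?mi ?mv ?mu"
   have e2: "engine 20 (Suc n) m' (Suc n) 1 N E' ?mi ?mv"
   proof
    show "E' \<subseteq> {..<Suc n} \<times> {..<Suc n}" using E1 TGn by (auto simp: E'_def hub_edges_def)
    show "EX w. (v, w) : E'" if "v < Suc n" for v
     using engine.out[OF e1, of v] that by (auto simp: E'_def hub_edges_def less_Suc_eq)
    show "card E' <= m'" unfolding E'[symmetric] using card_image_le[of "{..<m'}"] by simp
   qed (auto simp: N)
   have st2: "engine.start 20 (Suc n) m' (Suc n) 1 E' ?rn ?mi ?mv ?mu y2"
    unfolding engine.start_def[OF e2]
   proof (intro conjI allI impI)
    show "alst y2 f r = []" if "20 <= f" for f r using 1 y1(6)[OF that] by simp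
   qed (use 1 z E' in \<open>simp_all add: m'_def\<close>)
   have R2: "engine.Rand (Suc n) ?rn = ?R1" unfolding engine.Rand_def[OF e2] R1 by auto
   have L0: "engine.L (Suc n) ?mi ?mv ?mu 0 = {..<n}" unfolding engine.L_def[OF e2] by force
   have U0: "engine.U (Suc n) ?mi ?mv ?mu 0 = {n}" unfolding engine.U_def[OF e2] by auto
   note gec2 = engine.gec_def[OF e2]
   have g2: "v : \<Union>{X. ?gec2 X} \<longleftrightarrow> (EX Z. Z \<subseteq> {..<n} & (ALL u:Z Int ?R1. ALL w. (u, w) : E --> w : Z) &
    (ALL u:Z. EX t:TG Int Z. (u, t) : (E Int Z \<times> Z)\<^sup>*) & v : Z)" if v: "v < n" for v
   proof -
    have "v : \<Union>{X. ?gec2 X} \<longleftrightarrow> (EX X. X \<subseteq> {..n} & (ALL v:X Int ?R1. ALL w. (v, w) : E' --> w : X) & (ALL v:X. EX w:X. (v, w) : E') &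
      (ALL u:X. ALL w:X. (u, w) : (E' Int X \<times> X)\<^sup>*) & n : X & v : X)" (is "?A \<longleftrightarrow> ?B")
    proof
     assume ?A
     then obtain X where X: "?gec2 X" "v : X" by blast
     note g = X(1)[unfolded gec2 R2]
     have ga: "X \<subseteq> {..<Suc n}" using g by (elim conjE)
     have gb: "ALL v:X Int ?R1. ALL w. (v, w) : E' --> w : X" using g by (elim conjE)
     have gc: "ALL v:X. EX w:X. (v, w) : E'" using g by (elim conjE)
     have gd: "ALL u:X. ALL w:X. (u, w) : (E' Int X \<times> X)\<^sup>*" using g by (elim conjE)
     have gl: "ALL i<1. engine.L (Suc n) ?mi ?mv ?mu i Int X ~= {} --> engine.U (Suc n) ?mi ?mv ?mu i Int X ~= {}"
      using g by (elim conjE)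
     \<comment> \<open>The only pair has all vertices below \<open>n\<close> in its \<open>L\<close>
       and only \<open>n\<close> in its \<open>U\<close>, so it forces the additional vertex into
       the component.\<close>
     have nX: "n : X" using gl[rule_format, of 0] v X(2) unfolding L0 U0 by auto
     show ?B by (intro exI[of _ X] conjI) (rule ga[unfolded lessThan_Suc_atMost] gb gc gd nX X(2))+
    next
     assume ?B
     then obtain X where X: "X \<subseteq> {..n}" "ALL v:X Int ?R1. ALL w. (v, w) : E' --> w : X" "ALL v:X. EX w:X. (v, w) : E'"
      "ALL u:X. ALL w:X. (u, w) : (E' Int X \<times> X)\<^sup>*" "n : X" "v : X" by (elim exE conjE)
     have "?gec2 X" unfolding gec2 R2 lessThan_Suc_atMost
     proof (intro conjI)
      show "ALL i<1. engine.L (Suc n) ?mi ?mv ?mu i Int X ~= {} --> engine.U (Suc n) ?mi ?mv ?mu i Int X ~= {}"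
       using U0 X(5) by simp
      show "X ~= {}" using X(5) by blast
     qed (rule X(1) X(2) X(3) X(4))+
     thus ?A using X(6) by blast
    qed
    also have "... \<longleftrightarrow> (EX Z. Z \<subseteq> {..<n} & (ALL u:Z Int ?R1. ALL w. (u, w) : E --> w : Z) &
     (ALL u:Z. EX t:TG Int Z. (u, t) : (E Int Z \<times> Z)\<^sup>*) & v : Z)"
     unfolding E'_def by (rule hub_ec[OF E1 TGn _ v]) (auto simp: R1)
    finally show ?thesis .
   qed
   show ?case
   proof (rule hw_Seq, rule engine.hw_Engine[OF e2 st2], goal_cases)
    case (1 T3 y3)
    have y30: "areg y3 0 = Suc n" using 1(1)[unfolded engine.params_def[OF e2]] by simp
    have T3: "real T3 <= 100000 * work (Suc n) (m + 2 * n + 1) (Suc n)"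
     using 1(3)[folded work_def] work_mono[OF m', of "Suc n" "Suc n"] by linarith
    let ?J = "%i y. areg y 0 = Suc n & aarr y 28 = aarr y3 28 & (ALL v<i. aarr y 6 v = of_bool (aarr y3 28 v = 0))"
    show ?case
    proof (rule hw_Upto[where J = ?J and M = "Suc n" and K = 20], goal_cases)
     case (4 i y)
     thus ?case by (intro hw_Write) (auto simp: less_Suc_eq)
    next
     case (5 T4 y)
     show ?case
     proof (rule Q)
      have eq: "v < n ==> aarr y 6 v ~= 0 \<longleftrightarrow> v : \<Union>{X. ?gec2 X}" for v using 5(1) 1(2) by auto
      show "{v. v < n & aarr y 6 v ~= 0} = {v. v < n & (EX Z. Z \<subseteq> {..<n} &
       (ALL u:Z Int ?R1. ALL w. (u, w) : E --> w : Z) &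
       (ALL u:Z. EX t:\<Union>{X. ?gec1 X} Int Z. (u, t) : (E Int Z \<times> Z)\<^sup>*) & v : Z)}"
       unfolding TG_def[symmetric]
      proof (intro Collect_cong conj_cong[OF refl])
       fix v assume v: "v < n"
       show "(aarr y 6 v ~= 0) = (EX Z. Z \<subseteq> {..<n} & (ALL u:Z Int ?R1. ALL w. (u, w) : E --> w : Z) &
        (ALL u:Z. EX t:TG Int Z. (u, t) : (E Int Z \<times> Z)\<^sup>*) & v : Z)"
        by (rule trans[OF eq[OF v] g2[OF v]])
      qed
      have T24: "real T2 <= 100 * (real m + real n) + 200" "real T4 <= 40 * (real n + 1) + 20"
       using of_nat_mono[of T2 "100 * (m + n) + 200", where 'a = real] of_nat_mono[OF 5(2), where 'a = real]
        `T2 <= _` by auto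
      have w: "1 + real (m + 2 * n + 1) + real (Suc n) <= work (Suc n) (m + 2 * n + 1) (Suc n)"
      proof -
       have "0 <= real (Suc n) * log 2 (real (Suc n))" by (intro mult_nonneg_nonneg) auto
       moreover have "0 <= min (real (Suc n) ^ 2) (real (m + 2 * n + 1) * sqrt (real (m + 2 * n + 1)))"
        by (intro min.boundedI) auto
       ultimately show ?thesis unfolding work_def by linarith
      qed
      have w0: "0 <= work n m b"
      proof -
       have "0 <= real b * log 2 (real n)" by (cases "n = 0") (auto simp: log_def)
       moreover have "0 <= min (real n ^ 2) (real m * sqrt (real m))" by (intro min.boundedI) auto
       ultimately show ?thesis unfolding work_def by linarith
      qed
      have aux: "t1 + (t2 + (t3 + t4)) <= 200000 * (w1 + w2)"
       if "t1 <= 100000 * w1" "t2 <= 100 * (m' + n') + 200" "t3 <= 100000 * w2" "t4 <= 40 * (n' + 1) + 20"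
        "1 + (m' + 2 * n' + 1) + (1 + n') <= w2" "0 <= w1" "0 <= m'" "0 <= n'" for t1 t2 t3 t4 w1 w2 m' n' :: real
       using that by argo
      have "real T1 + (real T2 + (real T3 + real T4)) <= 200000 * (work n m b + work (Suc n) (m + 2 * n + 1) (Suc n))"
       by (rule aux[OF y1(4) T24(1) T3 T24(2) _ w0]) (use w in auto)
      thus "real (T1 + (T2 + (T3 + T4))) <= 200000 * (work n m b + work (Suc n) (m + 2 * n + 1) (Suc n))" by simp
     qed
    qed (use y30 in auto)
   qed
  qed
 qed
qed

lemma com_ok_Program: "com_ok Program"
 by (simp add: Program_def Prepare_def programs list_programs Row_def Member_def Elt_def Pos_def Idx_def)

section \<open>Running time and word length\<close>

text \<open>A crude bound that serves to choose the exponent of the word length.\<close>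

lemma work_le:
 assumes w: "2 <= w" and le: "n <= w" "m <= 2 * w" "b <= w"
 shows "work n m b <= 5 * real w ^ 2"
proof -
 have r: "2 <= real w" "real n <= real w" "real m <= 2 * real w" "real b <= real w"
  using w le(1,3) of_nat_mono[OF le(2), where 'a = real] by simp_all
 have r2: "2 * real w <= real w ^ 2" using mult_right_mono[OF r(1), of "real w"] by (simp add: power2_eq_square)
 have lg: "log 2 (real n) <= real w"
 proof (cases "n = 0")
  case False
  hence "log 2 (real n) <= real n" using less_exp[of n] by (intro log2_of_power_le) auto
  thus ?thesis using r(2) by linarith
 qed (simp add: log_def)
 have "real b * log 2 (real n) <= real w * real w"
 proof -
  have "real b * log 2 (real n) <= real b * real w" using lg by (intro mult_left_mono) auto
  also have "... <= real w * real w" using r(4) by (intro mult_right_mono) auto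
  finally show ?thesis .
 qed
 moreover have "min (real n ^ 2) (real m * sqrt (real m)) <= real w ^ 2"
  using power_mono[OF r(2), of 2] by (intro min.coboundedI1) simp
 ultimately show ?thesis using r r2 unfolding work_def power2_eq_square[symmetric] by linarith
qed

text \<open>With l = log n >= 1, m sqrt m is below m sqrt (m l), and \<open>n <= m <= n * n\<close>
  puts both m and n l below the minimum \<mu>. For the second pass n + 1 <= 2 n, m + 2 n + 1 <= 4 m
  and log (n + 1) <= 2 log n, so its terms are at most constant multiples of those bounds.\<close>

lemma work_final:
 fixes n m b :: nat
 assumes n: "2 <= n" "n <= m" "m <= n * n"
 defines "l \<equiv> log 2 (real n)"
 defines "\<mu> \<equiv> min (real n ^ 2) (real m * sqrt (real m * l))"
 shows "work n m b + work (Suc n) (m + 2 * n + 1) (Suc n) <= 22 * (\<mu> + real b * l)"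
proof -
 define s where "s = sqrt (real m * l)"
 let ?M = "m + 2 * n + 1"
 have rm: "real n <= real m" "real m <= real n ^ 2" "2 <= real n"
  using n(1,2) of_nat_mono[OF n(3), where 'a = real] by (simp_all add: power2_eq_square)
 have l1: "1 <= l" unfolding l_def using n by simp
 have ln: "l <= real n" unfolding l_def using n less_exp[of n] by (intro log2_of_power_le) auto
 have ml: "real m <= real m * l" using mult_left_mono[OF l1, of "real m"] by simp
 have s1: "sqrt (real m) <= s" unfolding s_def using ml by (rule real_sqrt_le_mono)
 have s2: "1 <= s" unfolding s_def using ml rm by (intro real_sqrt_ge_one) linarith
 have s3: "l <= s" unfolding s_def
 proof (rule real_le_rsqrt)
  have "l * l <= real m * l" using ln rm l1 by (intro mult_right_mono) auto
  thus "l\<^sup>2 <= real m * l" by (simp add: power2_eq_square)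
 qed
 have mu: "\<mu> = min (real n ^ 2) (real m * s)" by (simp add: \<mu>_def s_def)
 have A: "real m <= \<mu>" unfolding mu using mult_left_mono[OF s2, of "real m"] rm(2) by (intro min.boundedI) auto
 have B: "min (real n ^ 2) (real m * sqrt (real m)) <= \<mu>" unfolding mu by (intro min.mono mult_left_mono s1) auto
 have C: "real n * l <= \<mu>" unfolding mu
 proof (rule min.boundedI)
  show "real n * l <= real n ^ 2" using mult_left_mono[OF ln, of "real n"] by (simp add: power2_eq_square)
  show "real n * l <= real m * s" using rm(1) s3 l1 by (intro mult_mono) auto
 qed
 have n2: "real (Suc n) <= 2 * real n" using rm(3) by simp
 have D: "min (real (Suc n) ^ 2) (real ?M * sqrt (real ?M)) <= 8 * \<mu>"
 proof -
  have "real (Suc n) ^ 2 <= (2 * real n) ^ 2" using n2 by (intro power_mono) auto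
  hence "real (Suc n) ^ 2 <= 4 * real n ^ 2" by (simp add: power_mult_distrib)
  moreover have "0 <= real n ^ 2" by simp
  ultimately have 1: "real (Suc n) ^ 2 <= 8 * real n ^ 2" by linarith
  have M: "real ?M <= 4 * real m" using rm n(1) by simp
  have "sqrt (real ?M) <= sqrt (4 * real m)" using M by (rule real_sqrt_le_mono)
  also have "... = 2 * sqrt (real m)" by (simp add: real_sqrt_mult)
  finally have "sqrt (real ?M) <= 2 * s" using s1 by linarith
  hence "real ?M * sqrt (real ?M) <= (4 * real m) * (2 * s)" using M by (intro mult_mono) auto
  hence 2: "real ?M * sqrt (real ?M) <= 8 * (real m * s)" by simp
  have "min (real (Suc n) ^ 2) (real ?M * sqrt (real ?M)) <= min (8 * real n ^ 2) (8 * (real m * s))" using 1 2 by (rule min.mono)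
  also have "... = 8 * \<mu>" unfolding mu by (simp add: min_def)
  finally show ?thesis .
 qed
 have F: "real (Suc n) * log 2 (real (Suc n)) <= 4 * (real n * l)"
 proof -
  have "2 * real n <= real n ^ 2" unfolding power2_eq_square using rm(3) by (intro mult_right_mono) auto
  hence "real (Suc n) <= real n ^ 2" using n2 by (rule order_trans[rotated])
  hence "log 2 (real (Suc n)) <= log 2 (real n ^ 2)" by (subst log_le_cancel_iff) (use rm(3) in auto)
  also have "... = 2 * l" unfolding l_def using rm(3) by (subst log_nat_power) auto
  finally have "real (Suc n) * log 2 (real (Suc n)) <= (2 * real n) * (2 * l)" using n2 by (intro mult_mono) auto
  thus ?thesis by simp
 qed
 have bl: "real b <= real b * l" using mult_left_mono[OF l1, of "real b"] by simp
 define X1 where "X1 = min (real n ^ 2) (real m * sqrt (real m))"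
 define X2 where "X2 = min (real (Suc n) ^ 2) (real ?M * sqrt (real ?M))"
 define Y where "Y = real (Suc n) * log 2 (real (Suc n))"
 define Z where "Z = real b * l"
 have W1: "work n m b = 1 + real m + real b + Z + X1" by (simp add: work_def l_def X1_def Z_def)
 have W2: "work (Suc n) ?M (Suc n) = 1 + real ?M + real (Suc n) + Y + X2" unfolding work_def Y_def X2_def ..
 have M: "real ?M = real m + 2 * real n + 1" "real (Suc n) = real n + 1" by simp_all
 have "0 <= Z" using l1 by (simp add: Z_def)
 thus ?thesis unfolding W1 W2 M Z_def[symmetric]
  using A B[folded X1_def] C D[folded X2_def] F[folded Y_def] bl[folded Z_def] rm by argo
qed

lemma card_memberships:
 assumes "ALL (L, U):set SP. finite L & finite U"
 shows "card (memberships SP) = pairs_size SP"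
proof -
 have fin: "finite (fst (SP ! i))" "finite (snd (SP ! i))" if "i < length SP" for i
  using assms nth_mem[OF that] by (auto simp: split_beta)
 have "memberships SP = (SIGMA i:{..<length SP}. (%v. (v, False)) ` fst (SP ! i) Un (%v. (v, True)) ` snd (SP ! i))"
  by (auto simp: memberships_def split: if_splits)
 hence "card (memberships SP) = (SUM i<length SP. card ((%v. (v, False)) ` fst (SP ! i) Un (%v. (v, True)) ` snd (SP ! i)))"
  using fin by (simp add: card_SigmaI)
 also have "... = (SUM i<length SP. card (fst (SP ! i)) + card (snd (SP ! i)))"
 proof (intro sum.cong refl)
  fix i assume "i : {..<length SP}"
  hence "card ((%v. (v, False)) ` fst (SP ! i) Un (%v. (v, True)) ` snd (SP ! i)) =
    card ((%v. (v, False)) ` fst (SP ! i)) + card ((%v. (v, True)) ` snd (SP ! i))"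
   using fin[of i] by (intro card_Un_disjoint) auto
  thus "card ((%v. (v, False)) ` fst (SP ! i) Un (%v. (v, True)) ` snd (SP ! i)) = card (fst (SP ! i)) + card (snd (SP ! i))"
   by (simp add: card_image inj_on_def)
 qed
 also have "... = pairs_size SP"
  unfolding pairs_size_def by (simp add: sum_list_sum_nth split_beta atLeast0LessThan)
 finally show ?thesis .
qed

lemma array_of_less: "i < length xs ==> array_of xs i = xs ! i"
 by (simp add: array_of_def)

theorem theorem6:
  shows "\<exists>(prog :: com) (c :: nat) (C :: real).
    \<forall>(P :: nat mdp) (SP :: (nat set \<times> nat set) list) es ms (n :: nat) (m :: nat) (b :: nat).
      is_instance P SP es ms \<longrightarrow>
      n = card (verts P) \<longrightarrow> m = card (edges P) \<longrightarrow> b = pairs_size SP \<longrightarrow>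
      (\<exists>t s. exec ((n + m + b + length SP + 2) ^ c) prog (input_state P SP es ms) t s \<and>
         output_set n s = almost_sure_win P (Streett SP) \<and>
         (n \<ge> 2 \<longrightarrow>
            real t \<le> C * (min (real n ^ 2) (real m * sqrt (real m * log 2 (real n)))
                          + real b * log 2 (real n))))"
proof (rule exI[of _ Program], rule exI[of _ 144], rule exI[of _ 4400000], intro allI impI)
 fix P :: "nat mdp" and SP es ms and n m b :: nat
 assume inst: "is_instance P SP es ms" and n: "n = card (verts P)" and m: "m = card (edges P)" and b: "b = pairs_size SP"
 define k where "k = length SP"
 have mdp: "is_mdp P" and V: "verts P = {..<n}" and es: "distinct es" "set es = edges P" and ms: "distinct ms" "set ms = memberships SP"
  using inst n unfolding is_instance_def by simp_all
 have SPV: "L \<subseteq> {..<n}" "U \<subseteq> {..<n}" if "(L, U) : set SP" for L U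
  using inst that V unfolding is_instance_def by auto
 have les: "length es = m" using distinct_card[OF es(1)] es(2) m by simp
 have lms: "length ms = b"
 proof -
  have "ALL (L, U):set SP. finite L & finite U"
  proof (intro ballI case_prodI2)
   fix LU L U assume "LU : set SP" "LU = (L, U)"
   thus "finite L & finite U" using SPV[of L U] finite_subset[of L "{..<n}"] finite_subset[of U "{..<n}"] by simp
  qed
  thus ?thesis using distinct_card[OF ms(1)] ms(2) b card_memberships[of SP] by simp
 qed
 have E: "edges P \<subseteq> {..<n} \<times> {..<n}" and out: "!!v. v < n ==> EX w. (v, w) : edges P" and rv: "randv P \<subseteq> {..<n}"
  using mdp V unfolding is_mdp_def by auto
 define s0 where "s0 = input_state P SP es ms"
 define x0 where "x0 = \<lparr>areg = regs s0, aarr = arrs s0, alst = (%_ _. [])\<rparr>"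
 define N where "N = (%f::nat. if f = 3 then b else if f < 20 then n else Suc n)"
 define rn where "rn = (%v. of_bool (v : randv P) :: nat)"
 define mi where "mi = array_of (map fst ms)"
 define mv where "mv = array_of (map (fst \<circ> snd) ms)"
 define mu where "mu = array_of (map (of_bool \<circ> snd \<circ> snd) ms)"
 have msj: "mi j = fst (ms ! j)" "mv j = fst (snd (ms ! j))" "mu j = of_bool (snd (snd (ms ! j)))" if "j < b" for j
  using that lms by (simp_all add: mi_def mv_def mu_def array_of_less)
 have memj: "fst (ms ! j) < k" "fst (snd (ms ! j)) < n" if "j < b" for j
 proof -
  have "ms ! j : memberships SP" using that lms ms(2) nth_mem by metis
  then obtain i v u where h: "ms ! j = (i, v, u)" "i < length SP" "v : (if u then snd (SP ! i) else fst (SP ! i))"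
   unfolding memberships_def by blast
  thus "fst (ms ! j) < k" by (simp add: k_def)
  have "(fst (SP ! i), snd (SP ! i)) : set SP" using h(2) by simp
  thus "fst (snd (ms ! j)) < n" using h SPV[of "fst (SP ! i)" "snd (SP ! i)"] by (auto split: if_splits)
 qed
 have ex_ms: "(EX j<b. mv j = v & mi j = i & snd (snd (ms ! j)) = u) \<longleftrightarrow> (i, v, u) : memberships SP" for i v u
 proof -
  have "(i, v, u) : memberships SP \<longleftrightarrow> (EX j<b. ms ! j = (i, v, u))" using ms(2) lms by (metis in_set_conv_nth)
  also have "... \<longleftrightarrow> (EX j<b. mv j = v & mi j = i & snd (snd (ms ! j)) = u)" using msj by (auto simp: prod_eq_iff)
  finally show ?thesis by simp
 qed
 have e1: "engine 0 n m b k N (edges P) mi mv"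
 proof
  show "mi j < k & mv j < n" if "j < b" for j using msj[OF that] memj[OF that] by simp
 qed (use E out m in \<open>auto simp: N_def\<close>)
 have arr0: "arrs s0 0 = array_of (map fst es)" "arrs s0 (Suc 0) = array_of (map snd es)" "arrs s0 2 = rn" "arrs s0 3 = mi"
  "arrs s0 4 = mv" "arrs s0 5 = mu" "!!a. 5 < a ==> arrs s0 a = (%_. 0)"
  by (simp_all add: s0_def input_state_def rn_def mi_def mv_def mu_def)
 have reg0: "regs s0 = array_of [n, m, b, k]" by (simp add: s0_def input_state_def n les lms k_def)
 have rep: "rep N s0 x0" using arr0(7) by (auto simp: rep_def x0_def)
 have st: "engine.start 0 n m b k (edges P) rn mi mv mu x0"
  unfolding engine.start_def[OF e1]
 proof (intro conjI allI impI)
  have "edges P = (%e. es ! e) ` {..<m}" using es(2) les by (auto simp: set_conv_nth)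
  also have "... = (%e. (aarr x0 0 e, aarr x0 (Suc 0) e)) ` {..<m}"
   using les by (intro image_cong) (auto simp: x0_def arr0 array_of_less)
  finally show "edges P = (%e. (aarr x0 0 e, aarr x0 (Suc 0) e)) ` {..<m}" .
 qed (simp_all add: x0_def arr0 reg0 array_of_def)
 have Rand: "engine.Rand n rn = randv P" unfolding engine.Rand_def[OF e1] using rv by (auto simp: rn_def)
 have UL: "engine.U b mi mv mu i = snd (SP ! i)" "engine.L b mi mv mu i = fst (SP ! i)" if "i < k" for i
 proof -
  have "v : engine.U b mi mv mu i \<longleftrightarrow> (EX j<b. mv j = v & mi j = i & snd (snd (ms ! j)) = True)" for v
   unfolding engine.U_def[OF e1] using msj(3) by auto
  thus "engine.U b mi mv mu i = snd (SP ! i)" using that unfolding ex_ms by (auto simp: memberships_def k_def)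
  have "v : engine.L b mi mv mu i \<longleftrightarrow> (EX j<b. mv j = v & mi j = i & snd (snd (ms ! j)) = False)" for v
   unfolding engine.L_def[OF e1] using msj(3) by auto
  thus "engine.L b mi mv mu i = fst (SP ! i)" using that unfolding ex_ms by (auto simp: memberships_def k_def)
 qed
 have gec: "engine.gec n b k (edges P) rn mi mv mu X = good_ec P SP X" for X
 proof -
  have "(ALL i<k. engine.L b mi mv mu i Int X ~= {} --> engine.U b mi mv mu i Int X ~= {}) \<longleftrightarrow>
    (ALL i<k. fst (SP ! i) Int X ~= {} --> snd (SP ! i) Int X ~= {})" using UL by simp
  also have "... \<longleftrightarrow> (ALL (L, U):set SP. L Int X ~= {} --> U Int X ~= {})"
   by (simp add: all_set_conv_all_nth k_def split_beta)
  finally show ?thesis unfolding engine.gec_def[OF e1] good_ec_def Rand V by (simp only:)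
 qed
 define tm where "tm = work n m b + work (Suc n) (m + 2 * n + 1) (Suc n)"
 have "hw N Program (%T y. {v. v < n & aarr y 6 v ~= 0} = almost_sure_win P (Streett SP) & real T <= 200000 * tm) x0"
 proof (rule hw_Program[OF N_def e1 st], goal_cases)
  case (1 a)
  thus ?case by (simp add: x0_def arr0)
 next
  case (2 f r)
  thus ?case by (simp add: x0_def)
 next
  case (3 T y)
  have "almost_sure_win P (Streett SP) = {v. v < n & (EX Z. Z \<subseteq> {..<n} &
    (ALL u:Z Int randv P. ALL w. (u, w) : edges P --> w : Z) &
    (ALL u:Z. EX t:\<Union>{X. good_ec P SP X} Int Z. (u, t) : (edges P Int Z \<times> Z)\<^sup>*) & v : Z)}"
   unfolding almost_sure_win_Streett[OF mdp] V
  proof (rule Collect_cong, rule iffI)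
   fix v assume h: "EX Z. Z \<subseteq> {..<n} & (ALL u:Z Int randv P. ALL w. (u, w) : edges P --> w : Z) &
    (ALL u:Z. EX t:\<Union>{X. good_ec P SP X} Int Z. (u, t) : (edges P Int Z \<times> Z)\<^sup>*) & v : Z"
   then obtain Z where "Z \<subseteq> {..<n}" "v : Z" by (elim exE conjE)
   hence "v < n" by blast
   thus "v < n & (EX Z. Z \<subseteq> {..<n} & (ALL u:Z Int randv P. ALL w. (u, w) : edges P --> w : Z) &
    (ALL u:Z. EX t:\<Union>{X. good_ec P SP X} Int Z. (u, t) : (edges P Int Z \<times> Z)\<^sup>*) & v : Z)" using h by (rule conjI)
  qed (rule conjunct2)
  thus ?case using 3 unfolding Rand gec tm_def by (simp only:)
 qed
 then obtain t T s' y where run: "run Program s0 t s'" and T: "t <= T" and s': "rep N s' y"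
  and outp: "{v. v < n & aarr y 6 v ~= 0} = almost_sure_win P (Streett SP)" and tm: "real T <= 200000 * tm"
  using rep unfolding hw_def by blast
 have rt: "real t <= 200000 * tm" using of_nat_mono[OF T, where 'a = real] tm by linarith
 define w where "w = n + m + b + k + 2"
 have w2: "2 <= w" by (simp add: w_def)
 \<comment> \<open>2000000 < 2 ^ 21 <= w ^ 21 turns the constant into a power of \<open>w\<close>;
   the quadratic bound of \<open>work_le\<close> supplies the remaining factor
   \<open>w ^ 2\<close>.\<close>
 have tw: "t <= w ^ 23"
 proof -
  have "work n m b <= 5 * real w ^ 2" "work (Suc n) (m + 2 * n + 1) (Suc n) <= 5 * real w ^ 2"
   by (rule work_le[OF w2]; simp add: w_def)+
  hence "tm <= 10 * real w ^ 2" unfolding tm_def by simp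
  hence "real t <= 2000000 * real w ^ 2" using rt by simp
  hence "real t <= real (2000000 * w ^ 2)" by simp
  hence "t <= 2000000 * w ^ 2" by (simp only: of_nat_le_iff)
  also have "... <= 2 ^ 21 * w ^ 2" by (intro mult_right_mono) auto
  also have "... <= w ^ 21 * w ^ 2" using w2 by (intro mult_right_mono power_mono) auto
  also have "... = w ^ 23" by (simp flip: power_add)
  finally show ?thesis .
 qed
 have bounded: "bounded_state (w + 1) s0"
 proof -
  have "regs s0 r < w + 1" for r unfolding reg0 by (auto simp: array_of_def nth_Cons w_def split: nat.splits)
  moreover have "arrs s0 a i < w + 1" for a i
  proof -
   have es_i: "fst (es ! i) < n" "snd (es ! i) < n" if "i < length es" for i
    using nth_mem[OF that] es(2) E by auto
   have "a = 0 \<or> a = Suc 0 \<or> a = 2 \<or> a = 3 \<or> a = 4 \<or> a = 5 \<or> 5 < a" by arith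
   then consider "a = 0" | "a = Suc 0" | "a = 2" | "a = 3" | "a = 4" | "a = 5" | "5 < a" by blast
   thus ?thesis
   proof cases
    case 1
    thus ?thesis using es_i(1)[of i] by (auto simp: arr0 array_of_def w_def)
   next
    case 2
    thus ?thesis using es_i(2)[of i] by (auto simp: arr0 array_of_def w_def)
   next
    case 3
    thus ?thesis by (simp add: arr0 rn_def w_def)
   next
    case 4
    thus ?thesis using memj(1)[of i] lms by (auto simp: arr0 mi_def array_of_def w_def)
   next
    case 5
    thus ?thesis using memj(2)[of i] lms by (auto simp: arr0 mv_def array_of_def w_def)
   next
    case 6
    thus ?thesis by (auto simp: arr0 mu_def array_of_def w_def)
   next
    case 7
    thus ?thesis by (simp add: arr0)
   qed
  qed
  ultimately show ?thesis unfolding bounded_state_def by blast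
 qed
 \<comment> \<open>Inputs and time together stay below \<open>w ^ 24\<close>, and
   \<open>run_exec\<close> asks for the sixth power; this gives the exponent 144.\<close>
 have "(w + 1 + t) ^ 6 <= w ^ 144"
 proof -
  have "2 * w <= w * w" using w2 by (rule mult_le_mono1)
  hence "w + 1 <= w ^ 2" using w2 unfolding power2_eq_square by linarith
  also have "... <= w ^ 23" using w2 by (intro power_increasing) auto
  finally have "w + 1 + t <= 2 * w ^ 23" using tw by simp
  also have "... <= w * w ^ 23" using w2 by (intro mult_right_mono) auto
  also have "... = w ^ 24" by (simp flip: power_Suc)
  finally have "(w + 1 + t) ^ 6 <= (w ^ 24) ^ 6" by (intro power_mono) auto
  thus ?thesis by (simp flip: power_mult)
 qed
 hence ex: "exec (w ^ 144) Program s0 t s'"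
  using run_exec[OF run com_ok_Program bounded] w2 by simp
 have "output_set n s' = almost_sure_win P (Streett SP)"
  using s' outp by (simp add: output_set_def rep_def)
 \<comment> \<open>4400000 = 200000 * 22, the product of the constants in \<open>hw_Program\<close>
   and \<open>work_final\<close>.\<close>
 moreover have "real t <= 4400000 * (min (real n ^ 2) (real m * sqrt (real m * log 2 (real n))) + real b * log 2 (real n))"
  if n2: "2 <= n"
 proof -
  have "m <= n * n" using card_mono[OF _ E] unfolding m by (simp add: card_cartesian_product)
  from work_final[OF n2 engine.n_le_m[OF e1] this, of b, folded tm_def] rt show ?thesis by linarith
 qed
 ultimately show "EX t s. exec ((n + m + b + length SP + 2) ^ 144) Program (input_state P SP es ms) t s &
     output_set n s = almost_sure_win P (Streett SP) &
     (n >= 2 --> real t <= 4400000 * (min (real n ^ 2) (real m * sqrt (real m * log 2 (real n))) + real b * log 2 (real n)))"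
  using ex unfolding w_def k_def s0_def by blast
qed

end
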